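(* Let $G(\mathcal{C})$ and $G(\mathcal{C}')$ be two convex and proper non-unitary c-polyhedra that are based on the same oriented abstract spherical polyhedron $P$, are consistently oriented with $P$, and have Möbius-congruent c-faces (for each face $f$ of $P$ there is a Möbius transformation $T_f$ with $T_f(C_u)=C'_u$ as oriented circles for every vertex $u$ of $f$). Then $G(\mathcal{C})$ and $G(\mathcal{C}')$ are Möbius-congruent: there is a Möbius transformation $T$ of $\mathbb{S}^2$ with $T(C_u)=C'_u$ as oriented circles for every vertex $u$ of $P$.
   Context: **Circles and inversive distance.** $\mathbb{S}^2$ is the oriented unit sphere in $\mathbb{E}^3$. Each oriented circle $C\subset\mathbb{S}^2$ has a *companion disk* $D$: the closed disk bounded by $C$ that lies to the left of $C$ (so $\partial^+D=C$). If $C_1,C_2$ have companion disks with spherical centers $p_1,p_2$ and spherical radii $r_1,r_2$, their *inversive distance* is $\langle C_1,C_2\rangle=\dfrac{-p_1\cdot p_2+\cos r_1\cos r_2}{\sin r_1\sin r_2}$. It is Möbius invariant. When the circles meet it equals $\cos\alpha$, where $\alpha$ is the angle of the lune $D_1\cap D_2$ (the oriented angle of overlap). Circles are orthogonal iff the value is $0$. Möbius transformations are the orientation-preserving circle-preserving transformations of $\mathbb{S}^2$. A collection of circles is *coaxial* if its members belong to a common pencil (coaxial family) of circles. **Separation.** $C_1,C_2$ are *coupled* if one of the circles is contained in the companion disk of the other, otherwise *uncoupled*. They are *segregated* if they are uncoupled and overlap by at most $\pi/2$: either the companion disks are disjoint, or the circles meet in an oriented angle of at most $\pi/2$. **c-polyhedra.**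 An *abstract spherical polyhedron* $P$ is an oriented cellular decomposition of the $2$-sphere into finitely many combinatorial $n$-gons ($n\ge3$), with $1$-skeleton $G$ a graph without loops or multiple edges, such that distinct faces are either disjoint or meet at a set of vertices and full edges. A face is written $f=u_1\dots u_n$, listing vertices cyclically respecting orientation. A *c-polyhedron based on $P$*, written $G(\mathcal{C})$, is a family $\mathcal{C}=\{C_u\}$ of oriented circles in $\mathbb{S}^2$ indexed by the vertices of $P$ such that $C_u,C_v$ are uncoupled whenever $uv$ is an edge, and for each face $f=u_1\dots u_n$ the *c-face* $\mathcal{C}_f=\{C_{u_1},\dots,C_{u_n}\}$ is not coaxial and there is a (then unique) circle $O_f$, the *ortho-circle*, orthogonal to all circles of $\mathcal{C}_f$. It is *non-unitary* if $\langle C_u,C_v\rangle\ne\pm1$ for all edges $uv$. **Convex.** $G(\mathcal{C})$ is *convex* if the ortho-circles $O_f$, for all faces $f$, can be oriented so that every $C_u\in\mathcal{C}$ is segregated from every oriented ortho-circle (these oriented ortho-circles are denoted $O_f^+$), and moreover the circles of three consecutive vertices of a face are never coaxial. **Consistently oriented.** For every oriented face $f=u_1\dots u_n$ of $P$, the circles $C_{u_1},\dots,C_{u_n}$ are met in that order as one progresses around $O_f^+$ in the direction of its orientation, starting at $C_{u_1}$. **Hyperideal polygons.** Let $h_1,\dots,h_n$ be half-planes of the oriented hyperbolic plane $\mathbb{H}^2$ such that $Q=h_1\cap\dots\cap h_n$ is non-empty and the boundary line $\ell_i$ of each $h_i$ supports a non-empty segment, ray or line on the boundary of $Q$. Orient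 $\ell_i$ so that $\partial^+h_i=\ell_i$ and index so that $\ell_1,\dots,\ell_n$ are in cyclic counter-clockwise order along $Q$. Then $Q$ is a *convex hyperideal polygon* with oriented support lines $\ell_1,\dots,\ell_n$. When two consecutive lines (indices mod $n$) share no finite or ideal point, the hyperbolic segment orthogonal to both is called the *hyperideal vertex* they determine. $Q$ is *proper* if (1) every hyperideal vertex lies in $Q$, and (2) the lines $\ell_1,\dots,\ell_n$ along with the hyperideal vertices form the boundary of a bounded (compact) convex polygon contained in $Q$. **Proper c-polyhedra.** For a vertex $v$ of $P$, give the interior of the companion disk $D_v$ of $C_v$ its Poincaré hyperbolic metric (with $C_v$ as circle at infinity and orientation inherited from $\mathbb{S}^2$). Let $f_1,\dots,f_n$ be the faces at $v$ in cyclic order with respect to the orientation of $P$, and let $\ell_i$ be the hyperbolic line $D_v\cap O_{f_i}$, oriented oppositely to $O_{f_i}^+$. A non-unitary convex $G(\mathcal{C})$ is *proper* if for each vertex $v$ the lines $\ell_1,\dots,\ell_n$ are the oriented support lines of a proper convex hyperideal polygon in $D_v$. *)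

theory Defs
  imports "HOL-Analysis.Analysis"
begin

section \<open>Oriented circles in the unit sphere\<close>

text \<open>An oriented circle is recorded by the spherical center and the spherical radius of its
  companion disk; the disk determines the circle, and the circle is oriented so that the disk is on
  its left as seen from outside the sphere.\<close>

typedef ocircle = "{(p :: real^3, r :: real). norm p = 1 \<and> 0 < r \<and> r < pi}"
  by (rule exI[of _ "(axis 1 1, 1)"]) (use pi_gt3 in simp)

definition center :: "ocircle \<Rightarrow> real^3" where
  "center C = fst (Rep_ocircle C)"

definition radius :: "ocircle \<Rightarrow> real" where
  "radius C = snd (Rep_ocircle C)"

abbreviation S2 :: "(real^3) set" where
  "S2 \<equiv> sphere 0 1"

definition circ :: "ocircle \<Rightarrow> (real^3) set" where
  "circ C = {x \<in> S2. x \<bullet> center C = cos (radius C)}"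

definition cdisk :: "ocircle \<Rightarrow> (real^3) set" where
  "cdisk C = {x \<in> S2. x \<bullet> center C \<ge> cos (radius C)}"

definition opposite :: "ocircle \<Rightarrow> ocircle" where
  "opposite C = Abs_ocircle (- center C, pi - radius C)"

text \<open>The parametrization of an oriented circle in the direction of its orientation. The base
  direction \<open>a\<close> is a unit vector orthogonal to the center \<open>p\<close>. The velocity at a point \<open>x\<close> is
  \<open>p \<times> x\<close>, and its left normal \<open>x \<times> (p \<times> x)\<close> in the tangent plane points into the companion disk.\<close>

definition base_dir :: "ocircle \<Rightarrow> real^3 \<Rightarrow> bool" where
  "base_dir C a \<longleftrightarrow> norm a = 1 \<and> a \<bullet> center C = 0"

definition circ_point :: "ocircle \<Rightarrow> real^3 \<Rightarrow> real \<Rightarrow> real^3" where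
  "circ_point C a t = cos (radius C) *\<^sub>R center C
     + sin (radius C) *\<^sub>R (cos t *\<^sub>R a + sin t *\<^sub>R cross3 (center C) a)"

definition inversive_distance :: "ocircle \<Rightarrow> ocircle \<Rightarrow> real" where
  "inversive_distance C\<^sub>1 C\<^sub>2 =
     (- (center C\<^sub>1 \<bullet> center C\<^sub>2) + cos (radius C\<^sub>1) * cos (radius C\<^sub>2))
       / (sin (radius C\<^sub>1) * sin (radius C\<^sub>2))"

definition orthogonal_circles :: "ocircle \<Rightarrow> ocircle \<Rightarrow> bool" where
  "orthogonal_circles C\<^sub>1 C\<^sub>2 \<longleftrightarrow> inversive_distance C\<^sub>1 C\<^sub>2 = 0"

text \<open>For circles that meet, the inversive distance is the cosine of the angle of the lune in which
  their companion disks overlap.\<close>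

definition overlap_angle :: "ocircle \<Rightarrow> ocircle \<Rightarrow> real" where
  "overlap_angle C\<^sub>1 C\<^sub>2 = arccos (inversive_distance C\<^sub>1 C\<^sub>2)"

definition coupled :: "ocircle \<Rightarrow> ocircle \<Rightarrow> bool" where
  "coupled C\<^sub>1 C\<^sub>2 \<longleftrightarrow> circ C\<^sub>1 \<subseteq> cdisk C\<^sub>2 \<or> circ C\<^sub>2 \<subseteq> cdisk C\<^sub>1"

definition segregated :: "ocircle \<Rightarrow> ocircle \<Rightarrow> bool" where
  "segregated C\<^sub>1 C\<^sub>2 \<longleftrightarrow> \<not> coupled C\<^sub>1 C\<^sub>2 \<and>
     (cdisk C\<^sub>1 \<inter> cdisk C\<^sub>2 = {} \<or>
      circ C\<^sub>1 \<inter> circ C\<^sub>2 \<noteq> {} \<and> overlap_angle C\<^sub>1 C\<^sub>2 \<le> pi / 2)"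

text \<open>The pencil spanned by two distinct circles consists of the circles whose equation
  \<open>x \<bullet> p = cos r\<close> is a linear combination of the two given equations. Orientation plays no role.\<close>

definition pencil :: "ocircle \<Rightarrow> ocircle \<Rightarrow> ocircle set" where
  "pencil C\<^sub>1 C\<^sub>2 = {C. \<exists>a b. center C = a *\<^sub>R center C\<^sub>1 + b *\<^sub>R center C\<^sub>2 \<and>
                          cos (radius C) = a * cos (radius C\<^sub>1) + b * cos (radius C\<^sub>2)}"

definition coaxial :: "ocircle set \<Rightarrow> bool" where
  "coaxial S \<longleftrightarrow> (\<exists>C\<^sub>1 C\<^sub>2. circ C\<^sub>1 \<noteq> circ C\<^sub>2 \<and> S \<subseteq> pencil C\<^sub>1 C\<^sub>2)"


section \<open>Moebius transformations\<close>

text \<open>\<open>x \<bullet> (u \<times> v) > 0\<close> says that the tangent vectors \<open>u\<close>, \<open>v\<close> at \<open>x\<close> form a positive basis of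
  the tangent plane with respect to the outer normal \<open>x\<close>. Only the values of \<open>T\<close> on the sphere, and
  of its derivative on tangent vectors, matter.\<close>

definition orientation_preserving :: "(real^3 \<Rightarrow> real^3) \<Rightarrow> bool" where
  "orientation_preserving T \<longleftrightarrow>
     (\<forall>x\<in>S2. \<exists>T'. (T has_derivative T') (at x within S2) \<and>
        (\<forall>u v. u \<bullet> x = 0 \<and> v \<bullet> x = 0 \<and> x \<bullet> cross3 u v > 0
               \<longrightarrow> T x \<bullet> cross3 (T' u) (T' v) > 0))"

definition moebius_transformation :: "(real^3 \<Rightarrow> real^3) \<Rightarrow> bool" where
  "moebius_transformation T \<longleftrightarrow> bij_betw T S2 S2 \<and> (\<forall>C. \<exists>C'. T ` circ C = circ C') \<and> orientation_preserving T"

text \<open>\<open>T(C) = C'\<close> as oriented circles: an orientation-preserving \<open>T\<close> carries what is on the left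
  of \<open>C\<close> to what is on the left of its image.\<close>

definition maps_ocircle :: "(real^3 \<Rightarrow> real^3) \<Rightarrow> ocircle \<Rightarrow> ocircle \<Rightarrow> bool" where
  "maps_ocircle T C C' \<longleftrightarrow> T ` circ C = circ C' \<and> T ` cdisk C = cdisk C'"


section \<open>Abstract spherical polyhedra\<close>

text \<open>A polyhedron is given by its faces, each written as the list of its vertices in cyclic order
  respecting the orientation (one list for each face; its starting vertex is immaterial).\<close>

type_synonym 'v polyhedron = "'v list set"

definition consecutive :: "'v list \<Rightarrow> 'v \<Rightarrow> 'v \<Rightarrow> bool" where
  "consecutive f u v \<longleftrightarrow> (\<exists>i<length f. u = f ! i \<and> v = f ! (Suc i mod length f))"

definition vertex_set :: "'v polyhedron \<Rightarrow> 'v set" where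
  "vertex_set P = (\<Union>f\<in>P. set f)"

definition darts :: "'v polyhedron \<Rightarrow> ('v \<times> 'v) set" where
  "darts P = {(u, v). \<exists>f\<in>P. consecutive f u v}"

definition edges :: "'v polyhedron \<Rightarrow> 'v set set" where
  "edges P = {{u, v} | u v. (u, v) \<in> darts P}"

text \<open>\<open>face_cycle P v fs\<close>: the list \<open>fs\<close> enumerates the faces at \<open>v\<close> in positive cyclic order. With
  faces on the left of their directed edges, the positive successor of a face \<open>\<dots>w v\<dots>\<close> at \<open>v\<close> is the
  face \<open>\<dots>v w\<dots>\<close> across the edge \<open>vw\<close>.\<close>

definition face_cycle :: "'v polyhedron \<Rightarrow> 'v \<Rightarrow> 'v list list \<Rightarrow> bool" where
  "face_cycle P v fs \<longleftrightarrow> distinct fs \<and> set fs = {f \<in> P. v \<in> set f} \<and>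
     (\<forall>i<length fs. \<exists>w. consecutive (fs ! i) w v \<and> consecutive (fs ! (Suc i mod length fs)) v w)"

text \<open>Oriented cellular decompositions of the 2-sphere into polygons, combinatorially: the polygons
  are glued in pairs along oppositely directed edges, the faces at each vertex form a single cycle
  (so the result is a closed oriented surface), the surface is connected, and it has Euler
  characteristic 2. Since faces have distinct vertices and a directed edge lies in one face only,
  the 1-skeleton has no loops or multiple edges, and faces meet in common vertices and full edges.\<close>

definition spherical_polyhedron :: "'v polyhedron \<Rightarrow> bool" where
  "spherical_polyhedron P \<longleftrightarrow>
     finite P \<and>
     (\<forall>f\<in>P. 3 \<le> length f \<and> distinct f) \<and>
     (\<forall>f\<in>P. \<forall>g\<in>P. \<forall>u v. consecutive f u v \<and> consecutive g u v \<longrightarrow> f = g) \<and>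
     (\<forall>u v. (u, v) \<in> darts P \<longrightarrow> (v, u) \<in> darts P) \<and>
     (\<forall>v\<in>vertex_set P. \<exists>fs. face_cycle P v fs) \<and>
     (\<forall>u\<in>vertex_set P. \<forall>v\<in>vertex_set P. (u, v) \<in> (darts P)\<^sup>*) \<and>
     int (card (vertex_set P)) - int (card (edges P)) + int (card P) = 2"


section \<open>Circle polyhedra\<close>

definition c_polyhedron :: "'v polyhedron \<Rightarrow> ('v \<Rightarrow> ocircle) \<Rightarrow> bool" where
  "c_polyhedron P C \<longleftrightarrow>
     (\<forall>u v. {u, v} \<in> edges P \<longrightarrow> \<not> coupled (C u) (C v)) \<and>
     (\<forall>f\<in>P. \<not> coaxial (C ` set f) \<and> (\<exists>K. \<forall>u\<in>set f. orthogonal_circles K (C u)))"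

definition non_unitary :: "'v polyhedron \<Rightarrow> ('v \<Rightarrow> ocircle) \<Rightarrow> bool" where
  "non_unitary P C \<longleftrightarrow>
     (\<forall>u v. {u, v} \<in> edges P \<longrightarrow>
        inversive_distance (C u) (C v) \<noteq> 1 \<and> inversive_distance (C u) (C v) \<noteq> - 1)"

text \<open>\<open>convex_c_polyhedron P C Op\<close>: the circle polyhedron is convex, as witnessed by the oriented
  ortho-circles \<open>Op f\<close> (written \<open>O\<^sub>f\<^sup>+\<close> in the literature).\<close>

definition convex_c_polyhedron ::
    "'v polyhedron \<Rightarrow> ('v \<Rightarrow> ocircle) \<Rightarrow> ('v list \<Rightarrow> ocircle) \<Rightarrow> bool" where
  "convex_c_polyhedron P C Op \<longleftrightarrow>
     c_polyhedron P C \<and>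
     (\<forall>f\<in>P. \<forall>u\<in>set f. orthogonal_circles (Op f) (C u)) \<and>
     (\<forall>f\<in>P. \<forall>u\<in>vertex_set P. segregated (C u) (Op f)) \<and>
     (\<forall>f\<in>P. \<forall>u v w. consecutive f u v \<and> consecutive f v w \<longrightarrow> \<not> coaxial {C u, C v, C w})"

text \<open>A circle orthogonal to \<open>K\<close> crosses \<open>K\<close> in two points. Progressing along \<open>K\<close>, it is met at the
  one where \<open>K\<close> enters its companion disk.\<close>

definition enters_at :: "ocircle \<Rightarrow> ocircle \<Rightarrow> real^3 \<Rightarrow> bool" where
  "enters_at K C x \<longleftrightarrow> x \<in> circ K \<inter> circ C \<and> cross3 (center K) x \<bullet> center C > 0"

definition consistently_oriented ::
    "'v polyhedron \<Rightarrow> ('v \<Rightarrow> ocircle) \<Rightarrow> ('v list \<Rightarrow> ocircle) \<Rightarrow> bool" where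
  "consistently_oriented P C Op \<longleftrightarrow>
     (\<forall>f\<in>P. \<exists>a t. base_dir (Op f) a \<and> t 0 = 0 \<and>
        (\<forall>i j. i < j \<and> j < length f \<longrightarrow> t i < t j) \<and>
        (\<forall>i<length f. t i < 2 * pi \<and> enters_at (Op f) (C (f ! i)) (circ_point (Op f) a (t i))))"


section \<open>Hyperideal polygons\<close>

text \<open>The interior of the companion disk of \<open>B\<close> is a conformal model of the hyperbolic plane with
  \<open>B\<close> as circle at infinity. An oriented hyperbolic line is an oriented circle orthogonal to \<open>B\<close>
  (more precisely, its part inside \<open>B\<close>), and hyperbolic segments are arcs of such circles.\<close>

definition hplane :: "ocircle \<Rightarrow> (real^3) set" where
  "hplane B = cdisk B - circ B"

abbreviation htop :: "ocircle \<Rightarrow> (real^3) topology" where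
  "htop B \<equiv> top_of_set (hplane B)"

definition hline :: "ocircle \<Rightarrow> ocircle \<Rightarrow> (real^3) set" where
  "hline B L = hplane B \<inter> circ L"

text \<open>The arc \<open>S\<close> of the oriented hyperbolic line \<open>L\<close> runs from \<open>x\<close> to \<open>y\<close> in the direction of \<open>L\<close>.\<close>

definition harc :: "ocircle \<Rightarrow> ocircle \<Rightarrow> real^3 \<Rightarrow> real^3 \<Rightarrow> (real^3) set \<Rightarrow> bool" where
  "harc B L x y S \<longleftrightarrow> orthogonal_circles L B \<and>
     (\<exists>a s t. base_dir L a \<and> s \<le> t \<and> circ_point L a s = x \<and> circ_point L a t = y \<and>
        S = circ_point L a ` {s..t} \<and> S \<subseteq> hplane B)"

definition hsegment :: "ocircle \<Rightarrow> real^3 \<Rightarrow> real^3 \<Rightarrow> (real^3) set" where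
  "hsegment B x y = \<Union> {S. \<exists>L. harc B L x y S}"

definition hconvex :: "ocircle \<Rightarrow> (real^3) set \<Rightarrow> bool" where
  "hconvex B K \<longleftrightarrow> K \<subseteq> hplane B \<and> (\<forall>x\<in>K. \<forall>y\<in>K. hsegment B x y \<subseteq> K)"

text \<open>\<open>z\<close> lies strictly to the left of the hyperbolic line oriented from \<open>x\<close> to \<open>y\<close>.\<close>

definition hleft :: "ocircle \<Rightarrow> real^3 \<Rightarrow> real^3 \<Rightarrow> real^3 \<Rightarrow> bool" where
  "hleft B x y z \<longleftrightarrow> x \<noteq> y \<and> (\<exists>L S. harc B L x y S \<and> z \<in> hplane B \<inter> (cdisk L - circ L))"

text \<open>The intersection of the closed half-planes to the left of the given oriented lines.\<close>

definition hregion :: "ocircle \<Rightarrow> ocircle list \<Rightarrow> (real^3) set" where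
  "hregion B Ls = {x \<in> hplane B. \<forall>L\<in>set Ls. x \<in> cdisk L}"

definition hside :: "ocircle \<Rightarrow> ocircle list \<Rightarrow> ocircle \<Rightarrow> (real^3) set" where
  "hside B Ls L = hline B L \<inter> (htop B frontier_of hregion B Ls)"

text \<open>The lines are in cyclic counter-clockwise order along the convex region \<open>Q\<close> on their left if
  points chosen on successive sides form positively oriented triangles. A side is convex, so it
  contains a segment as soon as it has two points.\<close>

definition hyperideal_polygon :: "ocircle \<Rightarrow> ocircle list \<Rightarrow> bool" where
  "hyperideal_polygon B Ls \<longleftrightarrow>
     Ls \<noteq> [] \<and> distinct Ls \<and> (\<forall>L\<in>set Ls. orthogonal_circles L B) \<and>
     hregion B Ls \<noteq> {} \<and>
     (\<forall>L\<in>set Ls. \<exists>x\<in>hside B Ls L. \<exists>y\<in>hside B Ls L. x \<noteq> y) \<and>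
     (\<exists>x. (\<forall>i<length Ls. x i \<in> hside B Ls (Ls ! i)) \<and>
          (\<forall>i j k. i < j \<and> j < k \<and> k < length Ls \<longrightarrow> hleft B (x i) (x j) (x k)))"

text \<open>The common perpendicular segment of two lines without common finite or ideal point.\<close>

definition common_perpendicular :: "ocircle \<Rightarrow> ocircle \<Rightarrow> ocircle \<Rightarrow> (real^3) set" where
  "common_perpendicular B L\<^sub>1 L\<^sub>2 =
     \<Union> {hsegment B a b | a b. \<exists>N. orthogonal_circles N B \<and>
           orthogonal_circles N L\<^sub>1 \<and> orthogonal_circles N L\<^sub>2 \<and>
           a \<in> hline B N \<inter> hline B L\<^sub>1 \<and> b \<in> hline B N \<inter> hline B L\<^sub>2}"

definition hyperideal_vertices :: "ocircle \<Rightarrow> ocircle list \<Rightarrow> (real^3) set set" where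
  "hyperideal_vertices B Ls =
     {common_perpendicular B L\<^sub>1 L\<^sub>2 | L\<^sub>1 L\<^sub>2.
        consecutive Ls L\<^sub>1 L\<^sub>2 \<and> cdisk B \<inter> circ L\<^sub>1 \<inter> circ L\<^sub>2 = {}}"

definition proper_hyperideal_polygon :: "ocircle \<Rightarrow> ocircle list \<Rightarrow> bool" where
  "proper_hyperideal_polygon B Ls \<longleftrightarrow>
     hyperideal_polygon B Ls \<and>
     (\<forall>H\<in>hyperideal_vertices B Ls. H \<subseteq> hregion B Ls) \<and>
     (\<exists>K. compact K \<and> hconvex B K \<and> K \<subseteq> hregion B Ls \<and> htop B interior_of K \<noteq> {} \<and>
        htop B frontier_of K \<subseteq> (\<Union>L\<in>set Ls. hline B L) \<union> \<Union> (hyperideal_vertices B Ls) \<and>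
        (\<forall>H\<in>hyperideal_vertices B Ls. H \<subseteq> htop B frontier_of K) \<and>
        (\<forall>L\<in>set Ls. \<exists>x\<in>hline B L \<inter> (htop B frontier_of K).
                      \<exists>y\<in>hline B L \<inter> (htop B frontier_of K). x \<noteq> y))"


section \<open>Proper circle polyhedra\<close>

definition proper_c_polyhedron ::
    "'v polyhedron \<Rightarrow> ('v \<Rightarrow> ocircle) \<Rightarrow> ('v list \<Rightarrow> ocircle) \<Rightarrow> bool" where
  "proper_c_polyhedron P C Op \<longleftrightarrow>
     (\<forall>v\<in>vertex_set P. \<forall>fs. face_cycle P v fs \<longrightarrow>
        proper_hyperideal_polygon (C v) (map (\<lambda>f. opposite (Op f)) fs))"

end

theory Submission
  imports Defs
begin

text \<open>
The statement is Cauchy's rigidity theorem for circle polyhedra, and the proof is Cauchy's proof carried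
out in Lorentz space. A circle becomes a unit space-like vector \<open>cvec\<close> and a point of the sphere a null
vector \<open>hat\<close>; the form \<open>lq\<close> of two circles is minus their inversive distance. Orthogonality, the side of a
circle on which a point lies and segregation then become linear equations and inequalities, and Moebius
transformations become Lorentz transformations of positive determinant (\<open>moebius_lorentz\<close>). So congruent
faces have equal Gram matrices, and the congruence of one face extends to the whole polyhedron as soon as the
ortho-circles of any two adjacent faces have the same product \<open>lq\<close> in both polyhedra (\<open>congruence_spreads\<close>).

To see that these products agree (\<open>equal_angles\<close>), label each edge by the sign of the difference of the two
products, multiplied by the sign of \<open>(lq c\<^sub>u c\<^sub>v)\<^sup>2 - 1\<close>. Seen from a vertex \<open>v\<close>, the ortho-circles of the
faces at \<open>v\<close> are the sides of a convex polygon in the hyperbolic plane bounded by the circle of \<open>v\<close>, and the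
projections of the neighbouring circles are its vertices, which are real points where adjacent circles have
disjoint disks and hyperideal where they cross. The lengths of the sides are determined by the faces. The arm
lemma for such polygons (\<open>arm_lemma\<close>, \<open>closed_arm_lemma\<close>) says that opening the vertices of an arm, in the
sense of \<open>gain\<close>, moves its ends apart; the extra sign in the label accounts for the fact that a hyperideal
vertex opens when the product of its sides moves in the opposite direction. Hence the labels at a vertex
either all vanish or change sign at least four times (\<open>link_sign_changes\<close>). On a sphere this is possible only
if all labels vanish: the edges with a nonzero label would form a graph with too many edges for Euler's
formula (\<open>few_sign_changes\<close>).

Orientation enters once. The cyclic order of the sides of the polygons fixes the sign of a determinant formed
from three consecutive circles of a face and its ortho-circle (\<open>face_orientation\<close>), so an
orientation-preserving congruence of one face carries the ortho-circle to the ortho-circle, not to its opposite.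
\<close>

section \<open>Turns of plane frames\<close>

text \<open>The columns \<open>x\<close>, \<open>y\<close> and \<open>u\<close>, \<open>w\<close> of two frames
  are related by a matrix with equal diagonal entries. If the common entry is not positive, all entries of the
  second frame can be expressed by the four minors, and the signs of the minors contradict the position of the
  chord.\<close>

lemma late_case_impossible:
  fixes x1 x2 y1 y2 u1 u2 w1 w2 :: real
  assumes pos: "x2 > 0" "y1 > 0" "u2 > 0" "w1 > 0"
    and det: "y1 * x2 - x1 * y2 > 0" "w1 * u2 - u1 * w2 > 0"
    and left: "x1 * y1 + x2 * y2 \<ge> 0" "u1 * w1 + u2 * w2 \<ge> 0"
    and right: "x1 * x2 + y1 * y2 > 0" "u1 * u2 + w1 * w2 > 0"
    and pt: "w1 * x2 - u1 * y2 = u2 * y1 - w2 * x1" "w1 * x2 - u1 * y2 \<le> 0"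
    and late: "x1 > 0" "y2 < 0"
  shows False
proof -
  define D where "D = y1 * x2 - x1 * y2"
  define P where "P = - (w1 * x2 - u1 * y2)"
  define R where "R = - (u1 * y1 - w1 * x1)"
  define S where "S = w2 * x2 - u2 * y2"
  define z where "z = - y2"
  have z: "z > 0" "y2 = - z" using late unfolding z_def by auto
  have P0: "P \<ge> 0" using pt P_def by simp
  have Dz: "D = y1 * x2 + x1 * z" using D_def z by simp
  have P2: "P = - (u2 * y1 - w2 * x1)" using pt P_def by simp
  have D0: "D > 0" using det D_def by simp
  have e1: "D * w1 = R * z - P * y1" unfolding D_def P_def R_def z(2) by algebra
  have e2: "D * w2 = S * y1 + P * z" unfolding D_def P2 S_def z(2) by algebra
  have e3: "D * u1 = - (P * x1 + R * x2)" unfolding D_def P_def R_def z(2) by algebra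
  have e4: "D * u2 = S * x1 - P * x2" unfolding D_def P2 S_def z(2) by algebra
  have Rz: "R * z > 0" using e1 mult_pos_pos[OF D0 pos(4)] mult_nonneg_nonneg[OF P0 less_imp_le[OF pos(2)]] by linarith
  hence R0: "R > 0" using z by (simp add: zero_less_mult_iff)
  have "S * x1 > 0" using e4 mult_pos_pos[OF D0 pos(3)] mult_nonneg_nonneg[OF P0 less_imp_le[OF pos(1)]] by linarith
  hence S0: "S > 0" using late by (simp add: zero_less_mult_iff)
  have "D * u1 < 0" using e3 mult_nonneg_nonneg[OF P0 less_imp_le[OF late(1)]] mult_pos_pos[OF R0 pos(1)] by linarith
  hence u1: "u1 < 0" using D0 by (simp add: mult_less_0_iff)
  have "D * w2 > 0" using e2 mult_nonneg_nonneg[OF P0 less_imp_le[OF z(1)]] mult_pos_pos[OF S0 pos(2)] by linarith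
  hence w2: "w2 > 0" using D0 by (simp add: zero_less_mult_iff)
  \<comment> \<open>the fixed point of the motion on the chord lies to the left of the first line\<close>
  have c: "S * (x1 * y1) \<ge> R * (x2 * z)"
  proof (cases "R \<le> S")
    case True
    have "R * (x2 * z) \<le> S * (x2 * z)" using True pos z by (intro mult_right_mono) auto
    also have "\<dots> \<le> S * (x1 * y1)" using left(1) z S0 by (intro mult_left_mono) auto
    finally show ?thesis .
  next
    case False
    have "S * (u1 * w1) + R * (u2 * w2) = S * (u1 * w1 + u2 * w2) + (R - S) * (u2 * w2)"
      by algebra
    also have "\<dots> \<ge> 0"
      using mult_nonneg_nonneg[OF less_imp_le[OF S0] left(2)]
        mult_nonneg_nonneg[of "R - S" "u2 * w2"] mult_pos_pos[OF pos(3) w2] False by linarith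
    finally have a: "S * (u1 * w1) + R * (u2 * w2) \<ge> 0" .
    have "D^2 * (S * (u1 * w1) + R * (u2 * w2)) = S * ((D * u1) * (D * w1)) + R * ((D * u2) * (D * w2))"
      by algebra
    also have "\<dots> = (P^2 + R * S) * (S * (x1 * y1) - R * (x2 * z))"
      unfolding e1 e2 e3 e4 by algebra
    finally have "(P^2 + R * S) * (S * (x1 * y1) - R * (x2 * z)) \<ge> 0"
      using mult_nonneg_nonneg[OF zero_le_power2[of D] a] by simp
    moreover have "P^2 + R * S > 0" using R0 S0 by (simp add: add_nonneg_pos)
    ultimately show ?thesis by (simp add: zero_le_mult_iff)
  qed
  \<comment> \<open>both feet are on the right of the chord, so the rotation angle is less than a half-turn\<close>
  have a1: "x1 * x2 > y1 * z" using right(1) z by simp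
  have a2: "(D * w1) * (D * w2) > (- (D * u1)) * (D * u2)"
  proof -
    have "(D * w1) * (D * w2) - (- (D * u1)) * (D * u2) = D^2 * (u1 * u2 + w1 * w2)" by algebra
    also have "\<dots> > 0" using D0 right(2) by simp
    finally show ?thesis by simp
  qed
  have a3: "(- (D * u1)) * (D * u2) > 0"
    using mult_pos_pos[of "- (D * u1)" "D * u2"] D0 u1 pos(3) by (simp add: mult_pos_neg)
  have "(y1 * z) * ((- (D * u1)) * (D * u2)) < (x1 * x2) * ((D * w1) * (D * w2))"
    by (rule mult_strict_mono[OF a1 a2]) (use a1 a3 pos z in \<open>auto intro: less_trans[OF mult_pos_pos]\<close>)
  also have "(x1 * x2) * ((D * w1) * (D * w2)) - (y1 * z) * ((- (D * u1)) * (D * u2))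
      = P * D * (R * (x2 * z) - S * (x1 * y1))"
    unfolding e1 e2 e3 e4 using Dz by algebra
  hence "(x1 * x2) * ((D * w1) * (D * w2))
      = (y1 * z) * ((- (D * u1)) * (D * u2)) + P * D * (R * (x2 * z) - S * (x1 * y1))" by simp
  finally have "P * D * (R * (x2 * z) - S * (x1 * y1)) > 0" by simp
  moreover have "P * D * (R * (x2 * z) - S * (x1 * y1)) \<le> 0"
    using P0 D0 c by (simp add: mult_nonneg_nonpos)
  ultimately show False by simp
qed

text \<open>The equality case of the comparison of two arms: if the diagonal entries of the matrix carrying one
  frame to the other agree, they are positive. Geometrically, the motion is not a half-turn about a point of the
  chord or more.\<close>

lemma no_half_turn:
  fixes x1 x2 y1 y2 u1 u2 w1 w2 :: real
  assumes pos: "x2 > 0" "y1 > 0" "u2 > 0" "w1 > 0"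
    and det: "y1 * x2 - x1 * y2 > 0" "w1 * u2 - u1 * w2 > 0"
    and left: "x1 * y1 + x2 * y2 \<ge> 0" "u1 * w1 + u2 * w2 \<ge> 0"
    and right: "x1 * x2 + y1 * y2 > 0" "u1 * u2 + w1 * w2 > 0"
    and pt: "w1 * x2 - u1 * y2 = u2 * y1 - w2 * x1"
  shows "w1 * x2 - u1 * y2 > 0"
proof (rule ccontr)
  assume "\<not> ?thesis"
  hence le: "w1 * x2 - u1 * y2 \<le> 0" by simp
  define D where "D = y1 * x2 - x1 * y2"
  define p where "p = w1 * x2 - u1 * y2"
  define r where "r = u1 * y1 - w1 * x1"
  define s where "s = w2 * x2 - u2 * y2"
  have p2: "p = u2 * y1 - w2 * x1" using pt p_def by simp
  have p0: "p \<le> 0" using le p_def by simp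
  have D0: "D > 0" using det D_def by simp
  have e1: "D * w1 = p * y1 + r * y2" unfolding D_def p_def r_def by algebra
  have e2: "D * w2 = s * y1 + p * y2" unfolding D_def p2 s_def by algebra
  have e3: "D * u1 = p * x1 + r * x2" unfolding D_def p_def r_def by algebra
  have e4: "D * u2 = s * x1 + p * x2" unfolding D_def p2 s_def by algebra
  have ry: "r * y2 \<ge> - p * y1" "r * y2 > 0"
    using e1 mult_pos_pos[OF D0 pos(4)] mult_nonneg_nonneg[of "-p" y1] p0 pos by auto
  have sx: "s * x1 \<ge> - p * x2" "s * x1 > 0"
    using e4 mult_pos_pos[OF D0 pos(3)] mult_nonneg_nonneg[of "-p" x2] p0 pos by auto
  have ne: "x1 \<noteq> 0" "y2 \<noteq> 0" using ry sx by auto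
  show False
  proof (cases "x1 > 0")
    case x1: True
    show False
    proof (cases "y2 > 0")
      case True
      have "(- p * y1) * (- p * x2) \<le> (r * y2) * (s * x1)"
        by (rule mult_mono[OF ry(1) sx(1)]) (use ry sx p0 pos in \<open>auto simp: mult_nonpos_nonneg\<close>)
      hence a: "p^2 * (y1 * x2) \<le> (r * s) * (x1 * y2)" by (simp add: power2_eq_square algebra_simps)
      have "p^2 - r * s = D * (w1 * u2 - u1 * w2)"
        unfolding D_def p_def r_def s_def using pt by algebra
      moreover have "D * (w1 * u2 - u1 * w2) > 0" using D0 det by simp
      ultimately have rs: "r * s < p^2" by linarith
      have "(r * s) * (x1 * y2) < p^2 * (x1 * y2)" using rs x1 True by simp
      also have "\<dots> \<le> p^2 * (y1 * x2)" using det(1) by (intro mult_left_mono) auto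
      finally show False using a by simp
    next
      case False
      hence "y2 < 0" using ne by simp
      from late_case_impossible[OF pos det left right pt le x1 this] show False .
    qed
  next
    case False
    hence x1: "x1 < 0" using ne by simp
    hence s: "s < 0" using sx by (simp add: zero_less_mult_iff)
    show False
    proof (cases "y2 > 0")
      case True
      hence r: "r > 0" using ry by (simp add: zero_less_mult_iff)
      have "D * u1 > 0" using e3 mult_nonpos_nonpos[of p x1] p0 x1 mult_pos_pos[OF r pos(1)] by linarith
      hence u1: "u1 > 0" using D0 by (simp add: zero_less_mult_iff)
      have "D * w2 < 0" using e2 mult_nonpos_nonneg[of p y2] p0 True mult_neg_pos[OF s pos(2)] by linarith
      hence w2: "w2 < 0" using D0 by (simp add: mult_less_0_iff)
      show False
        by (rule late_case_impossible[OF pos(3,4,1,2) det(2,1) left(2,1) right(2,1) _ _ u1 w2])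
           (use pt le in \<open>simp_all add: algebra_simps\<close>)
    next
      case False
      hence "y2 < 0" using ne by simp
      hence "x1 * y1 + x2 * y2 < 0" using x1 pos by (simp add: add_neg_neg mult_neg_pos mult_pos_neg)
      thus False using left by simp
    qed
  qed
qed


text \<open>At a real vertex two consecutive frames differ by a rotation. Convexity and the position of the
  vertex on the right of the chord bound the angle of rotation to the first quadrant.\<close>

lemma canonical_turn_timelike:
  fixes x1 x2 y1 y2 a1 a2 b1 b2 c s :: real
  assumes pos: "x2 > 0" "y1 > 0" "a2 > 0" "b1 > 0"
    and turn: "a1 = c * x1 + s * y1" "a2 = c * x2 + s * y2" "b1 = c * y1 - s * x1" "b2 = c * y2 - s * x2"
    and cs: "c * s > 0"
    and det: "y1 * x2 - x1 * y2 = 1"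
    and left: "x1 * y1 + x2 * y2 \<ge> 0" "a1 * b1 + a2 * b2 \<ge> 0"
    and right: "x1 * x2 + y1 * y2 > 0"
  shows "c > 0" "s > 0"
proof -
  have "\<not> c < 0"
  proof
    assume c: "c < 0"
    hence s: "s < 0" using cs by (simp add: zero_less_mult_iff)
    have y2: "y2 < 0"
      using pos(3) turn(2) mult_neg_pos[OF c pos(1)] s by (smt (verit) mult_neg_neg mult_nonneg_nonpos mult_nonpos_nonneg)
    have x1: "x1 > 0"
      using pos(4) turn(3) mult_neg_pos[OF c pos(2)] s by (smt (verit) mult_nonpos_nonpos)
    define h where "h = x1 * y1 + x2 * y2"
    define K where "K = y1^2 + y2^2 - x1^2 - x2^2"
    have ge: "(c^2 - s^2) * h + c * s * K \<ge> 0"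
      using left(2) unfolding turn h_def K_def by (simp add: algebra_simps power2_eq_square)
    have g0: "(x1^2 - y1^2) * h + x1 * y1 * K = (x1 * (-y2) + y1 * x2) * (y1 * (-y2) - x1 * x2)"
      unfolding h_def K_def by algebra
    have "x1 * (-y2) + y1 * x2 > 0"
      using mult_pos_pos[of x1 "-y2"] mult_pos_pos[OF pos(2,1)] x1 y2 by linarith
    moreover have "y1 * (-y2) - x1 * x2 < 0" using right by simp
    ultimately have g1: "(x1^2 - y1^2) * h + x1 * y1 * K < 0" unfolding g0 by (simp add: mult_pos_neg)
    have "x1 * y1 * (c^2 - s^2) - c * s * (x1^2 - y1^2) = (c * x1 + s * y1) * (c * y1 - s * x1)"
      by algebra
    also have "\<dots> \<le> 0"
    proof -
      have "c * x1 + s * y1 \<le> 0" using c s x1 pos by (simp add: add_nonpos_nonpos mult_nonpos_nonneg)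
      thus ?thesis using pos(4) unfolding turn(3) by (simp add: mult_nonpos_nonneg)
    qed
    finally have "x1 * y1 * (c^2 - s^2) \<le> c * s * (x1^2 - y1^2)" by simp
    hence "x1 * y1 * (c^2 - s^2) * h \<le> c * s * (x1^2 - y1^2) * h"
      using left(1) h_def by (intro mult_right_mono) auto
    hence "x1 * y1 * ((c^2 - s^2) * h + c * s * K) \<le> c * s * ((x1^2 - y1^2) * h + x1 * y1 * K)"
      by (simp add: algebra_simps)
    also have "\<dots> < 0" using cs g1 by (simp add: mult_pos_neg)
    finally have "x1 * y1 * ((c^2 - s^2) * h + c * s * K) < 0" .
    moreover have "x1 * y1 > 0" using x1 pos by simp
    ultimately show False using mult_nonneg_nonneg[OF less_imp_le ge] by fastforce
  qed
  moreover have "c \<noteq> 0" using cs by auto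
  ultimately show "c > 0" by simp
  thus "s > 0" using cs by (simp add: zero_less_mult_iff)
qed

text \<open>A positive definite quadratic form written as a sum of two squares in two ways: the two pairs of
  linear forms differ by a rotation.\<close>

lemma same_point_turn:
  fixes x1 x2 y1 y2 a1 a2 b1 b2 eps eps' :: real
  assumes det: "y1 * x2 - x1 * y2 = 1" "b1 * a2 - a1 * b2 = 1"
    and e: "x1^2 + y1^2 = a1^2 + b1^2" "x1 * x2 + y1 * y2 = a1 * a2 + b1 * b2" "x2^2 + y2^2 = a2^2 + b2^2"
  defines "c \<equiv> x2 * b1 - x1 * b2" and "s \<equiv> x2 * a1 - x1 * a2"
  shows "a1 = c * x1 + s * y1" "a2 = c * x2 + s * y2" "b1 = c * y1 - s * x1" "b2 = c * y2 - s * x2"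
    and "c^2 + s^2 = 1"
proof -
  have b1: "b1 = (x1^2 + y1^2) * a2 - (x1 * x2 + y1 * y2) * a1"
    unfolding e using det(2) by algebra
  have b2: "b2 = (x1 * x2 + y1 * y2) * a2 - (x2^2 + y2^2) * a1"
    unfolding e using det(2) by algebra
  have c: "c = y1 * a2 - y2 * a1"
    unfolding c_def b1 b2 using det(1) by algebra
  have a1: "a1 = - (x1^2 + y1^2) * b2 + (x1 * x2 + y1 * y2) * b1"
    unfolding e using det(2) by algebra
  have a2: "a2 = - (x1 * x2 + y1 * y2) * b2 + (x2^2 + y2^2) * b1"
    unfolding e using det(2) by algebra
  have s: "s = y2 * b1 - y1 * b2"
    unfolding s_def using a1 a2 det(1) by algebra
  show "a1 = c * x1 + s * y1" unfolding c s_def using det(1) by algebra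
  show "a2 = c * x2 + s * y2" unfolding c s_def using det(1) by algebra
  show "b1 = c * y1 - s * x1" unfolding s c_def using det(1) by algebra
  show "b2 = c * y2 - s * x2" unfolding s c_def using det(1) by algebra
  have "c * c + s * s = (y1 * a2 - y2 * a1) * (x2 * b1 - x1 * b2) + (y2 * b1 - y1 * b2) * (x2 * a1 - x1 * a2)"
    using c s c_def s_def by simp
  also have "\<dots> = 1" using det by algebra
  finally show "c^2 + s^2 = 1" by (simp add: power2_eq_square)
qed

text \<open>Passing a real vertex. The frames of the two arms turn by angles in the first quadrant, and the
  hypothesis on the opening of the vertex compares these angles.\<close>

lemma step_timelike:
  fixes x1 x2 y1 y2 u1 u2 w1 w2 a1 a2 b1 b2 c1 c2 d1 d2 c s c' s' :: real
  assumes pos: "x2 > 0" "y1 > 0" "u2 > 0" "w1 > 0" "a2 > 0" "b1 > 0" "c2 > 0" "d1 > 0"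
    and det: "y1 * x2 - x1 * y2 = 1" "w1 * u2 - u1 * w2 = 1"
    and turn: "a1 = c * x1 + s * y1" "a2 = c * x2 + s * y2" "b1 = c * y1 - s * x1" "b2 = c * y2 - s * x2"
      "c^2 + s^2 = 1" "c * s > 0"
    and turn': "c1 = c' * u1 + s' * w1" "c2 = c' * u2 + s' * w2" "d1 = c' * w1 - s' * u1" "d2 = c' * w2 - s' * u2"
      "c'^2 + s'^2 = 1" "c' * s' > 0"
    and left: "x1 * y1 + x2 * y2 \<ge> 0" "u1 * w1 + u2 * w2 \<ge> 0" "a1 * b1 + a2 * b2 \<ge> 0" "c1 * d1 + c2 * d2 \<ge> 0"
    and right: "x1 * x2 + y1 * y2 > 0" "u1 * u2 + w1 * w2 > 0"
    and opens: "c'^2 - s'^2 \<ge> c^2 - s^2"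
  defines "p \<equiv> w1 * x2 - u1 * y2" and "t \<equiv> u2 * y1 - w2 * x1"
    and "p' \<equiv> d1 * a2 - c1 * b2" and "t' \<equiv> c2 * b1 - d2 * a1"
  assumes I: "p \<ge> t" "p = t \<longrightarrow> p > 0"
  shows "p' \<ge> t'" "p' = t' \<longrightarrow> p' > 0" "p > t \<or> c'^2 - s'^2 > c^2 - s^2 \<Longrightarrow> p' > t'"
proof -
  have c: "c > 0" "s > 0"
    by (rule canonical_turn_timelike[OF pos(1,2,5,6) turn(1-4) turn(6) det(1) left(1,3) right(1)])+
  have c': "c' > 0" "s' > 0"
    by (rule canonical_turn_timelike[OF pos(3,4,7,8) turn'(1-4) turn'(6) det(2) left(2,4) right(2)])+
  have dab: "b1 * a2 - a1 * b2 = 1" using det(1) turn by algebra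
  have dcd: "d1 * c2 - c1 * d2 = 1" using det(2) turn' by algebra
  define q where "q = w1 * a2 - u1 * b2"
  define r where "r = u2 * b1 - w2 * a1"
  have wedge: "t * q - p * r = s * ((x1 * x2 + y1 * y2) + (u1 * u2 + w1 * w2))"
    unfolding t_def q_def p_def r_def turn using det by algebra
  hence wpos: "t * q - p * r > 0" using c right by simp
  have avoid: "m * p + n * q > 0" if mn: "m > 0" "n \<ge> 0" "m * p + n * q = m * t + n * r" for m n
  proof -
    let ?x1 = "m * x1 + n * a1" and ?x2 = "m * x2 + n * a2" and ?y1 = "m * y1 + n * b1" and ?y2 = "m * y2 + n * b2"
    have dm: "?y1 * ?x2 - ?x1 * ?y2 = m^2 + 2 * m * n * c + n^2"
      unfolding turn using det(1) turn(5) by algebra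
    have dpos: "m^2 + 2 * m * n * c + n^2 > 0" using mn c by (simp add: add_pos_nonneg)
    have mix: "c * (x1 * b1 + x2 * b2 + a1 * y1 + a2 * y2) = (a1 * b1 + a2 * b2) + (x1 * y1 + x2 * y2)"
      unfolding turn using turn(5) by algebra
    have mixpos: "x1 * b1 + x2 * b2 + a1 * y1 + a2 * y2 \<ge> 0"
      using mix left c by (metis add_nonneg_nonneg zero_le_mult_iff not_less)
    have "?x1 * ?y1 + ?x2 * ?y2 = m^2 * (x1 * y1 + x2 * y2) + n^2 * (a1 * b1 + a2 * b2)
        + m * n * (x1 * b1 + x2 * b2 + a1 * y1 + a2 * y2)"
      by algebra
    also have "\<dots> \<ge> 0"
      using mult_nonneg_nonneg[of "m^2" "x1 * y1 + x2 * y2"] mult_nonneg_nonneg[of "n^2" "a1 * b1 + a2 * b2"]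
        mult_nonneg_nonneg[of "m * n" "x1 * b1 + x2 * b2 + a1 * y1 + a2 * y2"] mn left mixpos by simp
    finally have lm: "?x1 * ?y1 + ?x2 * ?y2 \<ge> 0" .
    have "?x1 * ?x2 + ?y1 * ?y2 = (m^2 + 2 * m * n * c + n^2) * (x1 * x2 + y1 * y2)"
      unfolding turn using turn(5) by algebra
    hence rm: "?x1 * ?x2 + ?y1 * ?y2 > 0" using dpos right by simp
    have "w1 * ?x2 - u1 * ?y2 > 0"
    proof (rule no_half_turn[where ?u2.0 = u2 and ?w2.0 = w2])
      show "w1 * ?x2 - u1 * ?y2 = u2 * ?y1 - w2 * ?x1"
        using mn(3) unfolding p_def q_def t_def r_def by (simp add: algebra_simps)
    qed (use pos mn lm rm left right det dm dpos in \<open>auto simp: add_pos_nonneg\<close>)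
    thus ?thesis unfolding p_def q_def by (simp add: algebra_simps)
  qed
  have qr: "q > r"
  proof (rule ccontr)
    assume "\<not> ?thesis"
    hence le: "q \<le> r" by simp
    show False
    proof (cases "q = r")
      case True
      show False
      proof (cases "p = t")
        case pt: True
        with True wpos show False by simp
      next
        case False
        hence "p > t" using I by simp
        moreover from wpos True have "q * (t - p) > 0" by (simp add: algebra_simps)
        ultimately have qn: "q < 0" by (simp add: zero_less_mult_iff)
        have ea: "a1 * a2 + b1 * b2 = x1 * x2 + y1 * y2" unfolding turn using turn(5) by algebra
        have "w1 * a2 - u1 * b2 > 0"
          by (rule no_half_turn[where ?u2.0 = u2 and ?w2.0 = w2])
             (use pos left right det dab ea True q_def r_def in auto)
        thus False using qn q_def by simp
      qed
    next
      case False
      hence lt: "q < r" using le by simp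
      have "(r - q) * p + (p - t) * q > 0"
        by (rule avoid) (use lt I in \<open>auto simp: algebra_simps\<close>)
      moreover have "(r - q) * p + (p - t) * q = - (t * q - p * r)" by algebra
      ultimately show False using wpos by simp
    qed
  qed
  define n where "n = s' / s"
  define m where "m = c' - c * s' / s"
  have n0: "n > 0" using c c' n_def by simp
  have cc: "c' \<ge> c" "s' \<le> s"
  proof -
    have "c'^2 \<ge> c^2" "s'^2 \<le> s^2" using opens turn(5) turn'(5) by auto
    thus "c' \<ge> c" "s' \<le> s" using c c' by (auto intro: power2_le_imp_le)
  qed
  have m0: "m \<ge> 0"
  proof -
    have "c * s' \<le> c' * s" using cc c c' by (intro mult_mono) auto
    thus ?thesis using c unfolding m_def by (simp add: field_simps)
  qed
  have ms: "m > 0" if "c'^2 - s'^2 > c^2 - s^2"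
  proof -
    have "c'^2 > c^2" using that turn(5) turn'(5) by auto
    hence "c' > c" using c' by (simp add: power2_less_imp_less)
    hence "c * s' < c' * s" using cc c c' by (intro mult_less_le_imp_less) auto
    thus ?thesis using c unfolding m_def by (simp add: field_simps)
  qed
  have cs': "c' = m + n * c" "s' = n * s" unfolding m_def n_def using c by auto
  have p': "p' = m * q + n * p"
    unfolding p'_def q_def p_def turn'(1-4) cs' unfolding turn(1-4) using turn(5) by algebra
  have t': "t' = m * r + n * t"
    unfolding t'_def r_def t_def turn'(1-4) cs' unfolding turn(1-4) using turn(5) by algebra
  have diff: "p' - t' = n * (p - t) + m * (q - r)" unfolding p' t' by algebra
  show "p' \<ge> t'" using diff n0 m0 I qr by (metis add_nonneg_nonneg diff_ge_0_iff_ge less_imp_le mult_nonneg_nonneg)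
  show "p' > t'" if "p > t \<or> c'^2 - s'^2 > c^2 - s^2"
  proof -
    have "p' - t' > 0"
    proof (cases "p > t")
      case True
      thus ?thesis unfolding diff using n0 m0 qr by (intro add_pos_nonneg) auto
    next
      case False
      thus ?thesis unfolding diff using n0 ms that I qr by (intro add_nonneg_pos) auto
    qed
    thus ?thesis by simp
  qed
  show "p' = t' \<longrightarrow> p' > 0"
  proof
    assume eq: "p' = t'"
    have "n * p + m * q > 0" by (rule avoid) (use n0 m0 eq in \<open>auto simp: p' t'\<close>)
    thus "p' > 0" by (simp add: p')
  qed
qed

text \<open>The determinant condition forces \<open>pp > tp\<close>, so weights that prefer the second terms
  preserve the inequality.\<close>

lemma cone_step:
  fixes tm pm tp pp C D :: real
  assumes "tm > 0" "pp > 0" "tm * pp - pm * tp > 0" "0 < C" "C \<le> D"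
    and I: "pm + pp \<ge> tm + tp"
  defines "P \<equiv> C * pm + D * pp" and "T \<equiv> C * tm + D * tp"
  shows "P \<ge> T" "P = T \<longrightarrow> P > 0" "pm + pp > tm + tp \<or> C < D \<Longrightarrow> P > T"
proof -
  have k: "pp > tp"
  proof (rule ccontr)
    assume "\<not> ?thesis"
    hence a: "tp \<ge> pp" by simp
    hence b: "pm \<ge> tm" using I by simp
    have "tm * pp \<le> pm * tp" using a b assms by (intro mult_mono) auto
    thus False using assms(3) by simp
  qed
  have e: "P - T = C * (pm + pp - tm - tp) + (D - C) * (pp - tp)" unfolding P_def T_def by algebra
  have "C * (pm + pp - tm - tp) \<ge> 0" "(D - C) * (pp - tp) \<ge> 0" using assms k by auto
  thus "P \<ge> T" using e by simp
  show "P > T" if "pm + pp > tm + tp \<or> C < D"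
  proof -
    have "C * (pm + pp - tm - tp) > 0 \<or> (D - C) * (pp - tp) > 0" using that assms k by auto
    thus ?thesis using e \<open>C * (pm + pp - tm - tp) \<ge> 0\<close> \<open>(D - C) * (pp - tp) \<ge> 0\<close> by linarith
  qed
  show "P = T \<longrightarrow> P > 0"
  proof (intro impI, rule ccontr)
    assume PT: "P = T" and "\<not> P > 0"
    hence P: "C * pm + D * pp \<le> 0" and T: "C * tm + D * tp \<le> 0" using P_def T_def by auto
    have "(C * tm) * (D * pp) \<le> (- (D * tp)) * (- (C * pm))"
    proof (rule mult_mono)
      have "C * tm > 0" "D * pp > 0" using assms by auto
      thus "0 \<le> - (D * tp)" "0 \<le> D * pp" using T by auto
    qed (use P T in auto)
    hence "(C * D) * (tm * pp) \<le> (C * D) * (pm * tp)" by (simp add: algebra_simps)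
    moreover have "C * D > 0" using assms by auto
    ultimately show False using assms(3) by (smt (verit) mult_le_cancel_left_pos)
  qed
qed

text \<open>Passing a hyperideal vertex. Consecutive frames now differ by a hyperbolic rotation, whose parameter
  measures the length of the common perpendicular of the two sides; \<open>opens\<close> compares these lengths.\<close>

lemma step_spacelike:
  fixes x1 x2 y1 y2 u1 u2 w1 w2 a1 a2 b1 b2 c1 c2 d1 d2 k h k' h' :: real
  assumes pos: "x2 > 0" "y1 > 0" "u2 > 0" "w1 > 0" "a2 > 0" "b1 > 0" "c2 > 0" "d1 > 0"
    and det: "y1 * x2 - x1 * y2 = 1" "w1 * u2 - u1 * w2 = 1"
    and turn: "a1 = k * y1 - h * x1" "a2 = k * y2 - h * x2" "b1 = h * y1 - k * x1" "b2 = h * y2 - k * x2"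
      "k^2 - h^2 = 1" "k * h > 0"
    and turn': "c1 = k' * w1 - h' * u1" "c2 = k' * w2 - h' * u2" "d1 = h' * w1 - k' * u1" "d2 = h' * w2 - k' * u2"
      "k'^2 - h'^2 = 1" "k' * h' > 0"
    and right: "y1 * y2 - x1 * x2 > 0" "w1 * w2 - u1 * u2 > 0"
    and opens: "k'^2 + h'^2 \<ge> k^2 + h^2"
  defines "p \<equiv> w1 * x2 - u1 * y2" and "t \<equiv> u2 * y1 - w2 * x1"
    and "p' \<equiv> d1 * a2 - c1 * b2" and "t' \<equiv> c2 * b1 - d2 * a1"
  assumes I: "p \<ge> t" "p = t \<longrightarrow> p > 0"
  shows "p' \<ge> t'" "p' = t' \<longrightarrow> p' > 0" "p > t \<or> k'^2 + h'^2 > k^2 + h^2 \<Longrightarrow> p' > t'"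
proof -
  have aux: "k > 0 \<and> h > 0 \<and> x2 + y2 > 0 \<and> y1 - x1 > 0 \<and> k > h"
    if pos: "x2 > 0" "y1 > 0" "k * y2 - h * x2 > 0" "h * y1 - k * x1 > 0" "k * h > 0"
      and right: "y1 * y2 - x1 * x2 > 0" and kh: "k^2 - h^2 = 1" and det: "y1 * x2 - x1 * y2 = 1"
    for x1 x2 y1 y2 k h :: real
  proof -
    have k: "k > 0"
    proof (rule ccontr)
      assume "\<not> k > 0"
      hence k: "k < 0" and h: "h < 0" using pos(5) by (auto simp: zero_less_mult_iff)
      have a: "(-h) * x2 > (-k) * y2" and b: "(-k) * x1 > (-h) * y1" using pos by auto
      have "(-h) * y1 > 0" using h pos by (simp add: mult_neg_pos)
      hence x1: "x1 > 0" using b k by (smt (verit) mult_nonneg_nonpos)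
      show False
      proof (cases "y2 > 0")
        case True
        have "((-k) * y2) * ((-h) * y1) < ((-h) * x2) * ((-k) * x1)"
          by (rule mult_strict_mono[OF a b]) (use h k pos x1 True in \<open>auto simp: mult_neg_pos mult_nonpos_nonneg\<close>)
        hence "(k * h) * (y1 * y2) < (k * h) * (x1 * x2)" by (simp add: algebra_simps)
        thus False using pos(5) right by (smt (verit) mult_left_mono)
      next
        case False
        hence "y1 * y2 \<le> 0" using pos by (simp add: mult_nonneg_nonpos)
        moreover have "x1 * x2 > 0" using x1 pos by simp
        ultimately show False using right by simp
      qed
    qed
    hence h: "h > 0" using pos(5) by (simp add: zero_less_mult_iff)
    have "k^2 > h^2" using kh by simp
    hence "k > h" using k by (simp add: power2_less_imp_less)
    have "2 * ((x2 + y2) * (y1 - x1)) = 2 * (y1 * y2 - x1 * x2) + 2 * (y1 * x2 - x1 * y2)" by algebra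
    hence UV: "(x2 + y2) * (y1 - x1) > 0" using right det by simp
    have "x2 + y2 > 0"
    proof (rule ccontr)
      assume "\<not> ?thesis"
      hence "x2 + y2 < 0" "y1 - x1 < 0" using UV by (auto simp: zero_less_mult_iff)
      hence "y2 < 0" "x1 > 0" using pos by auto
      hence "y1 * y2 < 0" "x1 * x2 > 0" using pos by (auto simp: mult_pos_neg)
      thus False using right by simp
    qed
    thus ?thesis using UV k h \<open>k > h\<close> by (simp add: zero_less_mult_iff)
  qed
  have A: "k > 0 \<and> h > 0 \<and> x2 + y2 > 0 \<and> y1 - x1 > 0 \<and> k > h"
    by (rule aux) (use pos turn det right in auto)
  have B: "k' > 0 \<and> h' > 0 \<and> u2 + w2 > 0 \<and> w1 - u1 > 0 \<and> k' > h'"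
    by (rule aux) (use pos turn' det right in auto)
  define tm where "tm = (u2 + w2) * (y1 - x1)"
  define pm where "pm = - (u1 + w1) * (y2 - x2)"
  define tp where "tp = - (w2 - u2) * (x1 + y1)"
  define pp where "pp = (w1 - u1) * (x2 + y2)"
  have "tm * pp - pm * tp = 2 * (y1 * y2 - x1 * x2) + 2 * (w1 * w2 - u1 * u2)"
    unfolding tm_def pp_def pm_def tp_def using det by algebra
  hence W: "tm * pp - pm * tp > 0" using right by simp
  define C where "C = k * k' - h * h'"
  define S where "S = h' * k - k' * h"
  have CS: "C^2 - S^2 = 1" unfolding C_def S_def using turn(5) turn'(5) by algebra
  have "h * h' < k * k'" using A B by (intro mult_strict_mono) auto
  hence C0: "C > 0" unfolding C_def by simp
  have hh: "h'^2 \<ge> h^2" "k'^2 \<ge> k^2" using opens turn(5) turn'(5) by auto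
  have S2: "S * (h' * k + k' * h) = h'^2 - h^2"
    unfolding S_def using turn(5) turn'(5) by algebra
  have hk: "h' * k + k' * h > 0" using A B by (simp add: add_pos_pos)
  have S0: "S \<ge> 0" using S2 hh(1) hk by (metis diff_ge_0_iff_ge not_less zero_le_mult_iff)
  have Ss: "S > 0" if "k'^2 + h'^2 > k^2 + h^2"
  proof -
    have "h'^2 - h^2 > 0" using that turn(5) turn'(5) by auto
    hence "S * (h' * k + k' * h) > 0" using S2 by simp
    thus ?thesis using hk by (simp add: zero_less_mult_iff)
  qed
  have "(C - S) * (C + S) = 1" using CS by algebra
  hence CmS: "C - S > 0" using C0 S0 by (smt (verit) mult_nonpos_nonneg)
  have pe: "pm + pp = 2 * p" "tm + tp = 2 * t"
    unfolding pm_def pp_def tm_def tp_def p_def t_def by algebra+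
  have pe': "(C - S) * pm + (C + S) * pp = 2 * p'" "(C - S) * tm + (C + S) * tp = 2 * t'"
    unfolding pm_def pp_def tm_def tp_def p'_def t'_def C_def S_def turn turn' by algebra+
  note st = cone_step[of tm pp pm tp "C - S" "C + S"]
  have prem: "tm > 0" "pp > 0" "tm * pp - pm * tp > 0" "0 < C - S" "C - S \<le> C + S" "tm + tp \<le> pm + pp"
    using A B W CmS S0 I unfolding pe by (auto simp: tm_def pp_def)
  from st(1)[OF prem] show "p' \<ge> t'" unfolding pe' by simp
  from st(2)[OF prem] show "p' = t' \<longrightarrow> p' > 0" unfolding pe' by simp
  show "p' > t'" if "p > t \<or> k'^2 + h'^2 > k^2 + h^2"
    using st(3)[OF prem] that Ss unfolding pe' pe by fastforce
qed

section \<open>The hyperbolic plane in symmetric matrices\<close>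

type_synonym sm = "real \<times> real \<times> real"

abbreviation cu :: "sm \<Rightarrow> real" where "cu P \<equiv> fst P"
abbreviation cv :: "sm \<Rightarrow> real" where "cv P \<equiv> fst (snd P)"
abbreviation cw :: "sm \<Rightarrow> real" where "cw P \<equiv> snd (snd P)"

text \<open>Points and lines of the hyperbolic plane are represented by symmetric matrices \<open>((u, v), (v,
  w))\<close>: the quadratic form \<open>mf P P\<close> is the determinant, so points are the positive definite
  matrices of determinant 1, and lines have determinant -1.\<close>

definition mf :: "sm \<Rightarrow> sm \<Rightarrow> real" where
  "mf P Q = (cu P * cw Q + cw P * cu Q) / 2 - cv P * cv Q"

text \<open>The Lorentzian cross product, up to a factor: \<open>crs P Q\<close> is orthogonal to both
  arguments.\<close>

definition crs :: "sm \<Rightarrow> sm \<Rightarrow> sm" where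
  "crs P Q = (2 * (cu P * cv Q - cv P * cu Q), cu P * cw Q - cw P * cu Q, 2 * (cv P * cw Q - cw P * cv Q))"

definition future :: "sm \<Rightarrow> bool" where
  "future P \<longleftrightarrow> mf P P > 0 \<and> cu P > 0"

text \<open>A line of determinant -1 is the symmetric product of its two ideal ends \<open>x\<close> and
  \<open>y\<close>, which are vectors of the plane. The signs of \<open>x2\<close> and \<open>y1\<close> select
  one of the two liftings of the ends.\<close>

definition frame :: "sm \<Rightarrow> real \<Rightarrow> real \<Rightarrow> real \<Rightarrow> real \<Rightarrow> bool" where
  "frame L x1 x2 y1 y2 \<longleftrightarrow> x2 > 0 \<and> y1 > 0 \<and> y1 * x2 - x1 * y2 = 1 \<and>
     L = (2 * x1 * y1, x1 * y2 + x2 * y1, 2 * x2 * y2)"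

text \<open>The points of the plane orthogonal to a line, in the coordinates given by the null vectors \<open>x
  x\<^sup>T\<close> and \<open>y y\<^sup>T\<close> of its ends.\<close>

definition pt :: "real \<Rightarrow> real \<Rightarrow> real \<Rightarrow> real \<Rightarrow> real \<Rightarrow> real \<Rightarrow> sm" where
  "pt x1 x2 y1 y2 alpha beta = (alpha * x1 * x1 + beta * y1 * y1, alpha * x1 * x2 + beta * y1 * y2, alpha * x2 * x2 + beta * y2 * y2)"

lemma frame_exists:
  assumes "mf L L = -1" "cv L > -1"
  obtains x1 x2 y1 y2 where "frame L x1 x2 y1 y2"
proof -
  obtain u v w where L: "L = (u, v, w)" by (metis prod.exhaust)
  have n: "u * w = (v - 1) * (v + 1)" using assms(1) by (simp add: L mf_def algebra_simps)
  have v: "v + 1 > 0" using assms(2) L by simp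
  have "u / (v + 1) * (w / 2) = (v - 1) / 2" using n v by (simp add: field_simps)
  hence "frame L (u / (v + 1)) 1 ((v + 1) / 2) (w / 2)"
    using v unfolding frame_def L by (simp add: field_simps)
  thus ?thesis using that by blast
qed

lemma frame_scale:
  assumes "frame L x1 x2 y1 y2" "\<sigma> > 0"
  shows "frame L (\<sigma> * x1) (\<sigma> * x2) (y1 / \<sigma>) (y2 / \<sigma>)"
    and "pt (\<sigma> * x1) (\<sigma> * x2) (y1 / \<sigma>) (y2 / \<sigma>) alpha beta = pt x1 x2 y1 y2 (alpha * \<sigma>^2) (beta / \<sigma>^2)"
  using assms by (auto simp: frame_def pt_def field_simps power2_eq_square)

lemma frame_coords:
  assumes "frame L x1 x2 y1 y2" "mf P L = 0"
  obtains alpha beta where "P = pt x1 x2 y1 y2 alpha beta"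
proof -
  obtain u v w where P: "P = (u, v, w)" by (metis prod.exhaust)
  have d: "y1 * x2 - x1 * y2 = 1" using assms(1) by (simp add: frame_def)
  have o: "u * x2 * y2 + w * x1 * y1 = v * (x1 * y2 + x2 * y1)"
    using assms by (simp add: frame_def mf_def P algebra_simps)
  define alpha where "alpha = u * y2^2 + w * y1^2 - 2 * v * y1 * y2"
  define beta where "beta = u * x2^2 + w * x1^2 - 2 * v * x1 * x2"
  have "u = alpha * x1 * x1 + beta * y1 * y1" "w = alpha * x2 * x2 + beta * y2 * y2"
    "v = alpha * x1 * x2 + beta * y1 * y2"
    unfolding alpha_def beta_def using d o by algebra+
  thus ?thesis using that[of alpha beta] by (simp add: P pt_def)
qed

lemma mf_pt:
  assumes "y1 * x2 - x1 * y2 = 1"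
  shows "mf (pt x1 x2 y1 y2 alpha beta) (pt x1 x2 y1 y2 gamma delta) = (alpha * delta + beta * gamma) / 2"
proof -
  have "2 * mf (pt x1 x2 y1 y2 alpha beta) (pt x1 x2 y1 y2 gamma delta) = (alpha * delta + beta * gamma) * (y1 * x2 - x1 * y2)^2"
    by (simp add: mf_def pt_def) algebra
  thus ?thesis using assms by simp
qed

lemma crs_pt:
  assumes "frame L x1 x2 y1 y2"
  shows "crs (pt x1 x2 y1 y2 alpha beta) (pt x1 x2 y1 y2 gamma delta) = (- (alpha * delta - beta * gamma)) *\<^sub>R L"
proof -
  have d: "y1 * x2 - x1 * y2 = 1" and L: "L = (2 * x1 * y1, x1 * y2 + x2 * y1, 2 * x2 * y2)"
    using assms by (auto simp: frame_def)
  show ?thesis unfolding crs_def pt_def L prod_eq_iff fst_conv snd_conv fst_scaleR snd_scaleR real_scaleR_def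
    using d by (intro conjI) algebra+
qed

lemma future_pt:
  assumes "frame L x1 x2 y1 y2" "future (pt x1 x2 y1 y2 alpha beta)"
  shows "alpha > 0" "beta > 0"
proof -
  have d: "y1 * x2 - x1 * y2 = 1" using assms by (auto simp: frame_def)
  have ab: "alpha * beta > 0" using assms(2) mf_pt[OF d, of alpha beta alpha beta] by (simp add: future_def)
  have u: "alpha * (x1 * x1) + beta * (y1 * y1) > 0" using assms(2) by (simp add: future_def pt_def algebra_simps)
  have "\<not> alpha < 0"
  proof
    assume "alpha < 0"
    moreover hence "beta < 0" using ab by (simp add: zero_less_mult_iff)
    ultimately have "alpha * (x1 * x1) \<le> 0" "beta * (y1 * y1) \<le> 0" by (auto simp: mult_nonpos_nonneg)
    thus False using u by simp
  qed
  thus "alpha > 0" "beta > 0" using ab by (auto simp: zero_less_mult_iff)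
qed

lemma pt_add: "mu *\<^sub>R pt x1 x2 y1 y2 alpha beta + nu *\<^sub>R pt x1 x2 y1 y2 gamma delta = pt x1 x2 y1 y2 (mu * alpha + nu * gamma) (mu * beta + nu * delta)"
  by (simp add: pt_def algebra_simps)

text \<open>Two segments \<open>PQ\<close> and \<open>P'Q'\<close> on lines \<open>L\<close> and
  \<open>L'\<close> with equal Gram matrices have equal coordinates in suitable frames of their lines. The
  numbers \<open>p\<close> and \<open>t\<close> are the diagonal entries of the matrix that carries the first
  frame to the second.\<close>

definition matched :: "sm \<Rightarrow> sm \<Rightarrow> sm \<Rightarrow> sm \<Rightarrow> sm \<Rightarrow> sm \<Rightarrow> real \<Rightarrow> real \<Rightarrow> bool" where
  "matched L L' P P' Q Q' p t \<longleftrightarrow> (\<exists>x1 x2 y1 y2 u1 u2 w1 w2 alpha beta gamma delta.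
     frame L x1 x2 y1 y2 \<and> frame L' u1 u2 w1 w2 \<and>
     P = pt x1 x2 y1 y2 alpha beta \<and> P' = pt u1 u2 w1 w2 alpha beta \<and>
     Q = pt x1 x2 y1 y2 gamma delta \<and> Q' = pt u1 u2 w1 w2 gamma delta \<and>
     alpha * delta - beta * gamma > 0 \<and>
     (\<exists>mu nu. mu \<ge> 0 \<and> nu \<ge> 0 \<and> mu * alpha + nu * gamma > 0 \<and> mu * beta + nu * delta > 0) \<and>
     p = w1 * x2 - u1 * y2 \<and> t = u2 * y1 - w2 * x1)"

lemma matched_exists:
  assumes L: "mf L L = -1" "cv L > -1" and L': "mf L' L' = -1" "cv L' > -1"
    and on: "mf P L = 0" "mf Q L = 0" "mf P' L' = 0" "mf Q' L' = 0"
    and gram: "mf P P = mf P' P'" "mf P Q = mf P' Q'" "mf Q Q = mf Q' Q'"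
    and nz: "mf P P \<noteq> 0"
    and ori: "crs P Q = (- kappa) *\<^sub>R L" "kappa > 0" "crs P' Q' = (- kappa') *\<^sub>R L'" "kappa' > 0"
    and fut: "mu \<ge> 0" "nu \<ge> 0" "future (mu *\<^sub>R P + nu *\<^sub>R Q)" "future (mu *\<^sub>R P' + nu *\<^sub>R Q')"
  obtains p t where "matched L L' P P' Q Q' p t"
proof -
  obtain x1 x2 y1 y2 where F: "frame L x1 x2 y1 y2" using frame_exists[OF L] .
  obtain u1 u2 w1 w2 where F': "frame L' u1 u2 w1 w2" using frame_exists[OF L'] .
  have d: "y1 * x2 - x1 * y2 = 1" "w1 * u2 - u1 * w2 = 1" using F F' by (auto simp: frame_def)
  obtain alpha beta where P: "P = pt x1 x2 y1 y2 alpha beta" using frame_coords[OF F on(1)] .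
  obtain gamma delta where Q: "Q = pt x1 x2 y1 y2 gamma delta" using frame_coords[OF F on(2)] .
  obtain a b where P': "P' = pt u1 u2 w1 w2 a b" using frame_coords[OF F' on(3)] .
  obtain c e where Q': "Q' = pt u1 u2 w1 w2 c e" using frame_coords[OF F' on(4)] .
  have Lnz: "L \<noteq> 0" "L' \<noteq> 0" using L(1) L'(1) by (auto simp: mf_def zero_prod_def)
  have o1: "alpha * delta - beta * gamma > 0"
  proof -
    have "(- (alpha * delta - beta * gamma)) *\<^sub>R L = (- kappa) *\<^sub>R L"
      using ori(1) crs_pt[OF F, of alpha beta gamma delta] unfolding P Q by metis
    hence "- (alpha * delta - beta * gamma) = - kappa" using Lnz(1) unfolding scaleR_cancel_right by blast
    thus ?thesis using ori(2) by simp
  qed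
  have o2: "a * e - b * c > 0"
  proof -
    have "(- (a * e - b * c)) *\<^sub>R L' = (- kappa') *\<^sub>R L'"
      using ori(3) crs_pt[OF F', of a b c e] unfolding P' Q' by metis
    hence "- (a * e - b * c) = - kappa'" using Lnz(2) unfolding scaleR_cancel_right by blast
    thus ?thesis using ori(4) by simp
  qed
  have g: "alpha * beta = a * b" "alpha * delta + beta * gamma = a * e + b * c" "gamma * delta = c * e"
    using gram unfolding P Q P' Q' mf_pt[OF d(1)] mf_pt[OF d(2)] by (auto simp: algebra_simps)
  have nz': "alpha \<noteq> 0" "beta \<noteq> 0" "a \<noteq> 0" "b \<noteq> 0" using nz g(1) unfolding P mf_pt[OF d(1)] by auto
  have "(alpha * delta - beta * gamma)^2 = (a * e - b * c)^2" using g by algebra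
  hence "alpha * delta - beta * gamma = a * e - b * c" using o1 o2 by (simp add: power2_eq_iff)
  hence h: "alpha * delta = a * e" "beta * gamma = b * c" using g(2) by auto
  have f1: "mu * alpha + nu * gamma > 0" "mu * beta + nu * delta > 0"
    using future_pt[OF F] fut(3) unfolding P Q pt_add by blast+
  have f2: "mu * a + nu * c > 0" "mu * b + nu * e > 0"
    using future_pt[OF F'] fut(4) unfolding P' Q' pt_add by blast+
  define rho where "rho = alpha / a"
  have r: "alpha = rho * a" "b = rho * beta" using nz' g(1) unfolding rho_def by (auto simp: field_simps)
  have rn: "rho \<noteq> 0" using nz' rho_def by simp
  have r2: "e = rho * delta" using h(1) nz' unfolding r(1) by (simp add: mult.assoc mult.left_commute)
  have r3: "gamma = rho * c" using h(2) nz' unfolding r(2) by (simp add: mult.assoc mult.left_commute)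
  have "mu * alpha + nu * gamma = rho * (mu * a + nu * c)" unfolding r r3 by algebra
  hence rpos: "rho > 0" using f1 f2 by (simp add: zero_less_mult_iff)
  define \<sigma> where "\<sigma> = sqrt (1 / rho)"
  have s: "\<sigma> > 0" "\<sigma>^2 = 1 / rho" using rpos by (auto simp: \<sigma>_def)
  note fs = frame_scale[OF F' s(1)]
  have "P' = pt (\<sigma> * u1) (\<sigma> * u2) (w1 / \<sigma>) (w2 / \<sigma>) alpha beta"
    unfolding P' fs(2) s r using rpos by (simp add: mult.commute)
  moreover have "Q' = pt (\<sigma> * u1) (\<sigma> * u2) (w1 / \<sigma>) (w2 / \<sigma>) gamma delta"
    unfolding Q' fs(2) s r2 r3 using rpos by (simp add: mult.commute)
  ultimately have "matched L L' P P' Q Q' ((w1 / \<sigma>) * x2 - (\<sigma> * u1) * y2) ((\<sigma> * u2) * y1 - (w2 / \<sigma>) * x1)"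
    unfolding matched_def using F fs(1) P Q o1 f1 fut(1,2) by blast
  thus ?thesis using that by blast
qed

lemma same_point_turn_spacelike:
  fixes x1 x2 y1 y2 a1 a2 b1 b2 :: real
  assumes det: "y1 * x2 - x1 * y2 = 1" "b1 * a2 - a1 * b2 = 1"
    and e: "y1^2 - x1^2 = a1^2 - b1^2" "y1 * y2 - x1 * x2 = a1 * a2 - b1 * b2" "y2^2 - x2^2 = a2^2 - b2^2"
  defines "k \<equiv> x2 * a1 - x1 * a2" and "h \<equiv> x2 * b1 - x1 * b2"
  shows "a1 = k * y1 - h * x1" "a2 = k * y2 - h * x2" "b1 = h * y1 - k * x1" "b2 = h * y2 - k * x2"
    and "k^2 - h^2 = 1"
proof -
  have b1: "b1 = - (y1^2 - x1^2) * a2 + (y1 * y2 - x1 * x2) * a1"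
    unfolding e using det(2) by algebra
  have b2: "b2 = - (y1 * y2 - x1 * x2) * a2 + (y2^2 - x2^2) * a1"
    unfolding e using det(2) by algebra
  have a1: "a1 = - (y1^2 - x1^2) * b2 + (y1 * y2 - x1 * x2) * b1"
    unfolding e using det(2) by algebra
  have a2: "a2 = - (y1 * y2 - x1 * x2) * b2 + (y2^2 - x2^2) * b1"
    unfolding e using det(2) by algebra
  have h: "h = y2 * a1 - y1 * a2"
    unfolding h_def b1 b2 using det(1) by algebra
  have k: "k = y2 * b1 - y1 * b2"
    unfolding k_def using a1 a2 det(1) by algebra
  show "a1 = k * y1 - h * x1" unfolding h k_def using det(1) by algebra
  show "a2 = k * y2 - h * x2" unfolding h k_def using det(1) by algebra
  show "b1 = h * y1 - k * x1" unfolding k h_def using det(1) by algebra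
  show "b2 = h * y2 - k * x2" unfolding k h_def using det(1) by algebra
  have "k * k - h * h = (y2 * b1 - y1 * b2) * (x2 * a1 - x1 * a2) - (y2 * a1 - y1 * a2) * (x2 * b1 - x1 * b2)"
    using h k h_def k_def by simp
  also have "\<dots> = 1" using det by algebra
  finally show "k^2 - h^2 = 1" by (simp add: power2_eq_square)
qed

section \<open>Comparing two sides\<close>

text \<open>The invariant that is transported along an arm. Positivity in the case of equality excludes
  half-turns.\<close>

definition adv :: "real \<Rightarrow> real \<Rightarrow> bool" where
  "adv p t \<longleftrightarrow> p \<ge> t \<and> (p = t \<longrightarrow> p > 0)"

lemma frame_scale_sqrt:
  assumes "frame L x1 x2 y1 y2" "gamma > 0" "delta > 0" "gamma * delta = 1"
  shows "frame L (sqrt gamma * x1) (sqrt gamma * x2) (sqrt delta * y1) (sqrt delta * y2)"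
    and "pt x1 x2 y1 y2 alpha beta = pt (sqrt gamma * x1) (sqrt gamma * x2) (sqrt delta * y1) (sqrt delta * y2) (alpha * delta) (beta * gamma)"
proof -
  have s: "sqrt gamma * sqrt delta = 1" using assms by (simp add: real_sqrt_mult[symmetric])
  have sq: "sqrt gamma * sqrt gamma = gamma" "sqrt delta * sqrt delta = delta" using assms by auto
  have d: "sqrt delta * y1 * (sqrt gamma * x2) - sqrt gamma * x1 * (sqrt delta * y2) = 1"
  proof -
    have "y1 * x2 - x1 * y2 = 1" using assms(1) by (simp add: frame_def)
    thus ?thesis using s by algebra
  qed
  have l: "sqrt gamma * x * (sqrt delta * y) = x * y" for x y using s by algebra
  show "frame L (sqrt gamma * x1) (sqrt gamma * x2) (sqrt delta * y1) (sqrt delta * y2)"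
    using assms l[of x1 y1] l[of x2 y2] l[of x1 y2] l[of x2 y1] d unfolding frame_def by (auto simp: mult_ac)
  have "alpha * delta * (sqrt gamma * x) * (sqrt gamma * y) = alpha * x * y" for x y
  proof -
    have "alpha * delta * (sqrt gamma * x) * (sqrt gamma * y) = alpha * (sqrt gamma * sqrt gamma * delta) * x * y" by algebra
    thus ?thesis unfolding sq assms(4) by simp
  qed
  moreover have "beta * gamma * (sqrt delta * x) * (sqrt delta * y) = beta * x * y" for x y
  proof -
    have "beta * gamma * (sqrt delta * x) * (sqrt delta * y) = beta * (gamma * (sqrt delta * sqrt delta)) * x * y" by algebra
    thus ?thesis unfolding sq assms(4) by simp
  qed
  ultimately show "pt x1 x2 y1 y2 alpha beta = pt (sqrt gamma * x1) (sqrt gamma * x2) (sqrt delta * y1) (sqrt delta * y2) (alpha * delta) (beta * gamma)"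
    unfolding pt_def by presburger
qed

lemma pt_scale_frames:
  fixes gamma delta :: real
  assumes "gamma > 0" "delta > 0" "gamma * delta = 1"
  shows "(sqrt delta * a) * (sqrt gamma * b) - (sqrt gamma * c) * (sqrt delta * d) = a * b - c * d"
proof -
  have s: "sqrt gamma * sqrt delta = 1" using assms by (simp add: real_sqrt_mult[symmetric])
  show ?thesis using s by algebra
qed

text \<open>The frames can be rescaled so that the second endpoint has normalized coordinates; this leaves
  \<open>p\<close> and \<open>t\<close> unchanged.\<close>

lemma matched_outD:
  assumes m: "matched L L' P P' e e' p t" and n: "mf e e = eps" "eps = 1 \<and> future e \<or> eps = -1"
  obtains x1 x2 y1 y2 u1 u2 w1 w2 alpha beta where
    "frame L x1 x2 y1 y2" "frame L' u1 u2 w1 w2" "P = pt x1 x2 y1 y2 alpha beta" "P' = pt u1 u2 w1 w2 alpha beta"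
    "e = pt x1 x2 y1 y2 eps 1" "e' = pt u1 u2 w1 w2 eps 1" "alpha - eps * beta > 0"
    "p = w1 * x2 - u1 * y2" "t = u2 * y1 - w2 * x1"
proof -
  from m obtain x1 x2 y1 y2 u1 u2 w1 w2 alpha beta gamma delta mu nu where
     F: "frame L x1 x2 y1 y2" and F': "frame L' u1 u2 w1 w2" and
     P: "P = pt x1 x2 y1 y2 alpha beta" "P' = pt u1 u2 w1 w2 alpha beta" and
     e: "e = pt x1 x2 y1 y2 gamma delta" "e' = pt u1 u2 w1 w2 gamma delta" and
     o: "alpha * delta - beta * gamma > 0" and
     f: "mu \<ge> 0" "nu \<ge> 0" "mu * alpha + nu * gamma > 0" "mu * beta + nu * delta > 0" and
     p: "p = w1 * x2 - u1 * y2" "t = u2 * y1 - w2 * x1"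
    unfolding matched_def by blast
  have d: "y1 * x2 - x1 * y2 = 1" using F by (auto simp: frame_def)
  have gd: "gamma * delta = eps" using n(1) unfolding e mf_pt[OF d] by (simp add: mult.commute)
  have s: "eps * gamma > 0 \<and> delta > 0"
  proof (cases "eps = 1")
    case True
    hence "future e" using n(2) by auto
    thus ?thesis using True future_pt[OF F, of gamma delta] e by simp
  next
    case False
    hence ep: "eps = -1" using n(2) by auto
    have "\<not> delta < 0"
    proof
      assume dn: "delta < 0"
      hence g: "gamma > 0" using gd ep by (smt (verit) mult_nonpos_nonpos)
      have "mu * beta > 0" using f(2,4) dn by (smt (verit) mult_nonneg_nonpos)
      hence b: "beta > 0" "mu > 0" using f(1) by (auto simp: zero_less_mult_iff)
      have "alpha * delta > 0" using o b g mult_pos_pos[of beta gamma] by linarith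
      hence a: "alpha < 0" using dn by (simp add: zero_less_mult_iff)
      have 1: "mu * (- alpha) < nu * gamma" and 2: "nu * (- delta) < mu * beta" using f by auto
      have "mu * (- alpha) > 0" using b a by (simp add: mult_pos_neg)
      hence nu: "nu > 0" using 1 g by (metis f(2) less_eq_real_def mult_zero_left not_less_iff_gr_or_eq)
      have 3: "(mu * (- alpha)) * (nu * (- delta)) < (nu * gamma) * (mu * beta)"
        by (rule mult_strict_mono[OF 1 2]) (use nu g dn in \<open>auto simp: mult_nonneg_nonpos\<close>)
      have "(mu * nu) * (alpha * delta - beta * gamma) > 0" using o b nu by simp
      thus False using 3 by (simp add: algebra_simps)
    qed
    moreover have "delta \<noteq> 0" using gd ep by auto
    ultimately have "delta > 0" by simp
    moreover have "gamma < 0" using gd ep \<open>delta > 0\<close> by (smt (verit) mult_nonneg_nonneg)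
    ultimately show ?thesis using ep by simp
  qed
  have e2: "eps * eps = 1" using n(2) by auto
  have sp: "eps * gamma > 0" "delta > 0" "eps * gamma * delta = 1" using s gd e2 by (auto simp: mult.assoc)
  note fs = frame_scale_sqrt[OF F sp] frame_scale_sqrt[OF F' sp]
  show ?thesis
  proof (rule that[OF fs(1) fs(3)])
    show "P = pt (sqrt (eps * gamma) * x1) (sqrt (eps * gamma) * x2) (sqrt delta * y1) (sqrt delta * y2) (alpha * delta) (beta * (eps * gamma))"
      unfolding P by (rule fs)
    show "P' = pt (sqrt (eps * gamma) * u1) (sqrt (eps * gamma) * u2) (sqrt delta * w1) (sqrt delta * w2) (alpha * delta) (beta * (eps * gamma))"
      unfolding P by (rule fs)
    have gd2: "gamma * delta = eps" "delta * (eps * gamma) = 1"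
      using gd sp(3) mult.commute[of delta "eps * gamma"] by auto
    show "e = pt (sqrt (eps * gamma) * x1) (sqrt (eps * gamma) * x2) (sqrt delta * y1) (sqrt delta * y2) eps 1"
      unfolding e fs(2) gd2 ..
    show "e' = pt (sqrt (eps * gamma) * u1) (sqrt (eps * gamma) * u2) (sqrt delta * w1) (sqrt delta * w2) eps 1"
      unfolding e fs(4) gd2 ..
    have "alpha * delta - eps * (beta * (eps * gamma)) = alpha * delta - beta * gamma" using e2 by algebra
    thus "alpha * delta - eps * (beta * (eps * gamma)) > 0" using o by (simp only:)
    show "p = sqrt delta * w1 * (sqrt (eps * gamma) * x2) - sqrt (eps * gamma) * u1 * (sqrt delta * y2)"
      unfolding p pt_scale_frames[OF sp] ..
    show "t = sqrt (eps * gamma) * u2 * (sqrt delta * y1) - sqrt delta * w2 * (sqrt (eps * gamma) * x1)"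
      unfolding p using pt_scale_frames[OF sp, of y1 u2 x1 w2] by (simp add: mult_ac)
  qed
qed

lemma matched_inD:
  assumes m: "matched M M' e e' Q Q' p t" and n: "mf e e = eps" "eps = 1 \<and> future e \<or> eps = -1"
  obtains a1 a2 b1 b2 c1 c2 d1 d2 where
    "frame M a1 a2 b1 b2" "frame M' c1 c2 d1 d2"
    "e = pt a1 a2 b1 b2 1 eps" "e' = pt c1 c2 d1 d2 1 eps"
    "p = d1 * a2 - c1 * b2" "t = c2 * b1 - d2 * a1"
proof -
  from m obtain a1 a2 b1 b2 c1 c2 d1 d2 alpha beta gamma delta mu nu where
     F: "frame M a1 a2 b1 b2" and F': "frame M' c1 c2 d1 d2" and
     e: "e = pt a1 a2 b1 b2 alpha beta" "e' = pt c1 c2 d1 d2 alpha beta" and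
     o: "alpha * delta - beta * gamma > 0" and
     f: "mu \<ge> 0" "nu \<ge> 0" "mu * alpha + nu * gamma > 0" "mu * beta + nu * delta > 0" and
     p: "p = d1 * a2 - c1 * b2" "t = c2 * b1 - d2 * a1"
    unfolding matched_def by blast
  have d: "b1 * a2 - a1 * b2 = 1" using F by (auto simp: frame_def)
  have gd: "alpha * beta = eps" using n(1) unfolding e mf_pt[OF d] by (simp add: mult.commute)
  have s: "eps * beta > 0 \<and> alpha > 0"
  proof (cases "eps = 1")
    case True
    hence "future e" using n(2) by auto
    thus ?thesis using True future_pt[OF F, of alpha beta] e by simp
  next
    case False
    hence ep: "eps = -1" using n(2) by auto
    have "\<not> alpha < 0"
    proof
      assume an: "alpha < 0"
      hence b: "beta > 0" using gd ep by (smt (verit) mult_nonpos_nonpos)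
      have "nu * gamma > 0" using f(1,3) an by (smt (verit) mult_nonneg_nonpos)
      hence g: "gamma > 0" "nu > 0" using f(2) by (auto simp: zero_less_mult_iff)
      have "alpha * delta > 0" using o b g mult_pos_pos[of beta gamma] by linarith
      hence dl: "delta < 0" using an by (simp add: zero_less_mult_iff)
      have 1: "mu * (- alpha) < nu * gamma" and 2: "nu * (- delta) < mu * beta" using f by auto
      have "nu * (- delta) > 0" using g dl by (simp add: mult_pos_neg)
      hence mu: "mu > 0" using 2 b by (metis f(1) less_eq_real_def mult_zero_left not_less_iff_gr_or_eq)
      have 3: "(mu * (- alpha)) * (nu * (- delta)) < (nu * gamma) * (mu * beta)"
        by (rule mult_strict_mono[OF 1 2]) (use mu g dl in \<open>auto simp: mult_nonneg_nonpos\<close>)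
      have "(mu * nu) * (alpha * delta - beta * gamma) > 0" using o g mu by simp
      thus False using 3 by (simp add: algebra_simps)
    qed
    moreover have "alpha \<noteq> 0" using gd ep by auto
    ultimately have "alpha > 0" by simp
    moreover have "beta < 0" using gd ep \<open>alpha > 0\<close> by (smt (verit) mult_nonneg_nonneg)
    ultimately show ?thesis using ep by simp
  qed
  have e2: "eps * eps = 1" using n(2) by auto
  have sp: "alpha > 0" "eps * beta > 0" "alpha * (eps * beta) = 1" using s gd e2 by (auto simp: algebra_simps)
  note fs = frame_scale_sqrt[OF F sp] frame_scale_sqrt[OF F' sp]
  show ?thesis
  proof (rule that[OF fs(1) fs(3)])
    have gd2: "alpha * (eps * beta) = 1" "beta * alpha = eps"
      using gd sp(3) mult.commute[of beta alpha] by auto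
    show "e = pt (sqrt alpha * a1) (sqrt alpha * a2) (sqrt (eps * beta) * b1) (sqrt (eps * beta) * b2) 1 eps"
      unfolding e fs(2) gd2 ..
    show "e' = pt (sqrt alpha * c1) (sqrt alpha * c2) (sqrt (eps * beta) * d1) (sqrt (eps * beta) * d2) 1 eps"
      unfolding e fs(4) gd2 ..
    show "p = sqrt (eps * beta) * d1 * (sqrt alpha * a2) - sqrt alpha * c1 * (sqrt (eps * beta) * b2)"
      unfolding p pt_scale_frames[OF sp] ..
    show "t = sqrt alpha * c2 * (sqrt (eps * beta) * b1) - sqrt (eps * beta) * d2 * (sqrt alpha * a1)"
      unfolding p using pt_scale_frames[OF sp, of b1 c2 a1 d2] by (simp add: mult_ac)
  qed
qed

lemma trace_frame: "frame L x1 x2 y1 y2 \<Longrightarrow> cu L + cw L = 2 * (x1 * y1 + x2 * y2)"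
  by (simp add: frame_def)

lemma mf2: "2 * mf P Q = cu P * cw Q + cw P * cu Q - 2 * cv P * cv Q"
  by (simp add: mf_def)

text \<open>The rotation at a real vertex in terms of the form: the product of the lines is minus the cosine of
  twice the angle.\<close>

lemma turn_timelike_mf:
  assumes F: "frame L x1 x2 y1 y2" and G: "frame M a1 a2 b1 b2"
    and turn: "a1 = c * x1 + s * y1" "a2 = c * x2 + s * y2" "b1 = c * y1 - s * x1" "b2 = c * y2 - s * x2"
  shows "mf L M = - (c^2 - s^2)" "mf M (pt x1 x2 y1 y2 alpha beta) = c * s * (alpha - beta)"
proof -
  have d: "y1 * x2 - x1 * y2 = 1" using F by (auto simp: frame_def)
  have LM: "L = (2 * x1 * y1, x1 * y2 + x2 * y1, 2 * x2 * y2)" "M = (2 * a1 * b1, a1 * b2 + a2 * b1, 2 * a2 * b2)"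
    using F G by (auto simp: frame_def)
  have "2 * mf L M = - 2 * (c^2 - s^2) * (y1 * x2 - x1 * y2)^2"
    unfolding mf2 LM turn fst_conv snd_conv by algebra
  thus "mf L M = - (c^2 - s^2)" using d by simp
  have "2 * mf M (pt x1 x2 y1 y2 alpha beta) = 2 * c * s * (alpha - beta) * (y1 * x2 - x1 * y2)^2"
    unfolding mf2 LM pt_def turn fst_conv snd_conv by algebra
  thus "mf M (pt x1 x2 y1 y2 alpha beta) = c * s * (alpha - beta)" using d by simp
qed

lemma turn_spacelike_mf:
  assumes F: "frame L x1 x2 y1 y2" and G: "frame M a1 a2 b1 b2"
    and turn: "a1 = k * y1 - h * x1" "a2 = k * y2 - h * x2" "b1 = h * y1 - k * x1" "b2 = h * y2 - k * x2"
  shows "mf L M = k^2 + h^2" "mf M (pt x1 x2 y1 y2 alpha beta) = k * h * (alpha + beta)"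
proof -
  have d: "y1 * x2 - x1 * y2 = 1" using F by (auto simp: frame_def)
  have LM: "L = (2 * x1 * y1, x1 * y2 + x2 * y1, 2 * x2 * y2)" "M = (2 * a1 * b1, a1 * b2 + a2 * b1, 2 * a2 * b2)"
    using F G by (auto simp: frame_def)
  have "2 * mf L M = 2 * (k^2 + h^2) * (y1 * x2 - x1 * y2)^2"
    unfolding mf2 LM turn fst_conv snd_conv by algebra
  thus "mf L M = k^2 + h^2" using d by simp
  have "2 * mf M (pt x1 x2 y1 y2 alpha beta) = 2 * k * h * (alpha + beta) * (y1 * x2 - x1 * y2)^2"
    unfolding mf2 LM pt_def turn fst_conv snd_conv by algebra
  thus "mf M (pt x1 x2 y1 y2 alpha beta) = k * h * (alpha + beta)" using d by simp
qed

text \<open>The invariant passes a vertex if the vertex opens. At a real vertex this is a rotation argument, at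
  a hyperideal vertex a cone argument.\<close>

lemma matched_step:
  assumes m1: "matched L L' P P' e e' p t" and m2: "matched M M' e e' Q Q' p2 t2"
    and n: "mf e e = 1 \<and> future e \<or> mf e e = -1"
    and right: "cv e > 0" "cv e' > 0"
    and left: "cu L + cw L \<ge> 0" "cu L' + cw L' \<ge> 0" "cu M + cw M \<ge> 0" "cu M' + cw M' \<ge> 0"
    and turn: "mf M P > 0" "mf M' P' > 0"
    and opens: "mf e e * (mf L M - mf L' M') \<ge> 0"
    and I: "adv p t"
  shows "adv p2 t2" "p > t \<or> mf e e * (mf L M - mf L' M') > 0 \<Longrightarrow> p2 > t2"
proof -
  define eps where "eps = mf e e"
  have n': "mf e e = eps" "eps = 1 \<and> future e \<or> eps = -1" using n eps_def by auto
  obtain x1 x2 y1 y2 u1 u2 w1 w2 alpha beta where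
    F: "frame L x1 x2 y1 y2" and F': "frame L' u1 u2 w1 w2" and P: "P = pt x1 x2 y1 y2 alpha beta" "P' = pt u1 u2 w1 w2 alpha beta"
    and e: "e = pt x1 x2 y1 y2 eps 1" "e' = pt u1 u2 w1 w2 eps 1" and o: "alpha - eps * beta > 0"
    and p: "p = w1 * x2 - u1 * y2" "t = u2 * y1 - w2 * x1"
    using matched_outD[OF m1 n'] .
  obtain a1 a2 b1 b2 c1 c2 d1 d2 where
    G: "frame M a1 a2 b1 b2" and G': "frame M' c1 c2 d1 d2"
    and e2: "e = pt a1 a2 b1 b2 1 eps" "e' = pt c1 c2 d1 d2 1 eps"
    and p2: "p2 = d1 * a2 - c1 * b2" "t2 = c2 * b1 - d2 * a1"
    using matched_inD[OF m2 n'] .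
  have det: "y1 * x2 - x1 * y2 = 1" "w1 * u2 - u1 * w2 = 1" "b1 * a2 - a1 * b2 = 1" "d1 * c2 - c1 * d2 = 1"
    and pos: "x2 > 0" "y1 > 0" "u2 > 0" "w1 > 0" "a2 > 0" "b1 > 0" "c2 > 0" "d1 > 0"
    using F F' G G' by (auto simp: frame_def)
  have lt: "x1 * y1 + x2 * y2 \<ge> 0" "u1 * w1 + u2 * w2 \<ge> 0" "a1 * b1 + a2 * b2 \<ge> 0" "c1 * d1 + c2 * d2 \<ge> 0"
    using left unfolding trace_frame[OF F] trace_frame[OF F'] trace_frame[OF G] trace_frame[OF G'] by auto
  have I': "p \<ge> t" "p = t \<longrightarrow> p > 0" using I by (auto simp: adv_def)
  have "adv p2 t2 \<and> (p > t \<or> mf e e * (mf L M - mf L' M') > 0 \<longrightarrow> p2 > t2)"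
  proof (cases "eps = 1")
    case True
    have E: "x1^2 + y1^2 = a1^2 + b1^2" "x1 * x2 + y1 * y2 = a1 * a2 + b1 * b2" "x2^2 + y2^2 = a2^2 + b2^2"
      using e(1) e2(1) True by (auto simp: pt_def power2_eq_square)
    have E': "u1^2 + w1^2 = c1^2 + d1^2" "u1 * u2 + w1 * w2 = c1 * c2 + d1 * d2" "u2^2 + w2^2 = c2^2 + d2^2"
      using e(2) e2(2) True by (auto simp: pt_def power2_eq_square)
    note T = same_point_turn[OF det(1,3) E] and T' = same_point_turn[OF det(2,4) E']
    define c s c' s' where defs: "c = x2 * b1 - x1 * b2" "s = x2 * a1 - x1 * a2"
        "c' = u2 * d1 - u1 * d2" "s' = u2 * c1 - u1 * c2"
    note T = T[folded defs] and T' = T'[folded defs]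
    note mfs = turn_timelike_mf[OF F G T(1-4)] and mfs' = turn_timelike_mf[OF F' G' T'(1-4)]
    have cs: "c * s > 0" using turn(1) o True unfolding P mfs by (simp add: zero_less_mult_iff)
    have cs': "c' * s' > 0" using turn(2) o True unfolding P mfs' by (simp add: zero_less_mult_iff)
    have r: "x1 * x2 + y1 * y2 > 0" "u1 * u2 + w1 * w2 > 0" using right True unfolding e by (auto simp: pt_def)
    have op: "c'^2 - s'^2 \<ge> c^2 - s^2" using opens True unfolding n'(1) mfs mfs' by simp
    have "adv p2 t2" unfolding adv_def p2
      using step_timelike(1,2)[OF pos det(1,2) T cs T' cs' lt r op I'[unfolded p]] by blast
    moreover have "p2 > t2" if "p > t \<or> mf e e * (mf L M - mf L' M') > 0"
      unfolding p2
      by (rule step_timelike(3)[OF pos det(1,2) T cs T' cs' lt r op I'[unfolded p]])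
         (use that True in \<open>auto simp: n'(1) mfs mfs' p\<close>)
    ultimately show ?thesis by blast
  next
    case False
    hence ep: "eps = -1" using n' by auto
    have E: "y1^2 - x1^2 = a1^2 - b1^2" "y1 * y2 - x1 * x2 = a1 * a2 - b1 * b2" "y2^2 - x2^2 = a2^2 - b2^2"
      using e(1) e2(1) ep by (auto simp: pt_def power2_eq_square)
    have E': "w1^2 - u1^2 = c1^2 - d1^2" "w1 * w2 - u1 * u2 = c1 * c2 - d1 * d2" "w2^2 - u2^2 = c2^2 - d2^2"
      using e(2) e2(2) ep by (auto simp: pt_def power2_eq_square)
    note T = same_point_turn_spacelike[OF det(1,3) E] and T' = same_point_turn_spacelike[OF det(2,4) E']
    define k h k' h' where defs: "k = x2 * a1 - x1 * a2" "h = x2 * b1 - x1 * b2"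
        "k' = u2 * c1 - u1 * c2" "h' = u2 * d1 - u1 * d2"
    note T = T[folded defs] and T' = T'[folded defs]
    note mfs = turn_spacelike_mf[OF F G T(1-4)] and mfs' = turn_spacelike_mf[OF F' G' T'(1-4)]
    have cs: "k * h > 0" using turn(1) o ep unfolding P mfs by (simp add: zero_less_mult_iff)
    have cs': "k' * h' > 0" using turn(2) o ep unfolding P mfs' by (simp add: zero_less_mult_iff)
    have r: "y1 * y2 - x1 * x2 > 0" "w1 * w2 - u1 * u2 > 0" using right ep unfolding e by (auto simp: pt_def)
    have op: "k'^2 + h'^2 \<ge> k^2 + h^2" using opens ep unfolding n'(1) mfs mfs' by simp
    have "adv p2 t2" unfolding adv_def p2
      using step_spacelike(1,2)[OF pos det(1,2) T cs T' cs' r op I'[unfolded p]] by blast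
    moreover have "p2 > t2" if "p > t \<or> mf e e * (mf L M - mf L' M') > 0"
      unfolding p2
      by (rule step_spacelike(3)[OF pos det(1,2) T cs T' cs' r op I'[unfolded p]])
         (use that ep in \<open>auto simp: n'(1) mfs mfs' p\<close>)
    ultimately show ?thesis by blast
  qed
  thus "adv p2 t2" "p > t \<or> mf e e * (mf L M - mf L' M') > 0 \<Longrightarrow> p2 > t2" by auto
qed

section \<open>The arm lemma\<close>

text \<open>An open convex chain of sides \<open>L 0\<close>, ..., \<open>L k\<close> with vertices \<open>E
  0\<close>, ..., \<open>E (Suc k)\<close>. The ends lie on the chord \<open>v = 0\<close> and all other
  vertices on its right; the base point \<open>(1, 0, 1)\<close> lies to the left of all sides.\<close>

definition arm :: "nat \<Rightarrow> (nat \<Rightarrow> sm) \<Rightarrow> (nat \<Rightarrow> sm) \<Rightarrow> bool" where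
  "arm k L E \<longleftrightarrow> 1 \<le> k \<and>
     (\<forall>j\<le>k. mf (L j) (L j) = -1 \<and> cu (L j) + cw (L j) \<ge> 0 \<and> mf (E j) (L j) = 0 \<and> mf (E (Suc j)) (L j) = 0 \<and>
            (\<exists>kappa>0. crs (E j) (E (Suc j)) = (- kappa) *\<^sub>R L j)) \<and>
     (\<forall>j<k. mf (L (Suc j)) (E j) > 0) \<and>
     (\<forall>j. 1 \<le> j \<and> j \<le> k \<longrightarrow> cv (E j) > 0 \<and> (mf (E j) (E j) = 1 \<and> future (E j) \<or> mf (E j) (E j) = -1)) \<and>
     cv (E 0) = 0 \<and> cv (E (Suc k)) = 0"

text \<open>Equal lengths of sides, with a real point at the same position in both arms, so that
  corresponding segments lie in the same component of the hyperboloid.\<close>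

definition same_sides :: "nat \<Rightarrow> (nat \<Rightarrow> sm) \<Rightarrow> (nat \<Rightarrow> sm) \<Rightarrow> bool" where
  "same_sides k E E' \<longleftrightarrow> mf (E 0) (E 0) \<noteq> 0 \<and>
     (\<forall>j\<le>Suc k. mf (E j) (E j) = mf (E' j) (E' j)) \<and>
     (\<forall>j\<le>k. mf (E j) (E (Suc j)) = mf (E' j) (E' (Suc j)) \<and>
        (\<exists>mu\<ge>0. \<exists>nu\<ge>0. future (mu *\<^sub>R E j + nu *\<^sub>R E (Suc j)) \<and> future (mu *\<^sub>R E' j + nu *\<^sub>R E' (Suc j))))"

text \<open>The amount by which the vertex \<open>E (Suc j)\<close> opens from the first chain to the second.
  The factor \<open>mf (E (Suc j)) (E (Suc j))\<close> is positive at real and negative at hyperideal vertices.\<close>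

definition gain :: "(nat \<Rightarrow> sm) \<Rightarrow> (nat \<Rightarrow> sm) \<Rightarrow> (nat \<Rightarrow> sm) \<Rightarrow> nat \<Rightarrow> real" where
  "gain L E L' j = mf (E (Suc j)) (E (Suc j)) * (mf (L j) (L (Suc j)) - mf (L' j) (L' (Suc j)))"

lemma future_pos: "future P \<Longrightarrow> cu P > 0 \<and> cw P > 0"
proof -
  assume f: "future P"
  have "cu P * cw P > cv P * cv P" "cu P > 0" using f by (auto simp: future_def mf_def)
  moreover have "cv P * cv P \<ge> 0" by simp
  ultimately show ?thesis by (smt (verit) mult_nonneg_nonpos)
qed

text \<open>The condition of \<open>frame_exists\<close> holds for a line that has the base point on its left
  and meets the closed right half-plane in a real point.\<close>

lemma canonical_line:
  assumes L: "mf L L = -1" "cu L + cw L \<ge> 0"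
    and z: "future z" "mf z L = 0" "cv z \<ge> 0" and y: "mf y L = 0" "cv y \<noteq> 0"
  shows "cv L > -1"
proof (rule ccontr)
  assume "\<not> ?thesis"
  hence v: "cv L \<le> -1" by simp
  have "cu L * cw L = cv L * cv L - 1" using L by (simp add: mf_def)
  also have "\<dots> \<ge> 0" using v mult_mono[of 1 "- cv L" 1 "- cv L"] by simp
  finally have uw: "cu L \<ge> 0 \<and> cw L \<ge> 0" using L(2) by (smt (verit) mult_neg_pos mult_pos_neg)
  have zp: "cu z > 0" "cw z > 0" using future_pos[OF z(1)] by auto
  have "cu z * cw L + cw z * cu L = 2 * (cv z * cv L)" using z(2) by (simp add: mf_def)
  moreover have "cv z * cv L \<le> 0" using z(3) v by (simp add: mult_nonneg_nonpos)
  moreover have "cu z * cw L \<ge> 0" "cw z * cu L \<ge> 0" using zp uw by auto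
  ultimately have "cu z * cw L = 0" "cw z * cu L = 0" by linarith+
  hence "cw L = 0" "cu L = 0" using zp by auto
  thus False using y v by (auto simp: mf_def)
qed

lemma arm_canonical:
  assumes "arm k L E" "same_sides k E E'" "j \<le> k"
  shows "cv (L j) > -1"
proof -
  obtain mu nu where f: "mu \<ge> 0" "nu \<ge> 0" "future (mu *\<^sub>R E j + nu *\<^sub>R E (Suc j))"
    using assms by (auto simp: same_sides_def)
  have L: "mf (L j) (L j) = -1" "cu (L j) + cw (L j) \<ge> 0" "mf (E j) (L j) = 0" "mf (E (Suc j)) (L j) = 0"
    using assms by (auto simp: arm_def)
  have nn: "cv (E i) \<ge> 0" if "i \<le> Suc k" for i
  proof -
    consider "i = 0" | "i = Suc k" | "1 \<le> i \<and> i \<le> k" using \<open>i \<le> Suc k\<close> by fastforce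
    thus ?thesis using assms(1) by cases (auto simp: arm_def intro: less_imp_le)
  qed
  have "cv (E j) \<noteq> 0 \<or> cv (E (Suc j)) \<noteq> 0"
  proof (cases "j = 0")
    case True
    hence "cv (E (Suc j)) > 0" using assms(1) by (auto simp: arm_def)
    thus ?thesis by simp
  next
    case False
    hence "cv (E j) > 0" using assms(1,3) by (auto simp: arm_def)
    thus ?thesis by simp
  qed
  then obtain y where y: "mf y (L j) = 0" "cv y \<noteq> 0" using L by blast
  show ?thesis
  proof (rule canonical_line[OF L(1,2) f(3) _ _ y])
    have "2 * mf (mu *\<^sub>R E j + nu *\<^sub>R E (Suc j)) (L j) = 2 * mu * mf (E j) (L j) + 2 * nu * mf (E (Suc j)) (L j)"
      by (simp add: mf_def algebra_simps add_divide_distrib)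
    thus "mf (mu *\<^sub>R E j + nu *\<^sub>R E (Suc j)) (L j) = 0" using L by simp
    show "cv (mu *\<^sub>R E j + nu *\<^sub>R E (Suc j)) \<ge> 0" using nn[of j] nn[of "Suc j"] assms(3) f by simp
  qed
qed

lemma same_sides_sym: "same_sides k E E' \<Longrightarrow> same_sides k E' E"
  unfolding same_sides_def by fastforce

text \<open>Iterating \<open>matched_step\<close> along the arm.\<close>

lemma arm_chain:
  assumes A: "arm k L E" "arm k L' E'" and S: "same_sides k E E'"
    and op: "\<And>j. j < k \<Longrightarrow> gain L E L' j \<ge> 0"
  obtains p t where
    "matched (L 0) (L' 0) (E 0) (E' 0) (E (Suc 0)) (E' (Suc 0)) (p 0) (t 0)"
    "matched (L k) (L' k) (E k) (E' k) (E (Suc k)) (E' (Suc k)) (p k) (t k)"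
    "adv (p 0) (t 0) \<Longrightarrow> adv (p k) (t k)"
    "adv (p 0) (t 0) \<Longrightarrow> \<exists>j<k. gain L E L' j > 0 \<Longrightarrow> p k > (t k :: real)"
proof -
  have S': "same_sides k E' E" by (rule same_sides_sym[OF S])
  have nz: "mf (E j) (E j) \<noteq> 0" if "j \<le> k" for j
  proof (cases "j = 0")
    case True
    thus ?thesis using S unfolding same_sides_def by blast
  next
    case False
    hence "1 \<le> j \<and> j \<le> k" using that by simp
    hence "mf (E j) (E j) = 1 \<or> mf (E j) (E j) = -1" using A(1) unfolding arm_def by blast
    thus ?thesis by auto
  qed
  have "\<exists>p t. matched (L j) (L' j) (E j) (E' j) (E (Suc j)) (E' (Suc j)) p t" if j: "j \<le> k" for j
  proof -
    obtain mu nu where f: "mu \<ge> 0" "nu \<ge> 0" "future (mu *\<^sub>R E j + nu *\<^sub>R E (Suc j))" "future (mu *\<^sub>R E' j + nu *\<^sub>R E' (Suc j))"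
      using S j by (auto simp: same_sides_def)
    obtain kappa kappa' where o: "crs (E j) (E (Suc j)) = (- kappa) *\<^sub>R L j" "kappa > 0"
      "crs (E' j) (E' (Suc j)) = (- kappa') *\<^sub>R L' j" "kappa' > 0"
      using A j unfolding arm_def by metis
    have L: "mf (L j) (L j) = -1" "mf (L' j) (L' j) = -1" "mf (E j) (L j) = 0" "mf (E (Suc j)) (L j) = 0"
       "mf (E' j) (L' j) = 0" "mf (E' (Suc j)) (L' j) = 0" using A j by (auto simp: arm_def)
    have g: "mf (E j) (E j) = mf (E' j) (E' j)" "mf (E j) (E (Suc j)) = mf (E' j) (E' (Suc j))"
        "mf (E (Suc j)) (E (Suc j)) = mf (E' (Suc j)) (E' (Suc j))" using S j by (auto simp: same_sides_def)
    show ?thesis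
      using matched_exists[OF L(1) arm_canonical[OF A(1) S j] L(2) arm_canonical[OF A(2) S' j] L(3-6) g nz[OF j] o f]
      by metis
  qed
  then obtain p t where m: "\<And>j. j \<le> k \<Longrightarrow> matched (L j) (L' j) (E j) (E' j) (E (Suc j)) (E' (Suc j)) (p j) (t j)"
    by metis
  have step: "adv (p (Suc j)) (t (Suc j))" "p j > t j \<or> gain L E L' j > 0 \<Longrightarrow> p (Suc j) > t (Suc j)"
    if j: "j < k" and a: "adv (p j) (t j)" for j
  proof -
    have n: "mf (E (Suc j)) (E (Suc j)) = 1 \<and> future (E (Suc j)) \<or> mf (E (Suc j)) (E (Suc j)) = -1"
      and r: "cv (E (Suc j)) > 0" "cv (E' (Suc j)) > 0"
      and l: "cu (L j) + cw (L j) \<ge> 0" "cu (L' j) + cw (L' j) \<ge> 0"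
         "cu (L (Suc j)) + cw (L (Suc j)) \<ge> 0" "cu (L' (Suc j)) + cw (L' (Suc j)) \<ge> 0"
      and tn: "mf (L (Suc j)) (E j) > 0" "mf (L' (Suc j)) (E' j) > 0"
      using A j by (auto simp: arm_def)
    note ms = matched_step[OF m[of j] m[of "Suc j"] n r l tn op[OF j, unfolded gain_def] a]
    show "adv (p (Suc j)) (t (Suc j))" using ms j by simp
    show "p (Suc j) > t (Suc j)" if "p j > t j \<or> gain L E L' j > 0"
      using ms j that unfolding gain_def by simp
  qed
  have all: "adv (p j) (t j) \<and> ((\<exists>i<j. gain L E L' i > 0) \<longrightarrow> p j > t j)"
    if "adv (p 0) (t 0)" "j \<le> k" for j
    using that
  proof (induction j)
    case (Suc j)
    hence "adv (p j) (t j)" "(\<exists>i<j. gain L E L' i > 0) \<longrightarrow> p j > t j" "j < k" by auto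
    thus ?case using step[of j] less_Suc_eq by blast
  qed auto
  show ?thesis using that[of p t] m[of 0] m[of k] all[of k] by blast
qed

lemma diag_ratio:
  assumes "frame L x1 x2 y1 y2" "pt x1 x2 y1 y2 alpha beta = (b1, 0, b2)"
  shows "beta * y1 = x2 * b1" "beta * y2 = - x1 * b2" "alpha * x1 = - y2 * b1" "alpha * x2 = y1 * b2"
proof -
  have d: "y1 * x2 - x1 * y2 = 1" using assms by (simp add: frame_def)
  have b: "b1 = alpha * x1 * x1 + beta * y1 * y1" "b2 = alpha * x2 * x2 + beta * y2 * y2" and z: "alpha * x1 * x2 + beta * y1 * y2 = 0"
    using assms(2) by (auto simp: pt_def)
  show "beta * y1 = x2 * b1" unfolding b using d z by algebra
  show "beta * y2 = - x1 * b2" unfolding b using d z by algebra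
  show "alpha * x1 = - y2 * b1" unfolding b using d z by algebra
  show "alpha * x2 = y1 * b2" unfolding b using d z by algebra
qed

lemma diag_ratio_pt:
  assumes F: "frame L x1 x2 y1 y2" "pt x1 x2 y1 y2 alpha beta = (b1, 0, b2)"
    and F': "frame L' u1 u2 w1 w2" "pt u1 u2 w1 w2 alpha beta = (c1, 0, c2)"
  shows "b1 * (w1 * x2 - u1 * y2) = c1 * (u2 * y1 - w2 * x1)"
    and "c2 * (w1 * x2 - u1 * y2) = b2 * (u2 * y1 - w2 * x1)"
  using diag_ratio[OF F] diag_ratio[OF F'] by algebra+

text \<open>At a common first vertex on the chord the matrix between the frames has equal diagonal entries.\<close>

lemma start_future:
  assumes m: "matched L L' P P' Q Q' p t" and P: "P = (b1, 0, b2)" "P' = P" "mf P P \<noteq> 0" "future P"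
    and Q: "cv Q > 0" "cv Q' > 0"
  shows "p = t" "p > 0"
proof -
  from m obtain x1 x2 y1 y2 u1 u2 w1 w2 alpha beta gamma delta where
     F: "frame L x1 x2 y1 y2" and F': "frame L' u1 u2 w1 w2" and
     e: "P = pt x1 x2 y1 y2 alpha beta" "P' = pt u1 u2 w1 w2 alpha beta" and
     q: "Q = pt x1 x2 y1 y2 gamma delta" "Q' = pt u1 u2 w1 w2 gamma delta" and
     o: "alpha * delta - beta * gamma > 0" and
     p: "p = w1 * x2 - u1 * y2" "t = u2 * y1 - w2 * x1"
    unfolding matched_def by blast
  have pos: "x2 > 0" "y1 > 0" "u2 > 0" "w1 > 0" using F F' by (auto simp: frame_def)
  have ab: "alpha > 0" "beta > 0" using future_pt[OF F, of alpha beta] P(4) unfolding e(1) by blast+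
  have e': "pt x1 x2 y1 y2 alpha beta = (b1, 0, b2)" "pt u1 u2 w1 w2 alpha beta = (b1, 0, b2)" using e P by auto
  have "b1 \<noteq> 0" using P by (auto simp: mf_def)
  thus "p = t" using diag_ratio_pt(1)[OF F e'(1) F' e'(2)] p by simp
  have key: "x1 < 0 \<and> y2 > 0" if "alpha * x1 * x2 + beta * y1 * y2 = 0" "gamma * x1 * x2 + delta * y1 * y2 > 0" "x2 > 0" "y1 > 0"
    for x1 x2 y1 y2 :: real
  proof -
    have "alpha * (gamma * x1 * x2 + delta * y1 * y2) = (y1 * y2) * (alpha * delta - beta * gamma)" using that(1) by algebra
    moreover have "alpha * (gamma * x1 * x2 + delta * y1 * y2) > 0" using ab that by simp
    ultimately have "y1 * y2 > 0" using o by (simp add: zero_less_mult_iff)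
    hence y: "y2 > 0" using that by (simp add: zero_less_mult_iff)
    have "(alpha * x2) * x1 = - (beta * (y1 * y2))" using that(1) by algebra
    also have "\<dots> < 0" using ab y that by simp
    finally have "(alpha * x2) * x1 < 0" .
    hence "x1 < 0" using ab that(3) by (simp add: mult_less_0_iff)
    thus ?thesis using y by simp
  qed
  have k1: "x1 < 0 \<and> y2 > 0" by (rule key[of x1 x2 y1 y2]) (use e' q Q pos in \<open>auto simp: pt_def\<close>)
  have k2: "u1 < 0 \<and> w2 > 0" by (rule key[of u1 u2 w1 w2]) (use e' q Q pos in \<open>auto simp: pt_def\<close>)
  have "u1 * y2 < 0" "w1 * x2 > 0" using k1 k2 pos by (auto simp: mult_neg_pos)
  thus "p > 0" unfolding p by simp
qed

lemma start_spacelike: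
  assumes m: "matched L L' P P' Q Q' p t" and P: "P = (b1, 0, b2)" "P' = P" "mf P P = -1"
  shows "p = t" "p > 0"
proof -
  obtain x1 x2 y1 y2 u1 u2 w1 w2 where
    F: "frame L x1 x2 y1 y2" and F': "frame L' u1 u2 w1 w2"
    and e: "P = pt x1 x2 y1 y2 1 (-1)" "P' = pt u1 u2 w1 w2 1 (-1)"
    and p: "p = w1 * x2 - u1 * y2" "t = u2 * y1 - w2 * x1"
    using matched_inD[OF m P(3)] by blast
  have pos: "x2 > 0" "y1 > 0" "u2 > 0" "w1 > 0" using F F' by (auto simp: frame_def)
  have e': "pt x1 x2 y1 y2 1 (-1) = (b1, 0, b2)" "pt u1 u2 w1 w2 1 (-1) = (b1, 0, b2)" using e P by auto
  have b: "b1 * b2 = -1" using P by (auto simp: mf_def)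
  hence "b1 \<noteq> 0" by auto
  thus "p = t" using diag_ratio_pt(1)[OF F e'(1) F' e'(2)] p by simp
  note d = diag_ratio[OF F e'(1)] and d' = diag_ratio[OF F' e'(2)]
  have b2: "b2 > 0" using d(4) pos by (metis mult_1 zero_less_mult_pos)
  have "x2 * x2 - y2 * y2 = b2" "u2 * u2 - w2 * w2 = b2"
    using e' by (auto simp: pt_def)
  hence "y2^2 < x2^2" "w2^2 < u2^2" using b2 by (simp_all add: power2_eq_square)
  hence sq: "\<bar>y2\<bar> < x2" "\<bar>w2\<bar> < u2" using pos abs_less_iff power2_less_imp_less[of "\<bar>y2\<bar>" x2]
     power2_less_imp_less[of "\<bar>w2\<bar>" u2] by auto
  have "\<bar>w2 * y2\<bar> < u2 * x2" unfolding abs_mult using sq pos by (intro mult_strict_mono) auto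
  moreover have "b2 * p = u2 * x2 - w2 * y2"
  proof -
    have "b2 * p = (w1 * b2) * x2 - (u1 * b2) * y2" unfolding p by algebra
    also have "\<dots> = u2 * x2 - w2 * y2" using d' by (simp add: mult.commute)
    finally show ?thesis .
  qed
  ultimately have "b2 * p > 0" by linarith
  thus "p > 0" using b2 by (simp add: zero_less_mult_iff)
qed

text \<open>Cauchy's arm lemma: the first end is common, and \<open>b1 + b2\<close> is twice the hyperbolic
  cosine of the distance from it to the other end. At the last vertex the inequality \<open>p \<ge> t\<close>
  compares these distances.\<close>

theorem arm_lemma:
  assumes A: "arm k L E" "arm k L' E'" and S: "same_sides k E E'"
    and op: "\<And>j. j < k \<Longrightarrow> gain L E L' j \<ge> 0"
    and a: "E 0 = (1, 0, 1)" "E' 0 = (1, 0, 1)"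
    and b: "E (Suc k) = (b1, 0, b2)" "b1 > b2" "b2 > 0" "b1 * b2 = 1"
    and b': "E' (Suc k) = (c1, 0, c2)" "c1 > c2" "c2 > 0" "c1 * c2 = 1"
  shows "b1 + b2 \<le> c1 + c2" "\<exists>j<k. gain L E L' j > 0 \<Longrightarrow> b1 + b2 < c1 + c2"
proof -
  obtain p t where
    m0: "matched (L 0) (L' 0) (E 0) (E' 0) (E (Suc 0)) (E' (Suc 0)) (p 0) (t 0)" and
    mk: "matched (L k) (L' k) (E k) (E' k) (E (Suc k)) (E' (Suc k)) (p k) (t k)" and
    ad: "adv (p 0) (t 0) \<Longrightarrow> adv (p k) (t k)"
    "adv (p 0) (t 0) \<Longrightarrow> \<exists>j<k. gain L E L' j > 0 \<Longrightarrow> p k > (t k :: real)"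
    using arm_chain[OF A S op] by metis
  have "p 0 = t 0" "p 0 > 0"
    using start_future[OF m0, of 1 1] a A by (auto simp: arm_def mf_def future_def)
  hence st: "adv (p 0) (t 0)" by (simp add: adv_def)
  from mk obtain x1 x2 y1 y2 u1 u2 w1 w2 alpha beta gamma delta where
     F: "frame (L k) x1 x2 y1 y2" and F': "frame (L' k) u1 u2 w1 w2" and
     q: "E (Suc k) = pt x1 x2 y1 y2 gamma delta" "E' (Suc k) = pt u1 u2 w1 w2 gamma delta" and
     p: "p k = w1 * x2 - u1 * y2" "t k = u2 * y1 - w2 * x1"
    unfolding matched_def by blast
  have q': "pt x1 x2 y1 y2 gamma delta = (b1, 0, b2)" "pt u1 u2 w1 w2 gamma delta = (c1, 0, c2)" using q b b' by auto
  have pos: "x2 > 0" "y1 > 0" "u2 > 0" "w1 > 0" using F F' by (auto simp: frame_def)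
  have late: "x1 \<ge> 0 \<and> y2 \<le> 0" if F: "frame M x1 x2 y1 y2" and q: "pt x1 x2 y1 y2 gamma delta = (b1, 0, b2)"
      and b: "b1 > b2" "b2 > 0" "b1 * b2 = 1" and tr: "cu M + cw M \<ge> 0" for M x1 x2 y1 y2 b1 b2
  proof -
    have pos: "x2 > 0" "y1 > 0" and det: "y1 * x2 - x1 * y2 = 1" using F by (auto simp: frame_def)
    note d = diag_ratio[OF F q]
    have g: "gamma > 0" using d(4) pos b by (metis mult_pos_pos zero_less_mult_pos2)
    have "b2 * gamma * (x1 * y1 + x2 * y2) = (gamma * x1) * (y1 * b2) + b2 * gamma * x2 * y2" by algebra
    also have "\<dots> = gamma * x2 * y2 * (b2 - b1)" using d(3,4) by algebra
    finally have "gamma * x2 * y2 * (b2 - b1) = b2 * gamma * (x1 * y1 + x2 * y2)" ..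
    also have "\<dots> \<ge> 0" using b g tr unfolding trace_frame[OF F] by simp
    finally have "(gamma * x2 * (b1 - b2)) * y2 \<le> 0" by (simp add: algebra_simps)
    moreover have "gamma * x2 * (b1 - b2) > 0" using g pos b by simp
    ultimately have y: "y2 \<le> 0" by (metis mult_pos_pos not_less)
    have "gamma * x1 \<ge> 0" unfolding d(3) using y b by (simp add: mult_nonpos_nonneg)
    hence "x1 \<ge> 0" using g by (simp add: zero_le_mult_iff)
    thus ?thesis using y by simp
  qed
  have l1: "x1 \<ge> 0 \<and> y2 \<le> 0" by (rule late[OF F q'(1) b(2-4)]) (use A in \<open>auto simp: arm_def\<close>)
  have l2: "u1 \<ge> 0 \<and> w2 \<le> 0" by (rule late[OF F' q'(2) b'(2-4)]) (use A in \<open>auto simp: arm_def\<close>)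
  have "u1 * y2 \<le> 0" "w1 * x2 > 0" using l1 l2 pos by (auto simp: mult_nonneg_nonpos)
  hence pp: "p k > 0" unfolding p by simp
  have r: "b1 * p k = c1 * t k" using diag_ratio_pt(1)[OF F q'(1) F' q'(2)] p by simp
  have b0: "b1 > 0" "c1 > 0" using b b' by auto
  have "c1 * t k > 0" using r pp b0 by (metis mult_pos_pos)
  hence tp: "t k > 0" using b0 by (simp add: zero_less_mult_iff)
  have ge1: "b1 > 1" "c1 > 1"
  proof -
    have "x > 1" if "x > y" "y > 0" "x * y = 1" for x y :: real
    proof (rule ccontr)
      assume "\<not> x > 1"
      hence "x * y \<le> 1 * y" using that by (intro mult_right_mono) auto
      thus False using that \<open>\<not> x > 1\<close> by linarith
    qed
    thus "b1 > 1" "c1 > 1" using b b' by blast+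
  qed
  have mono: "(c1 - b1) * (b1 * c1 - 1) = (b1 * c1) * ((c1 + c2) - (b1 + b2))"
    using b(4) b'(4) by algebra
  have bc: "b1 * c1 > 1" using ge1 less_1_mult by blast
  have diff: "(c1 - b1) * t k = b1 * (p k - t k)" using r by algebra
  have 1: "c1 \<ge> b1" if "p k \<ge> t k"
  proof -
    have "(c1 - b1) * t k \<ge> 0" unfolding diff using that b0 by simp
    thus ?thesis using tp by (simp add: zero_le_mult_iff)
  qed
  have 2: "c1 > b1" if "p k > t k"
  proof -
    have "(c1 - b1) * t k > 0" unfolding diff using that b0 by simp
    thus ?thesis using tp by (simp add: zero_less_mult_iff)
  qed
  have "(b1 * c1) * ((c1 + c2) - (b1 + b2)) \<ge> 0"
    unfolding mono[symmetric] using 1 bc ad(1)[OF st] by (auto simp: adv_def)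
  thus "b1 + b2 \<le> c1 + c2" using bc by (simp add: zero_le_mult_iff)
  show "b1 + b2 < c1 + c2" if "\<exists>j<k. gain L E L' j > 0"
  proof -
    have "(b1 * c1) * ((c1 + c2) - (b1 + b2)) > 0"
      unfolding mono[symmetric] using 2 bc ad(2)[OF st that] by simp
    thus ?thesis using bc by (simp add: zero_less_mult_iff)
  qed
qed

text \<open>If both ends of the arms agree, the invariant would be strict at the end while the common last
  vertex forces equality, so no vertex can open.\<close>

theorem closed_arm_lemma:
  assumes A: "arm k L E" "arm k L' E'" and S: "same_sides k E E'"
    and op: "\<And>j. j < k \<Longrightarrow> gain L E L' j \<ge> 0"
    and a: "E' 0 = E 0" "mf (E 0) (E 0) = 1 \<and> future (E 0) \<or> mf (E 0) (E 0) = -1"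
    and b: "E' (Suc k) = E (Suc k)" "mf (E (Suc k)) (E (Suc k)) \<noteq> 0"
  shows "\<forall>j<k. gain L E L' j = 0"
proof (rule ccontr)
  assume "\<not> ?thesis"
  hence ex: "\<exists>j<k. gain L E L' j > 0" using op by (metis less_eq_real_def)
  obtain p t where
    m0: "matched (L 0) (L' 0) (E 0) (E' 0) (E (Suc 0)) (E' (Suc 0)) (p 0) (t 0)" and
    mk: "matched (L k) (L' k) (E k) (E' k) (E (Suc k)) (E' (Suc k)) (p k) (t k)" and
    ad: "adv (p 0) (t 0) \<Longrightarrow> \<exists>j<k. gain L E L' j > 0 \<Longrightarrow> p k > (t k :: real)"
    using arm_chain[OF A S op] by metis
  have z: "cv (E 0) = 0" "cv (E (Suc k)) = 0" "cv (E (Suc 0)) > 0" "cv (E' (Suc 0)) > 0"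
    using A by (auto simp: arm_def)
  obtain g1 g2 where g: "E 0 = (g1, 0, g2)" using z by (metis prod.collapse)
  obtain h1 h2 where h: "E (Suc k) = (h1, 0, h2)" using z by (metis prod.collapse)
  have "p 0 = t 0 \<and> p 0 > 0"
    using a start_future[OF m0 g a(1) _ _ z(3,4)] start_spacelike[OF m0 g a(1)] by fastforce
  hence "adv (p 0) (t 0)" by (simp add: adv_def)
  hence gt: "p k > t k" using ad ex by simp
  from mk obtain x1 x2 y1 y2 u1 u2 w1 w2 alpha beta gamma delta where
     F: "frame (L k) x1 x2 y1 y2" and F': "frame (L' k) u1 u2 w1 w2" and
     q: "E (Suc k) = pt x1 x2 y1 y2 gamma delta" "E' (Suc k) = pt u1 u2 w1 w2 gamma delta" and
     p: "p k = w1 * x2 - u1 * y2" "t k = u2 * y1 - w2 * x1"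
    unfolding matched_def by blast
  have q': "pt x1 x2 y1 y2 gamma delta = (h1, 0, h2)" "pt u1 u2 w1 w2 gamma delta = (h1, 0, h2)" using q b h by auto
  have "h1 \<noteq> 0" using b h by (auto simp: mf_def)
  hence "p k = t k" using diag_ratio_pt(1)[OF F q'(1) F' q'(2)] p by simp
  thus False using gt by simp
qed

section \<open>Isometries and normal forms\<close>

definition sm_iso :: "(sm \<Rightarrow> sm) \<Rightarrow> bool" where
  "sm_iso phi \<longleftrightarrow> linear phi \<and> (\<forall>P Q. mf (phi P) (phi Q) = mf P Q \<and> crs (phi P) (phi Q) = phi (crs P Q)) \<and>
     (\<forall>P. future P \<longrightarrow> future (phi P))"

lemma mf_sym: "mf P Q = mf Q P" by (simp add: mf_def algebra_simps)

lemma mf_add_left: "mf (P + Q) R = mf P R + mf Q R"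
  by (simp add: mf_def algebra_simps add_divide_distrib)

lemma mf_scale_left: "mf (c *\<^sub>R P) R = c * mf P R"
  by (simp add: mf_def algebra_simps)

lemma mf_add_right: "mf R (P + Q) = mf R P + mf R Q"
  by (simp add: mf_def algebra_simps add_divide_distrib)

lemma mf_scale_right: "mf R (c *\<^sub>R P) = c * mf R P"
  by (simp add: mf_def algebra_simps)

lemma mf_minus_left: "mf (- P) Q = - mf P Q" by (simp add: mf_def field_simps)

lemma mf_minus_right: "mf P (- Q) = - mf P Q" by (simp add: mf_def field_simps)

lemma mf_diff_left: "mf (P - Q) R = mf P R - mf Q R" by (simp add: mf_def field_simps)

lemma mf_diff_right: "mf R (P - Q) = mf R P - mf R Q" by (simp add: mf_def field_simps)

lemmas mf_lin = mf_add_left mf_add_right mf_scale_left mf_scale_right mf_minus_left mf_minus_right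
  mf_diff_left mf_diff_right

lemma crs_lin:
  "crs (P + Q) R = crs P R + crs Q R" "crs R (P + Q) = crs R P + crs R Q"
  "crs (c *\<^sub>R P) R = c *\<^sub>R crs P R" "crs R (c *\<^sub>R P) = c *\<^sub>R crs R P"
  "crs P P = 0"
  by (auto simp: crs_def algebra_simps zero_prod_def)

lemma crs_anti: "crs P R = - crs R P"
  by (simp add: crs_def)

lemma mf_crs:
  "mf (crs P Q) R = - mf (crs Q P) R" "mf (crs P Q) R = mf (crs Q R) P"
  by (simp_all add: mf_def crs_def field_simps)

lemma mf_crs_same: "mf (crs P Q) P = 0" "mf (crs P Q) Q = 0"
  by (simp_all add: mf_def crs_def field_simps)

lemma mf_crs_crs: "mf (crs P Q) (crs P Q) = 4 * (mf P P * mf Q Q - (mf P Q)^2)"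
  by (simp add: mf_def crs_def field_simps power2_eq_square)

lemma orth_two:
  assumes "mf L P = 0" "mf L Q = 0"
  shows "mf (crs P Q) (crs P Q) *\<^sub>R L = mf (crs P Q) L *\<^sub>R crs P Q"
proof -
  obtain p1 p2 p3 where P: "P = (p1, p2, p3)" by (metis prod.exhaust)
  obtain q1 q2 q3 where Q: "Q = (q1, q2, q3)" by (metis prod.exhaust)
  obtain l1 l2 l3 where L: "L = (l1, l2, l3)" by (metis prod.exhaust)
  have 1: "l1 * p3 + l3 * p1 = 2 * l2 * p2" using assms(1) by (simp add: mf_def P L)
  have 2: "l1 * q3 + l3 * q1 = 2 * l2 * q2" using assms(2) by (simp add: mf_def Q L)
  have e: "mf (crs P Q) (crs P Q) = 4 * (p1 * q2 - p2 * q1) * (p2 * q3 - p3 * q2) - (p1 * q3 - p3 * q1)^2"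
      "mf (crs P Q) L = (p1 * q2 - p2 * q1) * l3 + (p2 * q3 - p3 * q2) * l1 - (p1 * q3 - p3 * q1) * l2"
    by (simp_all add: mf_def crs_def P Q L field_simps power2_eq_square)
  have c: "crs P Q = (2 * (p1 * q2 - p2 * q1), p1 * q3 - p3 * q1, 2 * (p2 * q3 - p3 * q2))"
    by (simp add: crs_def P Q)
  show ?thesis unfolding e unfolding c L prod_eq_iff fst_conv snd_conv fst_scaleR snd_scaleR real_scaleR_def
    apply (intro conjI)
    subgoal using 1 2 by algebra
    subgoal using 1 2 by algebra
    subgoal using 1 2 by algebra
    done
qed

lemma span_two:
  assumes "mf (crs a b) x = 0"
  shows "mf (crs a b) (crs a b) *\<^sub>R x = mf (crs x b) (crs a b) *\<^sub>R a + mf (crs a x) (crs a b) *\<^sub>R b"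
proof -
  obtain a1 a2 a3 where A: "a = (a1, a2, a3)" by (metis prod.exhaust)
  obtain b1 b2 b3 where B: "b = (b1, b2, b3)" by (metis prod.exhaust)
  obtain x1 x2 x3 where X: "x = (x1, x2, x3)" by (metis prod.exhaust)
  have h: "(a1 * b2 - a2 * b1) * x3 + (a2 * b3 - a3 * b2) * x1 = (a1 * b3 - a3 * b1) * x2"
    using assms by (simp add: mf_def crs_def A B X field_simps)
  have e: "mf (crs p q) (crs r s) = 2 * (cu p * cv q - cv p * cu q) * (cv r * cw s - cw r * cv s)
     + 2 * (cv p * cw q - cw p * cv q) * (cu r * cv s - cv r * cu s) - (cu p * cw q - cw p * cu q) * (cu r * cw s - cw r * cu s)"
    for p q r s by (simp add: mf_def crs_def field_simps)
  show ?thesis unfolding e A B X prod_eq_iff fst_conv snd_conv fst_scaleR snd_scaleR real_scaleR_def fst_add snd_add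
    apply (intro conjI)
    subgoal using h by algebra
    subgoal using h by algebra
    subgoal using h by algebra
    done
qed

lemma future_mf_pos:
  assumes "future P" "future Q"
  shows "mf P Q > 0"
proof -
  have p: "cu P > 0" "cw P > 0" "cu Q > 0" "cw Q > 0" using future_pos assms by auto
  have 1: "cu P * cw P > (cv P)^2" "cu Q * cw Q > (cv Q)^2"
    using assms by (auto simp: future_def mf_def power2_eq_square)
  have "(cv P)^2 * (cv Q)^2 < (cu P * cw P) * (cu Q * cw Q)"
    using 1 p by (intro mult_strict_mono) auto
  also have "\<dots> = (cu P * cw Q) * (cw P * cu Q)" by algebra
  also have "\<dots> \<le> ((cu P * cw Q + cw P * cu Q) / 2)^2"
  proof -
    have "((cu P * cw Q + cw P * cu Q) / 2)^2 - (cu P * cw Q) * (cw P * cu Q) = ((cu P * cw Q - cw P * cu Q) / 2)^2"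
      by (simp add: power2_eq_square field_simps)
    thus ?thesis by (metis diff_ge_0_iff_ge zero_le_power2)
  qed
  finally have "(cv P * cv Q)^2 < ((cu P * cw Q + cw P * cu Q) / 2)^2" by (simp add: power_mult_distrib)
  moreover have "(cu P * cw Q + cw P * cu Q) / 2 > 0" using p by (simp add: add_pos_pos)
  ultimately have "cv P * cv Q < (cu P * cw Q + cw P * cu Q) / 2"
    by (meson less_imp_le power_less_imp_less_base)
  thus ?thesis by (simp add: mf_def)
qed

lemma future_if_mf_pos:
  assumes "future w" "mf z z > 0" "mf z w > 0"
  shows "future z"
proof (rule ccontr)
  assume n: "\<not> future z"
  hence "cu z \<le> 0" using assms by (auto simp: future_def)
  moreover have "cu z \<noteq> 0"
  proof
    assume "cu z = 0"
    hence "mf z z = - ((cv z)^2)" by (simp add: mf_def power2_eq_square)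
    thus False using assms(2) zero_le_power2[of "cv z"] by linarith
  qed
  ultimately have "future (- z)" using assms(2) by (simp add: future_def mf_def)
  from future_mf_pos[OF this assms(1)] assms(3) show False by (simp add: mf_lin)
qed

lemma future_scale: "future P \<Longrightarrow> c > 0 \<Longrightarrow> future (c *\<^sub>R P)"
  by (simp add: future_def mf_lin)

lemma future_add: "future P \<Longrightarrow> future Q \<Longrightarrow> future (P + Q)"
  using future_mf_pos[of P Q] by (simp add: future_def mf_lin mf_sym)

lemma future_transfer:
  assumes w: "future (m *\<^sub>R P + n *\<^sub>R Q)" "m > 0" "n > 0"
    and z: "mf (k *\<^sub>R P + l *\<^sub>R Q) (k *\<^sub>R P + l *\<^sub>R Q) > 0" "k > 0" "l > 0"
    and PQ: "mf P P > 0 \<and> future P \<or> mf P P < 0" "mf Q Q > 0 \<and> future Q \<or> mf Q Q < 0"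
  shows "future (k *\<^sub>R P + l *\<^sub>R Q)"
proof (cases "future P \<and> future Q")
  case True
  thus ?thesis using z by (simp add: future_add future_scale)
next
  case False
  define A where "A = mf P P"
  define B where "B = mf Q Q"
  define g where "g = mf P Q"
  have fw: "m^2 * A + 2 * m * n * g + n^2 * B > 0"
    using w(1) by (simp add: future_def mf_lin A_def B_def g_def mf_sym[of Q P] power2_eq_square algebra_simps)
  have fz: "k^2 * A + 2 * k * l * g + l^2 * B > 0"
    using z(1) by (simp add: mf_lin A_def B_def g_def mf_sym[of Q P] power2_eq_square algebra_simps)
  have e: "mf (k *\<^sub>R P + l *\<^sub>R Q) (m *\<^sub>R P + n *\<^sub>R Q) = k * m * A + (k * n + l * m) * g + l * n * B"
    by (simp add: mf_lin A_def B_def g_def mf_sym[of Q P] algebra_simps)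
  have AB: "A < 0 \<or> B < 0" using False PQ by (auto simp: A_def B_def)
  have i1: "2 * (m * k) * (k * m * A + (k * n + l * m) * g + l * n * B)
     = k^2 * (m^2 * A + 2 * m * n * g + n^2 * B) + m^2 * (k^2 * A + 2 * k * l * g + l^2 * B) - B * (k * n - l * m)^2"
    by algebra
  have i2: "2 * (n * l) * (k * m * A + (k * n + l * m) * g + l * n * B)
     = l^2 * (m^2 * A + 2 * m * n * g + n^2 * B) + n^2 * (k^2 * A + 2 * k * l * g + l^2 * B) - A * (k * n - l * m)^2"
    by algebra
  have "k * m * A + (k * n + l * m) * g + l * n * B > 0"
  proof (cases "B < 0")
    case True
    have "k^2 * (m^2 * A + 2 * m * n * g + n^2 * B) > 0" "m^2 * (k^2 * A + 2 * k * l * g + l^2 * B) > 0"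
      "B * (k * n - l * m)^2 \<le> 0" using fw fz True w z by (auto simp: mult_nonpos_nonneg)
    hence "2 * (m * k) * (k * m * A + (k * n + l * m) * g + l * n * B) > 0" unfolding i1 by linarith
    moreover have "2 * (m * k) > 0" using w z by simp
    ultimately show ?thesis using zero_less_mult_pos by blast
  next
    case False
    hence A: "A < 0" using AB by simp
    have "l^2 * (m^2 * A + 2 * m * n * g + n^2 * B) > 0" "n^2 * (k^2 * A + 2 * k * l * g + l^2 * B) > 0"
      "A * (k * n - l * m)^2 \<le> 0" using fw fz A w z by (auto simp: mult_nonpos_nonneg)
    hence "2 * (n * l) * (k * m * A + (k * n + l * m) * g + l * n * B) > 0" unfolding i2 by linarith
    moreover have "2 * (n * l) > 0" using w z by simp
    ultimately show ?thesis using zero_less_mult_pos by blast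
  qed
  thus ?thesis using future_if_mf_pos[OF w(1) z(1)] e by simp
qed

text \<open>The group \<open>SL(2)\<close> acts on symmetric matrices by \<open>P \<mapsto> M P
  M\<^sup>T\<close> as a group of isometries; it moves any line and any point on it to standard position.\<close>

lemma normal_form_exists:
  assumes L: "mf L L = -1" and a: "mf a a = 1" "future a" "mf a L = 0"
  obtains phi where "sm_iso phi" "phi L = (0, 1, 0)" "phi a = (1, 0, 1)"
proof -
  obtain u v w where Le: "L = (u, v, w)" by (metis prod.exhaust)
  have n: "u * w = (v - 1) * (v + 1)" using L by (simp add: Le mf_def algebra_simps)
  have "\<exists>x1 x2 y1 y2. y1 * x2 - x1 * y2 = 1 \<and> L = (2 * x1 * y1, x1 * y2 + x2 * y1, 2 * x2 * y2)"
  proof (cases "v = -1")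
    case False
    have "u / (v + 1) * (w / 2) = (v - 1) / 2" using n False by (simp add: field_simps)
    thus ?thesis using False unfolding Le
      by (intro exI[of _ "u / (v + 1)"] exI[of _ 1] exI[of _ "(v + 1) / 2"] exI[of _ "w / 2"]) (simp add: field_simps)
  next
    case True
    have "u = 0 \<or> w = 0" using n True by simp
    thus ?thesis using True unfolding Le
      by (intro exI[of _ 1] exI[of _ "- w / 2"] exI[of _ "u / 2"] exI[of _ "-1"]) auto
  qed
  then obtain x1 x2 y1 y2 where d: "y1 * x2 - x1 * y2 = 1" and Lx: "L = (2 * x1 * y1, x1 * y2 + x2 * y1, 2 * x2 * y2)"
    by blast
  obtain a1 a2 a3 where ae: "a = (a1, a2, a3)" by (metis prod.exhaust)
  have o: "a1 * x2 * y2 + a3 * x1 * y1 = a2 * (x1 * y2 + x2 * y1)"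
    using a(3) by (simp add: mf_def ae Lx algebra_simps)
  have n1: "a1 * a3 - a2^2 = 1" using a(1) by (simp add: mf_def ae power2_eq_square)
  have ap: "a1 > 0" "a3 > 0" using future_pos[OF a(2)] ae by auto
  define alpha where "alpha = a1 * y2^2 + a3 * y1^2 - 2 * a2 * y1 * y2"
  define beta where "beta = a1 * x2^2 + a3 * x1^2 - 2 * a2 * x1 * x2"
  have ab: "alpha * beta = 1" unfolding alpha_def beta_def using n1 d o by algebra
  have "a1 * alpha = (a1 * y2 - a2 * y1)^2 + y1^2" unfolding alpha_def using n1 by algebra
  hence "a1 * alpha \<ge> 0" by simp
  hence "alpha \<ge> 0" using ap by (simp add: zero_le_mult_iff)
  hence al: "alpha > 0" using ab by (metis mult_zero_left less_eq_real_def zero_neq_one)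
  define s where "s = sqrt alpha"
  define r where "r = 1 / s"
  have s: "s > 0" "s * s = alpha" using al s_def by auto
  have "r > 0" "s * r = 1" using s(1) r_def by auto
  moreover hence "r * r * alpha = 1" unfolding s(2)[symmetric] by algebra
  ultimately have r: "r > 0" "s * r = 1" "r * r * alpha = 1" by auto
  have rb: "s * s * beta = 1" "r * r * alpha = 1" using ab s r by auto
  define m11 where "m11 = s * x2"
  define m12 where "m12 = - s * x1"
  define m21 where "m21 = - r * y2"
  define m22 where "m22 = r * y1"
  have dm: "m11 * m22 - m12 * m21 = 1" unfolding m11_def m12_def m21_def m22_def using d r by algebra
  define phi :: "sm \<Rightarrow> sm" where "phi = (\<lambda>P.
     (m11^2 * cu P + 2 * m11 * m12 * cv P + m12^2 * cw P,
      m11 * m21 * cu P + (m11 * m22 + m12 * m21) * cv P + m12 * m22 * cw P,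
      m21^2 * cu P + 2 * m21 * m22 * cv P + m22^2 * cw P))"
  have lin: "linear phi" by (rule linearI) (simp_all add: phi_def algebra_simps)
  have mfp: "mf (phi P) (phi Q) = mf P Q" for P Q
  proof -
    have "2 * mf (phi P) (phi Q) = 2 * mf P Q"
      unfolding mf2 phi_def fst_conv snd_conv using dm by algebra
    thus ?thesis by simp
  qed
  have crsp: "crs (phi P) (phi Q) = phi (crs P Q)" for P Q
    unfolding crs_def phi_def prod_eq_iff fst_conv snd_conv
    apply (intro conjI)
    subgoal using dm by algebra
    subgoal using dm by algebra
    subgoal using dm by algebra
    done
  have phiL: "phi L = (0, 1, 0)"
    unfolding Lx phi_def prod_eq_iff fst_conv snd_conv m11_def m12_def m21_def m22_def
    apply (intro conjI)
    subgoal by algebra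
    subgoal using d r(2) by algebra
    subgoal by algebra
    done
  have phia: "phi a = (1, 0, 1)"
  proof -
    have "m11^2 * a1 + 2 * m11 * m12 * a2 + m12^2 * a3 = s * s * beta"
      unfolding m11_def m12_def beta_def by algebra
    moreover have "m21^2 * a1 + 2 * m21 * m22 * a2 + m22^2 * a3 = r * r * alpha"
      unfolding m21_def m22_def alpha_def by algebra
    moreover have "m11 * m21 * a1 + (m11 * m22 + m12 * m21) * a2 + m12 * m22 * a3 = 0"
      unfolding m11_def m12_def m21_def m22_def using o by algebra
    ultimately show ?thesis using rb unfolding phi_def ae by simp
  qed
  have fut: "future (phi P)" if P: "future P" for P
  proof (rule future_if_mf_pos)
    show "future (phi a)" unfolding phia by (simp add: future_def mf_def)
    show "mf (phi P) (phi P) > 0" using P unfolding mfp by (simp add: future_def)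
    show "mf (phi P) (phi a) > 0" unfolding mfp by (rule future_mf_pos[OF P a(2)])
  qed
  show ?thesis using that[of phi] lin mfp crsp fut phiL phia by (auto simp: sm_iso_def)
qed

section \<open>Links of vertices\<close>

lemma future_or_past: "mf z z > 0 \<Longrightarrow> future z \<or> future (- z)"
proof -
  assume a: "mf z z > 0"
  have "cu z \<noteq> 0"
  proof
    assume "cu z = 0"
    hence "mf z z = - ((cv z)^2)" by (simp add: mf_def power2_eq_square)
    thus False using a zero_le_power2[of "cv z"] by linarith
  qed
  thus ?thesis using a by (auto simp: future_def mf_def)
qed

text \<open>A closed convex polygon with sides \<open>L i\<close> and vertices \<open>E i\<close>, extended
  periodically. Side \<open>i\<close> joins \<open>E i\<close> and \<open>E (Suc i)\<close> and contains a real
  point strictly between them.\<close>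

definition link :: "nat \<Rightarrow> (nat \<Rightarrow> sm) \<Rightarrow> (nat \<Rightarrow> sm) \<Rightarrow> bool" where
  "link n L E \<longleftrightarrow> 3 \<le> n \<and> (\<forall>i. L (i + n) = L i \<and> E (i + n) = E i) \<and>
     (\<forall>i. mf (L i) (L i) = -1 \<and> mf (E i) (L i) = 0 \<and> mf (E (Suc i)) (L i) = 0 \<and>
          (\<exists>kappa>0. crs (E i) (E (Suc i)) = (- kappa) *\<^sub>R L i) \<and>
          (mf (E i) (E i) = 1 \<and> future (E i) \<or> mf (E i) (E i) = -1) \<and>
          (\<exists>mu>0. \<exists>nu>0. future (mu *\<^sub>R E i + nu *\<^sub>R E (Suc i)))) \<and>
     (\<forall>i j. mf (L i) (E j) \<ge> 0) \<and>
     (\<forall>i j. L i = L j \<or> L i = - L j \<longrightarrow> i mod n = j mod n)"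

definition same_link :: "(nat \<Rightarrow> sm) \<Rightarrow> (nat \<Rightarrow> sm) \<Rightarrow> bool" where
  "same_link E E' \<longleftrightarrow> (\<forall>i. mf (E i) (E i) = mf (E' i) (E' i) \<and> mf (E i) (E (Suc i)) = mf (E' i) (E' (Suc i)))"

lemma mod_neq:
  fixes i j n :: nat
  assumes "i < j" "j < i + n"
  shows "i mod n \<noteq> j mod n"
proof
  assume "i mod n = j mod n"
  hence "n dvd j - i" using assms(1) by (metis less_imp_le mod_eq_dvd_iff_nat)
  moreover have "0 < j - i" "j - i < n" using assms by auto
  ultimately show False using nat_dvd_not_less by blast
qed

text \<open>A polygon has distinct side lines, and two vectors on one side determine the line.\<close>

lemma link_other_side:
  assumes K: "link n L E" and ij: "i mod n \<noteq> j mod n"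
  shows "\<not> (mf (L i) (E j) = 0 \<and> mf (L i) (E (Suc j)) = 0)"
proof
  assume z: "mf (L i) (E j) = 0 \<and> mf (L i) (E (Suc j)) = 0"
  obtain kappa where k: "kappa > 0" "crs (E j) (E (Suc j)) = (- kappa) *\<^sub>R L j"
    using K unfolding link_def by blast
  have u: "mf (L i) (L i) = -1" "mf (L j) (L j) = -1" using K by (auto simp: link_def)
  have "mf (crs (E j) (E (Suc j))) (crs (E j) (E (Suc j))) *\<^sub>R L i
      = mf (crs (E j) (E (Suc j))) (L i) *\<^sub>R crs (E j) (E (Suc j))"
    using z by (intro orth_two) auto
  hence "(- (kappa * kappa)) *\<^sub>R L i = (kappa * kappa * mf (L j) (L i)) *\<^sub>R L j"
    unfolding k(2) by (simp add: mf_lin u)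
  hence "(kappa * kappa) *\<^sub>R L i = (kappa * kappa) *\<^sub>R ((- mf (L j) (L i)) *\<^sub>R L j)"
    by (simp add: minus_equation_iff[of "(kappa * kappa) *\<^sub>R L i"])
  moreover have "kappa * kappa \<noteq> 0" using k by simp
  ultimately have L: "L i = (- mf (L j) (L i)) *\<^sub>R L j" using scaleR_left_imp_eq by blast
  define c where "c = - mf (L j) (L i)"
  have Lc: "L i = c *\<^sub>R L j" using L c_def by simp
  have "- 1 = c * c * mf (L j) (L j)" using u(1) unfolding Lc by (simp add: mf_lin)
  hence "c * c = 1" using u by simp
  hence "c = 1 \<or> c = -1" by (metis square_eq_1_iff)
  hence "L i = L j \<or> L i = - L j" using Lc by auto
  thus False using K ij unfolding link_def by blast
qed

definition on_side :: "(nat \<Rightarrow> sm) \<Rightarrow> nat \<Rightarrow> real \<Rightarrow> real \<Rightarrow> sm" where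
  "on_side E s mu nu = mu *\<^sub>R E s + nu *\<^sub>R E (Suc s)"

lemma link_cut_positive:
  assumes K: "link n L E" and m: "mu > 0" "nu > 0" and ij: "i mod n \<noteq> s mod n"
  shows "mf (L i) (on_side E s mu nu) > 0"
proof -
  have "mf (L i) (E s) \<ge> 0" "mf (L i) (E (Suc s)) \<ge> 0" using K by (auto simp: link_def)
  moreover have "mf (L i) (E s) \<noteq> 0 \<or> mf (L i) (E (Suc s)) \<noteq> 0" using link_other_side[OF K ij] by blast
  ultimately have "mf (L i) (E s) > 0 \<or> mf (L i) (E (Suc s)) > 0" by linarith
  moreover have "mu * mf (L i) (E s) \<ge> 0" "nu * mf (L i) (E (Suc s)) \<ge> 0"
    using m \<open>mf (L i) (E s) \<ge> 0\<close> \<open>mf (L i) (E (Suc s)) \<ge> 0\<close> by auto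
  ultimately show ?thesis unfolding on_side_def mf_lin
    by (smt (verit) m mult_pos_pos)
qed

text \<open>Convexity: the chord through two boundary points separates the vertices of the two arcs.\<close>

lemma link_chord_side:
  assumes K: "link n L E" and st: "s < t" "t < s + n"
    and a: "a = on_side E s mu nu" "mu > 0" "nu > 0" "future a"
    and b: "b = on_side E t mu' nu'" "mu' > 0" "nu' > 0" "future b"
    and j: "s < j" "j \<le> t"
  shows "mf (crs a b) (E j) > 0"
proof -
  have Lsb: "mf (L s) b > 0" unfolding b(1) by (rule link_cut_positive[OF K b(2,3) mod_neq[OF st]])
  have Lta: "mf (L t) a > 0" unfolding a(1) by (rule link_cut_positive[OF K a(2,3) mod_neq[OF st, symmetric]])
  have z: "mf (E i) (L i) = 0" "mf (E (Suc i)) (L i) = 0" for i using K by (auto simp: link_def)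
  have az: "mf (L s) a = 0" and bz: "mf (L t) b = 0"
    unfolding a(1) b(1) on_side_def mf_lin using z[of s] z[of t] by (auto simp: mf_sym)
  obtain kappa where k: "\<And>i. kappa i > 0" "\<And>i. crs (E i) (E (Suc i)) = (- kappa i) *\<^sub>R L i"
  proof -
    have "\<forall>i. \<exists>kappa>0. crs (E i) (E (Suc i)) = (- kappa) *\<^sub>R L i" using K unfolding link_def by blast
    thus ?thesis using that by metis
  qed
  have first: "mf (crs a b) (E (Suc s)) > 0"
  proof -
    have "mf (crs a b) (E (Suc s)) = mf (crs (E (Suc s)) a) b" using mf_crs(2)[of "E (Suc s)" a b] by simp
    also have "\<dots> = mu * mf (crs (E (Suc s)) (E s)) b"
      unfolding a(1) on_side_def crs_lin mf_lin by (simp add: mf_def)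
    also have "\<dots> = mu * kappa s * mf (L s) b" using k(2)[of s] by (simp add: crs_anti[of "E (Suc s)"] mf_lin)
    finally show ?thesis using a k Lsb by simp
  qed
  have last: "mf (crs a b) (E t) > 0"
  proof -
    have "mf (crs a b) (E t) = mf (crs b (E t)) a" by (rule mf_crs(2))
    also have "\<dots> = nu' * mf (crs (E (Suc t)) (E t)) a"
      unfolding b(1) on_side_def crs_lin mf_lin by (simp add: mf_def)
    also have "\<dots> = nu' * kappa t * mf (L t) a" using k(2)[of t] by (simp add: crs_anti[of "E (Suc t)"] mf_lin)
    finally show ?thesis using b k Lta by simp
  qed
  define N where "N = mf (crs a b) (crs a b)"
  have ab: "mf a a > 0" "mf b b > 0" "mf a b > 0" using a(4) b(4) future_mf_pos by (auto simp: future_def)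
  have N: "N \<noteq> 0"
  proof
    assume "N = 0"
    have "mf (L s) (crs a b) = 0 \<or> True" by simp
    \<comment> \<open>if the Gram determinant vanished then a and b would be proportional\<close>
    define w where "w = mf a a *\<^sub>R b - mf a b *\<^sub>R a"
    have wa: "mf w a = 0" unfolding w_def by (simp add: mf_def algebra_simps diff_divide_distrib)
    have "mf w w = mf a a * (mf a a * mf b b - (mf a b)^2)"
      unfolding w_def by (simp add: mf_def field_simps power2_eq_square)
    hence ww: "mf w w = 0" using \<open>N = 0\<close> unfolding N_def mf_crs_crs by simp
    have w0: "w = 0"
    proof -
      have "future (a + c *\<^sub>R w)" for c
      proof (rule future_if_mf_pos[OF a(4)])
        show "mf (a + c *\<^sub>R w) (a + c *\<^sub>R w) > 0" "mf (a + c *\<^sub>R w) a > 0"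
          using ab wa ww by (auto simp: mf_lin mf_sym[of a w])
      qed
      hence "cu (a + c *\<^sub>R w) > 0 \<and> cw (a + c *\<^sub>R w) > 0" for c using future_pos by blast
      hence pos: "cu a + c * cu w > 0" "cw a + c * cw w > 0" for c by auto
      have "cu w = 0" using pos(1)[of "- cu a / cu w"] by (cases "cu w = 0") auto
      moreover have "cw w = 0" using pos(2)[of "- cw a / cw w"] by (cases "cw w = 0") auto
      moreover have "cv w = 0" using ww \<open>cu w = 0\<close> by (simp add: mf_def)
      ultimately show ?thesis by (simp add: prod_eq_iff zero_prod_def)
    qed
    have "mf (L s) w = mf a a * mf (L s) b" unfolding w_def mf_lin az by simp
    thus False using w0 ab Lsb by (simp add: mf_def)
  qed
  show ?thesis
  proof (rule ccontr)
    assume "\<not> ?thesis"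
    hence bad: "\<exists>i. s < i \<and> i \<le> t \<and> mf (crs a b) (E i) \<le> 0" using j by auto
    define i where "i = (LEAST i. s < i \<and> i \<le> t \<and> mf (crs a b) (E i) \<le> 0)"
    have i: "s < i" "i \<le> t" "mf (crs a b) (E i) \<le> 0"
      using LeastI_ex[OF bad] unfolding i_def by auto
    have least: "mf (crs a b) (E l) > 0" if "s < l" "l < i" for l
      using not_less_Least[of l "\<lambda>i. s < i \<and> i \<le> t \<and> mf (crs a b) (E i) \<le> 0"] that i unfolding i_def by auto
    have ne: "i \<noteq> Suc s" "i \<noteq> t" using i first last by auto
    obtain l where l: "i = Suc l" using i by (cases i) auto
    have lr: "s < l" "l < t" using i l ne by auto
    define p where "p = mf (crs a b) (E l)"
    define q where "q = - mf (crs a b) (E i)"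
    have pq: "p > 0" "q \<ge> 0" using least[of l] lr l i p_def q_def by auto
    define x where "x = p *\<^sub>R E i + q *\<^sub>R E l"
    have xz: "mf (crs a b) x = 0" unfolding x_def mf_lin p_def q_def by simp
    define alpha where "alpha = mf (crs x b) (crs a b) / N"
    define beta where "beta = mf (crs a x) (crs a b) / N"
    have "N *\<^sub>R x = N *\<^sub>R (alpha *\<^sub>R a + beta *\<^sub>R b)"
      using span_two[OF xz] N unfolding N_def[symmetric] alpha_def beta_def by (simp add: scaleR_add_right)
    hence x: "x = alpha *\<^sub>R a + beta *\<^sub>R b" using N by (simp only: scaleR_cancel_left) simp
    have Lx: "mf (L m) x \<ge> 0" for m
    proof -
      have "mf (L m) (E i) \<ge> 0" "mf (L m) (E l) \<ge> 0" using K by (auto simp: link_def)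
      thus ?thesis unfolding x_def mf_lin using pq by simp
    qed
    have "mf (L s) x = beta * mf (L s) b" unfolding x mf_lin az by simp
    hence be: "beta \<ge> 0" using Lx[of s] Lsb by (simp add: zero_le_mult_iff)
    have "mf (L t) x = alpha * mf (L t) a" unfolding x mf_lin bz by simp
    hence al: "alpha \<ge> 0" using Lx[of t] Lta by (simp add: zero_le_mult_iff)
    have la: "mf (L l) a > 0" unfolding a(1)
      by (rule link_cut_positive[OF K a(2,3) mod_neq[symmetric]]) (use lr st in auto)
    have lb: "mf (L l) b > 0" unfolding b(1)
      by (rule link_cut_positive[OF K b(2,3) mod_neq]) (use lr st in auto)
    have "mf (L l) x = 0" unfolding x_def mf_lin using z[of l] l by (simp add: mf_sym)
    hence "alpha * mf (L l) a + beta * mf (L l) b = 0" unfolding x mf_lin .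
    moreover have "alpha * mf (L l) a \<ge> 0" "beta * mf (L l) b \<ge> 0" using al be la lb by auto
    ultimately have "alpha * mf (L l) a = 0" "beta * mf (L l) b = 0" by linarith+
    hence "alpha = 0" "beta = 0" using la lb by auto
    hence "x = 0" using x by simp
    hence "crs (E l) x = 0" by (simp add: crs_def zero_prod_def)
    hence "p *\<^sub>R crs (E l) (E i) = 0" unfolding x_def crs_lin by (simp add: crs_lin)
    hence "crs (E l) (E i) = 0" using pq by simp
    hence "L l = 0" using k(1,2)[of l] l by auto
    moreover have "mf (L l) (L l) = -1" using K by (auto simp: link_def)
    ultimately show False by (simp add: mf_def zero_prod_def)
  qed
qed

lemma sm_iso_lin:
  assumes "sm_iso phi"
  shows "phi (P + Q) = phi P + phi Q" "phi (c *\<^sub>R P) = c *\<^sub>R phi P" "phi (- P) = - phi P"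
    "mf (phi P) (phi Q) = mf P Q" "crs (phi P) (phi Q) = phi (crs P Q)" "future P \<Longrightarrow> future (phi P)"
  using assms linear_add linear_cmul linear_neg unfolding sm_iso_def by blast+

definition arm_seq :: "nat \<Rightarrow> sm \<Rightarrow> sm \<Rightarrow> (nat \<Rightarrow> sm) \<Rightarrow> nat \<Rightarrow> (nat \<Rightarrow> sm)" where
  "arm_seq k a b E s j = (if j = 0 then a else if j = Suc k then b else E (s + j))"

lemma arm_iso:
  assumes phi: "sm_iso phi" "phi C = (0, 1, 0)" "phi a = (1, 0, 1)" and k: "1 \<le> k"
    and L: "\<And>j. j \<le> k \<Longrightarrow> mf (L j) (L j) = -1 \<and> mf a (L j) \<ge> 0 \<and> mf (E j) (L j) = 0 \<and> mf (E (Suc j)) (L j) = 0 \<and>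
            (\<exists>kappa>0. crs (E j) (E (Suc j)) = (- kappa) *\<^sub>R L j)"
    and T: "\<And>j. j < k \<Longrightarrow> mf (L (Suc j)) (E j) > 0"
    and E: "\<And>j. 1 \<le> j \<Longrightarrow> j \<le> k \<Longrightarrow> mf C (E j) < 0 \<and> (mf (E j) (E j) = 1 \<and> future (E j) \<or> mf (E j) (E j) = -1)"
    and C: "mf C (E 0) = 0" "mf C (E (Suc k)) = 0"
  shows "arm k (\<lambda>j. phi (L j)) (\<lambda>j. phi (E j))"
proof -
  note l = sm_iso_lin[OF phi(1)]
  have v: "cv (phi P) = - mf C P" for P
    using l(4)[of C P] unfolding phi(2) by (simp add: mf_def)
  have tr: "cu (phi P) + cw (phi P) = 2 * mf a P" for P
    using l(4)[of a P] unfolding phi(3) by (simp add: mf_def[of "(1, 0, 1)"])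
  have "\<exists>kappa>0. crs (phi (E j)) (phi (E (Suc j))) = (- kappa) *\<^sub>R phi (L j)" if "j \<le> k" for j
  proof -
    obtain kappa where "kappa > 0" "crs (E j) (E (Suc j)) = (- kappa) *\<^sub>R L j" using L \<open>j \<le> k\<close> by blast
    thus ?thesis using l(5)[of "E j" "E (Suc j)"] l(2)[of "- kappa" "L j"] by metis
  qed
  thus ?thesis unfolding arm_def l(4) v tr using L T E C k l(6) by (auto; blast)
qed

text \<open>Two polygons with the same side lengths can be cut at the same real point of a side, because whether
  a combination of the endpoints is a real point depends on the Gram matrix only.\<close>

lemma cut_exists:
  assumes K: "link n L E" "link n L' E'" and S: "same_link E E'"
  obtains mu nu where "mu > 0" "nu > 0" "future (on_side E s mu nu)" "future (on_side E' s mu nu)"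
    "mf (on_side E s mu nu) (on_side E s mu nu) = 1" "mf (on_side E' s mu nu) (on_side E' s mu nu) = 1"
proof -
  have "\<exists>mu>0. \<exists>nu>0. future (mu *\<^sub>R E s + nu *\<^sub>R E (Suc s))" using K(1) unfolding link_def by blast
  then obtain m n where mn: "m > 0" "n > 0" "future (m *\<^sub>R E s + n *\<^sub>R E (Suc s))" by blast
  have "\<exists>mu>0. \<exists>nu>0. future (mu *\<^sub>R E' s + nu *\<^sub>R E' (Suc s))" using K(2) unfolding link_def by blast
  then obtain m' n' where mn': "m' > 0" "n' > 0" "future (m' *\<^sub>R E' s + n' *\<^sub>R E' (Suc s))" by blast
  define q where "q = mf (m *\<^sub>R E s + n *\<^sub>R E (Suc s)) (m *\<^sub>R E s + n *\<^sub>R E (Suc s))"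
  have q: "q > 0" using mn(3) by (simp add: q_def future_def)
  define c where "c = 1 / sqrt q"
  have c: "c > 0" "c * c * q = 1" using q by (auto simp: c_def)
  have e: "mf (on_side E s mu nu) (on_side E s mu nu) = mf (on_side E' s mu nu) (on_side E' s mu nu)" for mu nu
    using S unfolding same_link_def on_side_def mf_lin mf_sym[of "E (Suc s)" "E s"] mf_sym[of "E' (Suc s)" "E' s"] by simp
  have o: "on_side E s (c * m) (c * n) = c *\<^sub>R (m *\<^sub>R E s + n *\<^sub>R E (Suc s))"
    by (simp add: on_side_def scaleR_add_right)
  have f: "future (on_side E s (c * m) (c * n))" unfolding o by (rule future_scale[OF mn(3) c(1)])
  have n1: "mf (on_side E s (c * m) (c * n)) (on_side E s (c * m) (c * n)) = 1"
    unfolding o using c(2) by (simp add: mf_scale_left mf_scale_right q_def)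
  have ty: "mf (E' i) (E' i) > 0 \<and> future (E' i) \<or> mf (E' i) (E' i) < 0" for i
  proof -
    have "mf (E' i) (E' i) = 1 \<and> future (E' i) \<or> mf (E' i) (E' i) = -1" using K(2) unfolding link_def by blast
    thus ?thesis by auto
  qed
  have f': "future (on_side E' s (c * m) (c * n))" unfolding on_side_def
    by (rule future_transfer[OF mn'(3,1,2) _ _ _ ty ty])
       (use n1 e mn c in \<open>auto simp: on_side_def[symmetric]\<close>)
  show ?thesis using that[of "c * m" "c * n"] c mn f f' n1 e by simp
qed

text \<open>Cutting a polygon along a chord and moving the chord to standard position yields an arm.\<close>

lemma arm_of_link:
  assumes K: "link n L E" and st: "s < t" "t < s + n"
    and a: "a = on_side E s mu nu" "mu > 0" "nu > 0" "future a" "mf a a = 1"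
    and b: "b = on_side E t mu' nu'" "mu' > 0" "nu' > 0" "future b" "mf b b = 1"
  obtains phi b1 b2 where "sm_iso phi"
    "arm (t - s) (\<lambda>j. phi (L (s + j))) (\<lambda>j. phi (arm_seq (t - s) a b E s j))"
    "phi a = (1, 0, 1)" "phi b = (b1, 0, b2)" "b1 > b2" "b2 > 0" "b1 * b2 = 1"
proof -
  have z: "mf (E i) (L i) = 0" "mf (E (Suc i)) (L i) = 0" "mf (L i) (L i) = -1" for i using K by (auto simp: link_def)
  have ex: "\<exists>kappa>0. crs (E i) (E (Suc i)) = (- kappa) *\<^sub>R L i" for i using K unfolding link_def by blast
  define k where "k = t - s"
  have k: "1 \<le> k" "t = s + k" "k < n" using st by (auto simp: k_def)
  have chord: "mf (crs a b) (E (s + j)) > 0" if "1 \<le> j" "j \<le> k" for j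
    by (rule link_chord_side[OF K st a(1-4) b(1-4)]) (use that k in auto)
  have "mf a b > 0" using future_mf_pos a b by blast
  have N0: "mf (crs a b) (crs a b) \<noteq> 0"
  proof
    assume "mf (crs a b) (crs a b) = 0"
    hence "(mf a b)^2 = 1" unfolding mf_crs_crs using a b by simp
    hence ab1: "mf a b = 1" using \<open>mf a b > 0\<close> by (simp add: power2_eq_1_iff)
    define w where "w = b - a"
    have ww: "mf w w = 0" "mf a w = 0" unfolding w_def mf_lin
      using ab1 a(5) b(5) by (auto simp: mf_sym[of b a])
    have "future (a + c *\<^sub>R w)" for c
    proof (rule future_if_mf_pos[OF a(4)])
      show "mf (a + c *\<^sub>R w) (a + c *\<^sub>R w) > 0" "mf (a + c *\<^sub>R w) a > 0"
        using a(5) ww by (auto simp: mf_lin mf_sym[of w a])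
    qed
    hence "cu (a + c *\<^sub>R w) > 0 \<and> cw (a + c *\<^sub>R w) > 0" for c using future_pos by blast
    hence pos: "cu a + c * cu w > 0" "cw a + c * cw w > 0" for c by auto
    have "cu w = 0" using pos(1)[of "- cu a / cu w"] by (cases "cu w = 0") auto
    moreover have "cw w = 0" using pos(2)[of "- cw a / cw w"] by (cases "cw w = 0") auto
    moreover have "cv w = 0" using ww \<open>cu w = 0\<close> by (simp add: mf_def)
    ultimately have "w = 0" by (simp add: prod_eq_iff zero_prod_def)
    hence "b = a" using w_def by simp
    hence "mf (crs a b) (E (s + 1)) = 0" by (simp add: crs_lin mf_def)
    thus False using chord[of 1] k by simp
  qed
  define N where "N = - mf (crs a b) (crs a b)"
  have "(mf a b)^2 \<ge> 1"
  proof (rule ccontr)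
    assume "\<not> ?thesis"
    hence lt: "(mf a b)^2 < 1" by simp
    define w where "w = b - mf a b *\<^sub>R a"
    have ww: "mf w w = 1 - (mf a b)^2" "mf a w = 0" unfolding w_def mf_lin
      using a(5) b(5) by (auto simp: mf_sym[of b a] power2_eq_square)
    hence "future w \<or> future (- w)" using lt future_or_past[of w] by simp
    hence "mf a w > 0 \<or> mf a (- w) > 0" using future_mf_pos[OF a(4)] by blast
    thus False using ww(2) by (simp add: mf_minus_right)
  qed
  hence N: "N > 0" using N0 unfolding N_def mf_crs_crs using a b by simp
  define c where "c = 1 / sqrt N"
  have c: "c > 0" "c * c * N = 1" using N by (auto simp: c_def)
  define C where "C = (- c) *\<^sub>R crs a b"
  have CC: "mf C C = -1" using c(2) unfolding C_def mf_lin N_def by simp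
  have aC: "mf a C = 0" "mf b C = 0" unfolding C_def mf_lin using mf_crs_same by (auto simp: mf_sym)
  obtain phi where phi: "sm_iso phi" "phi C = (0, 1, 0)" "phi a = (1, 0, 1)"
    using normal_form_exists[OF CC a(5,4) aC(1)] .
  note l = sm_iso_lin[OF phi(1)]
  have "arm k (\<lambda>j. phi (L (s + j))) (\<lambda>j. phi (arm_seq k a b E s j))"
  proof (rule arm_iso[OF phi k(1)])
    fix j assume j: "j \<le> k"
    have "mf a (L (s + j)) \<ge> 0"
    proof -
      have "mf (L (s + j)) (E s) \<ge> 0" "mf (L (s + j)) (E (Suc s)) \<ge> 0" using K by (auto simp: link_def)
      thus ?thesis unfolding a(1) on_side_def mf_lin using a by (simp add: mf_sym)
    qed
    moreover have "mf (arm_seq k a b E s j) (L (s + j)) = 0"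
      using j z[of s] z[of "s + j"] unfolding arm_seq_def a(1) on_side_def by (auto simp: mf_lin)
    moreover have "mf (arm_seq k a b E s (Suc j)) (L (s + j)) = 0"
      using j z[of t] z[of "s + j"] unfolding arm_seq_def b(1) on_side_def by (auto simp: mf_lin k(2))
    moreover have "\<exists>kappa>0. crs (arm_seq k a b E s j) (arm_seq k a b E s (Suc j)) = (- kappa) *\<^sub>R L (s + j)"
    proof -
      obtain kappa where kappa: "kappa > 0" "crs (E (s + j)) (E (Suc (s + j))) = (- kappa) *\<^sub>R L (s + j)" using ex by blast
      consider "j = 0" | "j = k" "j \<noteq> 0" | "0 < j" "j < k" using j by linarith
      thus ?thesis
      proof cases
        case 1
        have "crs a (E (Suc s)) = (- (mu * kappa)) *\<^sub>R L s"
          unfolding a(1) on_side_def crs_lin using kappa 1 by simp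
        thus ?thesis using 1 k a kappa unfolding arm_seq_def by (intro exI[of _ "mu * kappa"]) auto
      next
        case 2
        have "crs (E t) b = (- (nu' * kappa)) *\<^sub>R L t"
          unfolding b(1) on_side_def crs_lin using kappa 2 k by simp
        thus ?thesis using 2 k b kappa unfolding arm_seq_def by (intro exI[of _ "nu' * kappa"]) auto
      next
        case 3
        thus ?thesis using kappa unfolding arm_seq_def by auto
      qed
    qed
    ultimately show "mf (L (s + j)) (L (s + j)) = - 1 \<and> mf a (L (s + j)) \<ge> 0 \<and> mf (arm_seq k a b E s j) (L (s + j)) = 0 \<and>
        mf (arm_seq k a b E s (Suc j)) (L (s + j)) = 0 \<and>
        (\<exists>kappa>0. crs (arm_seq k a b E s j) (arm_seq k a b E s (Suc j)) = (- kappa) *\<^sub>R L (s + j))"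
      using z by blast
  next
    fix j assume j: "j < k"
    show "mf (L (s + Suc j)) (arm_seq k a b E s j) > 0"
    proof (cases "j = 0")
      case True
      have "mf (L (s + 1)) (on_side E s mu nu) > 0"
        by (rule link_cut_positive[OF K a(2,3) mod_neq[symmetric]]) (use k in auto)
      thus ?thesis using True a unfolding arm_seq_def by simp
    next
      case False
      have "(s + Suc j) mod n \<noteq> (s + j) mod n" by (rule mod_neq[symmetric]) (use k in auto)
      from link_other_side[OF K this] have "mf (L (s + Suc j)) (E (s + j)) \<noteq> 0" using z(1)[of "s + Suc j"] by (simp add: mf_sym)
      moreover have "mf (L (s + Suc j)) (E (s + j)) \<ge> 0" using K unfolding link_def by blast
      ultimately show ?thesis using False j unfolding arm_seq_def by simp
    qed
  next
    fix j assume j: "1 \<le> j" "j \<le> k"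
    have "mf C (E (s + j)) < 0" unfolding C_def mf_lin using chord[OF j] c by simp
    moreover have "mf (E (s + j)) (E (s + j)) = 1 \<and> future (E (s + j)) \<or> mf (E (s + j)) (E (s + j)) = -1"
      using K unfolding link_def by blast
    ultimately show "mf C (arm_seq k a b E s j) < 0 \<and>
      (mf (arm_seq k a b E s j) (arm_seq k a b E s j) = 1 \<and> future (arm_seq k a b E s j) \<or>
       mf (arm_seq k a b E s j) (arm_seq k a b E s j) = -1)"
      using j unfolding arm_seq_def by simp
  qed (use aC in \<open>auto simp: arm_seq_def mf_sym\<close>)
  moreover obtain b1 v b2 where be: "phi b = (b1, v, b2)" by (metis prod.exhaust)
  have "mf (phi C) (phi b) = 0" using l(4) aC(2) by (simp add: mf_sym)
  hence v: "v = 0" unfolding phi(2) be by (simp add: mf_def)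
  have bb: "b1 * b2 = 1" using l(4)[of b b] b(5) unfolding be v by (simp add: mf_def)
  have "future (phi b)" using l(6) b by blast
  hence "b2 > 0" using future_pos unfolding be by fastforce
  moreover have "b1 > b2"
  proof -
    have "C = (- c) *\<^sub>R crs a b" by (rule C_def)
    hence "phi C = (- c) *\<^sub>R crs (phi a) (phi b)" using l(2)[of "- c" "crs a b"] l(5)[of a b] by simp
    hence "1 = (- c) * (b2 - b1)" unfolding phi be v by (simp add: crs_def)
    hence "c * (b1 - b2) = 1" by (simp add: algebra_simps)
    thus ?thesis using c by (smt (verit) mult_nonneg_nonpos)
  qed
  ultimately show ?thesis using that[of phi b1 b2] phi be v bb k_def by blast
qed

section \<open>Sign changes around a vertex\<close>

lemma same_link_sym: "same_link E E' \<Longrightarrow> same_link E' E"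
  by (simp add: same_link_def)

lemma link_arm_comparison:
  assumes K: "link n L E" "link n L' E'" and S: "same_link E E'"
    and st: "s < t" "t < s + n"
    and op: "\<And>j. s \<le> j \<Longrightarrow> j < t \<Longrightarrow> gain L E L' j \<ge> 0"
    and c: "mu > 0" "nu > 0" "mu' > 0" "nu' > 0"
    and a: "a = on_side E s mu nu" "future a" "mf a a = 1"
    and b: "b = on_side E t mu' nu'" "future b" "mf b b = 1"
    and a': "a' = on_side E' s mu nu" "future a'" "mf a' a' = 1"
    and b': "b' = on_side E' t mu' nu'" "future b'" "mf b' b' = 1"
  shows "mf a b \<le> mf a' b'" "\<exists>j. s \<le> j \<and> j < t \<and> gain L E L' j > 0 \<Longrightarrow> mf a b < mf a' b'"
proof -
  define k where "k = t - s"
  have k: "1 \<le> k" "t = s + k" using st by (auto simp: k_def)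
  obtain phi b1 b2 where phi: "sm_iso phi"
    "arm k (\<lambda>j. phi (L (s + j))) (\<lambda>j. phi (arm_seq k a b E s j))"
    "phi a = (1, 0, 1)" "phi b = (b1, 0, b2)" "b1 > b2" "b2 > 0" "b1 * b2 = 1"
    using arm_of_link[OF K(1) st a(1) c(1,2) a(2,3) b(1) c(3,4) b(2,3)] k_def by metis
  obtain phi' c1 c2 where phi': "sm_iso phi'"
    "arm k (\<lambda>j. phi' (L' (s + j))) (\<lambda>j. phi' (arm_seq k a' b' E' s j))"
    "phi' a' = (1, 0, 1)" "phi' b' = (c1, 0, c2)" "c1 > c2" "c2 > 0" "c1 * c2 = 1"
    using arm_of_link[OF K(2) st a'(1) c(1,2) a'(2,3) b'(1) c(3,4) b'(2,3)] k_def by metis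
  note l = sm_iso_lin[OF phi(1)] and l' = sm_iso_lin[OF phi'(1)]
  have g: "mf (E i) (E i) = mf (E' i) (E' i)" "mf (E i) (E (Suc i)) = mf (E' i) (E' (Suc i))"
     "mf (E (Suc i)) (E i) = mf (E' (Suc i)) (E' i)" for i
    using S by (auto simp: same_link_def mf_sym)
  have ss: "same_sides k (\<lambda>j. phi (arm_seq k a b E s j)) (\<lambda>j. phi' (arm_seq k a' b' E' s j))"
    unfolding same_sides_def l(4) l'(4)
  proof (intro conjI allI impI)
    show "mf (arm_seq k a b E s 0) (arm_seq k a b E s 0) \<noteq> 0" using a by (simp add: arm_seq_def)
    show "mf (arm_seq k a b E s j) (arm_seq k a b E s j) = mf (arm_seq k a' b' E' s j) (arm_seq k a' b' E' s j)" for j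
      using a(3) b(3) a'(3) b'(3) g by (simp add: arm_seq_def)
    fix j assume j: "j \<le> k"
    show "mf (arm_seq k a b E s j) (arm_seq k a b E s (Suc j)) = mf (arm_seq k a' b' E' s j) (arm_seq k a' b' E' s (Suc j))"
    proof -
      consider "j = 0" | "j = k" "j \<noteq> 0" | "0 < j" "j < k" using j by linarith
      thus ?thesis
      proof cases
        case 1
        thus ?thesis using k g unfolding arm_seq_def a(1) a'(1) on_side_def by (simp add: mf_lin)
      next
        case 2
        thus ?thesis using k g unfolding arm_seq_def b(1) b'(1) on_side_def by (simp add: mf_lin)
      next
        case 3
        thus ?thesis using g by (simp add: arm_seq_def)
      qed
    qed
    show "\<exists>mu\<ge>0. \<exists>nu\<ge>0. future (mu *\<^sub>R phi (arm_seq k a b E s j) + nu *\<^sub>R phi (arm_seq k a b E s (Suc j))) \<and>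
             future (mu *\<^sub>R phi' (arm_seq k a' b' E' s j) + nu *\<^sub>R phi' (arm_seq k a' b' E' s (Suc j)))"
    proof -
      have "\<exists>mu\<ge>0. \<exists>nu\<ge>0. future (mu *\<^sub>R arm_seq k a b E s j + nu *\<^sub>R arm_seq k a b E s (Suc j)) \<and>
             future (mu *\<^sub>R arm_seq k a' b' E' s j + nu *\<^sub>R arm_seq k a' b' E' s (Suc j))"
      proof -
        consider "j = 0" | "j = k" "j \<noteq> 0" | "0 < j" "j < k" using j by linarith
        thus ?thesis
        proof cases
          case 1
          thus ?thesis using a a' unfolding arm_seq_def by (intro exI[of _ 1] conjI exI[of _ 0]) auto
        next
          case 2
          thus ?thesis using b b' unfolding arm_seq_def by (intro exI[of _ 0] conjI exI[of _ 1]) auto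
        next
          case 3
          obtain m n where "m > 0" "n > 0" "future (on_side E (s + j) m n)" "future (on_side E' (s + j) m n)"
            using cut_exists[OF K S] by metis
          thus ?thesis using 3 unfolding arm_seq_def on_side_def by (intro exI[of _ m] conjI exI[of _ n]) auto
        qed
      qed
      then obtain x y where xy: "x \<ge> 0" "y \<ge> 0"
          and f: "future (x *\<^sub>R arm_seq k a b E s j + y *\<^sub>R arm_seq k a b E s (Suc j))"
          and f': "future (x *\<^sub>R arm_seq k a' b' E' s j + y *\<^sub>R arm_seq k a' b' E' s (Suc j))" by blast
      show ?thesis using xy l(6)[OF f] l'(6)[OF f'] unfolding l(1,2) l'(1,2) by blast
    qed
  qed
  have ga: "gain (\<lambda>j. phi (L (s + j))) (\<lambda>j. phi (arm_seq k a b E s j)) (\<lambda>j. phi' (L' (s + j))) j = gain L E L' (s + j)"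
    if "j < k" for j
    unfolding gain_def l(4) l'(4) using that by (simp add: arm_seq_def)
  have st0: "phi (arm_seq k a b E s 0) = (1, 0, 1)" "phi' (arm_seq k a' b' E' s 0) = (1, 0, 1)"
    "phi (arm_seq k a b E s (Suc k)) = (b1, 0, b2)" "phi' (arm_seq k a' b' E' s (Suc k)) = (c1, 0, c2)"
    using phi phi' by (auto simp: arm_seq_def)
  have op': "gain (\<lambda>j. phi (L (s + j))) (\<lambda>j. phi (arm_seq k a b E s j)) (\<lambda>j. phi' (L' (s + j))) j \<ge> 0" if "j < k" for j
    unfolding ga[OF that] using op[of "s + j"] that k by simp
  note al = arm_lemma[OF phi(2) phi'(2) ss op' st0(1,2) st0(3) phi(5-7) st0(4) phi'(5-7)]
  have m: "mf a b = (b1 + b2) / 2" using l(4)[of a b] unfolding phi(3,4) by (simp add: mf_def[of "(1, 0, 1)"])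
  have m': "mf a' b' = (c1 + c2) / 2" using l'(4)[of a' b'] unfolding phi'(3,4) by (simp add: mf_def[of "(1, 0, 1)"])
  show "mf a b \<le> mf a' b'" using al(1) unfolding m m' by simp
  assume "\<exists>j. s \<le> j \<and> j < t \<and> gain L E L' j > 0"
  then obtain j where j: "s \<le> j" "j < t" "gain L E L' j > 0" by blast
  have "\<exists>j<k. gain (\<lambda>j. phi (L (s + j))) (\<lambda>j. phi (arm_seq k a b E s j)) (\<lambda>j. phi' (L' (s + j))) j > 0"
    by (rule exI[of _ "j - s"]) (use j k ga[of "j - s"] in auto)
  thus "mf a b < mf a' b'" using al(2) unfolding m m' by simp
qed

lemma gain_swap: "same_link E E' \<Longrightarrow> gain L' E' L j = - gain L E L' j"
  by (simp add: gain_def same_link_def algebra_simps)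

lemma on_side_shift: "link n L E \<Longrightarrow> on_side E (s + n) mu nu = on_side E s mu nu"
proof -
  assume K: "link n L E"
  have "E (s + n) = E s" "E (Suc s + n) = E (Suc s)" using K unfolding link_def by blast+
  thus ?thesis by (simp add: on_side_def)
qed

text \<open>If the vertices of one arc between two sides only open and those of the complementary arc only
  close, the chord joining them would become both longer and shorter.\<close>

lemma two_arcs:
  assumes K: "link n L E" "link n L' E'" and S: "same_link E E'"
    and st: "s < t" "t < s + n"
    and op: "\<And>j. s \<le> j \<Longrightarrow> j < t \<Longrightarrow> gain L E L' j \<ge> 0"
    and cl: "\<And>j. t \<le> j \<Longrightarrow> j < s + n \<Longrightarrow> gain L E L' j \<le> 0"
  shows "\<not> (\<exists>j. s \<le> j \<and> j < t \<and> gain L E L' j > 0)"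
proof
  assume ex: "\<exists>j. s \<le> j \<and> j < t \<and> gain L E L' j > 0"
  obtain mu nu where a: "mu > 0" "nu > 0" "future (on_side E s mu nu)" "future (on_side E' s mu nu)"
    "mf (on_side E s mu nu) (on_side E s mu nu) = 1" "mf (on_side E' s mu nu) (on_side E' s mu nu) = 1"
    using cut_exists[OF K S, where s = s] .
  obtain mu' nu' where b: "mu' > 0" "nu' > 0" "future (on_side E t mu' nu')" "future (on_side E' t mu' nu')"
    "mf (on_side E t mu' nu') (on_side E t mu' nu') = 1" "mf (on_side E' t mu' nu') (on_side E' t mu' nu') = 1"
    using cut_exists[OF K S, where s = t] .
  have 1: "mf (on_side E s mu nu) (on_side E t mu' nu') < mf (on_side E' s mu nu) (on_side E' t mu' nu')"
    by (rule link_arm_comparison(2)[OF K S st op a(1,2) b(1,2) refl a(3,5) refl b(3,5) refl a(4,6) refl b(4,6) ex])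
  note sh = on_side_shift[OF K(1)] on_side_shift[OF K(2)]
  have "mf (on_side E' t mu' nu') (on_side E' (s + n) mu nu) \<le> mf (on_side E t mu' nu') (on_side E (s + n) mu nu)"
    by (rule link_arm_comparison(1)[OF K(2,1) same_link_sym[OF S] _ _ _ b(1,2) a(1,2) refl b(4,6) refl _ _ refl b(3,5) refl])
       (use st a sh cl in \<open>auto simp: gain_swap[OF S]\<close>)
  thus False using 1 unfolding sh by (simp add: mf_sym)
qed

text \<open>Only the two endpoints of a side lie on its line, because the side lines are distinct.\<close>

lemma link_vertex_off_side:
  assumes K: "link n L E" and z: "mf (L i) (E j) = 0"
  shows "j mod n = i mod n \<or> j mod n = Suc i mod n"
proof (rule ccontr)
  assume ne: "\<not> ?thesis"
  have n3: "3 \<le> n" and per: "\<And>i. L (i + n) = L i" "\<And>i. E (i + n) = E i" using K by (auto simp: link_def)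
  have zz: "mf (L i) (E i) = 0" "mf (L i) (E (Suc i)) = 0" "mf (L i) (L i) = -1" for i
    using K by (auto simp: link_def mf_sym)
  have nn: "mf (L i) (E l) \<ge> 0" for i l using K unfolding link_def by blast
  define h where "h = j + n - 1"
  have h: "Suc h = j + n" using n3 by (simp add: h_def)
  have Eh: "E (Suc h) = E j" "L (Suc h) = L j" unfolding h by (rule per)+
  have nej: "Suc h mod n \<noteq> i mod n" using ne unfolding h by simp
  have neh: "h mod n \<noteq> i mod n"
  proof
    assume "h mod n = i mod n"
    hence "Suc h mod n = Suc i mod n" by (metis mod_Suc_eq)
    thus False using ne unfolding h by simp
  qed
  have m: "h mod n \<noteq> Suc h mod n" by (rule mod_neq) (use n3 in auto)
  have A: "mf (L h) (E (Suc (Suc h))) > 0"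
    using link_other_side[OF K m] zz(2)[of h] nn[of h "Suc (Suc h)"] by (simp add: less_eq_real_def)
  have B: "mf (L (Suc h)) (E h) > 0"
    using link_other_side[OF K m[symmetric]] zz(1)[of "Suc h"] nn[of "Suc h" h] by (simp add: less_eq_real_def)
  define p where "p = mf (L i) (E (Suc (Suc h))) / mf (L h) (E (Suc (Suc h)))"
  define q where "q = mf (L i) (E h) / mf (L (Suc h)) (E h)"
  have pq: "p \<ge> 0" "q \<ge> 0" using A B nn by (auto simp: p_def q_def)
  define w where "w = L i - p *\<^sub>R L h - q *\<^sub>R L (Suc h)"
  have w1: "mf w (E h) = 0" unfolding w_def mf_lin using B zz(1)[of h] by (simp add: q_def)
  have w2: "mf w (E (Suc h)) = 0" unfolding w_def mf_lin using z Eh zz(2)[of h] zz(1)[of "Suc h"] by simp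
  have w3: "mf w (E (Suc (Suc h))) = 0" unfolding w_def mf_lin using A zz(2)[of "Suc h"] by (simp add: p_def)
  obtain kappa where kappa: "kappa > 0" "crs (E h) (E (Suc h)) = (- kappa) *\<^sub>R L h" using K unfolding link_def by blast
  have "(- (kappa * kappa)) *\<^sub>R w = (kappa * kappa * mf (L h) w) *\<^sub>R L h"
    using orth_two[OF w1 w2] unfolding kappa(2) by (simp add: mf_lin zz)
  hence wL: "(kappa * kappa) *\<^sub>R w = (- (kappa * kappa * mf (L h) w)) *\<^sub>R L h"
    by (simp add: minus_equation_iff[of "(kappa * kappa) *\<^sub>R w"])
  have "(- (kappa * kappa * mf (L h) w)) * mf (L h) (E (Suc (Suc h))) = mf ((kappa * kappa) *\<^sub>R w) (E (Suc (Suc h)))"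
    unfolding wL mf_lin ..
  also have "\<dots> = 0" unfolding mf_lin w3 by simp
  finally have "kappa * kappa * mf (L h) w = 0" using A by simp
  hence "(kappa * kappa) *\<^sub>R w = 0" using wL by simp
  hence "w = 0" using kappa by simp
  hence Li: "L i = p *\<^sub>R L h + q *\<^sub>R L (Suc h)" by (simp add: w_def algebra_simps)
  have s: "p * mf (L h) (E l) + q * mf (L (Suc h)) (E l) = mf (L i) (E l)" for l unfolding Li mf_lin ..
  have each: "p * mf (L h) (E l) = 0 \<and> q * mf (L (Suc h)) (E l) = 0" if "l = i \<or> l = Suc i" for l
  proof -
    have "p * mf (L h) (E l) + q * mf (L (Suc h)) (E l) = 0" using s[of l] that zz by auto
    moreover have "p * mf (L h) (E l) \<ge> 0" "q * mf (L (Suc h)) (E l) \<ge> 0" using pq nn by auto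
    ultimately show ?thesis by linarith
  qed
  have "p = 0" using each[of i] each[of "Suc i"] link_other_side[OF K neh] by auto
  moreover have "q = 0" using each[of i] each[of "Suc i"] link_other_side[OF K nej] by auto
  ultimately have "L i = 0" using Li by simp
  thus False using zz(3)[of i] by (simp add: mf_def zero_prod_def)
qed

lemma axis_point_eq:
  fixes g1 g2 h1 h2 :: real
  assumes "g1 * g2 = h1 * h2" "g1 + g2 = h1 + h2" "(g2 - g1) * (h2 - h1) > 0"
  shows "g1 = h1 \<and> g2 = h2"
proof -
  have "(g2 - g1)^2 = (h2 - h1)^2" using assms(1,2) by algebra
  hence "g2 - g1 = h2 - h1 \<or> g2 - g1 = - (h2 - h1)" by (simp add: power2_eq_iff)
  moreover have "g2 - g1 = - (h2 - h1) \<Longrightarrow> False"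
  proof -
    assume "g2 - g1 = - (h2 - h1)"
    hence "(g2 - g1) * (h2 - h1) = - ((h2 - h1)^2)" by algebra
    thus False using assms(3) zero_le_power2[of "h2 - h1"] by linarith
  qed
  ultimately have "g2 - g1 = h2 - h1" by blast
  thus ?thesis using assms(2) by linarith
qed

text \<open>Without a sign change, cut the polygon at a single side: the remaining sides form an arm whose ends
  are the endpoints of that side, hence keep their position.\<close>

lemma no_change:
  assumes K: "link n L E" "link n L' E'" and S: "same_link E E'"
    and op: "\<And>j. gain L E L' j \<ge> 0"
  shows "gain L E L' j = 0"
proof -
  have n3: "3 \<le> n" using K(1) unfolding link_def by blast
  define s where "s = j + n - 1"
  define k where "k = n - 2"
  have k: "1 \<le> k" "Suc k = n - 1" using n3 by (auto simp: k_def)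
  obtain mu nu where a: "mu > 0" "nu > 0" "future (on_side E s mu nu)" "future (on_side E' s mu nu)"
    "mf (on_side E s mu nu) (on_side E s mu nu) = 1" "mf (on_side E' s mu nu) (on_side E' s mu nu) = 1"
    using cut_exists[OF K S, where s = s] .
  have build: "\<exists>phi g1 g2 h1 h2. sm_iso phi \<and>
     arm k (\<lambda>j. phi (L (Suc s + j))) (\<lambda>j. phi (E (Suc s + j))) \<and>
     phi (E (Suc s)) = (g1, 0, g2) \<and> phi (E s) = (h1, 0, h2) \<and> g2 > g1 \<and> h2 < h1 \<and>
     g1 + g2 = 2 * mf (on_side E s mu nu) (E (Suc s)) \<and> h1 + h2 = 2 * mf (on_side E s mu nu) (E s) \<and>
     g1 * g2 = mf (E (Suc s)) (E (Suc s)) \<and> h1 * h2 = mf (E s) (E s)"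
    if K: "link n L E" and a: "future (on_side E s mu nu)" "mf (on_side E s mu nu) (on_side E s mu nu) = 1" for L E
  proof -
    have z: "mf (E i) (L i) = 0" "mf (E (Suc i)) (L i) = 0" "mf (L i) (L i) = -1" for i using K by (auto simp: link_def)
    have ex: "\<exists>kappa>0. crs (E i) (E (Suc i)) = (- kappa) *\<^sub>R L i" for i using K unfolding link_def by blast
    have per: "L (i + n) = L i" "E (i + n) = E i" for i using K unfolding link_def by blast+
    have nn: "mf (L i) (E l) \<ge> 0" for i l using K unfolding link_def by blast
    have "mf (on_side E s mu nu) (- L s) = 0" unfolding on_side_def mf_lin using z[of s] by simp
    then obtain phi where phi: "sm_iso phi" "phi (- L s) = (0, 1, 0)" "phi (on_side E s mu nu) = (1, 0, 1)"
      using normal_form_exists[of "- L s" "on_side E s mu nu"] a z(3)[of s] by (auto simp: mf_lin)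
    have ar: "arm k (\<lambda>j. phi (L (Suc s + j))) (\<lambda>j. phi (E (Suc s + j)))"
    proof (rule arm_iso[OF phi k(1)])
      fix i assume i: "i \<le> k"
      have "mf (on_side E s mu nu) (L (Suc s + i)) \<ge> 0"
        unfolding on_side_def mf_lin using nn \<open>mu > 0\<close> \<open>nu > 0\<close> by (simp add: mf_sym)
      thus "mf (L (Suc s + i)) (L (Suc s + i)) = - 1 \<and> mf (on_side E s mu nu) (L (Suc s + i)) \<ge> 0 \<and>
         mf (E (Suc s + i)) (L (Suc s + i)) = 0 \<and> mf (E (Suc s + Suc i)) (L (Suc s + i)) = 0 \<and>
         (\<exists>kappa>0. crs (E (Suc s + i)) (E (Suc s + Suc i)) = (- kappa) *\<^sub>R L (Suc s + i))"
        using z[of "Suc s + i"] ex[of "Suc s + i"] by simp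
    next
      fix i assume i: "i < k"
      have "(Suc s + Suc i) mod n \<noteq> (Suc s + i) mod n" by (rule mod_neq[symmetric]) (use n3 in auto)
      from link_other_side[OF K this] have "mf (L (Suc s + Suc i)) (E (Suc s + i)) \<noteq> 0"
        using z(1)[of "Suc s + Suc i"] by (simp add: mf_sym)
      thus "mf (L (Suc s + Suc i)) (E (Suc s + i)) > 0" using nn[of "Suc s + Suc i" "Suc s + i"] by linarith
    next
      fix i assume i: "1 \<le> i" "i \<le> k"
      have "(Suc s + i) mod n \<noteq> s mod n" by (rule mod_neq[symmetric]) (use i k n3 in auto)
      moreover have "(Suc s + i) mod n \<noteq> Suc s mod n" by (rule mod_neq[symmetric]) (use i k n3 in auto)
      ultimately have "mf (L s) (E (Suc s + i)) \<noteq> 0" using link_vertex_off_side[OF K] by blast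
      hence pos: "mf (L s) (E (Suc s + i)) > 0" using nn[of s "Suc s + i"] by linarith
      have "mf (E (Suc s + i)) (E (Suc s + i)) = 1 \<and> future (E (Suc s + i)) \<or> mf (E (Suc s + i)) (E (Suc s + i)) = - 1"
        using K unfolding link_def by blast
      thus "mf (- L s) (E (Suc s + i)) < 0 \<and>
        (mf (E (Suc s + i)) (E (Suc s + i)) = 1 \<and> future (E (Suc s + i)) \<or> mf (E (Suc s + i)) (E (Suc s + i)) = - 1)"
        using pos by (simp add: mf_minus_left)
    next
      show "mf (- L s) (E (Suc s + 0)) = 0" using z(2)[of s] by (simp add: mf_lin mf_sym)
      have "E (Suc s + Suc k) = E s" using per(2)[of s] k n3 by simp
      thus "mf (- L s) (E (Suc s + Suc k)) = 0" using z(1)[of s] by (simp add: mf_lin mf_sym)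
    qed
    note l = sm_iso_lin[OF phi(1)]
    have v: "cv (phi P) = mf (L s) P" for P
      using l(4)[of "- L s" P] unfolding phi(2) by (simp add: mf_def[of "(0,1,0)"] mf_minus_left)
    have tr: "cu (phi P) + cw (phi P) = 2 * mf (on_side E s mu nu) P" for P
      using l(4)[of "on_side E s mu nu" P] unfolding phi(3) by (simp add: mf_def[of "(1, 0, 1)"])
    have v0: "cv (phi (E (Suc s))) = 0" "cv (phi (E s)) = 0" unfolding v using z[of s] by (auto simp: mf_sym)
    obtain g1 g2 where g: "phi (E (Suc s)) = (g1, 0, g2)" using v0 by (metis prod.collapse)
    obtain h1 h2 where h: "phi (E s) = (h1, 0, h2)" using v0 by (metis prod.collapse)
    have gh: "g1 * g2 = mf (E (Suc s)) (E (Suc s))" "h1 * h2 = mf (E s) (E s)"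
      using l(4)[of "E (Suc s)" "E (Suc s)"] l(4)[of "E s" "E s"] unfolding g h
      by (simp_all add: mf_def[of "(g1, 0, g2)"] mf_def[of "(h1, 0, h2)"])
    have gh': "g1 + g2 = 2 * mf (on_side E s mu nu) (E (Suc s))" "h1 + h2 = 2 * mf (on_side E s mu nu) (E s)"
      using tr[of "E (Suc s)"] tr[of "E s"] unfolding g h by auto
    obtain kappa where kappa: "kappa > 0" "crs (E s) (E (Suc s)) = (- kappa) *\<^sub>R L s" using ex by blast
    have "crs (on_side E s mu nu) (E (Suc s)) = (mu * kappa) *\<^sub>R (- L s)"
      unfolding on_side_def crs_lin kappa(2) by simp
    hence "crs (phi (on_side E s mu nu)) (phi (E (Suc s))) = (mu * kappa) *\<^sub>R phi (- L s)"
      using l(2)[of "mu * kappa" "- L s"] l(5)[of "on_side E s mu nu" "E (Suc s)"] by (simp only:)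
    hence "g2 - g1 = mu * kappa" unfolding phi(2,3) g by (simp add: crs_def)
    hence o1: "g2 > g1" using kappa \<open>mu > 0\<close> by (smt (verit) mult_pos_pos)
    have "crs (on_side E s mu nu) (E s) = (- (nu * kappa)) *\<^sub>R (- L s)"
      unfolding on_side_def crs_lin crs_anti[of "E (Suc s)" "E s"] kappa(2) by simp
    hence "crs (phi (on_side E s mu nu)) (phi (E s)) = (- (nu * kappa)) *\<^sub>R phi (- L s)"
      using l(2)[of "- (nu * kappa)" "- L s"] l(5)[of "on_side E s mu nu" "E s"] by (simp only:)
    hence "h2 - h1 = - (nu * kappa)" unfolding phi(2,3) h by (simp add: crs_def)
    hence o2: "h2 < h1" using kappa \<open>nu > 0\<close> by (smt (verit) mult_pos_pos)
    show ?thesis using phi(1) ar g h o1 o2 gh' gh by (intro exI conjI)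
  qed
  obtain phi g1 g2 h1 h2 where phi: "sm_iso phi"
     "arm k (\<lambda>j. phi (L (Suc s + j))) (\<lambda>j. phi (E (Suc s + j)))"
     "phi (E (Suc s)) = (g1, 0, g2)" "phi (E s) = (h1, 0, h2)" "g2 > g1" "h2 < h1"
     "g1 + g2 = 2 * mf (on_side E s mu nu) (E (Suc s))" "h1 + h2 = 2 * mf (on_side E s mu nu) (E s)"
     "g1 * g2 = mf (E (Suc s)) (E (Suc s))" "h1 * h2 = mf (E s) (E s)"
    using build[OF K(1) a(3,5)] by (elim exE conjE) (rule that)
  obtain phi' a1 a2 b1 b2 where phi': "sm_iso phi'"
     "arm k (\<lambda>j. phi' (L' (Suc s + j))) (\<lambda>j. phi' (E' (Suc s + j)))"
     "phi' (E' (Suc s)) = (a1, 0, a2)" "phi' (E' s) = (b1, 0, b2)" "a2 > a1" "b2 < b1"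
     "a1 + a2 = 2 * mf (on_side E' s mu nu) (E' (Suc s))" "b1 + b2 = 2 * mf (on_side E' s mu nu) (E' s)"
     "a1 * a2 = mf (E' (Suc s)) (E' (Suc s))" "b1 * b2 = mf (E' s) (E' s)"
    using build[OF K(2) a(4,6)] by (elim exE conjE) (rule that)
  note l = sm_iso_lin[OF phi(1)] and l' = sm_iso_lin[OF phi'(1)]
  have g: "mf (E i) (E i) = mf (E' i) (E' i)" "mf (E i) (E (Suc i)) = mf (E' i) (E' (Suc i))" for i
    using S by (auto simp: same_link_def)
  have g': "mf (E (Suc i)) (E i) = mf (E' (Suc i)) (E' i)" for i using g(2)[of i] by (simp add: mf_sym)
  have os: "mf (on_side E s mu nu) (E (Suc s)) = mf (on_side E' s mu nu) (E' (Suc s))"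
     "mf (on_side E s mu nu) (E s) = mf (on_side E' s mu nu) (E' s)"
    unfolding on_side_def mf_lin g g' by simp_all
  have e1: "g1 = a1 \<and> g2 = a2"
  proof (rule axis_point_eq)
    show "g1 * g2 = a1 * a2" using phi(9) phi'(9) g(1)[of "Suc s"] by simp
    show "g1 + g2 = a1 + a2" using phi(7) phi'(7) os(1) by simp
    show "0 < (g2 - g1) * (a2 - a1)" using phi(5) phi'(5) by simp
  qed
  have e2: "h1 = b1 \<and> h2 = b2"
  proof (rule axis_point_eq)
    show "h1 * h2 = b1 * b2" using phi(10) phi'(10) g(1)[of s] by simp
    show "h1 + h2 = b1 + b2" using phi(8) phi'(8) os(2) by simp
    show "0 < (h2 - h1) * (b2 - b1)" using phi(6) phi'(6) by (simp add: mult_neg_neg)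
  qed
  have nz: "mf (E i) (E i) = 1 \<and> future (E i) \<or> mf (E i) (E i) = -1" for i using K(1) unfolding link_def by blast
  have ss: "same_sides k (\<lambda>j. phi (E (Suc s + j))) (\<lambda>j. phi' (E' (Suc s + j)))"
    unfolding same_sides_def l(4) l'(4)
  proof (intro conjI allI impI)
    show "mf (E (Suc s + 0)) (E (Suc s + 0)) \<noteq> 0" using nz[of "Suc s + 0"] by auto
    show "\<exists>mu\<ge>0. \<exists>nu\<ge>0. future (mu *\<^sub>R phi (E (Suc s + j)) + nu *\<^sub>R phi (E (Suc s + Suc j))) \<and>
             future (mu *\<^sub>R phi' (E' (Suc s + j)) + nu *\<^sub>R phi' (E' (Suc s + Suc j)))" for j
    proof -
      obtain m q where m: "m > 0" "q > 0" "future (on_side E (Suc s + j) m q)" "future (on_side E' (Suc s + j) m q)"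
        using cut_exists[OF K S] by metis
      have "future (m *\<^sub>R phi (E (Suc s + j)) + q *\<^sub>R phi (E (Suc s + Suc j)))"
        using l(6)[OF m(3)] unfolding on_side_def l(1,2) by simp
      moreover have "future (m *\<^sub>R phi' (E' (Suc s + j)) + q *\<^sub>R phi' (E' (Suc s + Suc j)))"
        using l'(6)[OF m(4)] unfolding on_side_def l'(1,2) by simp
      ultimately show ?thesis using less_imp_le[OF m(1)] less_imp_le[OF m(2)] by blast
    qed
  qed (use g in auto)
  have ga: "gain (\<lambda>j. phi (L (Suc s + j))) (\<lambda>j. phi (E (Suc s + j))) (\<lambda>j. phi' (L' (Suc s + j))) i = gain L E L' (Suc s + i)" for i
    unfolding gain_def l(4) l'(4) by simp
  have per: "L (i + n) = L i" "E (i + n) = E i" "L' (i + n) = L' i" "E' (i + n) = E' i" for i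
    using K unfolding link_def by blast+
  have last: "E (Suc s + Suc k) = E s" "E' (Suc s + Suc k) = E' s" using per(2,4)[of s] k n3 by simp_all
  have "\<forall>i<k. gain (\<lambda>j. phi (L (Suc s + j))) (\<lambda>j. phi (E (Suc s + j))) (\<lambda>j. phi' (L' (Suc s + j))) i = 0"
  proof (rule closed_arm_lemma[OF phi(2) phi'(2) ss])
    show "gain (\<lambda>j. phi (L (Suc s + j))) (\<lambda>j. phi (E (Suc s + j))) (\<lambda>j. phi' (L' (Suc s + j))) i \<ge> 0" for i
      unfolding ga by (rule op)
    show "phi' (E' (Suc s + 0)) = phi (E (Suc s + 0))" using phi(3) phi'(3) e1 by simp
    show "phi' (E' (Suc s + Suc k)) = phi (E (Suc s + Suc k))" unfolding last using phi(4) phi'(4) e2 by simp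
    show "mf (phi (E (Suc s + 0))) (phi (E (Suc s + 0))) = 1 \<and> future (phi (E (Suc s + 0))) \<or> mf (phi (E (Suc s + 0))) (phi (E (Suc s + 0))) = - 1"
      using nz[of "Suc s + 0"] l(6)[of "E (Suc s + 0)"] unfolding l(4) by blast
    show "mf (phi (E (Suc s + Suc k))) (phi (E (Suc s + Suc k))) \<noteq> 0"
      using nz[of "Suc s + Suc k"] unfolding l(4) by auto
  qed
  hence "gain (\<lambda>j. phi (L (Suc s + j))) (\<lambda>j. phi (E (Suc s + j))) (\<lambda>j. phi' (L' (Suc s + j))) 0 = 0" using k by simp
  hence "gain L E L' (Suc s + 0) = 0" using ga[of 0] by (simp only:)
  moreover have "gain L E L' (j + n) = gain L E L' j"
    unfolding gain_def using per(1)[of j] per(1)[of "Suc j"] per(2)[of "Suc j"] per(3)[of j] per(3)[of "Suc j"] by simp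
  moreover have "Suc s + 0 = j + n" using n3 by (simp add: s_def)
  ultimately show ?thesis by simp
qed

text \<open>A nonzero sign pattern on a cycle with fewer than four sign changes is either constant, excluded by
  \<open>no_change\<close>, or has exactly two changes, which is excluded by \<open>two_arcs\<close> with cuts
  on sides between vertices of opposite sign.\<close>

theorem link_sign_changes:
  assumes K: "link n L E" "link n L' E'" and S: "same_link E E'"
    and nz: "gain L E L' j \<noteq> 0"
  shows "\<exists>i1 i2 i3 i4. i1 < i2 \<and> i2 < i3 \<and> i3 < i4 \<and> i4 < n \<and>
    gain L E L' i1 * gain L E L' i2 < 0 \<and> gain L E L' i2 * gain L E L' i3 < 0 \<and> gain L E L' i3 * gain L E L' i4 < 0"
proof -
  have main: "\<exists>i1 i2 i3 i4. i1 < i2 \<and> i2 < i3 \<and> i3 < i4 \<and> i4 < n \<and>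
    gain L E L' i1 * gain L E L' i2 < 0 \<and> gain L E L' i2 * gain L E L' i3 < 0 \<and> gain L E L' i3 * gain L E L' i4 < 0"
    if K: "link n L E" "link n L' E'" and S: "same_link E E'" and f: "i1 < n" "gain L E L' i1 > 0"
      and first: "\<And>i. i < i1 \<Longrightarrow> gain L E L' i = 0" for L E L' E' i1
  proof -
    define g where "g = gain L E L'"
    have n3: "3 \<le> n" using K(1) unfolding link_def by blast
    have per: "g (i + n) = g i" for i
    proof -
      have "L (i + n) = L i" "L (Suc i + n) = L (Suc i)" "E (Suc i + n) = E (Suc i)" "L' (i + n) = L' i" "L' (Suc i + n) = L' (Suc i)"
        using K unfolding link_def by blast+
      thus ?thesis by (simp add: g_def gain_def)
    qed
    have permod: "g i = g (i mod n)" for i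
    proof (induction i rule: less_induct)
      case (less i)
      show ?case
      proof (cases "i < n")
        case False
        hence "g i = g (i - n)" using per[of "i - n"] by simp
        also have "\<dots> = g ((i - n) mod n)" by (rule less) (use False n3 in auto)
        finally show ?thesis using False by (simp add: le_mod_geq)
      qed simp
    qed
    have "\<exists>i. i < n \<and> g i < 0"
    proof (rule ccontr)
      assume "\<not> ?thesis"
      hence "g (i mod n) \<ge> 0" for i using n3 by (metis mod_less_divisor not_less order_less_le_trans zero_less_numeral)
      hence "gain L E L' i \<ge> 0" for i using permod g_def by metis
      from no_change[OF K S this, of i1] f show False by simp
    qed
    then have exn: "\<exists>i. i < n \<and> g i < 0" .
    define i2 where "i2 = (LEAST i. i < n \<and> g i < 0)"
    have i2: "i2 < n" "g i2 < 0" using LeastI_ex[OF exn] by (auto simp: i2_def)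
    have b2: "g i \<ge> 0" if "i < i2" for i
      using not_less_Least[of i "\<lambda>i. i < n \<and> g i < 0"] that i2 unfolding i2_def by auto
    have i12: "i1 < i2" using first[of i2] i2 f unfolding g_def by (metis less_irrefl linorder_neqE_nat less_asym)
    have ex3: "\<exists>i. i2 < i \<and> i < n \<and> g i > 0"
    proof (rule ccontr)
      assume no: "\<not> ?thesis"
      have "\<not> (\<exists>j. 0 \<le> j \<and> j < i2 \<and> gain L E L' j > 0)"
      proof (rule two_arcs[OF K S])
        show "0 < i2" "i2 < 0 + n" using i12 i2 by auto
        show "gain L E L' j \<ge> 0" if "j < i2" for j using b2[OF that] by (simp add: g_def)
        show "gain L E L' j \<le> 0" if "i2 \<le> j" "j < 0 + n" for j
          using no that i2 unfolding g_def by (metis add_0 le_neq_implies_less less_imp_le not_less)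
      qed
      thus False using i12 f by auto
    qed
    define i3 where "i3 = (LEAST i. i2 < i \<and> i < n \<and> g i > 0)"
    have i3: "i2 < i3" "i3 < n" "g i3 > 0" using LeastI_ex[OF ex3] by (auto simp: i3_def)
    have b3: "g i \<le> 0" if "i2 \<le> i" "i < i3" for i
      using not_less_Least[of i "\<lambda>i. i2 < i \<and> i < n \<and> g i > 0"] that i2 i3 unfolding i3_def
      by (metis le_neq_implies_less less_imp_le less_trans not_less)
    have "\<exists>i. i3 < i \<and> i < n \<and> g i < 0"
    proof (rule ccontr)
      assume no: "\<not> ?thesis"
      have "\<not> (\<exists>j. i3 \<le> j \<and> j < i2 + n \<and> gain L E L' j > 0)"
      proof (rule two_arcs[OF K S])
        show "i3 < i2 + n" "i2 + n < i3 + n" using i3 by auto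
        show "gain L E L' j \<ge> 0" if "i3 \<le> j" "j < i2 + n" for j
        proof (cases "j < n")
          case True
          thus ?thesis using no that i3 unfolding g_def by (metis le_neq_implies_less less_imp_le not_less)
        next
          case False
          hence "g j = g (j - n)" using per[of "j - n"] by simp
          thus ?thesis using b2[of "j - n"] that False unfolding g_def by simp
        qed
        show "gain L E L' j \<le> 0" if "i2 + n \<le> j" "j < i3 + n" for j
        proof -
          have "g j = g (j - n)" using per[of "j - n"] that by simp
          thus ?thesis using b3[of "j - n"] that unfolding g_def by simp
        qed
      qed
      moreover have "i3 \<le> i3 \<and> i3 < i2 + n \<and> gain L E L' i3 > 0" using i3 g_def by simp
      ultimately show False by blast
    qed
    then obtain i4 where i4: "i3 < i4" "i4 < n" "g i4 < 0" by blast
    show ?thesis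
      by (rule exI[of _ i1], rule exI[of _ i2], rule exI[of _ i3], rule exI[of _ i4])
         (use i12 i2 i3 i4 f g_def in \<open>auto simp: mult_pos_neg mult_neg_pos\<close>)
  qed
  define g where "g = gain L E L'"
  have n3: "3 \<le> n" using K(1) unfolding link_def by blast
  have per: "g (i + n) = g i" for i
  proof -
    have "L (i + n) = L i" "L (Suc i + n) = L (Suc i)" "E (Suc i + n) = E (Suc i)" "L' (i + n) = L' i" "L' (Suc i + n) = L' (Suc i)"
      using K unfolding link_def by blast+
    thus ?thesis by (simp add: g_def gain_def)
  qed
  have "\<exists>i<n. g i \<noteq> 0"
  proof (rule ccontr)
    assume no: "\<not> ?thesis"
    have "g i = 0" for i
    proof (induction i rule: less_induct)
      case (less i)
      show ?case
      proof (cases "i < n")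
        case False
        hence "g i = g (i - n)" using per[of "i - n"] by simp
        also have "\<dots> = 0" by (rule less) (use False n3 in auto)
        finally show ?thesis .
      qed (use no in auto)
    qed
    thus False using nz g_def by simp
  qed
  hence ex: "\<exists>i. i < n \<and> g i \<noteq> 0" by blast
  define i1 where "i1 = (LEAST i. i < n \<and> g i \<noteq> 0)"
  have i1: "i1 < n" "g i1 \<noteq> 0" using LeastI_ex[OF ex] by (auto simp: i1_def)
  have first: "g i = 0" if "i < i1" for i
    using not_less_Least[of i "\<lambda>i. i < n \<and> g i \<noteq> 0"] that i1 unfolding i1_def by auto
  show ?thesis
  proof (cases "g i1 > 0")
    case True
    show ?thesis by (rule main[OF K S i1(1)]) (use True first g_def in auto)
  next
    case False
    have sw: "gain L' E' L i = - g i" for i unfolding g_def by (rule gain_swap[OF S])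
    have "\<exists>i1 i2 i3 i4. i1 < i2 \<and> i2 < i3 \<and> i3 < i4 \<and> i4 < n \<and>
      gain L' E' L i1 * gain L' E' L i2 < 0 \<and> gain L' E' L i2 * gain L' E' L i3 < 0 \<and> gain L' E' L i3 * gain L' E' L i4 < 0"
      by (rule main[OF K(2,1) same_link_sym[OF S] i1(1)]) (use False i1 first in \<open>auto simp: sw\<close>)
    thus ?thesis unfolding sw g_def by simp
  qed
qed

section \<open>Spherical polyhedra as permutations of darts\<close>

definition sdiff :: "'a set \<Rightarrow> 'a set \<Rightarrow> 'a set" where
  "sdiff A B = (A - B) \<union> (B - A)"

lemma sdiff_iff: "x \<in> sdiff A B \<longleftrightarrow> (x \<in> A) \<noteq> (x \<in> B)" by (auto simp: sdiff_def)

lemma sdiff_cancel: "sdiff (sdiff A B) B = A" by (auto simp: sdiff_def)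

lemma odd_card_sdiff:
  assumes "finite A" "finite B"
  shows "odd (card (sdiff A B)) \<longleftrightarrow> odd (card A) \<noteq> odd (card B)"
proof -
  have 1: "card (sdiff A B) = card (A - B) + card (B - A)"
    unfolding sdiff_def using assms by (intro card_Un_disjoint) auto
  have 2: "card A = card (A \<inter> B) + card (A - B)" "card B = card (A \<inter> B) + card (B - A)"
    using card_Int_Diff[OF assms(1), of B] card_Int_Diff[OF assms(2), of A] by (simp_all add: Int_commute)
  show ?thesis unfolding 1 2 by presburger
qed

lemma card_changes_even:
  fixes t :: "'a \<Rightarrow> bool"
  assumes "finite A" "bij_betw \<pi> A A"
  shows "even (card {d \<in> A. t d \<noteq> t (\<pi> d)})"
proof -
  let ?B = "{d \<in> A. t d}" and ?C = "{d \<in> A. t (\<pi> d)}"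
  have im: "\<pi> ` A = A" and inj: "inj_on \<pi> A" using assms(2) by (auto simp: bij_betw_def)
  have "\<pi> ` ?C = ?B"
  proof (intro equalityI subsetI)
    fix x assume "x \<in> \<pi> ` ?C"
    thus "x \<in> ?B" using im by auto
  next
    fix x assume x: "x \<in> ?B"
    hence "x \<in> \<pi> ` A" using im by simp
    then obtain d where "d \<in> A" "x = \<pi> d" by (rule imageE)
    thus "x \<in> \<pi> ` ?C" using x by simp
  qed
  moreover have "inj_on \<pi> ?C" by (rule inj_on_subset[OF inj]) auto
  ultimately have "card ?C = card ?B" using card_image[of \<pi> ?C] by simp
  moreover have "{d \<in> A. t d \<noteq> t (\<pi> d)} = sdiff ?B ?C" by (auto simp: sdiff_def)
  ultimately show ?thesis using odd_card_sdiff[of ?B ?C] assms(1) by auto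
qed

text \<open>Rank and nullity over the field with two elements, for the vector space of subsets with symmetric
  difference.\<close>

lemma card_kernel_image:
  assumes X: "finite X" and h: "\<And>S T. S \<subseteq> X \<Longrightarrow> T \<subseteq> X \<Longrightarrow> h (sdiff S T) = sdiff (h S) (h T)"
  shows "2 ^ card X = card {S \<in> Pow X. h S = {}} * card (h ` Pow X)"
proof -
  let ?K = "{S \<in> Pow X. h S = {}}"
  let ?F = "\<lambda>y. {S \<in> Pow X. h S = y}"
  have fib: "card (?F y) = card ?K" if y: "y \<in> h ` Pow X" for y
  proof -
    obtain S0 where S0: "S0 \<subseteq> X" "h S0 = y" using y by auto
    have "bij_betw (\<lambda>S. sdiff S S0) ?K (?F y)"
    proof (rule bij_betwI[where g = "\<lambda>S. sdiff S S0"])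
      show "(\<lambda>S. sdiff S S0) \<in> ?K \<rightarrow> ?F y"
      proof
        fix S assume S: "S \<in> ?K"
        have "h (sdiff S S0) = y" using h[of S S0] S S0 by (auto simp: sdiff_def)
        thus "sdiff S S0 \<in> ?F y" using S S0 by (auto simp: sdiff_def)
      qed
      show "(\<lambda>S. sdiff S S0) \<in> ?F y \<rightarrow> ?K"
      proof
        fix S assume S: "S \<in> ?F y"
        have "h (sdiff S S0) = {}" using h[of S S0] S S0 by (auto simp: sdiff_def)
        thus "sdiff S S0 \<in> ?K" using S S0 by (auto simp: sdiff_def)
      qed
      show "sdiff (sdiff S S0) S0 = S" for S by (rule sdiff_cancel)
      show "sdiff (sdiff S S0) S0 = S" for S by (rule sdiff_cancel)
    qed
    thus ?thesis using bij_betw_same_card by fastforce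
  qed
  have "2 ^ card X = card (Pow X)" using X by (simp add: card_Pow)
  also have "Pow X = (\<Union>y\<in>h ` Pow X. ?F y)" by auto
  also have "card \<dots> = (\<Sum>y\<in>h ` Pow X. card (?F y))"
    using X by (intro card_UN_disjoint) auto
  also have "\<dots> = (\<Sum>y\<in>h ` Pow X. card ?K)" using fib by simp
  finally show ?thesis by simp
qed

locale finite_perm =
  fixes \<sigma> :: "'d \<Rightarrow> 'd" and D :: "'d set"
  assumes fin: "finite D" and bij: "bij_betw \<sigma> D D"
begin

lemma pow_in: "d \<in> D \<Longrightarrow> (\<sigma> ^^ k) d \<in> D"
  using bij by (induction k) (auto simp: bij_betw_def)

lemma pow_inj: "d \<in> D \<Longrightarrow> e \<in> D \<Longrightarrow> (\<sigma> ^^ k) d = (\<sigma> ^^ k) e \<Longrightarrow> d = e"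
proof (induction k)
  case (Suc k)
  hence "(\<sigma> ^^ k) d = (\<sigma> ^^ k) e"
    using bij pow_in unfolding bij_betw_def inj_on_def by (metis comp_apply funpow.simps(2))
  thus ?case using Suc by blast
qed simp

lemma period: "d \<in> D \<Longrightarrow> \<exists>k>0. (\<sigma> ^^ k) d = d"
proof -
  assume d: "d \<in> D"
  have "\<not> inj_on (\<lambda>k. (\<sigma> ^^ k) d) {..card D}"
  proof
    assume "inj_on (\<lambda>k. (\<sigma> ^^ k) d) {..card D}"
    hence "card {..card D} \<le> card D" using pow_in[OF d] fin by (intro card_inj_on_le[of _ _ D]) auto
    thus False by simp
  qed
  then obtain i j where "i < j" "(\<sigma> ^^ i) d = (\<sigma> ^^ j) d"
    unfolding inj_on_def by (metis linorder_neqE_nat)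
  hence "(\<sigma> ^^ i) d = (\<sigma> ^^ i) ((\<sigma> ^^ (j - i)) d)"
    by (metis comp_apply funpow_add le_add_diff_inverse less_imp_le)
  hence "(\<sigma> ^^ (j - i)) d = d" using pow_inj[OF d pow_in[OF d]] by metis
  thus ?thesis using \<open>i < j\<close> by (intro exI[of _ "j - i"]) auto
qed

text \<open>The first return map of a permutation to a subset: it skips the darts with zero label when running
  around a vertex.\<close>

definition ret_time :: "'d set \<Rightarrow> 'd \<Rightarrow> nat" where
  "ret_time N d = (LEAST k. 0 < k \<and> (\<sigma> ^^ k) d \<in> N)"

definition ret :: "'d set \<Rightarrow> 'd \<Rightarrow> 'd" where
  "ret N d = (\<sigma> ^^ ret_time N d) d"

lemma ret_time:
  assumes "N \<subseteq> D" "d \<in> N"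
  shows "0 < ret_time N d" "ret N d \<in> N" "\<And>k. 0 < k \<Longrightarrow> k < ret_time N d \<Longrightarrow> (\<sigma> ^^ k) d \<notin> N"
proof -
  have ex: "\<exists>k. 0 < k \<and> (\<sigma> ^^ k) d \<in> N" using period[of d] assms by (metis subsetD)
  show "0 < ret_time N d" "ret N d \<in> N" using LeastI_ex[OF ex] by (auto simp: ret_time_def ret_def)
  show "\<And>k. 0 < k \<Longrightarrow> k < ret_time N d \<Longrightarrow> (\<sigma> ^^ k) d \<notin> N"
    using not_less_Least unfolding ret_time_def by blast
qed

lemma ret_bij:
  assumes N: "N \<subseteq> D"
  shows "bij_betw (ret N) N N"
proof -
  have key: "d = e" if de: "d \<in> N" "e \<in> N" "ret N d = ret N e" "ret_time N d \<le> ret_time N e" for d e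
  proof -
    let ?a = "ret_time N d" and ?b = "ret_time N e"
    have "(\<sigma> ^^ ?a) d = (\<sigma> ^^ ?a) ((\<sigma> ^^ (?b - ?a)) e)"
      using de by (metis comp_apply funpow_add le_add_diff_inverse ret_def)
    hence d: "d = (\<sigma> ^^ (?b - ?a)) e" using pow_inj pow_in de N by (metis subsetD)
    have "?b - ?a = 0"
    proof (rule ccontr)
      assume "?b - ?a \<noteq> 0"
      moreover have "?b - ?a < ?b" using ret_time(1)[OF N de(1)] ret_time(1)[OF N de(2)] by simp
      ultimately show False using ret_time(3)[OF N de(2)] d de(1) by (metis neq0_conv)
    qed
    thus ?thesis using d by simp
  qed
  have inj: "inj_on (ret N) N"
    unfolding inj_on_def using key by (metis nat_le_linear)
  have "ret N ` N \<subseteq> N" using ret_time(2)[OF N] by auto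
  moreover have "finite N" using fin N finite_subset by blast
  ultimately show ?thesis using inj by (metis bij_betw_def endo_inj_surj)
qed

end

lemma consecutive_next_unique:
  assumes "distinct f" "consecutive f u v" "consecutive f u w"
  shows "v = w"
  using assms unfolding consecutive_def by (metis nth_eq_iff_index_eq)

lemma consecutive_prev_unique:
  assumes "distinct f" "consecutive f u v" "consecutive f w v"
  shows "u = w"
proof -
  obtain i j where ij: "i < length f" "u = f ! i" "v = f ! (Suc i mod length f)"
      "j < length f" "w = f ! j" "v = f ! (Suc j mod length f)"
    using assms unfolding consecutive_def by blast
  have "Suc i mod length f < length f" "Suc j mod length f < length f" using ij by (metis mod_less_divisor gr_implies_not0 neq0_conv)+
  hence "Suc i mod length f = Suc j mod length f" using ij assms(1) nth_eq_iff_index_eq by metis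
  hence "i = j" using ij by (auto simp: mod_Suc split: if_splits)
  thus ?thesis using ij by simp
qed

lemma consecutive_in_set: "consecutive f u v \<Longrightarrow> u \<in> set f \<and> v \<in> set f"
  unfolding consecutive_def by (metis mod_less_divisor nth_mem gr_implies_not0 neq0_conv)

lemma consecutive_ex: "u \<in> set f \<Longrightarrow> (\<exists>v. consecutive f u v) \<and> (\<exists>v. consecutive f v u)"
proof
  assume "u \<in> set f"
  then obtain i where i: "i < length f" "u = f ! i" by (metis in_set_conv_nth)
  thus "\<exists>v. consecutive f u v" unfolding consecutive_def by blast
  define j where "j = (i + length f - 1) mod length f"
  have "j < length f" using i unfolding j_def by (intro mod_less_divisor) auto
  moreover have "Suc j mod length f = i"
  proof -
    have "Suc j mod length f = Suc (i + length f - 1) mod length f" unfolding j_def by (rule mod_Suc_eq)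
    also have "Suc (i + length f - 1) = i + length f" using i by linarith
    finally show ?thesis using i by simp
  qed
  ultimately show "\<exists>v. consecutive f v u" unfolding consecutive_def using i by metis
qed

locale polyhedron =
  fixes P :: "'v polyhedron"
  assumes sph: "spherical_polyhedron P"
begin

abbreviation D :: "('v \<times> 'v) set" where "D \<equiv> darts P"

abbreviation V :: "'v set" where "V \<equiv> vertex_set P"

lemmas sphD = sph[unfolded spherical_polyhedron_def]

lemma finP: "finite P" using sphD by (elim conjE) assumption
lemma face_all: "\<forall>f\<in>P. 3 \<le> length f \<and> distinct f" using sphD by (elim conjE) assumption
lemma left_all: "\<forall>f\<in>P. \<forall>g\<in>P. \<forall>u v. consecutive f u v \<and> consecutive g u v \<longrightarrow> f = g"
  using sphD by (elim conjE) assumption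
lemma sym_all: "\<forall>u v. (u, v) \<in> D \<longrightarrow> (v, u) \<in> D" using sphD by (elim conjE) assumption
lemma cycle_all: "\<forall>v\<in>V. \<exists>fs. face_cycle P v fs" using sphD by (elim conjE) assumption
lemma connected_all: "\<forall>u\<in>V. \<forall>v\<in>V. (u, v) \<in> D\<^sup>*" using sphD by (elim conjE) assumption
lemma euler: "int (card V) - int (card (edges P)) + int (card P) = 2" using sphD by (elim conjE) assumption


lemma face: "f \<in> P \<Longrightarrow> 3 \<le> length f \<and> distinct f" using face_all by (rule bspec)

lemma left_unique: "f \<in> P \<Longrightarrow> g \<in> P \<Longrightarrow> consecutive f u v \<Longrightarrow> consecutive g u v \<Longrightarrow> f = g"
  using left_all by meson

lemma darts_sym: "(u, v) \<in> D \<Longrightarrow> (v, u) \<in> D" using sym_all by meson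

lemma finV: "finite V" using finP by (auto simp: vertex_set_def)

lemma darts_V: "(u, v) \<in> D \<Longrightarrow> u \<in> V \<and> v \<in> V"
  unfolding darts_def vertex_set_def using consecutive_in_set by fastforce

lemma finD: "finite D"
  by (rule finite_subset[of _ "V \<times> V"]) (use darts_V finV in auto)

lemma no_loop: "(u, v) \<in> D \<Longrightarrow> u \<noteq> v"
proof
  assume "(u, v) \<in> D" "u = v"
  then obtain f i where f: "f \<in> P" "i < length f" "f ! i = f ! (Suc i mod length f)"
    unfolding darts_def consecutive_def by auto
  have "Suc i mod length f < length f" using f by (intro mod_less_divisor) auto
  hence "i = Suc i mod length f" using f face nth_eq_iff_index_eq by metis
  thus False using f face[of f] by (auto simp: mod_Suc split: if_splits)
qed

text \<open>The face on the left of a dart; by the gluing axiom there is exactly one.\<close>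

definition lf :: "'v \<times> 'v \<Rightarrow> 'v list" where
  "lf d = (THE f. f \<in> P \<and> consecutive f (fst d) (snd d))"

lemma lf: "d \<in> D \<Longrightarrow> lf d \<in> P \<and> consecutive (lf d) (fst d) (snd d)"
proof -
  assume "d \<in> D"
  then obtain f where f: "f \<in> P \<and> consecutive f (fst d) (snd d)" unfolding darts_def by auto
  show ?thesis unfolding lf_def
    by (rule theI[of _ f], rule f) (use f left_unique in blast)
qed

lemma lf_eq: "f \<in> P \<Longrightarrow> consecutive f u v \<Longrightarrow> lf (u, v) = f"
  using lf[of "(u, v)"] left_unique unfolding darts_def by auto

lemma dart_of_face: "f \<in> P \<Longrightarrow> consecutive f u v \<Longrightarrow> (u, v) \<in> D"
  unfolding darts_def by blast

definition rv :: "'v \<times> 'v \<Rightarrow> 'v \<times> 'v" where "rv d = (snd d, fst d)"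

lemma rv_simps [simp]: "rv (rv d) = d" "fst (rv d) = snd d" "snd (rv d) = fst d" "rv (u, v) = (v, u)"
  by (auto simp: rv_def)

lemma rv_in: "d \<in> D \<Longrightarrow> rv d \<in> D" using darts_sym[of "fst d" "snd d"] by (simp add: rv_def)

text \<open>The next dart at the same vertex in positive direction.\<close>

definition rot :: "'v \<times> 'v \<Rightarrow> 'v \<times> 'v" where
  "rot d = (fst d, THE x. consecutive (lf d) x (fst d))"

lemma rot:
  assumes "d \<in> D"
  shows "rot d \<in> D" "fst (rot d) = fst d" "lf (rv (rot d)) = lf d" "consecutive (lf d) (snd (rot d)) (fst d)"
proof -
  have l: "lf d \<in> P" "consecutive (lf d) (fst d) (snd d)" using lf[OF assms] by auto
  hence "fst d \<in> set (lf d)" using consecutive_in_set by fast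
  then obtain x where x: "consecutive (lf d) x (fst d)" using consecutive_ex by metis
  hence "(THE x. consecutive (lf d) x (fst d)) = x"
    by (rule the_equality) (use consecutive_prev_unique face[OF l(1)] x in metis)
  hence r: "rot d = (fst d, x)" by (simp add: rot_def)
  show "rot d \<in> D" unfolding r using darts_sym dart_of_face[OF l(1) x] by blast
  show "fst (rot d) = fst d" by (simp add: r)
  show "lf (rv (rot d)) = lf d" unfolding r using lf_eq[OF l(1) x] by simp
  show "consecutive (lf d) (snd (rot d)) (fst d)" using r x by simp
qed

lemma rot_inj: "inj_on rot D"
proof
  fix d e assume de: "d \<in> D" "e \<in> D" "rot d = rot e"
  have "lf d = lf e" using rot(3)[OF de(1)] rot(3)[OF de(2)] de(3) by simp
  moreover have f: "fst d = fst e" using rot(2)[OF de(1)] rot(2)[OF de(2)] de(3) by simp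
  ultimately have "snd d = snd e"
    using lf[OF de(1)] lf[OF de(2)] face consecutive_next_unique by metis
  thus "d = e" using f by (simp add: prod_eq_iff)
qed

lemma rot_bij: "bij_betw rot D D"
  using rot_inj rot(1) finD endo_inj_surj[of D rot] unfolding bij_betw_def by blast

sublocale finite_perm rot D
  using finD rot_bij by unfold_locales

lemma fst_pow: "d \<in> D \<Longrightarrow> fst ((rot ^^ k) d) = fst d"
  by (induction k) (auto simp: rot(2)[OF pow_in])

text \<open>A face cycle at a vertex is the same as an orbit of \<open>rot\<close>: the neighbours \<open>w
  i\<close> separate consecutive faces.\<close>

lemma star:
  assumes v: "v \<in> V"
  obtains fs w where "face_cycle P v fs" "0 < length fs"
    "\<And>i. i < length fs \<Longrightarrow> consecutive (fs ! i) (w i) v \<and> consecutive (fs ! (Suc i mod length fs)) v (w i)"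
    "\<And>i. i < length fs \<Longrightarrow> (v, w i) \<in> D \<and> rot (v, w i) = (v, w (Suc i mod length fs)) \<and> lf (v, w i) = fs ! (Suc i mod length fs)"
    "\<And>x. (v, x) \<in> D \<Longrightarrow> \<exists>i<length fs. x = w i"
    "inj_on w {..<length fs}"
proof -
  obtain fs where fc: "face_cycle P v fs" using cycle_all v by meson
  have dist: "distinct fs" and sfs: "set fs = {f \<in> P. v \<in> set f}" using fc by (auto simp: face_cycle_def)
  have "\<forall>i<length fs. \<exists>w. consecutive (fs ! i) w v \<and> consecutive (fs ! (Suc i mod length fs)) v w"
    using fc unfolding face_cycle_def by blast
  then obtain w where w: "\<And>i. i < length fs \<Longrightarrow> consecutive (fs ! i) (w i) v \<and> consecutive (fs ! (Suc i mod length fs)) v (w i)"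
    by metis
  have pos: "0 < length fs" using v sfs by (auto simp: vertex_set_def)
  have inP: "fs ! i \<in> P" if "i < length fs" for i using sfs nth_mem[OF that] by blast
  have md: "Suc i mod length fs < length fs" for i using pos by simp
  have l: "lf (v, w i) = fs ! (Suc i mod length fs)" "(v, w i) \<in> D" if "i < length fs" for i
    using w[OF that] inP[OF md] lf_eq dart_of_face by blast+
  have r: "rot (v, w i) = (v, w (Suc i mod length fs))" if i: "i < length fs" for i
  proof -
    have "consecutive (fs ! (Suc i mod length fs)) (snd (rot (v, w i))) v" using rot(4)[OF l(2)[OF i]] l(1)[OF i] by simp
    hence "snd (rot (v, w i)) = w (Suc i mod length fs)"
      using w[OF md] face[OF inP[OF md]] consecutive_prev_unique by metis
    thus ?thesis using rot(2)[OF l(2)[OF i]] by (simp add: prod_eq_iff)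
  qed
  have all: "\<exists>i<length fs. x = w i" if x: "(v, x) \<in> D" for x
  proof -
    have "lf (v, x) \<in> set fs" using lf[OF x] sfs consecutive_in_set by fastforce
    then obtain j where j: "j < length fs" "lf (v, x) = fs ! j" by (metis in_set_conv_nth)
    define i where "i = (j + length fs - 1) mod length fs"
    have i: "i < length fs" using pos by (simp add: i_def)
    have "Suc i mod length fs = Suc (j + length fs - 1) mod length fs" unfolding i_def by (rule mod_Suc_eq)
    also have "Suc (j + length fs - 1) = j + length fs" using j by linarith
    finally have "Suc i mod length fs = j" using j by simp
    hence "consecutive (fs ! j) v (w i)" using w[OF i] by simp
    moreover have "consecutive (fs ! j) v x" using lf[OF x] j by simp
    ultimately have "x = w i" using consecutive_next_unique face[OF inP[OF j(1)]] by metis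
    thus ?thesis using i by blast
  qed
  have inj: "inj_on w {..<length fs}"
  proof
    fix i j assume ij: "i \<in> {..<length fs}" "j \<in> {..<length fs}" "w i = w j"
    hence "fs ! (Suc i mod length fs) = fs ! (Suc j mod length fs)" using l by (metis lessThan_iff)
    hence "Suc i mod length fs = Suc j mod length fs" using dist md nth_eq_iff_index_eq by metis
    thus "i = j" using ij by (auto simp: mod_Suc split: if_splits)
  qed
  show ?thesis using that[OF fc pos] w l r all inj by blast
qed

lemma rot_transitive:
  assumes "(v, x) \<in> D" "(v, y) \<in> D"
  shows "\<exists>k. (rot ^^ k) (v, x) = (v, y)"
proof -
  have v: "v \<in> V" using assms darts_V by blast
  show ?thesis
  proof (rule star[OF v])
    fix fs w
    assume s1: "0 < length fs" and
      s2': "\<And>i. i < length fs \<Longrightarrow> (v, w i) \<in> D \<and> rot (v, w i) = (v, w (Suc i mod length fs)) \<and> lf (v, w i) = fs ! (Suc i mod length fs)" and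
      s3: "\<And>x. (v, x) \<in> D \<Longrightarrow> \<exists>i<length fs. x = w i"
    have s2: "\<And>i. i < length fs \<Longrightarrow> rot (v, w i) = (v, w (Suc i mod length fs))" using s2' by blast
    note s = s1 s2 s3
    have it: "(rot ^^ k) (v, w i) = (v, w ((i + k) mod length fs))" if i: "i < length fs" for i k
    proof (induction k)
      case (Suc k)
      thus ?case using s(2)[of "(i + k) mod length fs"] s(1) by (simp add: mod_Suc_eq)
    qed (use i in simp)
    obtain i j where ij: "i < length fs" "x = w i" "j < length fs" "y = w j" using s(3) assms by metis
    have "(i + (j + length fs - i)) mod length fs = j" using ij by simp
    thus ?thesis using it[OF ij(1), of "j + length fs - i"] ij by metis
  qed
qed

lemma V_D: "v \<in> V \<Longrightarrow> \<exists>x. (v, x) \<in> D"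
  unfolding vertex_set_def using consecutive_ex dart_of_face by fast

text \<open>Faces around a vertex are connected through its edges, and vertices are connected through edges, so
  a set of faces closed under crossing edges is everything.\<close>

lemma faces_connected:
  assumes A: "A \<subseteq> P" "A \<noteq> {}" and cl: "\<And>d. d \<in> D \<Longrightarrow> lf d \<in> A \<Longrightarrow> lf (rv d) \<in> A"
  shows "A = P"
proof -
  have around: "lf (v, y) \<in> A" if "(v, x) \<in> D" "(v, y) \<in> D" "lf (v, x) \<in> A" for v x y
  proof -
    have "\<exists>k. (rot ^^ k) (v, x) = (v, y)" by (rule rot_transitive[OF that(1,2)])
    then obtain k where k: "(rot ^^ k) (v, x) = (v, y)" ..
    have "lf ((rot ^^ j) (v, x)) \<in> A" for j
    proof (induction j)
      case (Suc j)
      let ?d = "(rot ^^ j) (v, x)"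
      have d: "?d \<in> D" using pow_in that by blast
      have "lf (rv (rot ?d)) \<in> A" using rot(3)[OF d] Suc by simp
      hence "lf (rv (rv (rot ?d))) \<in> A" using cl[of "rv (rot ?d)"] rot(1)[OF d] rv_in by simp
      thus ?case by simp
    qed (use that in simp)
    thus ?thesis using k by metis
  qed
  have around_f: "f \<in> A" if "f \<in> P" "v \<in> set f" "(v, x) \<in> D" "lf (v, x) \<in> A" for f v x
  proof -
    obtain y where y: "consecutive f v y" using consecutive_ex \<open>v \<in> set f\<close> by metis
    thus ?thesis using around[OF that(3) dart_of_face[OF that(1) y] that(4)] lf_eq[OF that(1) y] by simp
  qed
  obtain f0 where f0: "f0 \<in> A" "f0 \<in> P" using A by blast
  obtain u0 where u0: "u0 \<in> set f0" using face[OF f0(2)] by (cases f0) auto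
  have u0V: "u0 \<in> V" using u0 f0 by (auto simp: vertex_set_def)
  obtain x0 where x0: "consecutive f0 u0 x0" using consecutive_ex u0 by metis
  have reach: "(u0, v) \<in> D\<^sup>* \<Longrightarrow> (\<forall>x. (v, x) \<in> D \<longrightarrow> lf (v, x) \<in> A)" for v
  proof (induction rule: rtrancl_induct)
    case base
    show ?case using around[OF dart_of_face[OF f0(2) x0]] lf_eq[OF f0(2) x0] f0 by blast
  next
    case (step y z)
    have l: "lf (y, z) \<in> A" using step by blast
    have "lf (y, z) \<in> P" "z \<in> set (lf (y, z))" using lf[OF step(2)] consecutive_in_set by fastforce+
    then obtain x' where x': "consecutive (lf (y, z)) z x'" using consecutive_ex by metis
    have "lf (z, x') = lf (y, z)" using lf_eq x' \<open>lf (y, z) \<in> P\<close> by blast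
    thus ?case using around[OF dart_of_face[OF _ x']] l \<open>lf (y, z) \<in> P\<close> by metis
  qed
  have "f \<in> A" if f: "f \<in> P" for f
  proof -
    obtain v where v: "v \<in> set f" using face[OF f] by (cases f) auto
    hence vV: "v \<in> V" using f by (auto simp: vertex_set_def)
    have "(u0, v) \<in> D\<^sup>*" using connected_all u0V vV by meson
    moreover obtain x where "(v, x) \<in> D" using V_D[OF vV] by blast
    ultimately show ?thesis using reach around_f[OF f v] by blast
  qed
  thus ?thesis using A by blast
qed

end

section \<open>Cauchy's counting argument\<close>

context polyhedron
begin

definition edge :: "'v \<times> 'v \<Rightarrow> 'v set" where "edge d = {fst d, snd d}"

lemma edge_rv [simp]: "edge (rv d) = edge d" by (auto simp: edge_def rv_def)

lemma edge_eq: "edge d = edge e \<longleftrightarrow> e = d \<or> e = rv d"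
  by (auto simp: edge_def rv_def doubleton_eq_iff prod_eq_iff)

lemma edges_image: "edges P = edge ` D"
  by (auto simp: edges_def edge_def image_iff) (metis fst_conv snd_conv)+

lemma finE: "finite (edges P)" using finD by (simp add: edges_image)

text \<open>The boundary of a set of faces modulo 2.\<close>

definition bd :: "'v list set \<Rightarrow> 'v set set" where
  "bd A = edge ` {d \<in> D. (lf d \<in> A) \<noteq> (lf (rv d) \<in> A)}"

lemma bd_iff: "d \<in> D \<Longrightarrow> edge d \<in> bd A \<longleftrightarrow> (lf d \<in> A) \<noteq> (lf (rv d) \<in> A)"
proof
  assume d: "d \<in> D" and "edge d \<in> bd A"
  then obtain d' where d': "d' \<in> D" "(lf d' \<in> A) \<noteq> (lf (rv d') \<in> A)" "edge d = edge d'" unfolding bd_def by blast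
  hence "d' = d \<or> d' = rv d" using edge_eq by blast
  thus "(lf d \<in> A) \<noteq> (lf (rv d) \<in> A)"
  proof
    assume "d' = rv d"
    thus ?thesis using d'(2) by simp
  qed (use d' in simp)
next
  assume "d \<in> D" "(lf d \<in> A) \<noteq> (lf (rv d) \<in> A)"
  thus "edge d \<in> bd A" unfolding bd_def by blast
qed

lemma bd_sub: "bd A \<subseteq> edges P" by (auto simp: bd_def edges_image)

text \<open>The boundary of a set of edges modulo 2.\<close>

definition oddv :: "'v set set \<Rightarrow> 'v set" where
  "oddv S = {v \<in> V. odd (card {e \<in> S. v \<in> e})}"

lemma oddv_sdiff:
  assumes "S \<subseteq> edges P" "T \<subseteq> edges P"
  shows "oddv (sdiff S T) = sdiff (oddv S) (oddv T)"
proof -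
  have "finite S" "finite T" using assms finE finite_subset by blast+
  have par: "odd (card {e \<in> sdiff S T. v \<in> e}) \<longleftrightarrow> odd (card {e \<in> S. v \<in> e}) \<noteq> odd (card {e \<in> T. v \<in> e})" for v
  proof -
    have eq: "{e \<in> sdiff S T. v \<in> e} = sdiff {e \<in> S. v \<in> e} {e \<in> T. v \<in> e}" by (auto simp: sdiff_def)
    have "finite {e \<in> S. v \<in> e}" "finite {e \<in> T. v \<in> e}"
      using \<open>finite S\<close> \<open>finite T\<close> by (auto intro: rev_finite_subset)
    thus ?thesis unfolding eq by (rule odd_card_sdiff)
  qed
  show ?thesis
  proof (intro set_eqI)
    show "v \<in> oddv (sdiff S T) \<longleftrightarrow> v \<in> sdiff (oddv S) (oddv T)" for v
    proof -
      have od: "v \<in> oddv X \<longleftrightarrow> v \<in> V \<and> odd (card {e \<in> X. v \<in> e})" for X by (simp add: oddv_def)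
      show ?thesis unfolding sdiff_iff[of v "oddv S" "oddv T"] od using par[of v] by blast
    qed
  qed
qed

lemma star_perm: "bij_betw rot {d \<in> D. fst d = v} {d \<in> D. fst d = v}"
proof -
  have "rot ` {d \<in> D. fst d = v} \<subseteq> {d \<in> D. fst d = v}" using rot by auto
  moreover have "inj_on rot {d \<in> D. fst d = v}" using rot_inj by (rule inj_on_subset) auto
  ultimately show ?thesis using finD endo_inj_surj[of "{d \<in> D. fst d = v}" rot] by (auto simp: bij_betw_def)
qed

text \<open>Running around a vertex, the membership in \<open>A\<close> changes an even number of times.\<close>

lemma oddv_bd: "oddv (bd A) = {}"
proof -
  have "even (card {e \<in> bd A. v \<in> e})" for v
  proof -
    let ?S = "{d \<in> D. fst d = v}"
    let ?C = "{d \<in> ?S. (lf d \<in> A) \<noteq> (lf (rot d) \<in> A)}"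
    have "bij_betw (\<lambda>d. edge (rot d)) ?C {e \<in> bd A. v \<in> e}"
      unfolding bij_betw_def
    proof
      show "inj_on (\<lambda>d. edge (rot d)) ?C"
      proof
        fix d e assume de: "d \<in> ?C" "e \<in> ?C" "edge (rot d) = edge (rot e)"
        have "rot e = rot d"
        proof (rule ccontr)
          assume "rot e \<noteq> rot d"
          hence "rot e = rv (rot d)" using de(3) edge_eq by metis
          hence "fst (rot e) = snd (rot d)" by simp
          hence "fst (rot d) = snd (rot d)" using de rot(2) by auto
          moreover have "d \<in> D" using de(1) by simp
          ultimately show False
            using no_loop[of "fst (rot d)" "snd (rot d)", unfolded prod.collapse, OF rot(1)] by blast
        qed
        thus "d = e" using rot_inj de by (auto simp: inj_on_def)
      qed
      show "(\<lambda>d. edge (rot d)) ` ?C = {e \<in> bd A. v \<in> e}"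
      proof (intro equalityI subsetI)
        fix e assume "e \<in> (\<lambda>d. edge (rot d)) ` ?C"
        then obtain d where d: "d \<in> D" "fst d = v" "(lf d \<in> A) \<noteq> (lf (rot d) \<in> A)" "e = edge (rot d)" by auto
        have "(lf (rot d) \<in> A) \<noteq> (lf (rv (rot d)) \<in> A)" using d(3) rot(3)[OF d(1)] by simp
        hence "e \<in> bd A" using bd_iff[OF rot(1)[OF d(1)]] d(4) by blast
        moreover have "v \<in> e" using d rot(2)[OF d(1)] by (simp add: edge_def)
        ultimately show "e \<in> {e \<in> bd A. v \<in> e}" by simp
      next
        fix e assume "e \<in> {e \<in> bd A. v \<in> e}"
        then obtain d0 where d0: "d0 \<in> D" "e = edge d0" "v \<in> edge d0" "edge d0 \<in> bd A" by (auto simp: bd_def)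
        have "\<exists>d1\<in>D. e = edge d1 \<and> fst d1 = v"
        proof (cases "fst d0 = v")
          case False
          hence "fst (rv d0) = v" using d0 by (auto simp: edge_def)
          thus ?thesis using d0 rv_in edge_rv by metis
        qed (use d0 in auto)
        then obtain d1 where d1: "d1 \<in> D" "e = edge d1" "fst d1 = v" by blast
        have "d1 \<in> rot ` ?S" using star_perm[of v] d1 by (simp add: bij_betw_def)
        then obtain d where d: "d1 = rot d" "d \<in> ?S" by (rule imageE)
        note d = d(2) d(1)[symmetric]
        have "(lf d1 \<in> A) \<noteq> (lf (rv d1) \<in> A)" using d0(4) d0(2) d1 bd_iff by metis
        moreover have dD: "d \<in> D" "fst d = v" using d(1) by auto
        ultimately have "(lf d \<in> A) \<noteq> (lf (rot d) \<in> A)" using rot(3)[OF dD(1)] d(2) by metis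
        hence "d \<in> ?C" using dD by blast
        thus "e \<in> (\<lambda>d. edge (rot d)) ` ?C" using d(2) d1(2) by (intro image_eqI[of _ _ d]) simp_all
      qed
    qed
    hence eq: "card ?C = card {e \<in> bd A. v \<in> e}" by (rule bij_betw_same_card)
    have "finite ?S" using finD by simp
    hence "even (card ?C)" by (rule card_changes_even[OF _ star_perm])
    thus ?thesis unfolding eq .
  qed
  thus ?thesis by (simp add: oddv_def)
qed

lemma bd_sdiff: "bd (sdiff A B) = sdiff (bd A) (bd B)"
proof -
  have "e \<in> bd (sdiff A B) \<longleftrightarrow> e \<in> sdiff (bd A) (bd B)" if "e \<in> edges P" for e
  proof -
    have "e \<in> edge ` D" using that edges_image by simp
    then obtain d where d: "d \<in> D" "e = edge d" by blast
    show ?thesis unfolding d(2) bd_iff[OF d(1)] sdiff_iff by auto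
  qed
  moreover have "sdiff (bd A) (bd B) \<subseteq> edges P" using bd_sub by (auto simp: sdiff_def)
  ultimately show ?thesis using bd_sub by blast
qed

lemma P_nonempty: "P \<noteq> {}"
proof
  assume "P = {}"
  hence "V = {}" "edges P = {}" by (auto simp: vertex_set_def edges_def darts_def)
  thus False using euler \<open>P = {}\<close> by simp
qed

text \<open>The kernel of the boundary map consists of the empty set and of \<open>P\<close> by connectedness,
  so the map is injective on the sets avoiding a fixed face.\<close>

lemma bd_inj:
  assumes f0: "f0 \<in> P" and AB: "A \<subseteq> P - {f0}" "B \<subseteq> P - {f0}" and eq: "bd A = bd B"
  shows "A = B"
proof (rule ccontr)
  assume ne: "A \<noteq> B"
  let ?X = "sdiff A B"
  have bdX: "bd ?X = {}" unfolding bd_sdiff eq by (auto simp: sdiff_def)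
  have "?X = P"
  proof (rule faces_connected)
    show "?X \<subseteq> P" "?X \<noteq> {}" using AB ne by (auto simp: sdiff_def)
    show "lf (rv d) \<in> ?X" if "d \<in> D" "lf d \<in> ?X" for d
      using bd_iff[OF that(1), of ?X] bdX that(2) by auto
  qed
  thus False using f0 AB by (auto simp: sdiff_def)
qed

lemma path_oddv: "(u, v) \<in> D\<^sup>* \<Longrightarrow> u \<in> V \<Longrightarrow> \<exists>T\<subseteq>edges P. oddv T = sdiff {u} {v}"
proof (induction rule: rtrancl_induct)
  case base
  show ?case by (intro exI[of _ "{}"]) (auto simp: oddv_def sdiff_def)
next
  case (step y z)
  then obtain T where T: "T \<subseteq> edges P" "oddv T = sdiff {u} {y}" by blast
  have e: "{edge (y, z)} \<subseteq> edges P" using step(2) by (auto simp: edges_image)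
  have "oddv {edge (y, z)} = {y, z}"
  proof -
    have "{e \<in> {edge (y, z)}. v \<in> e} = (if v \<in> {y, z} then {edge (y, z)} else {})" for v by (auto simp: edge_def)
    thus ?thesis using darts_V[OF step(2)] by (auto simp: oddv_def split: if_splits)
  qed
  hence "oddv (sdiff T {edge (y, z)}) = sdiff (sdiff {u} {y}) {y, z}" using oddv_sdiff[OF T(1) e] T by simp
  also have "\<dots> = sdiff {u} {z}" using no_loop[OF step(2)] by (auto simp: sdiff_def)
  finally show ?case using T e by (intro exI[of _ "sdiff T {edge (y, z)}"]) (auto simp: sdiff_def)
qed

lemma card_oddv_image: "2 ^ (card V - 1) \<le> card (oddv ` Pow (edges P))"
proof -
  have "V \<noteq> {}" using P_nonempty face by (fastforce simp: vertex_set_def)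
  then obtain r where r: "r \<in> V" by blast
  have "\<exists>T\<subseteq>edges P. oddv T - {r} = S" if "finite S" "S \<subseteq> V - {r}" for S
    using that
  proof (induction S)
    case empty
    show ?case by (intro exI[of _ "{}"]) (auto simp: oddv_def)
  next
    case (insert v S)
    then obtain T where T: "T \<subseteq> edges P" "oddv T - {r} = S" by blast
    have v: "v \<in> V" using insert by blast
    have "(v, r) \<in> D\<^sup>*" using connected_all r v by meson
    then obtain T' where T': "T' \<subseteq> edges P" "oddv T' = sdiff {v} {r}" using path_oddv v by blast
    have "oddv (sdiff T T') = sdiff (oddv T) (sdiff {v} {r})" using oddv_sdiff T T' by simp
    hence "oddv (sdiff T T') - {r} = insert v S" using T(2) insert by (auto simp: sdiff_def)
    moreover have "sdiff T T' \<subseteq> edges P" using T T' by (auto simp: sdiff_def)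
    ultimately show ?case by blast
  qed
  hence sol: "\<exists>T\<subseteq>edges P. oddv T - {r} = S" if "S \<subseteq> V - {r}" for S
    using that finite_subset[OF that] finV by blast
  have "Pow (V - {r}) \<subseteq> (\<lambda>U. U - {r}) ` oddv ` Pow (edges P)"
  proof
    fix S assume "S \<in> Pow (V - {r})"
    then obtain T where "T \<subseteq> edges P" "oddv T - {r} = S" using sol by blast
    thus "S \<in> (\<lambda>U. U - {r}) ` oddv ` Pow (edges P)" by blast
  qed
  moreover have fi: "finite (oddv ` Pow (edges P))" using finE by simp
  ultimately have "card (Pow (V - {r})) \<le> card ((\<lambda>U. U - {r}) ` oddv ` Pow (edges P))" by (intro card_mono) auto
  also have "\<dots> \<le> card (oddv ` Pow (edges P))" using fi by (rule card_image_le)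
  finally show ?thesis using finV r by (simp add: card_Pow)
qed

text \<open>A sphere has no first homology modulo 2. By connectedness the cycles are at most as many as the
  boundaries, once Euler's formula is used to compare exponents.\<close>

lemma cycles_are_boundaries:
  assumes "S \<subseteq> edges P" "oddv S = {}"
  shows "\<exists>A\<subseteq>P. S = bd A"
proof -
  let ?Z = "{S \<in> Pow (edges P). oddv S = {}}"
  obtain f0 where f0: "f0 \<in> P" using P_nonempty by blast
  have "inj_on bd (Pow (P - {f0}))" unfolding inj_on_def using bd_inj[OF f0] by blast
  hence c1: "card (bd ` Pow (P - {f0})) = 2 ^ (card P - 1)" using finP f0 by (simp add: card_image card_Pow)
  have sub: "bd ` Pow (P - {f0}) \<subseteq> ?Z" using bd_sub oddv_bd by auto
  have finZ: "finite ?Z" using finE by simp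
  have pos: "card V \<ge> 1" "card P \<ge> 1"
    using P_nonempty face finV finP by (fastforce simp: vertex_set_def Suc_le_eq card_gt_0_iff)+
  have eu: "card (edges P) = (card V - 1) + (card P - 1)"
    using euler pos by linarith
  have "2 ^ card (edges P) = card ?Z * card (oddv ` Pow (edges P))"
    by (rule card_kernel_image[OF finE oddv_sdiff])
  hence "card ?Z * 2 ^ (card V - 1) \<le> 2 ^ card (edges P)" using card_oddv_image by simp
  hence "card ?Z * 2 ^ (card V - 1) \<le> 2 ^ (card P - 1) * 2 ^ (card V - 1)"
    unfolding eu by (simp add: power_add mult.commute)
  hence "card ?Z \<le> card (bd ` Pow (P - {f0}))" unfolding c1 by simp
  with finZ sub have "bd ` Pow (P - {f0}) = ?Z" by (rule card_seteq)
  hence "S \<in> bd ` Pow (P - {f0})" using assms by blast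
  thus ?thesis by blast
qed

end

locale labelled_polyhedron = polyhedron P for P :: "'v polyhedron" +
  fixes N :: "('v \<times> 'v) set"
  assumes ND: "N \<subseteq> darts P" and Nrv: "d \<in> N \<Longrightarrow> rv d \<in> N" and Nne: "N \<noteq> {}"
begin

definition adj :: "('v list \<times> 'v list) set" where
  "adj = {(lf d, lf (rv d)) | d. d \<in> D - N}"

definition region :: "'v list \<Rightarrow> 'v list set" where
  "region f = {g. (f, g) \<in> adj\<^sup>*}"

lemma adj_sym: "(f, g) \<in> adj \<Longrightarrow> (g, f) \<in> adj"
proof -
  assume "(f, g) \<in> adj"
  then obtain d where d: "d \<in> D" "d \<notin> N" "f = lf d" "g = lf (rv d)" by (auto simp: adj_def)
  moreover have "rv d \<in> D - N" using d rv_in Nrv[of "rv d"] by auto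
  ultimately show ?thesis unfolding adj_def using rv_simps(1) by (metis (mono_tags, lifting) mem_Collect_eq)
qed

lemma region_self: "f \<in> region f" by (simp add: region_def)

lemma region_eq: "g \<in> region f \<Longrightarrow> region g = region f"
proof -
  assume "g \<in> region f"
  hence fg: "(f, g) \<in> adj\<^sup>*" by (simp add: region_def)
  have "sym adj" using adj_sym by (auto simp: sym_def)
  hence "sym (adj\<^sup>*)" by (rule sym_rtrancl)
  hence "(g, f) \<in> adj\<^sup>*" using fg by (simp add: symD)
  thus ?thesis using fg by (auto simp: region_def)
qed

lemma region_step: "d \<in> D \<Longrightarrow> d \<notin> N \<Longrightarrow> region (lf (rv d)) = region (lf d)"
proof (rule region_eq)
  assume "d \<in> D" "d \<notin> N"
  hence "(lf d, lf (rv d)) \<in> adj" unfolding adj_def by blast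
  thus "lf (rv d) \<in> region (lf d)" by (simp add: region_def)
qed

lemma region_sub: "f \<in> P \<Longrightarrow> region f \<subseteq> P"
proof
  fix g assume f: "f \<in> P" and "g \<in> region f"
  hence "(f, g) \<in> adj\<^sup>*" by (simp add: region_def)
  thus "g \<in> P" by (induction rule: rtrancl_induct) (use f lf rv_in in \<open>auto simp: adj_def\<close>)
qed

abbreviation regions :: "'v list set set" where "regions \<equiv> region ` P"

text \<open>Euler's inequality for the graph of labelled edges, whose faces are the regions into which it
  divides the sphere. Its cycles are boundaries of unions of regions, and complementary unions have the same
  boundary.\<close>

lemma euler_inequality: "card (edge ` N) + 1 \<le> card (fst ` N) + card regions"
proof -
  let ?E = "edge ` N"
  let ?Z = "{S \<in> Pow ?E. oddv S = {}}"
  have finN: "finite N" using ND finD finite_subset by blast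
  have sub: "?E \<subseteq> edges P" using ND by (auto simp: edges_image)
  have "2 ^ card ?E = card ?Z * card (oddv ` Pow ?E)"
    by (rule card_kernel_image) (use finN sub oddv_sdiff in auto)
  moreover have "oddv ` Pow ?E \<subseteq> Pow (fst ` N)"
  proof
    fix U assume "U \<in> oddv ` Pow ?E"
    then obtain S where S: "S \<subseteq> ?E" "U = oddv S" by auto
    have "v \<in> fst ` N" if v: "v \<in> oddv S" for v
    proof -
      have "{e \<in> S. v \<in> e} \<noteq> {}" using v unfolding oddv_def by (metis (no_types, lifting) card.empty even_zero mem_Collect_eq)
      then obtain d where d: "d \<in> N" "v \<in> edge d" using S(1) by blast
      hence "v = fst d \<or> v = fst (rv d)" by (auto simp: edge_def)
      thus ?thesis using d(1) Nrv[OF d(1)] by blast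
    qed
    thus "U \<in> Pow (fst ` N)" using S by auto
  qed
  hence "card (oddv ` Pow ?E) \<le> card (Pow (fst ` N))" using finN by (intro card_mono) auto
  hence "card (oddv ` Pow ?E) \<le> 2 ^ card (fst ` N)" using finN by (simp add: card_Pow)
  ultimately have 1: "2 ^ card ?E \<le> card ?Z * 2 ^ card (fst ` N)" by simp
  let ?C = "{A \<in> Pow P. \<forall>f\<in>A. region f \<subseteq> A}"
  obtain f0 where f0: "f0 \<in> P" using P_nonempty by blast
  have closed: "(lf d \<in> A) = (lf (rv d) \<in> A)" if "bd A \<subseteq> ?E" "d \<in> D" "d \<notin> N" for A d
  proof -
    have "edge d \<notin> ?E"
    proof
      assume "edge d \<in> ?E"
      then obtain e where "e \<in> N" "edge d = edge e" by blast
      hence "d = e \<or> d = rv e" "e \<in> N" using edge_eq[of e d] by auto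
      thus False using that(3) Nrv by blast
    qed
    thus ?thesis using bd_iff[OF that(2)] that(1) by blast
  qed
  have inC: "A \<in> ?C" if "A \<subseteq> P" "bd A \<subseteq> ?E" for A
  proof -
    have "region f \<subseteq> A" if f: "f \<in> A" for f
    proof
      fix g assume "g \<in> region f"
      hence "(f, g) \<in> adj\<^sup>*" by (simp add: region_def)
      thus "g \<in> A"
        by (induction rule: rtrancl_induct) (use f closed \<open>bd A \<subseteq> ?E\<close> in \<open>auto simp: adj_def\<close>)
    qed
    thus ?thesis using that by auto
  qed
  have compl: "P - A \<in> ?C \<and> bd (P - A) = bd A" if A: "A \<in> ?C" for A
  proof
    have "region f \<subseteq> P - A" if f: "f \<in> P - A" for f
    proof
      fix g assume g: "g \<in> region f"
      hence "g \<in> P" using region_sub f by blast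
      moreover have "g \<notin> A"
      proof
        assume "g \<in> A"
        hence "region g \<subseteq> A" using A by blast
        hence "f \<in> A" using region_eq[OF g] region_self by auto
        thus False using f by blast
      qed
      ultimately show "g \<in> P - A" by blast
    qed
    thus "P - A \<in> ?C" by auto
    have "edge d \<in> bd (P - A) \<longleftrightarrow> edge d \<in> bd A" if d: "d \<in> D" for d
      using bd_iff[OF d] lf[OF d] lf[OF rv_in[OF d]] by auto
    thus "bd (P - A) = bd A" using bd_sub unfolding edges_image by blast
  qed
  have finC: "finite ?C" using finP by simp
  have half: "?Z \<subseteq> bd ` {A \<in> ?C. f0 \<in> A}" "?Z \<subseteq> bd ` {A \<in> ?C. f0 \<notin> A}"
  proof -
    have "S \<in> bd ` {A \<in> ?C. f0 \<in> A} \<and> S \<in> bd ` {A \<in> ?C. f0 \<notin> A}" if S: "S \<in> ?Z" for S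
    proof -
      have "S \<subseteq> edges P" "oddv S = {}" using S sub by auto
      then obtain A where A: "A \<subseteq> P" "S = bd A" using cycles_are_boundaries by blast
      have AC: "A \<in> ?C" using inC[OF A(1)] A(2) S by auto
      note cp = compl[OF AC]
      have eq: "S = bd (P - A)" using cp A(2) by simp
      show ?thesis
      proof (cases "f0 \<in> A")
        case True
        hence "P - A \<in> {A \<in> ?C. f0 \<notin> A}" "A \<in> {A \<in> ?C. f0 \<in> A}" using cp AC by blast+
        thus ?thesis using A(2) eq by blast
      next
        case False
        hence "P - A \<in> {A \<in> ?C. f0 \<in> A}" "A \<in> {A \<in> ?C. f0 \<notin> A}" using cp AC f0 by blast+
        thus ?thesis using A(2) eq by blast
      qed
    qed
    thus "?Z \<subseteq> bd ` {A \<in> ?C. f0 \<in> A}" "?Z \<subseteq> bd ` {A \<in> ?C. f0 \<notin> A}" by blast+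
  qed
  define CC where "CC = ?C"
  have finCC: "finite {A \<in> CC. f0 \<in> A}" "finite {A \<in> CC. f0 \<notin> A}"
    using finC unfolding CC_def by (rule rev_finite_subset, blast)+
  have "card ?Z \<le> card {A \<in> CC. f0 \<in> A}" "card ?Z \<le> card {A \<in> CC. f0 \<notin> A}"
    using surj_card_le[OF finCC(1) half(1)[folded CC_def]] surj_card_le[OF finCC(2) half(2)[folded CC_def]] .
  moreover have un: "card ({A \<in> CC. f0 \<in> A} \<union> {A \<in> CC. f0 \<notin> A}) = card {A \<in> CC. f0 \<in> A} + card {A \<in> CC. f0 \<notin> A}"
    by (rule card_Un_disjoint[OF finCC]) blast
  have "{A \<in> CC. f0 \<in> A} \<union> {A \<in> CC. f0 \<notin> A} = CC" by blast
  hence "card CC = card {A \<in> CC. f0 \<in> A} + card {A \<in> CC. f0 \<notin> A}" using un by simp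
  ultimately have "2 * card ?Z \<le> card CC" by simp
  hence 2: "2 * card ?Z \<le> card ?C" unfolding CC_def .
  have "inj_on (\<lambda>A. region ` A) ?C"
  proof
    fix A B assume AB: "A \<in> ?C" "B \<in> ?C" "region ` A = region ` B"
    have "\<Union> (region ` A) = A" "\<Union> (region ` B) = B" using AB region_self by blast+
    thus "A = B" using AB(3) by metis
  qed
  hence "card ?C \<le> card (Pow regions)" using finP by (intro card_inj_on_le) auto
  hence 3: "card ?C \<le> 2 ^ card regions" using finP by (simp add: card_Pow)
  have "2 ^ (card ?E + 1) \<le> (2::nat) ^ (card (fst ` N) + card regions)"
  proof -
    have "2 ^ (card ?E + 1) \<le> 2 * card ?Z * 2 ^ card (fst ` N)" using 1 by simp
    also have "\<dots> \<le> 2 ^ card regions * 2 ^ card (fst ` N)" using 2 3 by (intro mult_right_mono) auto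
    finally show ?thesis by (simp add: power_add mult.commute)
  qed
  thus ?thesis by (rule power_le_imp_le_exp[rotated]) simp
qed

abbreviation nx :: "'v \<times> 'v \<Rightarrow> 'v \<times> 'v" where "nx \<equiv> ret N"

lemma nx_in: "d \<in> N \<Longrightarrow> nx d \<in> N" using ret_time(2)[OF ND] .

lemma nx_fst: "d \<in> N \<Longrightarrow> fst (nx d) = fst d"
  unfolding ret_def using fst_pow ND by blast

lemma nx_region: "d \<in> N \<Longrightarrow> region (lf (rv (nx d))) = region (lf d)"
proof -
  assume d: "d \<in> N"
  hence dD: "d \<in> D" using ND by blast
  have "region (lf (rv ((rot ^^ Suc k) d))) = region (lf d)" if "Suc k \<le> ret_time N d" for k
    using that
  proof (induction k)
    case 0
    show ?case using rot(3)[OF dD] by simp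
  next
    case (Suc k)
    let ?e = "(rot ^^ Suc k) d"
    have "Suc k < ret_time N d" using Suc.prems by simp
    hence e: "?e \<in> D" "?e \<notin> N" using pow_in[OF dD] ret_time(3)[OF ND d zero_less_Suc] by blast+
    have "region (lf (rv ((rot ^^ Suc (Suc k)) d))) = region (lf ?e)" using rot(3)[OF e(1)] by simp
    also have "\<dots> = region (lf (rv ?e))" using region_step[OF e] by simp
    also have "\<dots> = region (lf d)" using Suc by simp
    finally show ?case .
  qed
  from this[of "ret_time N d - 1"] ret_time(1)[OF ND d] show ?thesis by (simp add: ret_def)
qed

lemma nx_fixed: "d \<in> N \<Longrightarrow> nx d = d \<Longrightarrow> e \<in> N \<Longrightarrow> fst e = fst d \<Longrightarrow> e = d"
proof (rule ccontr)
  assume a: "d \<in> N" "nx d = d" "e \<in> N" "fst e = fst d" "e \<noteq> d"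
  let ?k = "ret_time N d"
  have k: "?k > 0" "(rot ^^ ?k) d = d" using ret_time(1)[OF ND a(1)] a(2) by (auto simp: ret_def)
  obtain j where j: "(rot ^^ j) d = e"
    using rot_transitive[of "fst d" "snd d" "snd e"] a ND by (metis prod.collapse subsetD)
  have it: "(rot ^^ (m * ?k)) d = d" for m
    by (induction m) (auto simp: funpow_add k(2))
  have "(rot ^^ (j mod ?k)) d = (rot ^^ (j mod ?k)) ((rot ^^ (j div ?k * ?k)) d)" using it by simp
  also have "\<dots> = (rot ^^ (j mod ?k + j div ?k * ?k)) d" by (simp only: funpow_add o_apply)
  also have "\<dots> = e" using j by (simp only: mod_div_mult_eq)
  finally have m: "(rot ^^ (j mod ?k)) d = e" .
  show False
  proof (cases "j mod ?k = 0")
    case True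
    thus False using m a by simp
  next
    case False
    thus False using ret_time(3)[OF ND a(1), of "j mod ?k"] m a k by simp
  qed
qed

definition face_next :: "'v \<times> 'v \<Rightarrow> 'v \<times> 'v" where "face_next d = rv (nx d)"

definition Nr :: "'v list set \<Rightarrow> ('v \<times> 'v) set" where "Nr R = {d \<in> N. region (lf d) = R}"

definition Nv :: "'v \<Rightarrow> ('v \<times> 'v) set" where "Nv v = {d \<in> N. fst d = v}"

lemma finN: "finite N" using ND finD finite_subset by blast

text \<open>Successors along the boundary of a region: turn around the vertex to the next labelled edge and
  cross over to its other end.\<close>

lemma face_next_bij: "bij_betw face_next (Nr R) (Nr R)"
proof -
  have "face_next d \<in> Nr R" if "d \<in> Nr R" for d
    using that nx_in[of d] Nrv[of "nx d"] nx_region[of d] by (simp add: Nr_def face_next_def)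
  hence "face_next ` Nr R \<subseteq> Nr R" by blast
  moreover have "inj_on face_next (Nr R)"
  proof
    fix d e assume "d \<in> Nr R" "e \<in> Nr R" "face_next d = face_next e"
    hence "d \<in> N" "e \<in> N" "nx d = nx e" unfolding Nr_def face_next_def by (auto) (metis rv_simps(1))
    thus "d = e" using ret_bij[OF ND] by (auto simp: bij_betw_def inj_on_def)
  qed
  moreover have "finite (Nr R)" using finN by (simp add: Nr_def)
  ultimately show ?thesis using endo_inj_surj unfolding bij_betw_def by blast
qed

lemma vertex_next_bij: "bij_betw nx (Nv v) (Nv v)"
proof -
  have "nx ` Nv v \<subseteq> Nv v" using nx_in nx_fst by (auto simp: Nv_def)
  moreover have "inj_on nx (Nv v)" using ret_bij[OF ND] by (auto simp: bij_betw_def inj_on_def Nv_def)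
  moreover have "finite (Nv v)" using finN by (simp add: Nv_def)
  ultimately show ?thesis using endo_inj_surj unfolding bij_betw_def by blast
qed

text \<open>A region has at least three boundary darts because the polyhedron has no loops or double edges and
  no vertex carries only one labelled edge.\<close>

lemma region_size:
  assumes big: "\<And>d. d \<in> N \<Longrightarrow> \<exists>e\<in>N. fst e = fst d \<and> e \<noteq> d" and R: "R \<in> regions"
  shows "3 \<le> card (Nr R)"
proof -
  obtain f where f: "f \<in> P" "R = region f" using R by blast
  have fin: "finite (Nr R)" using finN by (simp add: Nr_def)
  have "Nr R \<noteq> {}"
  proof
    assume e: "Nr R = {}"
    have "R = P"
    proof (rule faces_connected)
      show "R \<subseteq> P" "R \<noteq> {}" using f region_sub region_self by auto
      fix d assume d: "d \<in> D" "lf d \<in> R"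
      have "region (lf d) = R" using d f region_eq by blast
      hence "d \<notin> N" using e unfolding Nr_def by blast
      hence "region (lf (rv d)) = R" using region_step[OF d(1)] \<open>region (lf d) = R\<close> by simp
      thus "lf (rv d) \<in> R" using region_self by blast
    qed
    moreover obtain d where d: "d \<in> N" using Nne by blast
    ultimately have "lf d \<in> region f" using f lf[of d] ND by auto
    hence "d \<in> Nr R" using d f region_eq by (auto simp: Nr_def)
    thus False using e by blast
  qed
  then obtain d where d: "d \<in> Nr R" by blast
  have nf: "face_next d \<noteq> d" if "d \<in> N" for d
  proof
    assume "face_next d = d"
    hence "snd (nx d) = fst d" by (metis face_next_def rv_simps(2))
    hence "fst (nx d) = snd (nx d)" using nx_fst[OF that] by simp
    moreover have "nx d \<in> D" using nx_in[OF that] ND by blast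
    ultimately show False using no_loop[of "fst (nx d)" "snd (nx d)", unfolded prod.collapse] by blast
  qed
  have dN: "d \<in> N" using d by (simp add: Nr_def)
  define e where "e = face_next d"
  have e: "e \<in> Nr R" "e \<noteq> d" using face_next_bij[of R] d nf[OF dN] by (auto simp: bij_betw_def e_def)
  have eN: "e \<in> N" using e by (simp add: Nr_def)
  define g where "g = face_next e"
  have g: "g \<in> Nr R" "g \<noteq> e" using face_next_bij[of R] e nf[OF eN] by (auto simp: bij_betw_def g_def)
  have "g \<noteq> d"
  proof
    assume gd: "g = d"
    have "snd e = fst d" using nx_fst[OF dN] by (simp add: e_def face_next_def)
    moreover have "d = rv (nx e)" using gd by (metis g_def face_next_def)
    hence "snd d = fst e" using nx_fst[OF eN] by simp
    ultimately have "e = rv d" by (simp add: rv_def prod_eq_iff)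
    hence "nx d = d" unfolding e_def face_next_def by (metis rv_simps(1))
    thus False using big[OF dN] nx_fixed[OF dN] by blast
  qed
  hence "card {d, e, g} = 3" using e g by simp
  moreover have "{d, e, g} \<subseteq> Nr R" using d e g by simp
  ultimately show ?thesis using card_mono[OF fin] by metis
qed

text \<open>Cauchy's counting lemma. The number of changes is at least 4 per vertex, since it is even and at
  least 3. A region with \<open>m \<ge> 3\<close> boundary darts contributes at most \<open>2 * m - 4\<close>,
  since its number of changes is even and at most \<open>m\<close>. Summation contradicts Euler's inequality.\<close>

theorem few_sign_changes:
  fixes t :: "'v \<times> 'v \<Rightarrow> bool"
  assumes t: "\<And>d. d \<in> N \<Longrightarrow> t (rv d) = t d"
    and four: "\<And>d. d \<in> N \<Longrightarrow> 3 \<le> card {e \<in> Nv (fst d). t e \<noteq> t (nx e)}"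
  shows False
proof -
  define Ch where "Ch = {d \<in> N. t d \<noteq> t (nx d)}"
  have finCh: "finite Ch" using finN by (simp add: Ch_def)
  have v4: "4 \<le> card {d \<in> Ch. fst d = v}" if v: "v \<in> fst ` N" for v
  proof -
    have e: "{d \<in> Ch. fst d = v} = {e \<in> Nv v. t e \<noteq> t (nx e)}" by (auto simp: Ch_def Nv_def)
    have "even (card {e \<in> Nv v. t e \<noteq> t (nx e)})"
      by (rule card_changes_even[OF _ vertex_next_bij]) (use finN in \<open>simp add: Nv_def\<close>)
    moreover have "3 \<le> card {e \<in> Nv v. t e \<noteq> t (nx e)}" using four v by auto
    ultimately have "4 \<le> card {e \<in> Nv v. t e \<noteq> t (nx e)}" by presburger
    thus ?thesis using e by simp
  qed
  have "4 * card (fst ` N) = (\<Sum>v\<in>fst ` N. 4)" by simp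
  also have "\<dots> \<le> (\<Sum>v\<in>fst ` N. card {d \<in> Ch. fst d = v})" using v4 by (rule sum_mono)
  also have "\<dots> = card (\<Union>v\<in>fst ` N. {d \<in> Ch. fst d = v})"
    using finN finCh by (intro card_UN_disjoint[symmetric]) auto
  also have "(\<Union>v\<in>fst ` N. {d \<in> Ch. fst d = v}) = Ch" by (auto simp: Ch_def)
  finally have 1: "4 * card (fst ` N) \<le> card Ch" .
  have big: "\<exists>e\<in>N. fst e = fst d \<and> e \<noteq> d" if d: "d \<in> N" for d
  proof (rule ccontr)
    assume "\<not> ?thesis"
    hence "{e \<in> Nv (fst d). t e \<noteq> t (nx e)} \<subseteq> {d}" by (auto simp: Nv_def)
    hence "card {e \<in> Nv (fst d). t e \<noteq> t (nx e)} \<le> card {d}" by (intro card_mono) auto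
    thus False using four[OF d] by simp
  qed
  have r4: "card {d \<in> Ch. region (lf d) = R} + 4 \<le> 2 * card (Nr R)" if R: "R \<in> regions" for R
  proof -
    have e: "{d \<in> Ch. region (lf d) = R} = {d \<in> Nr R. t d \<noteq> t (face_next d)}"
    proof -
      have "t (rv (nx d)) = t (nx d)" if "d \<in> N" for d using t[OF nx_in[OF that]] .
      thus ?thesis unfolding Ch_def Nr_def face_next_def mem_Collect_eq by (intro Collect_cong) blast
    qed
    have ev: "even (card {d \<in> Nr R. t d \<noteq> t (face_next d)})"
      by (rule card_changes_even[OF _ face_next_bij]) (use finN in \<open>simp add: Nr_def\<close>)
    have le: "card {d \<in> Nr R. t d \<noteq> t (face_next d)} \<le> card (Nr R)"
      using finN by (intro card_mono) (auto simp: Nr_def)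
    have "3 \<le> card (Nr R)" by (rule region_size[OF big R])
    thus ?thesis using ev le unfolding e by presburger
  qed
  have finR: "finite regions" using finP by simp
  have inR: "region (lf d) \<in> regions" if "d \<in> N" for d using that ND lf by blast
  have "Ch = (\<Union>R\<in>regions. {d \<in> Ch. region (lf d) = R})"
  proof (intro equalityI subsetI)
    fix d assume d: "d \<in> Ch"
    hence "region (lf d) \<in> regions" unfolding Ch_def using inR by simp
    thus "d \<in> (\<Union>R\<in>regions. {d \<in> Ch. region (lf d) = R})" by (rule UN_I) (use d in \<open>simp add: Ch_def\<close>)
  qed (auto simp: Ch_def)
  hence "card Ch = card (\<Union>R\<in>regions. {d \<in> Ch. region (lf d) = R})" by (rule arg_cong)
  also have "\<dots> = (\<Sum>R\<in>regions. card {d \<in> Ch. region (lf d) = R})"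
    using finR finCh by (intro card_UN_disjoint) auto
  finally have c: "card Ch = (\<Sum>R\<in>regions. card {d \<in> Ch. region (lf d) = R})" .
  have "N = (\<Union>R\<in>regions. Nr R)"
  proof (intro equalityI subsetI)
    fix d assume d: "d \<in> N"
    hence "region (lf d) \<in> regions" using inR by simp
    thus "d \<in> (\<Union>R\<in>regions. Nr R)" by (rule UN_I) (use d in \<open>simp add: Nr_def\<close>)
  qed (auto simp: Nr_def)
  hence "card N = card (\<Union>R\<in>regions. Nr R)" by (rule arg_cong)
  also have "\<dots> = (\<Sum>R\<in>regions. card (Nr R))"
    using finR finN by (intro card_UN_disjoint) (auto simp: Nr_def)
  finally have n: "card N = (\<Sum>R\<in>regions. card (Nr R))" .
  have "(\<Sum>R\<in>regions. card {d \<in> Ch. region (lf d) = R} + 4) \<le> (\<Sum>R\<in>regions. 2 * card (Nr R))"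
    using r4 by (rule sum_mono)
  hence 2: "card Ch + 4 * card regions \<le> 2 * card N"
    unfolding c n by (simp add: sum.distrib sum_distrib_left)
  have "card N \<le> 2 * card (edge ` N)"
  proof -
    have "card N = card (\<Union>e\<in>edge ` N. {d \<in> N. edge d = e})" by (intro arg_cong[where f = card]) auto
    also have "\<dots> = (\<Sum>e\<in>edge ` N. card {d \<in> N. edge d = e})" using finN by (intro card_UN_disjoint) auto
    also have "\<dots> \<le> (\<Sum>e\<in>edge ` N. 2)"
    proof (rule sum_mono)
      fix e assume "e \<in> edge ` N"
      then obtain d where d: "e = edge d" by blast
      have "{d' \<in> N. edge d' = e} \<subseteq> {d, rv d}" unfolding d using edge_eq[of d] by auto
      hence "card {d' \<in> N. edge d' = e} \<le> card {d, rv d}" by (intro card_mono) auto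
      also have "\<dots> \<le> 2" by (simp add: card_insert_if)
      finally show "card {d' \<in> N. edge d' = e} \<le> 2" .
    qed
    finally show ?thesis by simp
  qed
  thus False using 1 2 euler_inequality by linarith
qed

text \<open>Between two positions of opposite sign there is a change at the last position before the second one
  that still has the sign of the first.\<close>

lemma alternations_give_changes:
  fixes s :: "'v \<times> 'v \<Rightarrow> real"
  assumes Ns: "\<And>d. d \<in> D \<Longrightarrow> d \<in> N \<longleftrightarrow> s d \<noteq> 0" and v: "v \<in> V"
    and w: "\<And>i. i < n \<Longrightarrow> (v, w i) \<in> D \<and> rot (v, w i) = (v, w (Suc i mod n))" and inj: "inj_on w {..<n}"
    and i: "i1 < i2" "i2 < i3" "i3 < i4" "i4 < n"
    and alt: "s (v, w i1) * s (v, w i2) < 0" "s (v, w i2) * s (v, w i3) < 0" "s (v, w i3) * s (v, w i4) < 0"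
  shows "3 \<le> card {e \<in> Nv v. (s e > 0) \<noteq> (s (nx e) > 0)}"
proof -
  have change: "\<exists>c. a \<le> c \<and> c < b \<and> (v, w c) \<in> Nv v \<and> (s (v, w c) > 0) \<noteq> (s (nx (v, w c)) > 0)"
    if ab: "a < b" "b < n" "s (v, w a) * s (v, w b) < 0" for a b
  proof -
    define G where "G = {c. a \<le> c \<and> c < b \<and> s (v, w c) * s (v, w a) > 0}"
    have "s (v, w a) \<noteq> 0" using ab by auto
    hence "s (v, w a) * s (v, w a) > 0" by (metis not_real_square_gt_zero)
    hence "a \<in> G" using ab by (simp add: G_def)
    moreover have finG: "finite G" by (rule finite_subset[of _ "{..<b}"]) (auto simp: G_def)
    ultimately have cG: "Max G \<in> G" and cmax: "\<And>c. c \<in> G \<Longrightarrow> c \<le> Max G" by (auto intro: Max_in)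
    define c where "c = Max G"
    have c: "a \<le> c" "c < b" "s (v, w c) * s (v, w a) > 0" using cG by (auto simp: G_def c_def)
    have cN: "(v, w c) \<in> N" using Ns w[of c] c ab by auto
    have it: "(rot ^^ k) (v, w c) = (v, w (c + k))" if "c + k \<le> b" for k
      using that
    proof (induction k)
      case (Suc k)
      thus ?case using w[of "c + k"] ab by simp
    qed simp
    have later: "c' \<notin> G" if "c < c'" for c' using cmax[of c'] that by (auto simp: c_def)
    let ?k = "ret_time N (v, w c)"
    have bN: "(v, w b) \<in> N" using Ns w[of b] ab by auto
    have kb: "?k \<le> b - c"
    proof (rule ccontr)
      assume "\<not> ?thesis"
      hence "(rot ^^ (b - c)) (v, w c) \<notin> N" using ret_time(3)[OF ND cN, of "b - c"] c by simp
      thus False using it[of "b - c"] c bN by simp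
    qed
    have k0: "0 < ?k" using ret_time(1)[OF ND cN] .
    have nxc: "nx (v, w c) = (v, w (c + ?k))" unfolding ret_def using it[of ?k] kb c by simp
    have "nx (v, w c) \<in> N" by (rule nx_in[OF cN])
    hence nz: "s (v, w (c + ?k)) \<noteq> 0" using Ns ND nxc by auto
    have "s (v, w (c + ?k)) * s (v, w a) < 0"
    proof (cases "c + ?k = b")
      case True
      thus ?thesis using ab by (simp add: mult.commute)
    next
      case False
      hence "c + ?k < b" using kb c by simp
      hence "\<not> s (v, w (c + ?k)) * s (v, w a) > 0" using later[of "c + ?k"] k0 c by (auto simp: G_def)
      thus ?thesis using nz \<open>s (v, w a) \<noteq> 0\<close> by (metis linorder_neqE_linordered_idom mult_eq_0_iff)
    qed
    hence "(s (v, w c) > 0) \<noteq> (s (nx (v, w c)) > 0)" unfolding nxc using c(3)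
      by (auto simp: zero_less_mult_iff mult_less_0_iff)
    thus ?thesis using c cN by (intro exI[of _ c]) (auto simp: Nv_def)
  qed
  obtain c1 where c1: "i1 \<le> c1" "c1 < i2" "(v, w c1) \<in> Nv v" "(s (v, w c1) > 0) \<noteq> (s (nx (v, w c1)) > 0)"
    using change[of i1 i2] i alt by auto
  obtain c2 where c2: "i2 \<le> c2" "c2 < i3" "(v, w c2) \<in> Nv v" "(s (v, w c2) > 0) \<noteq> (s (nx (v, w c2)) > 0)"
    using change[of i2 i3] i alt by auto
  obtain c3 where c3: "i3 \<le> c3" "c3 < i4" "(v, w c3) \<in> Nv v" "(s (v, w c3) > 0) \<noteq> (s (nx (v, w c3)) > 0)"
    using change[of i3 i4] i alt by auto
  have lt: "c1 < n" "c2 < n" "c3 < n" "c1 \<noteq> c2" "c2 \<noteq> c3" "c1 \<noteq> c3"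
    using c1(1,2) c2(1,2) c3(1,2) i by linarith+
  have "w c1 \<noteq> w c2" "w c2 \<noteq> w c3" "w c1 \<noteq> w c3"
    using inj_on_eq_iff[OF inj] lt by simp_all
  hence three: "card {(v, w c1), (v, w c2), (v, w c3)} = 3" by simp
  have sub: "{(v, w c1), (v, w c2), (v, w c3)} \<subseteq> {e \<in> Nv v. (s e > 0) \<noteq> (s (nx e) > 0)}"
    using c1 c2 c3 by simp
  have "finite {e \<in> Nv v. (s e > 0) \<noteq> (s (nx e) > 0)}" using finN by (simp add: Nv_def)
  from card_mono[OF this sub] show ?thesis unfolding three .
qed

end

section \<open>Circles as vectors in Lorentz space\<close>

text \<open>The form of signature (3, 1).\<close>

definition lq :: "real^4 \<Rightarrow> real^4 \<Rightarrow> real" where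
  "lq x y = x$1 * y$1 + x$2 * y$2 + x$3 * y$3 - x$4 * y$4"

definition vec4 :: "real^3 \<Rightarrow> real \<Rightarrow> real^4" where
  "vec4 p t = (\<chi> i. if i = 1 then p$1 else if i = 2 then p$2 else if i = 3 then p$3 else t)"

definition hat :: "real^3 \<Rightarrow> real^4" where "hat x = vec4 x 1"

text \<open>The equation \<open>x \<bullet> p = cos r\<close> of a circle, normalized to a unit vector; its sign
  records the companion disk.\<close>

definition cvec :: "ocircle \<Rightarrow> real^4" where
  "cvec C = (1 / sin (radius C)) *\<^sub>R vec4 (center C) (cos (radius C))"

lemma vec4_nth [simp]: "vec4 p t $ 1 = p $ 1" "vec4 p t $ 2 = p $ 2" "vec4 p t $ 3 = p $ 3" "vec4 p t $ 4 = t"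
  by (simp_all add: vec4_def)

lemma vec_eq_4: "(x :: real^4) = y \<longleftrightarrow> x$1 = y$1 \<and> x$2 = y$2 \<and> x$3 = y$3 \<and> x$4 = y$4"
  by (simp add: vec_eq_iff forall_4)

lemma lq_sym: "lq x y = lq y x" by (simp add: lq_def mult.commute)

lemma lq_lin:
  "lq (x + y) z = lq x z + lq y z" "lq z (x + y) = lq z x + lq z y"
  "lq (c *\<^sub>R x) z = c * lq x z" "lq z (c *\<^sub>R x) = c * lq z x"
  "lq (- x) z = - lq x z" "lq z (- x) = - lq z x"
  "lq (x - y) z = lq x z - lq y z" "lq z (x - y) = lq z x - lq z y"
  "lq 0 z = 0" "lq z 0 = 0"
  by (simp_all add: lq_def algebra_simps)

lemma inner3: "(x :: real^3) \<bullet> y = x$1 * y$1 + x$2 * y$2 + x$3 * y$3"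
  by (simp add: inner_vec_def sum_3)

lemma lq_vec4: "lq (vec4 p s) (vec4 r t) = p \<bullet> r - s * t"
  by (simp add: lq_def inner3)

lemma vec4_lin: "vec4 p s + vec4 r t = vec4 (p + r) (s + t)" "c *\<^sub>R vec4 p s = vec4 (c *\<^sub>R p) (c * s)"
  by (simp_all add: vec_eq_4)

lemma vec4_surj: "\<exists>p t. x = vec4 p t"
  by (rule exI[of _ "vector [x$1, x$2, x$3]"], rule exI[of _ "x$4"]) (simp add: vec_eq_4)

lemma center_radius: "norm (center C) = 1" "0 < radius C" "radius C < pi"
  using Rep_ocircle[of C] by (auto simp: center_def radius_def split: prod.splits)

lemma sin_radius: "sin (radius C) > 0" using center_radius by (simp add: sin_gt_zero)

lemma center_sq: "center C \<bullet> center C = 1" using center_radius(1)[of C] by (simp add: norm_eq_1)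

lemma cvec_sq: "lq (cvec C) (cvec C) = 1"
proof -
  have "lq (cvec C) (cvec C) = (1 - (cos (radius C))^2) / (sin (radius C))^2"
    by (simp add: cvec_def lq_lin lq_vec4 center_sq power2_eq_square field_simps)
  thus ?thesis using sin_radius[of C] by (simp add: sin_squared_eq[symmetric])
qed

lemma lq_cvec: "lq (cvec C) (cvec C') = - inversive_distance C C'"
  using sin_radius[of C] sin_radius[of C']
  by (simp add: cvec_def lq_lin lq_vec4 inversive_distance_def field_simps)

lemma lq_cvec_hat: "lq (cvec C) (hat x) = (x \<bullet> center C - cos (radius C)) / sin (radius C)"
  by (simp add: cvec_def hat_def lq_lin lq_vec4 inner_commute)

lemma circ_iff: "x \<in> circ C \<longleftrightarrow> x \<in> S2 \<and> lq (cvec C) (hat x) = 0"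
  using sin_radius[of C] by (simp add: circ_def lq_cvec_hat)

lemma cdisk_iff: "x \<in> cdisk C \<longleftrightarrow> x \<in> S2 \<and> lq (cvec C) (hat x) \<ge> 0"
  using sin_radius[of C] by (simp add: cdisk_def lq_cvec_hat zero_le_divide_iff)

lemma hplane_iff: "x \<in> hplane C \<longleftrightarrow> x \<in> S2 \<and> lq (cvec C) (hat x) > 0"
  unfolding hplane_def Diff_iff circ_iff cdisk_iff by auto

lemma orthogonal_iff: "orthogonal_circles C C' \<longleftrightarrow> lq (cvec C) (cvec C') = 0"
  by (simp add: orthogonal_circles_def lq_cvec)

lemma cvec_opposite: "cvec (opposite C) = - cvec C"
proof -
  have "(- center C, pi - radius C) \<in> {(p :: real^3, r :: real). norm p = 1 \<and> 0 < r \<and> r < pi}"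
    using center_radius[of C] by simp
  hence "center (opposite C) = - center C" "radius (opposite C) = pi - radius C"
    by (simp_all add: opposite_def center_def radius_def Abs_ocircle_inverse)
  thus ?thesis by (simp add: cvec_def vec_eq_4)
qed

lemma cvec_inj: "cvec C = cvec C' \<Longrightarrow> C = C'"
proof -
  assume eq: "cvec C = cvec C'"
  define s where "s = 1 / sin (radius C)"
  define s' where "s' = 1 / sin (radius C')"
  have pos: "s > 0" "s' > 0" using sin_radius by (auto simp: s_def s'_def)
  have "vec4 (s *\<^sub>R center C) (s * cos (radius C)) = vec4 (s' *\<^sub>R center C') (s' * cos (radius C'))"
    using eq unfolding cvec_def s_def s'_def vec4_lin .
  hence c: "s *\<^sub>R center C = s' *\<^sub>R center C'" and r: "s * cos (radius C) = s' * cos (radius C')"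
    by (simp_all add: vec_eq_4 vec_eq_iff forall_3)
  have "norm (s *\<^sub>R center C) = norm (s' *\<^sub>R center C')" using c by simp
  hence ss: "s = s'" using pos center_radius by simp
  hence "center C = center C'" using c pos by simp
  moreover have "cos (radius C) = cos (radius C')" using r ss pos by simp
  hence "radius C = radius C'" using center_radius by (metis cos_inj_pi less_imp_le)
  ultimately have "Rep_ocircle C = Rep_ocircle C'" by (simp add: center_def radius_def prod_eq_iff)
  thus ?thesis by (simp add: Rep_ocircle_inject)
qed

definition fut :: "real^4 \<Rightarrow> bool" where "fut z \<longleftrightarrow> lq z z < 0 \<and> z$4 > 0"

lemma space_sq: "lq (vec4 p t) (vec4 p t) = (norm p)^2 - t^2"
  by (simp add: lq_vec4 power2_norm_eq_inner) (simp add: power2_eq_square)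

text \<open>The reversed Cauchy-Schwarz inequality: the orthogonal complement of a time-like vector is positive
  definite.\<close>

lemma orth_timelike:
  assumes z: "lq z z < 0" and e: "lq z e = 0"
  shows "lq e e \<ge> 0" "lq e e = 0 \<Longrightarrow> e = 0"
proof -
  obtain p t where ze: "z = vec4 p t" using vec4_surj by blast
  obtain r s where ee: "e = vec4 r s" using vec4_surj by blast
  have pt: "(norm p)^2 < t^2" using z unfolding ze space_sq by simp
  have pr: "p \<bullet> r = t * s" using e unfolding ze ee lq_vec4 by simp
  have "(t * s)^2 \<le> (norm p)^2 * (norm r)^2"
    using Cauchy_Schwarz_ineq2[of p r] unfolding pr by (metis abs_le_square_iff abs_mult abs_norm_cancel power_mult_distrib)
  hence 1: "t^2 * s^2 \<le> (norm p)^2 * (norm r)^2" by (simp add: power_mult_distrib)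
  also have "\<dots> \<le> t^2 * (norm r)^2" using pt by (intro mult_right_mono) auto
  finally have "t^2 * s^2 \<le> t^2 * (norm r)^2" .
  moreover have t0: "t^2 > 0" using pt by (smt (verit) zero_le_power2)
  ultimately have le: "s^2 \<le> (norm r)^2" by simp
  thus "lq e e \<ge> 0" unfolding ee space_sq by simp
  assume "lq e e = 0"
  hence eq: "s^2 = (norm r)^2" unfolding ee space_sq by simp
  have "(norm r)^2 = 0"
  proof (rule ccontr)
    assume "(norm r)^2 \<noteq> 0"
    hence "(norm p)^2 * (norm r)^2 < t^2 * (norm r)^2" using pt by (intro mult_strict_right_mono) auto
    thus False using 1 eq by simp
  qed
  hence "r = 0" "s = 0" using eq by auto
  thus "e = 0" unfolding ee by (simp add: vec_eq_4)
qed

lemma fut_null_neg: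
  assumes z: "lq z z < 0" "z$4 > 0" and y: "lq y y \<le> 0" "y$4 > 0"
  shows "lq z y < 0"
proof -
  obtain p t where ze: "z = vec4 p t" using vec4_surj by blast
  obtain r s where ye: "y = vec4 r s" using vec4_surj by blast
  have t: "t > 0" "(norm p)^2 < t^2" using z unfolding ze space_sq by auto
  have s: "s > 0" "(norm r)^2 \<le> s^2" using y unfolding ye space_sq by auto
  have "norm p < t" using t power2_less_imp_less[of "norm p" t] by linarith
  moreover have "norm r \<le> s" using s power2_le_imp_le[of "norm r" s] by linarith
  ultimately have "norm p * norm r \<le> norm p * s" "norm p * s < t * s"
    using s by (auto intro: mult_left_mono)
  hence "norm p * norm r < t * s" by linarith
  moreover have "p \<bullet> r \<le> norm p * norm r" by (rule norm_cauchy_schwarz)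
  ultimately show ?thesis unfolding ze ye lq_vec4 by simp
qed

lemma fut_iff_null:
  assumes z: "lq z z < 0" and y: "lq y y \<le> 0" "y$4 > 0" "lq z y < 0"
  shows "fut z"
proof -
  have "z$4 \<noteq> 0"
  proof
    assume "z$4 = 0"
    hence "lq z z \<ge> 0" by (simp add: lq_def)
    thus False using z by simp
  qed
  moreover have "\<not> z$4 < 0"
  proof
    assume "z$4 < 0"
    hence "lq (- z) y < 0" using fut_null_neg[of "- z" y] z y by (simp add: lq_lin)
    thus False using y by (simp add: lq_lin)
  qed
  ultimately show ?thesis using z by (simp add: fut_def)
qed

lemma hat_null: "x \<in> S2 \<Longrightarrow> lq (hat x) (hat x) = 0"
  by (simp add: hat_def space_sq)

lemma hat_4 [simp]: "hat x $ 4 = 1" by (simp add: hat_def)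

lemma hat_hat: "lq (hat x) (hat y) = x \<bullet> y - 1" by (simp add: hat_def lq_vec4)

lemma hat_hat_neg:
  assumes "x \<in> S2" "y \<in> S2" "x \<noteq> y"
  shows "lq (hat x) (hat y) < 0"
proof -
  have "x \<bullet> x = 1" "y \<bullet> y = 1" using assms by (simp_all add: norm_eq_1)
  hence "(x - y) \<bullet> (x - y) = 2 - 2 * (x \<bullet> y)" by (simp add: inner_diff inner_commute)
  moreover have "(x - y) \<bullet> (x - y) > 0" using assms by simp
  ultimately show ?thesis unfolding hat_hat by simp
qed

lemma hat_inj: "hat x = hat y \<Longrightarrow> x = y"
  by (simp add: hat_def vec_eq_4 vec_eq_iff forall_3)

lemma point_of_null:
  assumes "lq z z = 0" "z$4 > 0"
  obtains x where "x \<in> S2" "z = (z$4) *\<^sub>R hat x"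
proof -
  obtain p t where ze: "z = vec4 p t" using vec4_surj by blast
  have t: "t > 0" "(norm p)^2 = t^2" using assms unfolding ze space_sq by auto
  hence "norm p = t" by (metis less_imp_le norm_ge_zero power2_eq_imp_eq)
  hence "(1 / t) *\<^sub>R p \<in> S2" using t by simp
  moreover have "z = (z$4) *\<^sub>R hat ((1 / t) *\<^sub>R p)" using t unfolding ze hat_def vec4_lin by simp
  ultimately show ?thesis using that by blast
qed

text \<open>The projection to the orthogonal complement of \<open>c\<close>.\<close>

definition proj :: "real^4 \<Rightarrow> real^4 \<Rightarrow> real^4" where
  "proj c x = x - lq x c *\<^sub>R c"

lemma proj_orth: "lq c c = 1 \<Longrightarrow> lq (proj c x) c = 0" "lq c c = 1 \<Longrightarrow> lq c (proj c x) = 0"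
  by (simp_all add: proj_def lq_lin lq_sym)

lemma lq_proj: "lq c o' = 0 \<Longrightarrow> lq (proj c x) o' = lq x o'"
  by (simp add: proj_def lq_lin)

lemma lq_proj_proj: "lq c c = 1 \<Longrightarrow> lq (proj c x) (proj c y) = lq x y - lq x c * lq y c"
  by (simp add: proj_def lq_lin lq_sym algebra_simps)

lemma circ_nonempty: "\<exists>x. x \<in> circ C"
proof -
  obtain a :: "real^3" where "a \<noteq> 0" "orthogonal (center C) a"
    using orthogonal_to_vector_exists[of "center C"] by (auto simp: orthogonal_commute)
  define b where "b = (1 / norm a) *\<^sub>R a"
  have b: "b \<bullet> b = 1" "b \<bullet> center C = 0"
    using \<open>a \<noteq> 0\<close> \<open>orthogonal (center C) a\<close>
    by (simp_all add: b_def orthogonal_def inner_commute dot_square_norm power2_eq_square)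
  define x where "x = cos (radius C) *\<^sub>R center C + sin (radius C) *\<^sub>R b"
  have "x \<bullet> x = (cos (radius C))^2 + (sin (radius C))^2"
    by (simp add: x_def inner_add b center_sq inner_commute power2_eq_square)
  hence "norm x = 1" by (simp add: norm_eq_1)
  moreover have "x \<bullet> center C = cos (radius C)" by (simp add: x_def inner_add b center_sq)
  ultimately show ?thesis by (auto simp: circ_def)
qed

lemma uncoupled_witness:
  assumes "\<not> coupled C C'"
  obtains x y where "x \<in> circ C" "lq (cvec C') (hat x) < 0" "y \<in> circ C'" "lq (cvec C) (hat y) < 0"
proof -
  obtain x where "x \<in> circ C" "x \<notin> cdisk C'" using assms by (auto simp: coupled_def)
  moreover obtain y where "y \<in> circ C'" "y \<notin> cdisk C" using assms by (auto simp: coupled_def)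
  ultimately show ?thesis using that by (auto simp: circ_iff cdisk_iff not_le)
qed

text \<open>A neighbouring circle with a real vertex on the hyperbolic plane of \<open>Cv\<close> lies on the
  future side because it has a point outside the other disk.\<close>

lemma link_vertex_future:
  assumes unc: "\<not> coupled Cv Cw" and q: "lq (proj (cvec Cv) (cvec Cw)) (proj (cvec Cv) (cvec Cw)) < 0"
  shows "fut (proj (cvec Cv) (cvec Cw))"
proof -
  obtain x y where y: "x \<in> circ Cv" "lq (cvec Cw) (hat x) < 0" using uncoupled_witness[OF unc] by metis
  have "lq (proj (cvec Cv) (cvec Cw)) (hat x) = lq (cvec Cw) (hat x)"
    using y(1) by (simp add: proj_def lq_lin circ_iff)
  thus ?thesis using fut_iff_null[OF q, of "hat x"] y hat_null by (auto simp: circ_iff)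
qed

text \<open>For crossing circles this is the bound on the angle. For disjoint disks the form is less than -1;
  the case greater than 1 would mean nested disks, and is excluded because both projections would be future
  vectors with a product of the wrong sign.\<close>

lemma segregated_nonpos:
  assumes "segregated C K"
  shows "lq (cvec C) (cvec K) \<le> 0"
proof (rule ccontr)
  assume "\<not> ?thesis"
  hence pos: "lq (cvec C) (cvec K) > 0" by simp
  define c where "c = cvec C"
  define k where "k = cvec K"
  have cc: "lq c c = 1" "lq k k = 1" "lq c k > 0" using cvec_sq pos by (auto simp: c_def k_def)
  have unc: "\<not> coupled C K" using assms by (simp add: segregated_def)
  define e where "e = proj c k"
  define g where "g = lq c k"
  have ee: "lq e e = 1 - g^2" unfolding e_def lq_proj_proj[OF cc(1)] using cc by (simp add: g_def lq_sym power2_eq_square)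
  have ec: "lq e c = 0" unfolding e_def by (rule proj_orth[OF cc(1)])
  have meet: "\<exists>x. x \<in> circ C \<and> lq e (hat x) \<ge> 0" if "g \<le> 1"
  proof -
    obtain x0 where x0: "x0 \<in> circ C" using circ_nonempty by blast
    have e0: "lq e e \<ge> 0" using that cc(3) ee g_def by (simp add: power_le_one)
    show ?thesis
    proof (cases "lq e (hat x0) \<ge> 0")
      case True
      thus ?thesis using x0 by blast
    next
      case False
      hence neg: "lq e (hat x0) < 0" by simp
      \<comment> \<open>reflect the point in the line orthogonal to e\<close>
      show ?thesis
      proof (cases "lq e e = 0")
        case False
        hence ep: "lq e e > 0" using e0 by simp
        define y where "y = hat x0 - (2 * lq e (hat x0) / lq e e) *\<^sub>R e"
        have yy: "lq y y = 0" unfolding y_def using ep hat_null x0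
          by (simp add: lq_lin lq_sym[of "hat x0" e] circ_iff field_simps)
        have ye: "lq e y = - lq e (hat x0)" unfolding y_def using ep by (simp add: lq_lin)
        have "lq c (hat x0) = 0" "lq c e = 0" using x0 ec by (simp_all add: circ_iff c_def lq_sym[of "cvec C" e])
        hence yc: "lq c y = 0" unfolding y_def lq_lin by simp
        have yx: "lq y (hat x0) = - 2 * (lq e (hat x0))^2 / lq e e"
          unfolding y_def using hat_null x0 by (simp add: lq_lin circ_iff power2_eq_square)
        have y4: "y$4 > 0"
        proof -
          have nz: "y \<noteq> 0" using ye neg by (auto simp: lq_lin)
          have ne4: "y$4 \<noteq> 0"
          proof
            assume "y$4 = 0"
            hence "(y$1)^2 + (y$2)^2 + (y$3)^2 = 0" using yy by (simp add: lq_def power2_eq_square)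
            hence "y$1 = 0 \<and> y$2 = 0 \<and> y$3 = 0"
              by (metis add_nonneg_eq_0_iff zero_le_power2 power_eq_0_iff add_nonneg_nonneg)
            thus False using nz \<open>y$4 = 0\<close> by (simp add: vec_eq_4)
          qed
          have "\<not> y$4 < 0"
          proof
            assume n: "y$4 < 0"
            have "lq (- y) (- y) = 0" "(- y)$4 > 0" using yy n by (auto simp: lq_lin)
            then obtain w where w: "w \<in> S2" "- y = ((- y)$4) *\<^sub>R hat w" using point_of_null by blast
            have "lq (- y) (hat x0) \<le> 0"
            proof -
              have "lq (hat w) (hat x0) \<le> 0"
                using hat_hat_neg[of w x0] hat_null[of x0] w x0 by (cases "w = x0") (auto simp: circ_iff)
              thus ?thesis using n by (subst w(2)) (simp add: lq_lin mult_nonpos_nonpos)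
            qed
            moreover have "lq y (hat x0) < 0" using yx neg ep by (simp add: divide_neg_pos)
            ultimately show False by (simp add: lq_lin)
          qed
          thus ?thesis using ne4 by simp
        qed
        obtain w where w: "w \<in> S2" "y = (y$4) *\<^sub>R hat w" using point_of_null[OF yy y4] .
        have "y$4 * lq c (hat w) = 0" using yc w(2) by (metis lq_lin(4))
        hence "w \<in> circ C" using y4 w by (simp add: circ_iff c_def)
        moreover have "y$4 * lq e (hat w) > 0" using ye neg w(2) by (metis lq_lin(4) neg_0_less_iff_less)
        hence "lq e (hat w) \<ge> 0" using y4 by (simp add: zero_less_mult_iff)
        ultimately show ?thesis by blast
      next
        case True
        \<comment> \<open>e is null: it spans a point of the circle itself\<close>
        have nz: "e \<noteq> 0" using neg by (auto simp: lq_lin)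
        have ne4: "e$4 \<noteq> 0"
        proof
          assume "e$4 = 0"
          hence "(e$1)^2 + (e$2)^2 + (e$3)^2 = 0" using True by (simp add: lq_def power2_eq_square)
          hence "e$1 = 0 \<and> e$2 = 0 \<and> e$3 = 0"
            by (metis add_nonneg_eq_0_iff zero_le_power2 power_eq_0_iff add_nonneg_nonneg)
          thus False using nz \<open>e$4 = 0\<close> by (simp add: vec_eq_4)
        qed
        define s where "s = (if e$4 > 0 then 1 else -1 :: real)"
        have s: "(s *\<^sub>R e)$4 > 0" "lq (s *\<^sub>R e) (s *\<^sub>R e) = 0" using ne4 True by (auto simp: s_def lq_lin)
        obtain w where w: "w \<in> S2" "s *\<^sub>R e = ((s *\<^sub>R e)$4) *\<^sub>R hat w" using point_of_null[OF s(2,1)] .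
        define m where "m = (s *\<^sub>R e)$4"
        have m: "m > 0" "s *\<^sub>R e = m *\<^sub>R hat w" using s w(2) by (auto simp: m_def)
        have "m * lq c (hat w) = 0"
          using m(2) ec by (metis lq_lin(4) lq_sym mult_zero_right)
        hence "w \<in> circ C" using m w by (simp add: circ_iff c_def)
        moreover have "m * lq e (hat w) = 0" using m(2) True by (metis lq_lin(4) mult_zero_right)
        hence "lq e (hat w) = 0" using m by simp
        ultimately show ?thesis by auto
      qed
    qed
  qed
  have kx: "lq k (hat x) = lq e (hat x)" if "x \<in> circ C" for x
    using that by (simp add: e_def proj_def lq_lin circ_iff c_def)
  show False
  proof (cases "cdisk C \<inter> cdisk K = {}")
    case False
    hence m: "circ C \<inter> circ K \<noteq> {}" and ov: "overlap_angle C K \<le> pi / 2" using assms by (auto simp: segregated_def)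
    then obtain x where x: "x \<in> circ C" "x \<in> circ K" by blast
    have inv: "inversive_distance C K = - g" using lq_cvec[of C K] by (simp add: g_def c_def k_def)
    have "g \<le> 1"
    proof (rule ccontr)
      assume "\<not> g \<le> 1"
      hence "lq e e < 0" using ee by (simp add: one_less_power)
      moreover have "lq e (hat x) = 0" using kx[OF x(1)] x(2) by (simp add: circ_iff k_def)
      ultimately have "hat x = 0" using orth_timelike(2)[of e "hat x"] hat_null x by (auto simp: circ_iff)
      thus False using hat_4[of x] by simp
    qed
    hence "arccos (- g) > pi / 2"
      using arccos_less_arccos[of "- g" 0] cc(3) by (simp add: g_def)
    thus False using ov inv by (simp add: overlap_angle_def)
  next
    case True
    have disj: "lq k (hat x) < 0" if "x \<in> circ C" for x
    proof -
      have "x \<in> cdisk C" using that by (simp add: circ_iff cdisk_iff)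
      hence "x \<notin> cdisk K" using True by blast
      thus ?thesis using that by (simp add: circ_iff cdisk_iff k_def)
    qed
    have g1: "g > 1"
    proof (rule ccontr)
      assume "\<not> ?thesis"
      then obtain x where "x \<in> circ C" "lq e (hat x) \<ge> 0" using meet by auto
      thus False using disj[of x] kx[of x] by simp
    qed
    have e1: "lq e e < 0" using ee g1 by (simp add: one_less_power)
    have "fut e" using link_vertex_future[OF unc] e1 unfolding e_def c_def k_def by blast
    moreover have "fut (proj k c)"
    proof -
      have "\<not> coupled K C" using unc by (auto simp: coupled_def)
      moreover have "lq (proj k c) (proj k c) < 0" unfolding lq_proj_proj[OF cc(2)] using cc g1
        by (simp add: g_def one_less_power power2_eq_square[symmetric])
      ultimately show ?thesis using link_vertex_future unfolding c_def k_def by blast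
    qed
    ultimately have "lq e (proj k c) < 0" using fut_null_neg[of e "proj k c"] by (auto simp: fut_def)
    moreover have "lq e (proj k c) = g * (g^2 - 1)"
      unfolding e_def proj_def using cc by (simp add: lq_lin lq_sym[of k c] g_def power2_eq_square algebra_simps)
    moreover have "g * (g^2 - 1) > 0" using g1 by (simp add: one_less_power)
    ultimately show False by simp
  qed
qed

section \<open>Charts and abstract links\<close>

definition rows4 :: "real^4 \<Rightarrow> real^4 \<Rightarrow> real^4 \<Rightarrow> real^4 \<Rightarrow> real^4^4" where
  "rows4 x y z w = (\<chi> i. if i = 1 then x else if i = 2 then y else if i = 3 then z else w)"

text \<open>The oriented volume, which detects the orientation of Lorentz transformations.\<close>

definition vol4 :: "real^4 \<Rightarrow> real^4 \<Rightarrow> real^4 \<Rightarrow> real^4 \<Rightarrow> real" where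
  "vol4 x y z w = det (rows4 x y z w)"

lemma rows4_nth [simp]: "rows4 x y z w $ 1 = x" "rows4 x y z w $ 2 = y" "rows4 x y z w $ 3 = z" "rows4 x y z w $ 4 = w"
  by (simp_all add: rows4_def)

lemma det_4:
  "det (A :: real^4^4) =
    A$1$1 * (A$2$2 * A$3$3 * A$4$4 + A$2$3 * A$3$4 * A$4$2 + A$2$4 * A$3$2 * A$4$3
           - A$2$2 * A$3$4 * A$4$3 - A$2$3 * A$3$2 * A$4$4 - A$2$4 * A$3$3 * A$4$2)
  - A$1$2 * (A$2$1 * A$3$3 * A$4$4 + A$2$3 * A$3$4 * A$4$1 + A$2$4 * A$3$1 * A$4$3
           - A$2$1 * A$3$4 * A$4$3 - A$2$3 * A$3$1 * A$4$4 - A$2$4 * A$3$3 * A$4$1)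
  + A$1$3 * (A$2$1 * A$3$2 * A$4$4 + A$2$2 * A$3$4 * A$4$1 + A$2$4 * A$3$1 * A$4$2
           - A$2$1 * A$3$4 * A$4$2 - A$2$2 * A$3$1 * A$4$4 - A$2$4 * A$3$2 * A$4$1)
  - A$1$4 * (A$2$1 * A$3$2 * A$4$3 + A$2$2 * A$3$3 * A$4$1 + A$2$3 * A$3$1 * A$4$2
           - A$2$1 * A$3$3 * A$4$2 - A$2$2 * A$3$1 * A$4$3 - A$2$3 * A$3$2 * A$4$1)"
proof -
  have f1: "finite {2::4, 3, 4}" "1 \<notin> {2::4, 3, 4}" by auto
  have f2: "finite {3::4, 4}" "2 \<notin> {3::4, 4}" by auto
  have f3: "finite {4::4}" "3 \<notin> {4::4}" by auto
  show ?thesis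
    unfolding det_def UNIV_4
    unfolding sum_over_permutations_insert[OF f1]
    unfolding sum_over_permutations_insert[OF f2]
    unfolding sum_over_permutations_insert[OF f3]
    unfolding permutes_sing
    by (simp add: sign_swap_id permutation_swap_id permutation_compose sign_compose sign_id swap_id_eq Transposition.transpose_def algebra_simps)
qed

lemmas vol4_expand = vol4_def[unfolded det_4 rows4_nth]

lemma vol4_lin:
  "vol4 c (x + x') y z = vol4 c x y z + vol4 c x' y z"
  "vol4 c x (y + y') z = vol4 c x y z + vol4 c x y' z"
  "vol4 c x y (z + z') = vol4 c x y z + vol4 c x y z'"
  "vol4 c (r *\<^sub>R x) y z = r * vol4 c x y z" "vol4 c x (r *\<^sub>R y) z = r * vol4 c x y z"
  "vol4 c x y (r *\<^sub>R z) = r * vol4 c x y z" "vol4 (r *\<^sub>R c) x y z = r * vol4 c x y z"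
  "vol4 c (- x) y z = - vol4 c x y z" "vol4 c x (- y) z = - vol4 c x y z" "vol4 c x y (- z) = - vol4 c x y z"
  by (simp_all add: vol4_expand algebra_simps)

lemma vol4_eq0: "vol4 c c y z = 0" "vol4 c x c z = 0" "vol4 c x y c = 0" "vol4 c x x z = 0"
    "vol4 c x y x = 0" "vol4 c x y y = 0"
  by (simp_all add: vol4_expand algebra_simps)

text \<open>The product of two triple products is a Gram determinant.\<close>

lemma gram3:
  fixes u a x y :: "real^3"
  shows "(cross3 u a \<bullet> x) * (cross3 u a \<bullet> y) =
    u \<bullet> u * (a \<bullet> a * (x \<bullet> y) - a \<bullet> y * (x \<bullet> a)) - u \<bullet> a * (a \<bullet> u * (x \<bullet> y) - a \<bullet> y * (x \<bullet> u))
    + u \<bullet> y * (a \<bullet> u * (x \<bullet> a) - a \<bullet> a * (x \<bullet> u))"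
  unfolding inner3 cross_components by algebra

lemma triple3:
  fixes u a :: "real^3"
  shows "u \<bullet> cross3 a (cross3 u a) = u \<bullet> u * (a \<bullet> a) - (u \<bullet> a)^2"
  unfolding inner3 cross_components by algebra

lemma orthonormal3:
  fixes u a q :: "real^3"
  assumes "u \<bullet> u = 1" "a \<bullet> a = 1" "u \<bullet> a = 0"
  shows "q = (q \<bullet> u) *\<^sub>R u + (q \<bullet> a) *\<^sub>R a + (q \<bullet> cross3 u a) *\<^sub>R cross3 u a" (is "q = ?r")
proof -
  have "(q - ?r) \<bullet> y = 0" for y
    using gram3[of u a q y] assms
    by (simp add: inner_diff_left inner_add_left inner_commute algebra_simps)
  from this[of "q - ?r"] show ?thesis by simp
qed

lemma unit_orthogonal3:
  fixes u :: "real^3"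
  obtains a :: "real^3" where "a \<bullet> a = 1" "u \<bullet> a = 0"
proof -
  obtain a :: "real^3" where a: "a \<noteq> 0" "orthogonal u a"
    using orthogonal_to_vector_exists[of u] by (auto simp: orthogonal_commute)
  have "((1 / norm a) *\<^sub>R a) \<bullet> ((1 / norm a) *\<^sub>R a) = 1" "u \<bullet> ((1 / norm a) *\<^sub>R a) = 0"
    using a by (simp_all add: orthogonal_def dot_square_norm power2_eq_square)
  thus ?thesis by (rule that)
qed

text \<open>An isometry from the orthogonal complement of \<open>c\<close>, with the sign of the form reversed,
  to symmetric matrices. It sends the points of the hyperbolic plane bounded by the circle to positive definite
  matrices and respects orientation.\<close>

definition chart :: "real^4 \<Rightarrow> (real^4 \<Rightarrow> sm) \<Rightarrow> bool" where
  "chart c phi \<longleftrightarrow> linear phi \<and> (\<forall>x y. lq c x = 0 \<longrightarrow> mf (phi x) (phi y) = - lq x y) \<and>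
     (\<forall>x. lq c x = 0 \<longrightarrow> fut x \<longrightarrow> future (phi x)) \<and>
     (\<forall>x y z. vol4 c x y z = mf (crs (phi x) (phi y)) (phi z) / 2)"

text \<open>An explicit orthonormal frame adapted to \<open>c\<close>, with coordinates \<open>(x\<^sub>0 +
  x\<^sub>1, x\<^sub>2, x\<^sub>0 - x\<^sub>1)\<close>.\<close>

lemma chart_exists:
  assumes c: "lq c c = 1"
  obtains phi where "chart c phi"
proof -
  obtain p t where ct: "c = vec4 p t" using vec4_surj by blast
  have pt: "p \<bullet> p = 1 + t^2" using c unfolding ct lq_vec4 by (simp add: power2_eq_square)
  hence m2: "(norm p)^2 = 1 + t^2" by (simp add: dot_square_norm)
  define m where "m = norm p"
  have "1 + t^2 > 0" by (simp add: add_pos_nonneg)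
  hence m: "m > 0" "m^2 = 1 + t^2" using m2 by (auto simp: m_def)
  define u where "u = (1 / m) *\<^sub>R p"
  have pu: "p = m *\<^sub>R u" using m by (simp add: u_def)
  have u: "u \<bullet> u = 1" using m by (simp add: u_def dot_square_norm power2_eq_square flip: m_def)
  obtain a where a: "a \<bullet> a = 1" "u \<bullet> a = 0" by (rule unit_orthogonal3)
  define b where "b = cross3 u a"
  define E0 where "E0 = vec4 (t *\<^sub>R u) m"
  define E1 where "E1 = vec4 a 0"
  define E2 where "E2 = vec4 b 0"
  have complete: "x = lq x c *\<^sub>R c - lq x E0 *\<^sub>R E0 + lq x E1 *\<^sub>R E1 + lq x E2 *\<^sub>R E2" for x
  proof -
    obtain q s where x: "x = vec4 q s" using vec4_surj by blast
    have q: "q = (q \<bullet> u) *\<^sub>R u + (q \<bullet> a) *\<^sub>R a + (q \<bullet> b) *\<^sub>R b"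
      unfolding b_def by (rule orthonormal3[OF u a])
    have mm: "m * m = 1 + t * t" using m by (simp add: power2_eq_square)
    have 1: "(m * (q \<bullet> u) - s * t) * m - (t * (q \<bullet> u) - s * m) * t = q \<bullet> u"
      using mm by algebra
    have 2: "(m * (q \<bullet> u) - s * t) * t - (t * (q \<bullet> u) - s * m) * m = s"
      using mm by algebra
    let ?l = "lq x c *\<^sub>R c - lq x E0 *\<^sub>R E0 + lq x E1 *\<^sub>R E1 + lq x E2 *\<^sub>R E2"
      and ?r = "vec4 ((q \<bullet> u) *\<^sub>R u + (q \<bullet> a) *\<^sub>R a + (q \<bullet> b) *\<^sub>R b) s"
    have "?l = ?r"
      unfolding vec_eq_4
    proof (intro conjI)
      have sp: "(m * (q \<bullet> u) - s * t) * (m * k) - (t * (q \<bullet> u) - s * m) * (t * k) = (q \<bullet> u) * k" for k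
        using arg_cong[OF 1, of "\<lambda>z. z * k"] by (simp add: algebra_simps)
      show "?l $ 1 = ?r $ 1"
        unfolding x ct pu E0_def E1_def E2_def lq_vec4 using sp[of "u$1"] by simp
      show "?l $ 2 = ?r $ 2"
        unfolding x ct pu E0_def E1_def E2_def lq_vec4 using sp[of "u$2"] by simp
      show "?l $ 3 = ?r $ 3"
        unfolding x ct pu E0_def E1_def E2_def lq_vec4 using sp[of "u$3"] by simp
      show "?l $ 4 = ?r $ 4"
        unfolding x ct pu E0_def E1_def E2_def lq_vec4 using 2 by simp
    qed
    thus ?thesis using q x by metis
  qed
  have expand: "lq x y = lq x c * lq y c - lq x E0 * lq y E0 + lq x E1 * lq y E1 + lq x E2 * lq y E2" for x y
  proof -
    have "lq x y = lq x (lq y c *\<^sub>R c - lq y E0 *\<^sub>R E0 + lq y E1 *\<^sub>R E1 + lq y E2 *\<^sub>R E2)"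
      using complete[of y] by metis
    thus ?thesis unfolding lq_lin by (simp add: mult.commute)
  qed
  have "vol4 c E0 E1 E2 = (m * m - t * t) * (u \<bullet> cross3 a b)"
    unfolding vol4_expand ct pu E0_def E1_def E2_def vec4_nth vector_scaleR_component inner3 cross_components
    by (simp add: algebra_simps)
  also have "\<dots> = 1" using m u a unfolding b_def triple3 by (simp add: power2_eq_square)
  finally have volF: "vol4 c E0 E1 E2 = 1" .
  define phi where "phi x = (- lq x E0 + lq x E1, lq x E2, - lq x E0 - lq x E1)" for x
  have lin: "linear phi"
    by (rule linearI) (simp_all add: phi_def lq_lin algebra_simps)
  have mfphi: "mf (phi x) (phi y) = - lq x y" if "lq c x = 0" for x y
  proof -
    have "lq x c = 0" using that lq_sym by metis
    thus ?thesis using expand[of x y] by (simp add: phi_def mf_def field_simps)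
  qed
  have E0f: "lq E0 E0 < 0" "E0 $ 4 > 0" using m u by (simp_all add: E0_def lq_vec4 power2_eq_square)
  have futphi: "future (phi x)" if x: "lq c x = 0" "fut x" for x
  proof -
    have xx: "lq x x < 0" "x $ 4 > 0" using x by (auto simp: fut_def)
    hence "mf (phi x) (phi x) > 0" using mfphi[OF x(1), of x] by simp
    moreover have "lq E0 x < 0" using fut_null_neg[OF E0f, of x] xx by simp
    hence x0: "- lq x E0 > 0" by (simp add: lq_sym)
    moreover have "- lq x E0 + lq x E1 > 0"
    proof (rule ccontr)
      assume "\<not> ?thesis"
      hence "- lq x E1 \<ge> - lq x E0" by simp
      hence "(- lq x E1)^2 \<ge> (- lq x E0)^2" using x0 by (intro power_mono) auto
      moreover have "(lq x E2)^2 \<ge> 0" by simp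
      moreover have "lq x c = 0" using x(1) lq_sym by metis
      ultimately have "lq x x \<ge> 0" using expand[of x x] by (simp add: power2_eq_square)
      thus False using xx by simp
    qed
    ultimately show ?thesis by (simp add: future_def phi_def)
  qed
  have volphi: "vol4 c x y z = mf (crs (phi x) (phi y)) (phi z) / 2" for x y z
  proof -
    define K where "K w = vec4 (vector [lq w c, - lq w E0, lq w E1]) (lq w E2)" for w
    have Kn: "K w $ 1 = lq w c" "K w $ 2 = - lq w E0" "K w $ 3 = lq w E1" "K w $ 4 = lq w E2" for w
      by (simp_all add: K_def)
    have row: "w = K w $ 1 *\<^sub>R c + K w $ 2 *\<^sub>R E0 + K w $ 3 *\<^sub>R E1 + K w $ 4 *\<^sub>R E2" for w
      unfolding Kn using complete[of w] by simp
    have "rows4 c x y z = rows4 (K c) (K x) (K y) (K z) ** rows4 c E0 E1 E2"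
    proof -
      have comp: "w $ j = K w $ 1 * c $ j + K w $ 2 * E0 $ j + K w $ 3 * E1 $ j + K w $ 4 * E2 $ j" for w j
        using arg_cong[OF row[of w], of "\<lambda>v. v $ j"] by simp
      have mm: "(rows4 p1 p2 p3 p4 ** rows4 c E0 E1 E2) $ i $ j = rows4 p1 p2 p3 p4 $ i $ 1 * c $ j + rows4 p1 p2 p3 p4 $ i $ 2 * E0 $ j
          + rows4 p1 p2 p3 p4 $ i $ 3 * E1 $ j + rows4 p1 p2 p3 p4 $ i $ 4 * E2 $ j" for p1 p2 p3 p4 i j
        by (simp add: matrix_matrix_mult_def sum_4)
      have "\<forall>i j. rows4 c x y z $ i $ j = (rows4 (K c) (K x) (K y) (K z) ** rows4 c E0 E1 E2) $ i $ j"
        unfolding mm forall_4 rows4_nth by (intro conjI comp)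
      thus ?thesis by (simp add: vec_eq_iff)
    qed
    hence "vol4 c x y z = vol4 (K c) (K x) (K y) (K z)"
      unfolding vol4_def using volF by (simp add: det_mul vol4_def)
    moreover have "lq c E0 = 0" "lq c E1 = 0" "lq c E2 = 0"
      using a u unfolding ct pu E0_def E1_def E2_def lq_vec4 b_def
      by (simp_all add: dot_cross_self inner_commute)
    ultimately have "vol4 c x y z = (K x $ 2 * K y $ 3 * K z $ 4 + K x $ 3 * K y $ 4 * K z $ 2 + K x $ 4 * K y $ 2 * K z $ 3
           - K x $ 2 * K y $ 4 * K z $ 3 - K x $ 3 * K y $ 2 * K z $ 4 - K x $ 4 * K y $ 3 * K z $ 2)"
      using c by (simp add: vol4_expand Kn)
    thus ?thesis unfolding Kn by (simp add: phi_def mf_def crs_def field_simps)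
  qed
  have "chart c phi" unfolding chart_def using lin mfphi futphi volphi by blast
  thus ?thesis by (rule that)
qed

lemma chart_inj:
  assumes phi: "chart c phi" and x: "lq c x = 0" and z: "phi x = 0"
  shows "x = 0"
proof -
  have q: "lq x y = 0" for y
  proof -
    have "mf (phi x) (phi y) = - lq x y" using phi x by (simp add: chart_def)
    thus ?thesis unfolding z by (simp add: mf_def zero_prod_def)
  qed
  obtain p t where xp: "x = vec4 p t" using vec4_surj by blast
  have "lq x (vec4 p (- t)) = p \<bullet> p + t * t" unfolding xp lq_vec4 by simp
  hence "p \<bullet> p + t * t = 0" using q by simp
  hence "p \<bullet> p = 0" "t * t = 0"
    using inner_ge_zero[of p] zero_le_square[of t] by linarith+
  hence "p = 0" "t = 0" by auto
  thus ?thesis unfolding xp by (simp add: vec_eq_4)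
qed

lemma crs_crs: "crs P (crs Q R) = 4 *\<^sub>R (mf P R *\<^sub>R Q - mf P Q *\<^sub>R R)"
proof -
  obtain p1 p2 p3 where P: "P = (p1, p2, p3)" by (metis prod.exhaust)
  obtain q1 q2 q3 where Q: "Q = (q1, q2, q3)" by (metis prod.exhaust)
  obtain r1 r2 r3 where R: "R = (r1, r2, r3)" by (metis prod.exhaust)
  show ?thesis unfolding P Q R by (simp add: crs_def mf_def field_simps)
qed

lemma crs_zero_left: "crs 0 P = 0" "crs P 0 = 0"
  by (simp_all add: crs_def zero_prod_def)

text \<open>The cross product of two vectors on a line is a multiple of the line, by the expansion of the double
  cross product.\<close>

lemma crs_on_line:
  assumes "mf L L = -1" "mf P L = 0" "mf Q L = 0"
  shows "crs P Q = (- mf (crs P Q) L) *\<^sub>R L"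
proof -
  have "crs L (crs P Q) = 0" unfolding crs_crs using assms by (simp add: mf_sym)
  hence "crs L (crs L (crs P Q)) = 0" by (simp add: crs_zero_left)
  moreover have "crs L (crs L (crs P Q)) = 4 *\<^sub>R (mf L (crs P Q) *\<^sub>R L - mf L L *\<^sub>R crs P Q)" by (rule crs_crs)
  ultimately have "mf L (crs P Q) *\<^sub>R L - mf L L *\<^sub>R crs P Q = 0" by simp
  hence "mf L (crs P Q) *\<^sub>R L + crs P Q = 0" using assms by simp
  hence "crs P Q = - (mf L (crs P Q) *\<^sub>R L)" by (metis add.commute eq_neg_iff_add_eq_0)
  thus ?thesis by (simp add: mf_sym)
qed

lemma crs_independent:
  assumes "mf P P \<noteq> 0" "crs P Q = 0"
  shows "Q = (mf P Q / mf P P) *\<^sub>R P"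
proof -
  have "crs P (crs P Q) = 0" using assms by (simp add: crs_zero_left)
  hence "mf P Q *\<^sub>R P = mf P P *\<^sub>R Q" unfolding crs_crs by simp
  hence "(1 / mf P P) *\<^sub>R (mf P P *\<^sub>R Q) = (1 / mf P P) *\<^sub>R (mf P Q *\<^sub>R P)" by simp
  thus ?thesis using assms(1) by simp
qed

text \<open>The data of a convex polygon in the hyperbolic plane bounded by the circle \<open>c\<close>:
  \<open>q i\<close> are the outward sides, \<open>e i\<close> the normalized vertices, and \<open>pts\<close>
  provides two real points on every side.\<close>

locale vertex_link =
  fixes c :: "real^4" and n :: nat and q e :: "nat \<Rightarrow> real^4"
  assumes cc: "lq c c = 1" and n2: "2 \<le> n"
    and per: "q (i + n) = q i" "e (i + n) = e i"
    and qq: "lq (q i) (q i) = 1" "lq c (q i) = 0"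
    and ee: "lq c (e i) = 0" "lq (e i) (q i) = 0" "lq (e (Suc i)) (q i) = 0"
    and unit: "lq (e i) (e i) = -1 \<and> fut (e i) \<or> lq (e i) (e i) = 1"
    and ind: "e (Suc i) \<noteq> r *\<^sub>R e i"
    and neg: "lq (q i) (e j) \<le> 0"
    and dist: "q i = q j \<or> q i = - q j \<Longrightarrow> i mod n = j mod n"
    and pts: "\<exists>z z'. fut z \<and> fut z' \<and> lq c z = 0 \<and> lq c z' = 0 \<and> (\<forall>r. z' \<noteq> r *\<^sub>R z) \<and>
        lq (q i) z = 0 \<and> lq (q i) z' = 0 \<and> (\<forall>j. lq (q j) z \<le> 0 \<and> lq (q j) z' \<le> 0)"
begin

context
  fixes phi assumes phi: "chart c phi"
begin

lemma lin: "linear phi" using phi by (simp add: chart_def)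

lemma mfq: "lq c x = 0 \<Longrightarrow> mf (phi x) (phi y) = - lq x y" using phi by (simp add: chart_def)

abbreviation L where "L i \<equiv> phi (q i)"
abbreviation E where "E i \<equiv> phi (e i)"

lemma LL: "mf (L i) (L i) = -1" using mfq qq by simp
lemma EL: "mf (E i) (L i) = 0" "mf (E (Suc i)) (L i) = 0" "mf (L i) (E j) \<ge> 0"
  using mfq ee qq neg by simp_all
lemma EE: "mf (E i) (E i) = - lq (e i) (e i)" using mfq ee by simp
lemma EE0: "mf (E i) (E i) \<noteq> 0" using EE unit by (metis neg_equal_zero zero_neq_neg_one zero_neq_one neg_0_equal_iff_equal)

definition tau where "tau i = - mf (crs (E i) (E (Suc i))) (L i)"

lemma crsE: "crs (E i) (E (Suc i)) = tau i *\<^sub>R L i"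
  unfolding tau_def by (rule crs_on_line[OF LL EL(1,2)])

lemma crsE0: "crs (E i) (E (Suc i)) \<noteq> 0"
proof
  assume "crs (E i) (E (Suc i)) = 0"
  from crs_independent[OF EE0 this] obtain r where "E (Suc i) = r *\<^sub>R E i" by blast
  hence "phi (e (Suc i) - r *\<^sub>R e i) = 0" using linear_diff[OF lin] linear_cmul[OF lin] by simp
  hence "e (Suc i) - r *\<^sub>R e i = 0" using chart_inj[OF phi, of "e (Suc i) - r *\<^sub>R e i"] ee by (simp add: lq_lin)
  thus False using ind[of i r] by simp
qed

lemma tau0: "tau i \<noteq> 0" using crsE0[of i] unfolding crsE by auto

lemma other:
  assumes "i mod n \<noteq> j mod n"
  shows "\<not> (mf (L i) (E j) = 0 \<and> mf (L i) (E (Suc j)) = 0)"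
proof
  assume "mf (L i) (E j) = 0 \<and> mf (L i) (E (Suc j)) = 0"
  hence "crs (E j) (E (Suc j)) = (- mf (crs (E j) (E (Suc j))) (L i)) *\<^sub>R L i"
    by (intro crs_on_line[OF LL]) (simp_all add: mf_sym)
  then obtain s where s: "tau j *\<^sub>R L j = s *\<^sub>R L i" unfolding crsE by blast
  hence "(1 / tau j) *\<^sub>R (tau j *\<^sub>R L j) = (1 / tau j) *\<^sub>R (s *\<^sub>R L i)" by simp
  hence Lj: "L j = (s / tau j) *\<^sub>R L i" using tau0[of j] by simp
  define r where "r = s / tau j"
  have "phi (q j - r *\<^sub>R q i) = 0" using Lj linear_diff[OF lin] linear_cmul[OF lin] by (simp add: r_def)
  hence qj: "q j = r *\<^sub>R q i" using chart_inj[OF phi, of "q j - r *\<^sub>R q i"] qq by (simp add: lq_lin)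
  hence "r * r = 1" using qq(1)[of j] qq(1)[of i] by (simp add: lq_lin)
  hence "r = 1 \<or> r = -1" by (simp add: square_eq_1_iff)
  hence "q j = q i \<or> q j = - q i" using qj by auto
  thus False using dist[of j i] assms by auto
qed

lemma n3: "3 \<le> n"
proof (rule ccontr)
  assume "\<not> ?thesis"
  hence n: "n = 2" using n2 by simp
  have "0 mod n \<noteq> Suc 0 mod n" using n by simp
  moreover have "mf (L 0) (E (Suc 0)) = 0" using EL(2)[of 0] by (simp add: mf_sym)
  moreover have "E (Suc (Suc 0)) = E 0" using per(2)[of 0] n by (simp add: numeral_2_eq_2)
  hence "mf (L 0) (E (Suc (Suc 0))) = 0" using EL(1)[of 0] by (simp add: mf_sym)
  ultimately show False using other[of 0 "Suc 0"] by blast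
qed

lemma next_strict: "mf (L (Suc i)) (E i) > 0" "mf (L i) (E (Suc (Suc i))) > 0"
proof -
  have ne: "Suc i mod n \<noteq> i mod n" using mod_neq[of i "Suc i" n] n3 by auto
  have "mf (L (Suc i)) (E (Suc i)) = 0" using EL(1)[of "Suc i"] by (simp add: mf_sym)
  thus "mf (L (Suc i)) (E i) > 0" using other[OF ne] EL(3)[of "Suc i" i] by linarith
  have "mf (L i) (E (Suc i)) = 0" using EL(2)[of i] by (simp add: mf_sym)
  thus "mf (L i) (E (Suc (Suc i))) > 0" using other[OF ne[symmetric]] EL(3)[of i "Suc (Suc i)"] by linarith
qed

text \<open>The orientation of two consecutive vertices relative to their side is the same for all sides:
  compare the triple product of three consecutive vertices expanded in two ways.\<close>

lemma tau_step: "tau i > 0 \<longleftrightarrow> tau (Suc i) > 0"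
proof -
  have "mf (crs (E i) (E (Suc i))) (E (Suc (Suc i))) = mf (crs (E (Suc i)) (E (Suc (Suc i)))) (E i)"
    by (rule mf_crs(2))
  hence "tau i * mf (L i) (E (Suc (Suc i))) = tau (Suc i) * mf (L (Suc i)) (E i)"
    unfolding crsE by (simp add: mf_lin)
  thus ?thesis using next_strict[of i] by (metis zero_less_mult_pos2 mult_pos_pos)
qed

lemma tau_sign: "tau i > 0 \<longleftrightarrow> tau 0 > 0"
  by (induction i) (use tau_step in auto)

text \<open>A point of a side that satisfies the inequalities of the two adjacent sides is a nonnegative
  combination of the endpoints.\<close>

lemma side_coords:
  assumes z: "lq c z = 0" "lq (q i) z = 0" "\<And>j. lq (q j) z \<le> 0"
  obtains alpha beta where "0 \<le> alpha" "0 \<le> beta" "z = alpha *\<^sub>R e i + beta *\<^sub>R e (Suc i)"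
proof -
  have mz: "mf (L j) (phi z) = - lq (q j) z" for j using mfq qq by simp
  have z0: "mf (crs (E i) (E (Suc i))) (phi z) = 0" unfolding crsE using mz[of i] z by (simp add: mf_lin)
  define N where "N = mf (crs (E i) (E (Suc i))) (crs (E i) (E (Suc i)))"
  have "N = - (tau i * tau i)" unfolding N_def crsE using LL by (simp add: mf_lin)
  hence N0: "N \<noteq> 0" using tau0 by simp
  obtain x y where "N *\<^sub>R phi z = x *\<^sub>R E i + y *\<^sub>R E (Suc i)" using span_two[OF z0] unfolding N_def by blast
  hence "(1 / N) *\<^sub>R (N *\<^sub>R phi z) = (1 / N) *\<^sub>R (x *\<^sub>R E i + y *\<^sub>R E (Suc i))" by simp
  hence pz: "phi z = (x / N) *\<^sub>R E i + (y / N) *\<^sub>R E (Suc i)" using N0 by (simp add: scaleR_add_right)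
  define alpha where "alpha = x / N"
  define beta where "beta = y / N"
  have "phi (z - (alpha *\<^sub>R e i + beta *\<^sub>R e (Suc i))) = 0"
    using pz linear_diff[OF lin] linear_cmul[OF lin] linear_add[OF lin] by (simp add: alpha_def beta_def)
  hence ze: "z = alpha *\<^sub>R e i + beta *\<^sub>R e (Suc i)"
    using chart_inj[OF phi, of "z - (alpha *\<^sub>R e i + beta *\<^sub>R e (Suc i))"] z(1) ee by (simp add: lq_lin)
  have "0 \<le> mf (L (Suc i)) (phi z)" using mz z(3) by simp
  also have "mf (L (Suc i)) (phi z) = alpha * mf (L (Suc i)) (E i)"
    unfolding pz using EL(1)[of "Suc i"] by (simp add: mf_lin mf_sym[of _ "E (Suc i)"] alpha_def)
  finally have a: "0 \<le> alpha" using next_strict(1)[of i] by (simp add: zero_le_mult_iff)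
  define j where "j = i + n - 1"
  have Sj: "Suc j = i + n" using n2 by (simp add: j_def)
  have ej: "E (Suc j) = E i" "E (Suc (Suc j)) = E (Suc i)"
    using per(2)[of i] per(2)[of "Suc i"] Sj by simp_all
  have "0 \<le> mf (L j) (phi z)" using mz z(3) by simp
  also have "mf (L j) (phi z) = beta * mf (L j) (E (Suc i))"
    unfolding pz using EL(2)[of j] unfolding ej by (simp add: mf_lin mf_sym[of _ "E i"] beta_def)
  finally have b: "0 \<le> beta" using next_strict(2)[of j] unfolding ej by (simp add: zero_le_mult_iff)
  show ?thesis using that[OF a b ze] .
qed

text \<open>The sum of two different points of a side has two positive coordinates.\<close>

lemma real_point: "\<exists>mu>0. \<exists>nu>0. future (mu *\<^sub>R E i + nu *\<^sub>R E (Suc i))"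
proof -
  obtain z z' where z: "fut z" "fut z'" "lq c z = 0" "lq c z' = 0" "\<And>r. z' \<noteq> r *\<^sub>R z"
    "lq (q i) z = 0" "lq (q i) z' = 0" "\<And>j. lq (q j) z \<le> 0" "\<And>j. lq (q j) z' \<le> 0"
    using pts[of i] by blast
  obtain a b where ab: "0 \<le> a" "0 \<le> b" "z = a *\<^sub>R e i + b *\<^sub>R e (Suc i)" using side_coords[OF z(3,6,8)] .
  obtain a' b' where ab': "0 \<le> a'" "0 \<le> b'" "z' = a' *\<^sub>R e i + b' *\<^sub>R e (Suc i)" using side_coords[OF z(4,7,9)] .
  have nz: "z \<noteq> 0" using z(1) by (auto simp: fut_def lq_lin)
  have pa: "a + a' > 0"
  proof (rule ccontr)
    assume "\<not> ?thesis"
    hence "a = 0" "a' = 0" using ab ab' by auto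
    moreover have "b \<noteq> 0" using nz ab \<open>a = 0\<close> by auto
    ultimately have "z' = (b' / b) *\<^sub>R z" using ab ab' by simp
    thus False using z(5) by blast
  qed
  have pb: "b + b' > 0"
  proof (rule ccontr)
    assume "\<not> ?thesis"
    hence "b = 0" "b' = 0" using ab ab' by auto
    moreover have "a \<noteq> 0" using nz ab \<open>b = 0\<close> by auto
    ultimately have "z' = (a' / a) *\<^sub>R z" using ab ab' by simp
    thus False using z(5) by blast
  qed
  have "future (phi z)" "future (phi z')" using phi z by (simp_all add: chart_def)
  hence "future (phi z + phi z')" by (rule future_add)
  moreover have "phi z + phi z' = (a + a') *\<^sub>R E i + (b + b') *\<^sub>R E (Suc i)"
    unfolding ab(3) ab'(3) using linear_add[OF lin] linear_cmul[OF lin] by (simp add: algebra_simps)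
  ultimately show ?thesis using pa pb by metis
qed

lemma EE1: "mf (E i) (E i) = 1 \<and> future (E i) \<or> mf (E i) (E i) = -1"
  using unit[of i] EE[of i] phi ee(1)[of i] by (auto simp: chart_def)

lemma side_eq:
  assumes "L i = L j \<or> L i = - L j"
  shows "i mod n = j mod n"
proof -
  have "phi (q i - q j) = 0 \<or> phi (q i + q j) = 0" using assms linear_diff[OF lin] linear_add[OF lin] by auto
  hence "q i - q j = 0 \<or> q i + q j = 0"
    using chart_inj[OF phi, of "q i - q j"] chart_inj[OF phi, of "q i + q j"] qq by (auto simp: lq_lin)
  hence "q i = q j \<or> q i = - q j" by (auto simp: eq_neg_iff_add_eq_0)
  thus ?thesis by (rule dist)
qed

lemma chart_link:
  assumes t: "tau 0 < 0"
  shows "link n L E"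
proof -
  have "tau i < 0" for i using tau_sign[of i] t tau0[of i] by (metis linorder_neqE_linordered_idom less_asym)
  hence k: "\<exists>kappa>0. crs (E i) (E (Suc i)) = (- kappa) *\<^sub>R L i" for i
    using crsE[of i] by (intro exI[of _ "- tau i"]) simp
  show ?thesis unfolding link_def using n3 per LL EL k EE1 real_point side_eq by (intro conjI allI impI) auto
qed

text \<open>Three points on the first three sides determine the orientation of the polygon: their volume is a
  nonnegative combination of volumes of vertices, which all have the sign of \<open>tau\<close>.\<close>

lemma oriented:
  assumes z: "\<And>k. k < 3 \<Longrightarrow> lq c (z k) = 0 \<and> lq (q k) (z k) = 0 \<and> (\<forall>j. lq (q j) (z k) \<le> 0)"
    and pos: "vol4 c (z 0) (z 1) (z 2) > 0"
  shows "vol4 c (e i) (e (Suc i)) (q i) < 0"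
proof -
  have ex: "\<exists>a b. 0 \<le> a \<and> 0 \<le> b \<and> z k = a *\<^sub>R e k + b *\<^sub>R e (Suc k)" if "k < 3" for k
    using side_coords[of "z k" k] z[OF that] by metis
  obtain a0 b0 where 0: "0 \<le> a0" "0 \<le> b0" "z 0 = a0 *\<^sub>R e 0 + b0 *\<^sub>R e 1" using ex[of 0] by auto
  obtain a1 b1 where 1: "0 \<le> a1" "0 \<le> b1" "z 1 = a1 *\<^sub>R e 1 + b1 *\<^sub>R e 2" using ex[of 1] by (auto simp: numeral_2_eq_2)
  obtain a2 b2 where 2: "0 \<le> a2" "0 \<le> b2" "z 2 = a2 *\<^sub>R e 2 + b2 *\<^sub>R e 3"
    using ex[of 2] by (auto simp: numeral_3_eq_3 numeral_2_eq_2)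
  have vol: "vol4 c x y w = mf (crs (phi x) (phi y)) (phi w) / 2" for x y w using phi by (simp add: chart_def)
  have v1: "vol4 c (e i) (e (Suc i)) w = tau i * mf (L i) (phi w) / 2" for i w
    unfolding vol crsE by (simp add: mf_lin)
  have v012: "vol4 c (e 0) (e 1) w = tau 0 * mf (L 0) (phi w) / 2" for w using v1[of 0] by simp
  have v123: "vol4 c (e 1) (e 2) (e 3) = tau 1 * mf (L 1) (E 3) / 2" using v1[of 1] by (simp add: numeral_2_eq_2)
  have "vol4 c (e 0) (e 2) (e 3) = vol4 c (e 2) (e 3) (e 0)" unfolding vol using mf_crs(2) by metis
  hence v023: "vol4 c (e 0) (e 2) (e 3) = tau 2 * mf (L 2) (E 0) / 2"
    using v1[of 2] by (simp add: numeral_3_eq_3 numeral_2_eq_2)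
  have exp: "vol4 c (z 0) (z 1) (z 2) = a0 * a1 * a2 * vol4 c (e 0) (e 1) (e 2) + a0 * a1 * b2 * vol4 c (e 0) (e 1) (e 3)
     + a0 * b1 * b2 * vol4 c (e 0) (e 2) (e 3) + b0 * b1 * b2 * vol4 c (e 1) (e 2) (e 3)"
    unfolding 0(3) 1(3) 2(3) vol4_lin by (simp add: vol4_eq0 algebra_simps)
  have "tau 0 > 0"
  proof (rule ccontr)
    assume "\<not> tau 0 > 0"
    hence t: "tau k \<le> 0" for k using tau_sign[of k] by simp
    have "vol4 c (e 0) (e 1) (e 2) \<le> 0" "vol4 c (e 0) (e 1) (e 3) \<le> 0" "vol4 c (e 0) (e 2) (e 3) \<le> 0" "vol4 c (e 1) (e 2) (e 3) \<le> 0"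
      unfolding v012 v123 v023 using t EL(3) by (simp_all add: mult_nonpos_nonneg)
    hence "a0 * a1 * a2 * vol4 c (e 0) (e 1) (e 2) \<le> 0" "a0 * a1 * b2 * vol4 c (e 0) (e 1) (e 3) \<le> 0"
     "a0 * b1 * b2 * vol4 c (e 0) (e 2) (e 3) \<le> 0" "b0 * b1 * b2 * vol4 c (e 1) (e 2) (e 3) \<le> 0"
      using 0 1 2 by (simp_all add: mult_nonneg_nonpos)
    thus False using pos exp by linarith
  qed
  hence "tau i > 0" using tau_sign by blast
  thus ?thesis unfolding v1 LL by simp
qed

end

definition mirror :: "sm \<Rightarrow> sm" where "mirror P = (cu P, - cv P, cw P)"

lemma mirror:
  "mf (mirror P) (mirror Q) = mf P Q" "crs (mirror P) (mirror Q) = - mirror (crs P Q)"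
  "future (mirror P) \<longleftrightarrow> future P" "mirror (P + Q) = mirror P + mirror Q" "mirror (r *\<^sub>R P) = r *\<^sub>R mirror P"
  "mirror (mirror P) = P" "mirror (- P) = - mirror P"
  by (simp_all add: mirror_def mf_def crs_def future_def algebra_simps prod_eq_iff)

lemma mirror_eq: "mirror P = mirror Q \<longleftrightarrow> P = Q" by (metis mirror(6))

text \<open>If the polygon runs in the wrong direction in the chart, it is replaced by its mirror image; the
  form, and hence every \<open>gain\<close>, is not affected.\<close>

theorem link_exists:
  obtains L E where "link n L E" "\<And>i j. mf (L i) (L j) = - lq (q i) (q j)" "\<And>i j. mf (E i) (E j) = - lq (e i) (e j)"
proof -
  obtain phi where phi: "chart c phi" using chart_exists[OF cc] .
  have g: "mf (phi (q i)) (phi (q j)) = - lq (q i) (q j)" "mf (phi (e i)) (phi (e j)) = - lq (e i) (e j)" for i j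
    using mfq[OF phi] qq ee by simp_all
  show ?thesis
  proof (cases "tau phi 0 < 0")
    case True
    from that[OF chart_link[OF phi True] g] show ?thesis .
  next
    case False
    hence t: "tau phi i > 0" for i using tau_sign[OF phi] tau0[OF phi] by (metis linorder_neqE_linordered_idom)
    have "link n (\<lambda>i. mirror (phi (q i))) (\<lambda>i. mirror (phi (e i)))"
    proof -
      have k: "\<exists>kappa>0. crs (mirror (phi (e i))) (mirror (phi (e (Suc i)))) = (- kappa) *\<^sub>R mirror (phi (q i))" for i
        unfolding mirror crsE[OF phi] using t[of i] by (intro exI[of _ "tau phi i"]) simp
      have r: "\<exists>mu>0. \<exists>nu>0. future (mu *\<^sub>R mirror (phi (e i)) + nu *\<^sub>R mirror (phi (e (Suc i))))" for i
        using real_point[OF phi, of i] by (simp add: mirror(3) flip: mirror(4,5))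
      have d: "i mod n = j mod n" if "mirror (phi (q i)) = mirror (phi (q j)) \<or> mirror (phi (q i)) = - mirror (phi (q j))" for i j
      proof -
        have "phi (q i) = phi (q j) \<or> phi (q i) = - phi (q j)" using that mirror_eq mirror(7) by metis
        thus ?thesis by (rule side_eq[OF phi])
      qed
      show ?thesis unfolding link_def mirror(1,3)
        using n3[OF phi] per LL[OF phi] EL[OF phi] k EE1[OF phi] r d by (intro conjI allI impI) auto
    qed
    from that[OF this] show ?thesis unfolding mirror using g by blast
  qed
qed

end

theorem vertex_alternations:
  assumes K: "vertex_link c n q e" "vertex_link c' n q' e'"
    and S: "\<And>i. lq (e i) (e i) = lq (e' i) (e' i)" "\<And>i. lq (e i) (e (Suc i)) = lq (e' i) (e' (Suc i))"
    and g: "\<And>i. g i = - lq (e (Suc i)) (e (Suc i)) * (lq (q' i) (q' (Suc i)) - lq (q i) (q (Suc i)))"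
    and nz: "g j \<noteq> 0"
  shows "\<exists>i1 i2 i3 i4. i1 < i2 \<and> i2 < i3 \<and> i3 < i4 \<and> i4 < n \<and> g i1 * g i2 < 0 \<and> g i2 * g i3 < 0 \<and> g i3 * g i4 < 0"
proof -
  obtain L E where L: "link n L E" "\<And>i j. mf (L i) (L j) = - lq (q i) (q j)" "\<And>i j. mf (E i) (E j) = - lq (e i) (e j)"
    using vertex_link.link_exists[OF K(1)] by metis
  obtain L' E' where L': "link n L' E'" "\<And>i j. mf (L' i) (L' j) = - lq (q' i) (q' j)" "\<And>i j. mf (E' i) (E' j) = - lq (e' i) (e' j)"
    using vertex_link.link_exists[OF K(2)] by metis
  have "same_link E E'" unfolding same_link_def L L' using S by simp
  moreover have gg: "gain L E L' i = g i" for i unfolding gain_def L L' g by simp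
  ultimately show ?thesis using link_sign_changes[OF L(1) L'(1), of j] nz unfolding gg by blast
qed

section \<open>Hyperideal polygons in Lorentz space\<close>

text \<open>The region is closed in the hyperbolic plane, so the points of its frontier belong to it.\<close>

lemma hside_point:
  assumes x: "x \<in> hside B Ls L"
  shows "x \<in> hplane B" "lq (cvec L) (hat x) = 0" "\<And>M. M \<in> set Ls \<Longrightarrow> lq (cvec M) (hat x) \<ge> 0"
proof -
  have hl: "x \<in> hline B L" and fr: "x \<in> htop B frontier_of hregion B Ls" using x by (auto simp: hside_def)
  have "x \<in> hplane B" "x \<in> circ L" using hl by (auto simp: hline_def)
  thus "x \<in> hplane B" "lq (cvec L) (hat x) = 0" by (simp_all add: circ_iff)
  define T where "T = (\<Inter>L\<in>set Ls. {x. center L \<bullet> x \<ge> cos (radius L)})"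
  have "closed T" unfolding T_def by (intro closed_INT ballI closed_halfspace_ge)
  moreover have "hregion B Ls = hplane B \<inter> T"
    by (auto simp: hregion_def T_def cdisk_def hplane_def inner_commute)
  ultimately have "closedin (htop B) (hregion B Ls)" by (metis closedin_closed_Int)
  hence "htop B frontier_of hregion B Ls \<subseteq> hregion B Ls" by (rule frontier_of_subset_closedin)
  hence "x \<in> hregion B Ls" using fr by blast
  thus "\<And>M. M \<in> set Ls \<Longrightarrow> lq (cvec M) (hat x) \<ge> 0" by (auto simp: hregion_def cdisk_iff)
qed

lemma proj_hat_future:
  assumes "x \<in> hplane B"
  shows "fut (proj (cvec B) (hat x))"
proof -
  define c where "c = cvec B"
  have "x \<in> S2" "lq c (hat x) > 0" using assms by (simp_all add: c_def hplane_iff)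
  hence c: "lq c c = 1" "lq (hat x) c > 0" "lq (hat x) (hat x) = 0"
    using cvec_sq hat_null lq_sym[of c "hat x"] by (simp_all add: c_def)
  have "lq (proj c (hat x)) (proj c (hat x)) = - ((lq (hat x) c)^2)"
    unfolding lq_proj_proj[OF c(1)] using c by (simp add: power2_eq_square)
  hence 1: "lq (proj c (hat x)) (proj c (hat x)) < 0" using c by simp
  have "lq (proj c (hat x)) (hat x) = - ((lq (hat x) c)^2)"
    unfolding proj_def lq_lin using c lq_sym[of c "hat x"] by (simp add: power2_eq_square)
  hence "lq (proj c (hat x)) (hat x) < 0" using c by simp
  thus ?thesis using fut_iff_null[OF 1, of "hat x"] c by (simp add: c_def)
qed

text \<open>A point of the hyperbolic plane is determined by the ray of its projection.\<close>

lemma proj_hat_distinct: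
  assumes "x \<in> hplane B" "y \<in> hplane B" "x \<noteq> y"
  shows "proj (cvec B) (hat y) \<noteq> r *\<^sub>R proj (cvec B) (hat x)"
proof
  define c where "c = cvec B"
  assume "proj (cvec B) (hat y) = r *\<^sub>R proj (cvec B) (hat x)"
  hence eq: "proj c (hat y) = r *\<^sub>R proj c (hat x)" by (simp add: c_def)
  have "x \<in> S2" "lq c (hat x) > 0" "y \<in> S2" "lq c (hat y) > 0" using assms by (simp_all add: c_def hplane_iff)
  hence c: "lq c c = 1" "lq (hat x) c > 0" "lq (hat x) (hat x) = 0" "lq (hat y) c > 0" "lq (hat y) (hat y) = 0"
    using cvec_sq hat_null lq_sym[of c "hat x"] lq_sym[of c "hat y"] by (simp_all add: c_def)
  have fx: "fut (proj c (hat x))" "fut (proj c (hat y))" using assms proj_hat_future by (simp_all add: c_def)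
  hence "proj c (hat x) $ 4 > 0" "r * proj c (hat x) $ 4 > 0" using eq by (auto simp: fut_def)
  hence r: "r > 0" by (simp add: zero_less_mult_iff)
  have "lq (proj c (hat y)) (proj c (hat y)) = r^2 * lq (proj c (hat x)) (proj c (hat x))"
    unfolding eq by (simp add: lq_lin power2_eq_square)
  hence "(lq (hat y) c)^2 = (r * lq (hat x) c)^2"
    unfolding lq_proj_proj[OF c(1)] using c by (simp add: power2_eq_square algebra_simps)
  hence b: "lq (hat y) c = r * lq (hat x) c" using r c by (simp add: power2_eq_iff_nonneg)
  have "hat y = r *\<^sub>R hat x" using eq unfolding proj_def b by (simp add: algebra_simps)
  hence "hat y $ 4 = r * hat x $ 4" by simp
  hence "r = 1" by simp
  hence "hat y = hat x" using \<open>hat y = r *\<^sub>R hat x\<close> by simp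
  thus False using hat_inj assms(3) by blast
qed

lemma hyperideal_side_points:
  assumes poly: "hyperideal_polygon B Ls" and L: "L \<in> set Ls"
  shows "\<exists>z z'. fut z \<and> fut z' \<and> lq (cvec B) z = 0 \<and> lq (cvec B) z' = 0 \<and> (\<forall>r. z' \<noteq> r *\<^sub>R z) \<and>
        lq (cvec L) z = 0 \<and> lq (cvec L) z' = 0 \<and> (\<forall>M\<in>set Ls. lq (cvec M) z \<ge> 0 \<and> lq (cvec M) z' \<ge> 0)"
proof -
  have "\<forall>L\<in>set Ls. \<exists>x\<in>hside B Ls L. \<exists>y\<in>hside B Ls L. x \<noteq> y"
    using poly unfolding hyperideal_polygon_def by (elim conjE) assumption
  then obtain x y where xy: "x \<in> hside B Ls L" "y \<in> hside B Ls L" "x \<noteq> y"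
    using L by blast
  note X = hside_point[OF xy(1)]
  note Y = hside_point[OF xy(2)]
  have M: "lq (cvec M) (proj (cvec B) z) = lq (cvec M) z" if "M \<in> set Ls" for M z
  proof -
    have "lq (cvec B) (cvec M) = 0" using poly that by (auto simp: hyperideal_polygon_def orthogonal_iff lq_sym)
    from lq_proj[OF this, of z] show ?thesis by (simp add: lq_sym)
  qed
  show ?thesis
    by (intro exI[of _ "proj (cvec B) (hat x)"] exI[of _ "proj (cvec B) (hat y)"])
       (use X Y M L proj_hat_future proj_hat_distinct[OF X(1) Y(1) xy(3)] proj_orth(2)[OF cvec_sq] in simp)
qed

text \<open>Two opposite sides would confine the region to a circle, but it has interior points. A small step
  towards the center of the circle leaves the circle.\<close>

lemma no_opposite_sides:
  assumes poly: "proper_hyperideal_polygon B Ls" and LM: "L \<in> set Ls" "M \<in> set Ls"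
  shows "cvec M \<noteq> - cvec L"
proof
  assume opp: "cvec M = - cvec L"
  obtain K where K: "K \<subseteq> hregion B Ls" "htop B interior_of K \<noteq> {}"
    using poly by (auto simp: proper_hyperideal_polygon_def)
  define U where "U = htop B interior_of K"
  have U: "openin (htop B) U" "U \<subseteq> K" "U \<noteq> {}"
    using K(2) interior_of_subset[of "htop B" K] openin_interior_of[of "htop B" K] by (simp_all add: U_def)
  have circU: "x \<in> circ L" if "x \<in> U" for x
  proof -
    have "x \<in> hregion B Ls" using that U K by blast
    hence "x \<in> cdisk L" "x \<in> cdisk M" using LM by (auto simp: hregion_def)
    hence "x \<in> S2" "lq (cvec L) (hat x) \<ge> 0" "lq (cvec L) (hat x) \<le> 0" using opp by (auto simp: cdisk_iff lq_lin)
    thus ?thesis by (simp add: circ_iff)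
  qed
  obtain W where W: "open W" "U = hplane B \<inter> W" using U(1) by (auto simp: openin_open)
  obtain x where x: "x \<in> U" using U(3) by blast
  define p where "p = center L"
  define r where "r = radius L"
  have r: "0 < r" "r < pi" "sin r > 0" using center_radius[of L] sin_radius by (auto simp: r_def)
  have xp: "x \<bullet> p = cos r" "x \<bullet> x = 1" using circU[OF x] by (auto simp: circ_def p_def r_def norm_eq_1)
  have pp: "p \<bullet> p = 1" by (simp add: p_def center_sq)
  define u where "u = (1 / sin r) *\<^sub>R (p - cos r *\<^sub>R x)"
  have ux: "u \<bullet> x = 0" "x \<bullet> u = 0" using xp by (simp_all add: u_def inner_diff inner_commute)
  have sq: "1 - cos r * cos r = sin r * sin r" using sin_cos_squared_add[of r] by (simp add: power2_eq_square)
  have up: "u \<bullet> p = sin r" using xp pp sq r by (simp add: u_def inner_diff inner_commute)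
  have "(p - cos r *\<^sub>R x) \<bullet> (p - cos r *\<^sub>R x) = sin r * sin r"
    using xp pp sq by (simp add: inner_diff inner_commute)
  hence uu: "u \<bullet> u = 1" using r by (simp add: u_def)
  define gamma where "gamma t = cos t *\<^sub>R x + sin t *\<^sub>R u" for t
  define W' where "W' = W \<inter> {y. center B \<bullet> y > cos (radius B)}"
  have oW: "open W'" unfolding W'_def by (intro open_Int W open_halfspace_gt)
  have S: "gamma t \<in> S2" for t
  proof -
    have "gamma t \<bullet> gamma t = (cos t)^2 + (sin t)^2" using ux uu xp by (simp add: gamma_def inner_add power2_eq_square)
    thus ?thesis by (simp add: norm_eq_1)
  qed
  have inU: "gamma t \<in> U" if "gamma t \<in> W'" for t
    using that S[of t] by (auto simp: W W'_def hplane_def cdisk_def circ_def inner_commute)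
  have "gamma 0 \<in> W'" using x by (auto simp: gamma_def W W'_def hplane_def cdisk_def circ_def inner_commute)
  moreover have "continuous_on UNIV gamma" unfolding gamma_def by (intro continuous_intros)
  ultimately have "open (gamma -` W')" "0 \<in> gamma -` W'" using oW by (auto simp: continuous_on_open_vimage)
  then obtain delta where d: "delta > 0" "ball 0 delta \<subseteq> gamma -` W'" using open_contains_ball by blast
  define t where "t = min (delta / 2) r"
  have t: "0 < t" "t \<le> r" "t < delta" using d r by (auto simp: t_def)
  hence "t \<in> ball 0 delta" by (simp add: dist_norm)
  hence "gamma t \<in> W'" using d(2) by blast
  hence "gamma t \<in> circ L" using inU circU by blast
  hence "gamma t \<bullet> p = cos r" by (simp add: circ_def p_def r_def)
  moreover have "gamma t \<bullet> p = cos (r - t)" using xp up by (simp add: gamma_def inner_add cos_diff mult.commute)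
  moreover have "cos r < cos (r - t)" using t r by (intro cos_monotone_0_pi) auto
  ultimately show False by simp
qed

text \<open>If \<open>h \<tau> = beta1 * cos \<tau> + beta2 * sin \<tau>\<close> exceeds \<open>q\<close>
  at both ends of an arc of half-length \<open>d\<close> centred at \<open>M\<close>, then \<open>h M = q * cos
  d\<close> would make the amplitude of \<open>h\<close> smaller than \<open>q\<close> in absolute value.\<close>

lemma arc_mean_nonzero:
  fixes beta1 beta2 q M d :: real
  assumes q: "beta1^2 + beta2^2 > q^2" and d: "sin d \<noteq> 0"
    and e: "beta1 * cos (M - d) + beta2 * sin (M - d) > q" "beta1 * cos (M + d) + beta2 * sin (M + d) > q"
  shows "beta1 * cos M + beta2 * sin M \<noteq> q * cos d"
proof
  assume z: "beta1 * cos M + beta2 * sin M = q * cos d"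
  define h where "h = beta1 * cos M + beta2 * sin M"
  define w where "w = beta1 * sin M - beta2 * cos M"
  have e1: "beta1 * cos (M - d) + beta2 * sin (M - d) = h * cos d + w * sin d"
    by (simp add: cos_diff sin_diff h_def w_def algebra_simps)
  have e2: "beta1 * cos (M + d) + beta2 * sin (M + d) = h * cos d - w * sin d"
    by (simp add: cos_add sin_add h_def w_def algebra_simps)
  have c2: "cos d * cos d = 1 - sin d * sin d" using sin_cos_squared_add[of d] by (simp add: power2_eq_square)
  have "h * cos d = q * (cos d * cos d)" using z by (simp add: h_def)
  hence "h * cos d = q - q * (sin d * sin d)" unfolding c2 by (simp add: algebra_simps)
  hence "w * sin d > q * (sin d * sin d)" "- (w * sin d) > q * (sin d * sin d)"
    using e unfolding e1 e2 by linarith+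
  hence "\<bar>w * sin d\<bar> < - q * (sin d * sin d)" by linarith
  hence "(w * sin d)^2 < (- q * (sin d * sin d))^2"
    by (metis abs_ge_zero power2_abs power_strict_mono pos2)
  hence "(sin d)^2 * w^2 < (sin d)^2 * (q^2 * (sin d)^2)" by (simp add: power2_eq_square algebra_simps)
  hence w: "w^2 < q^2 * (sin d)^2" by (simp add: mult_less_cancel_left_pos d)
  have "h^2 + w^2 = (beta1^2 + beta2^2) * ((sin M)^2 + (cos M)^2)"
    unfolding h_def w_def by algebra
  hence "h^2 + w^2 = beta1^2 + beta2^2" by simp
  moreover have "h^2 = q^2 * (cos d * cos d)" using z by (simp add: h_def power2_eq_square)
  hence "h^2 = q^2 - q^2 * (sin d)^2" unfolding c2 by (simp add: power2_eq_square algebra_simps)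
  ultimately show False using w q by linarith
qed

text \<open>By the previous lemma the expression keeps its sign while the arc grows from its initial point. In
  particular the arc is shorter than the full circle.\<close>

lemma arc_mean_pos:
  fixes beta1 beta2 q s t :: real
  assumes q: "beta1^2 + beta2^2 > q^2" and st: "s < t"
    and e: "\<And>\<tau>. s \<le> \<tau> \<Longrightarrow> \<tau> \<le> t \<Longrightarrow> beta1 * cos \<tau> + beta2 * sin \<tau> > q"
  shows "sin ((t - s) / 2) * (beta1 * cos ((s + t) / 2) + beta2 * sin ((s + t) / 2) - q * cos ((t - s) / 2)) > 0"
proof -
  define G where "G \<tau> = beta1 * cos ((s + \<tau>) / 2) + beta2 * sin ((s + \<tau>) / 2) - q * cos ((\<tau> - s) / 2)" for \<tau>
  have Gs: "G s > 0" using e[of s] st by (simp add: G_def)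
  have nz: "G \<tau> \<noteq> 0" if t: "s < \<tau>" "\<tau> \<le> t" "\<tau> < s + 2 * pi" for \<tau>
  proof -
    have "(s + \<tau>) / 2 - (\<tau> - s) / 2 = s" "(s + \<tau>) / 2 + (\<tau> - s) / 2 = \<tau>" by (simp_all add: field_simps)
    note eqs = this
    have "0 < (\<tau> - s) / 2" using t(1) by simp
    moreover have "(\<tau> - s) / 2 < pi" using t(3) by (simp add: pos_divide_less_eq algebra_simps)
    ultimately have "sin ((\<tau> - s) / 2) > 0" by (rule sin_gt_zero)
    hence "sin ((\<tau> - s) / 2) \<noteq> 0" by simp
    from arc_mean_nonzero[OF q this, of "(s + \<tau>) / 2", unfolded eqs, OF e[OF order_refl less_imp_le[OF st]] e[OF less_imp_le[OF t(1)] t(2)]]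
    show ?thesis unfolding G_def right_minus_eq .
  qed
  have cont: "continuous_on {s..\<tau>} G" for \<tau> unfolding G_def by (intro continuous_intros) auto
  have pos: "G \<tau> > 0" if t: "s < \<tau>" "\<tau> \<le> t" "\<tau> < s + 2 * pi" for \<tau>
  proof (rule ccontr)
    assume "\<not> G \<tau> > 0"
    then obtain x where "s \<le> x" "x \<le> \<tau>" "G x = 0" using IVT2'[OF _ _ _ cont, of \<tau> 0] Gs t by auto
    thus False using nz[of x] t Gs by (cases "x = s") auto
  qed
  have "t < s + 2 * pi"
  proof (rule ccontr)
    assume "\<not> ?thesis"
    hence t: "s + 2 * pi \<le> t" by simp
    have G: "G (s + 2 * pi) = - (beta1 * cos s + beta2 * sin s) + q" by (simp add: G_def add_divide_distrib)
    hence "G (s + 2 * pi) < 0" using e[of s] st by simp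
    then obtain x where x: "s \<le> x" "x \<le> s + 2 * pi" "G x = 0" using IVT2'[OF _ _ _ cont, of "s + 2 * pi" 0] Gs by auto
    have "x \<noteq> s" "x \<noteq> s + 2 * pi" using x Gs \<open>G (s + 2 * pi) < 0\<close> by auto
    thus False using nz[of x] x t by auto
  qed
  moreover from this have "(t - s) / 2 < pi" by (simp add: pos_divide_less_eq algebra_simps)
  hence "sin ((t - s) / 2) > 0" using st by (intro sin_gt_zero) simp_all
  ultimately show ?thesis using pos[of t] st by (simp add: G_def)
qed

lemma vol4_plane:
  fixes k a a2 :: "real^3"
  assumes k: "k \<bullet> k = 1" "a \<bullet> a = 1" "k \<bullet> a = 0" "a2 = cross3 k a"
  shows "vol4 (vec4 (x1 *\<^sub>R a + y1 *\<^sub>R a2) t1) (vec4 (x2 *\<^sub>R a + y2 *\<^sub>R a2) t2) (vec4 (x3 *\<^sub>R a + y3 *\<^sub>R a2) t3) (vec4 k t)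
     = - t1 * (x2 * y3 - y2 * x3) + t2 * (x1 * y3 - y1 * x3) - t3 * (x1 * y2 - y1 * x2)"
proof -
  have "vol4 (vec4 (x1 *\<^sub>R a + y1 *\<^sub>R a2) t1) (vec4 (x2 *\<^sub>R a + y2 *\<^sub>R a2) t2) (vec4 (x3 *\<^sub>R a + y3 *\<^sub>R a2) t3) (vec4 k t)
     = (- t1 * (x2 * y3 - y2 * x3) + t2 * (x1 * y3 - y1 * x3) - t3 * (x1 * y2 - y1 * x2)) * (k \<bullet> cross3 a a2)"
    unfolding vol4_expand vec4_nth vector_add_component vector_scaleR_component real_scaleR_def inner3 cross_components by algebra
  moreover have "k \<bullet> cross3 a a2 = 1" unfolding k(4) triple3 using k by simp
  ultimately show ?thesis by simp
qed

text \<open>The volume is linear in the third point and vanishes on the line through the first two, so it is a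
  multiple of \<open>lq (cvec L)\<close>. The sign of the factor is computed in an orthonormal basis adapted to
  \<open>L\<close>; it is positive because the arc from \<open>x\<close> to \<open>y\<close> stays in the
  hyperbolic plane.\<close>

lemma hleft_vol4:
  assumes h: "hleft B x y z"
  shows "vol4 (cvec B) (hat x) (hat y) (hat z) > 0"
proof -
  obtain L S where L: "x \<noteq> y" "harc B L x y S" "z \<in> hplane B" "z \<in> cdisk L - circ L" using h by (auto simp: hleft_def)
  obtain a s t where a: "orthogonal_circles L B" "base_dir L a" "s \<le> t" "circ_point L a s = x" "circ_point L a t = y"
      "circ_point L a ` {s..t} \<subseteq> hplane B" using L(2) by (auto simp: harc_def)
  define k where "k = center L"
  define r where "r = radius L"
  define a2 where "a2 = cross3 k a"
  define p where "p = center B"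
  define rho where "rho = radius B"
  have st: "s < t" using a(3-5) L(1) by (cases "s = t") auto
  have sr: "sin r > 0" "sin rho > 0" using sin_radius by (auto simp: r_def rho_def)
  have sc: "sin r * sin r = 1 - cos r * cos r" using sin_cos_squared_add[of r] by (simp add: power2_eq_square)
  have ka: "k \<bullet> k = 1" "a \<bullet> a = 1" "k \<bullet> a = 0"
    using a(2) center_sq by (auto simp: base_dir_def k_def norm_eq_1 inner_commute)
  have ob: "lq (cvec L) (cvec B) = 0" using a(1) by (simp add: orthogonal_iff)
  hence kp: "k \<bullet> p = cos r * cos rho" using sr
    by (simp add: cvec_def lq_lin lq_vec4 k_def p_def r_def rho_def)
  define beta1 where "beta1 = p \<bullet> a"
  define beta2 where "beta2 = p \<bullet> a2"
  have pe: "p = (p \<bullet> k) *\<^sub>R k + beta1 *\<^sub>R a + beta2 *\<^sub>R a2"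
    unfolding beta1_def beta2_def a2_def by (rule orthonormal3[OF ka])
  hence pe': "p = (cos r * cos rho) *\<^sub>R k + beta1 *\<^sub>R a + beta2 *\<^sub>R a2" using kp by (simp add: inner_commute)
  have "p \<bullet> p = (p \<bullet> k) * (k \<bullet> p) + beta1 * (a \<bullet> p) + beta2 * (a2 \<bullet> p)"
    by (subst (1) pe) (simp add: inner_add_left)
  hence "1 = (cos r * cos rho)^2 + beta1^2 + beta2^2"
    using kp center_sq[of B] by (simp add: p_def[symmetric] beta1_def beta2_def inner_commute power2_eq_square)
  moreover have "(cos rho)^2 < 1" using sr sin_cos_squared_add[of rho] by (smt (verit) zero_less_power)
  moreover have "(sin r * cos rho)^2 = (sin r * sin r) * (cos rho)^2" by (simp add: power2_eq_square)
  hence "(sin r * cos rho)^2 = (cos rho)^2 - (cos r * cos rho)^2"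
    unfolding sc by (simp add: power2_eq_square algebra_simps)
  ultimately have gam: "beta1^2 + beta2^2 > (sin r * cos rho)^2" by linarith
  define X where "X \<tau> = vec4 (cos \<tau> *\<^sub>R a + sin \<tau> *\<^sub>R a2) (sin r)" for \<tau>
  define K1 where "K1 = vec4 k (cos r)"
  have hx: "hat (circ_point L a \<tau>) = cos r *\<^sub>R K1 + sin r *\<^sub>R X \<tau>" for \<tau>
    unfolding hat_def circ_point_def K1_def X_def vec4_lin using sc
    by (simp add: k_def r_def a2_def vec_eq_4)
  have lK: "cvec L = (1 / sin r) *\<^sub>R K1" by (simp add: cvec_def K1_def k_def r_def)
  have above: "beta1 * cos \<tau> + beta2 * sin \<tau> > sin r * cos rho" if "s \<le> \<tau>" "\<tau> \<le> t" for \<tau>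
  proof -
    have "circ_point L a \<tau> \<in> hplane B" using a(6) that by auto
    hence "circ_point L a \<tau> \<bullet> p > cos rho" by (auto simp: hplane_def cdisk_def circ_def p_def rho_def)
    moreover have "circ_point L a \<tau> \<bullet> p = cos r * (cos r * cos rho) + sin r * (beta1 * cos \<tau> + beta2 * sin \<tau>)"
    proof -
      have ap: "a \<bullet> p = beta1" "a2 \<bullet> p = beta2" by (simp_all add: beta1_def beta2_def inner_commute)
      show ?thesis unfolding circ_point_def k_def[symmetric] r_def[symmetric] a2_def[symmetric]
        by (simp add: inner_add_left kp ap)
    qed
    ultimately have "sin r * (beta1 * cos \<tau> + beta2 * sin \<tau>) > cos rho * (1 - cos r * cos r)" by (simp add: algebra_simps)
    hence "sin r * (beta1 * cos \<tau> + beta2 * sin \<tau>) > sin r * (sin r * cos rho)" unfolding sc[symmetric] by (simp add: algebra_simps)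
    thus ?thesis using sr by simp
  qed
  define B1 where "B1 = vec4 (beta1 *\<^sub>R a + beta2 *\<^sub>R a2) (cos rho * (sin r * sin r))"
  have cB: "cvec B = (1 / sin rho) *\<^sub>R (B1 + (cos r * cos rho) *\<^sub>R K1)"
  proof -
    have "vec4 p (cos rho) = B1 + (cos r * cos rho) *\<^sub>R K1"
      unfolding B1_def K1_def vec4_lin sc using pe' by (simp add: algebra_simps)
    thus ?thesis by (simp add: cvec_def p_def rho_def)
  qed
  have vlK: "vol4 (u + m *\<^sub>R K1) x' y' K1 = vol4 u x' y' K1" "vol4 u (m *\<^sub>R K1 + x') y' K1 = vol4 u x' y' K1"
    "vol4 u x' (m *\<^sub>R K1 + y') K1 = vol4 u x' y' K1" for u m x' y'
    by (simp_all add: vol4_expand algebra_simps)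
  have "vol4 (cvec B) (hat x) (hat y) (cvec L) = (1 / sin rho) * (sin r * (sin r * (1 / sin r * vol4 B1 (X s) (X t) K1)))"
    unfolding a(4,5)[symmetric] hx cB lK vol4_lin vlK by (simp add: vol4_eq0)
  hence vv: "vol4 (cvec B) (hat x) (hat y) (cvec L) = sin r / sin rho * vol4 B1 (X s) (X t) K1" using sr by simp
  have "vol4 B1 (X s) (X t) K1 = - (cos rho * (sin r * sin r)) * (cos s * sin t - sin s * cos t)
      + sin r * (beta1 * sin t - beta2 * cos t) - sin r * (beta1 * sin s - beta2 * cos s)"
    unfolding B1_def X_def K1_def by (rule vol4_plane[OF ka a2_def])
  also have "\<dots> = 2 * sin r * (sin ((t - s) / 2) * (beta1 * cos ((s + t) / 2) + beta2 * sin ((s + t) / 2) - sin r * cos rho * cos ((t - s) / 2)))"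
  proof -
    define M where "M = (s + t) / 2"
    define d where "d = (t - s) / 2"
    have e: "s = M - d" "t = M + d" by (simp_all add: M_def d_def field_simps)
    have "(sin M)^2 + (cos M)^2 = 1" "(sin d)^2 + (cos d)^2 = 1" by simp_all
    thus ?thesis unfolding M_def[symmetric] d_def[symmetric] unfolding e cos_diff sin_diff cos_add sin_add by algebra
  qed
  finally have "vol4 B1 (X s) (X t) K1 > 0" using arc_mean_pos[OF gam st above] sr by simp
  hence pos: "vol4 (cvec B) (hat x) (hat y) (cvec L) > 0" unfolding vv using sr by simp
  obtain phi where phi: "chart (cvec B) phi" using chart_exists[OF cvec_sq] .
  have mfL: "mf (phi (cvec L)) (phi w) = - lq (cvec L) w" for w using phi ob by (simp add: chart_def lq_sym)
  have xy: "lq (cvec L) (hat x) = 0" "lq (cvec L) (hat y) = 0"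
  proof -
    have "lq K1 (X \<tau>) = - cos r * sin r" "lq K1 K1 = sin r * sin r" for \<tau>
      unfolding K1_def X_def lq_vec4 using ka sc by (simp_all add: inner_add_right a2_def dot_cross_self)
    hence "lq K1 (hat (circ_point L a \<tau>)) = 0" for \<tau> unfolding hx by (simp add: lq_lin)
    thus "lq (cvec L) (hat x) = 0" "lq (cvec L) (hat y) = 0" unfolding lK lq_lin a(4,5)[symmetric] by simp_all
  qed
  have vol: "vol4 (cvec B) u v w = mf (crs (phi u) (phi v)) (phi w) / 2" for u v w using phi by (simp add: chart_def)
  have "crs (phi (hat x)) (phi (hat y)) = (- mf (crs (phi (hat x)) (phi (hat y))) (phi (cvec L))) *\<^sub>R phi (cvec L)"
    using xy by (intro crs_on_line) (simp_all add: mfL cvec_sq mf_sym[of "phi (hat _)"])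
  then obtain m where m: "crs (phi (hat x)) (phi (hat y)) = m *\<^sub>R phi (cvec L)" by blast
  have "- m > 0" using pos unfolding vol m by (simp add: mf_lin mfL cvec_sq)
  moreover have "lq (cvec L) (hat z) > 0" using L(4) by (auto simp: cdisk_iff circ_iff)
  ultimately show ?thesis unfolding vol m by (simp add: mf_lin mfL mult_neg_pos)
qed

section \<open>Links of a circle polyhedron\<close>

lemma pencil_if_combination:
  assumes "cvec C = r *\<^sub>R cvec A + s *\<^sub>R cvec B"
  shows "C \<in> pencil A B"
proof -
  define x where "x = sin (radius C)"
  have x: "x > 0" using sin_radius by (simp add: x_def)
  define a where "a = x * r / sin (radius A)"
  define b where "b = x * s / sin (radius B)"
  have "vec4 (center C) (cos (radius C)) = x *\<^sub>R cvec C" using x by (simp add: cvec_def x_def)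
  also have "\<dots> = a *\<^sub>R vec4 (center A) (cos (radius A)) + b *\<^sub>R vec4 (center B) (cos (radius B))"
    unfolding assms by (simp add: cvec_def scaleR_add_right a_def b_def)
  finally have "center C = a *\<^sub>R center A + b *\<^sub>R center B" "cos (radius C) = a * cos (radius A) + b * cos (radius B)"
    unfolding vec4_lin by (simp_all add: vec_eq_4 vec_eq_iff forall_3)
  thus ?thesis unfolding pencil_def by blast
qed

lemma pencil_self: "A \<in> pencil A B" "B \<in> pencil A B"
  by (rule pencil_if_combination[of _ 1 _ 0]; simp) (rule pencil_if_combination[of _ 0 _ 1]; simp)

locale circle_polyhedron = polyhedron P for P :: "'v polyhedron" +
  fixes C :: "'v \<Rightarrow> ocircle" and Op :: "'v list \<Rightarrow> ocircle"
  assumes nonunit: "non_unitary P C" and conv: "convex_c_polyhedron P C Op" and proper: "proper_c_polyhedron P C Op"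
begin

abbreviation k where "k u \<equiv> cvec (C u)"
abbreviation q where "q f \<equiv> cvec (Op f)"

lemma kk: "lq (k u) (k u) = 1" "lq (q f) (q f) = 1" by (rule cvec_sq)+

lemma edge_uncoupled: "(u, v) \<in> D \<Longrightarrow> \<not> coupled (C u) (C v)"
proof -
  assume "(u, v) \<in> D"
  hence "{u, v} \<in> edges P" unfolding edges_def by blast
  moreover have "c_polyhedron P C" using conv unfolding convex_c_polyhedron_def by (elim conjE) assumption
  ultimately show ?thesis unfolding c_polyhedron_def by blast
qed

lemma edge_square: "(u, v) \<in> D \<Longrightarrow> (lq (k u) (k v))^2 \<noteq> 1"
proof -
  assume "(u, v) \<in> D"
  hence "{u, v} \<in> edges P" unfolding edges_def by blast
  hence "inversive_distance (C u) (C v) \<noteq> 1 \<and> inversive_distance (C u) (C v) \<noteq> - 1"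
    using nonunit unfolding non_unitary_def by blast
  hence "lq (k u) (k v) \<noteq> 1" "lq (k u) (k v) \<noteq> - 1" unfolding lq_cvec by auto
  thus ?thesis by (simp add: power2_eq_1_iff)
qed

lemma face_orth: "f \<in> P \<Longrightarrow> u \<in> set f \<Longrightarrow> lq (k u) (q f) = 0"
proof -
  assume fu: "f \<in> P" "u \<in> set f"
  have "\<forall>f\<in>P. \<forall>u\<in>set f. orthogonal_circles (Op f) (C u)" using conv unfolding convex_c_polyhedron_def by (elim conjE) assumption
  hence "orthogonal_circles (Op f) (C u)" using fu by blast
  thus ?thesis by (simp add: orthogonal_iff lq_sym)
qed

lemma face_neg: "f \<in> P \<Longrightarrow> u \<in> V \<Longrightarrow> lq (k u) (q f) \<le> 0"
proof -
  assume fu: "f \<in> P" "u \<in> V"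
  have "\<forall>f\<in>P. \<forall>u\<in>V. segregated (C u) (Op f)" using conv unfolding convex_c_polyhedron_def by (elim conjE) assumption
  thus ?thesis using fu segregated_nonpos by blast
qed

lemma edge_circ_neq: "(u, v) \<in> D \<Longrightarrow> circ (C u) \<noteq> circ (C v)"
  using edge_uncoupled[of u v] by (auto simp: coupled_def cdisk_iff circ_iff)

text \<open>Three consecutive circles of a face are not coaxial, and adjacent circles are different.\<close>

lemma face_independent:
  assumes f: "f \<in> P" "consecutive f u v" "consecutive f v w"
  shows "k u \<noteq> r *\<^sub>R k w + s *\<^sub>R k v"
proof
  assume "k u = r *\<^sub>R k w + s *\<^sub>R k v"
  hence "C u \<in> pencil (C w) (C v)" by (rule pencil_if_combination)
  hence "{C u, C v, C w} \<subseteq> pencil (C w) (C v)" using pencil_self by blast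
  moreover have "circ (C w) \<noteq> circ (C v)" using edge_circ_neq dart_of_face[OF f(1,3)] by metis
  ultimately have "coaxial {C u, C v, C w}" unfolding coaxial_def by blast
  moreover have "\<forall>f\<in>P. \<forall>u v w. consecutive f u v \<and> consecutive f v w \<longrightarrow> \<not> coaxial {C u, C v, C w}"
    using conv unfolding convex_c_polyhedron_def by (elim conjE) assumption
  ultimately show False using f by blast
qed

text \<open>The vertex of the link of \<open>v\<close> that belongs to the neighbour \<open>w\<close>,
  normalized to square 1 or -1.\<close>

definition ev :: "'v \<Rightarrow> 'v \<Rightarrow> real^4" where
  "ev v w = (1 / sqrt \<bar>1 - (lq (k w) (k v))^2\<bar>) *\<^sub>R proj (k v) (k w)"

lemma proj_sq: "lq (proj (k v) (k w)) (proj (k v) (k w)) = 1 - (lq (k w) (k v))^2"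
  unfolding lq_proj_proj[OF kk(1)] by (simp add: kk power2_eq_square)

lemma ev_scale: "(v, w) \<in> D \<Longrightarrow> 1 / sqrt \<bar>1 - (lq (k w) (k v))^2\<bar> > 0"
  using edge_square[OF darts_sym[of v w]] by simp

lemma ev_unit:
  assumes d: "(v, w) \<in> D"
  shows "lq (ev v w) (ev v w) = -1 \<and> fut (ev v w) \<or> lq (ev v w) (ev v w) = 1"
    "lq (ev v w) (ev v w) = sgn (1 - (lq (k w) (k v))^2)"
proof -
  define N where "N = 1 - (lq (k w) (k v))^2"
  define s where "s = 1 / sqrt \<bar>N\<bar>"
  have N: "N \<noteq> 0" using edge_square[OF darts_sym[OF d]] by (simp add: N_def)
  have s: "s > 0" "s * s * \<bar>N\<bar> = 1" using N by (simp_all add: s_def)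
  have l: "lq (ev v w) (ev v w) = s * s * N" unfolding ev_def lq_lin proj_sq by (simp add: N_def s_def)
  show 2: "lq (ev v w) (ev v w) = sgn (1 - (lq (k w) (k v))^2)"
    using s N unfolding l N_def[symmetric] by (cases "N > 0") auto
  show "lq (ev v w) (ev v w) = -1 \<and> fut (ev v w) \<or> lq (ev v w) (ev v w) = 1"
  proof (cases "N > 0")
    case True
    thus ?thesis using 2 by (simp add: N_def)
  next
    case False
    hence neg: "N < 0" using N by simp
    hence "lq (proj (k v) (k w)) (proj (k v) (k w)) < 0" unfolding proj_sq N_def .
    hence "fut (proj (k v) (k w))" by (rule link_vertex_future[OF edge_uncoupled[OF d]])
    hence "fut (ev v w)" using s(1) unfolding ev_def N_def[symmetric] s_def[symmetric]
      by (auto simp: fut_def lq_lin mult_pos_neg)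
    moreover have "lq (ev v w) (ev v w) = -1" using 2 neg by (simp add: N_def)
    ultimately show ?thesis by blast
  qed
qed

lemma ev_orth: "lq (k v) (ev v w) = 0" "lq (k v) (q f) = 0 \<Longrightarrow> lq (ev v w) (q f) = (1 / sqrt \<bar>1 - (lq (k w) (k v))^2\<bar>) * lq (k w) (q f)"
  unfolding ev_def lq_lin by (simp_all add: proj_orth(2)[OF kk(1)] lq_proj)

lemma star_polygon:
  assumes "v \<in> V" "face_cycle P v fs"
  shows "proper_hyperideal_polygon (C v) (map (\<lambda>f. opposite (Op f)) fs)"
  using proper assms unfolding proper_c_polyhedron_def by blast

text \<open>The faces at \<open>v\<close> in cyclic order give the sides, the neighbours of \<open>v\<close> the
  vertices. Side \<open>i\<close> contains the vertices of the neighbours before and after \<open>v\<close> on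
  face \<open>i\<close>.\<close>

lemma star_link:
  assumes v: "v \<in> V" and fc: "face_cycle P v fs" and n: "0 < length fs"
    and w: "\<And>i. i < length fs \<Longrightarrow> consecutive (fs ! i) (w i) v \<and> consecutive (fs ! (Suc i mod length fs)) v (w i)"
  shows "vertex_link (k v) (length fs) (\<lambda>i. q (fs ! (i mod length fs))) (\<lambda>i. ev v (w ((i + length fs - 1) mod length fs)))"
proof -
  define n where "n = length fs"
  define W where "W i = w ((i + n - 1) mod n)" for i
  define F where "F i = fs ! (i mod n)" for i
  have n0: "0 < n" using n by (simp add: n_def)
  have dist: "distinct fs" and sfs: "set fs = {f \<in> P. v \<in> set f}" using fc by (simp_all add: face_cycle_def)
  have md: "i mod n < n" for i using n0 by simp
  have F: "F i \<in> P" "v \<in> set (F i)" "F i \<in> set fs" for i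
    using nth_mem[of "i mod n" fs] md[of i] sfs unfolding F_def n_def by auto
  have WS: "W (Suc i) = w (i mod n)" for i using n0 by (simp add: W_def)
  have c1: "consecutive (F i) (W (Suc i)) v" for i unfolding WS F_def using w[of "i mod n"] md by (simp add: n_def)
  have c2: "consecutive (F i) v (W i)" for i
  proof -
    have "Suc ((i + n - 1) mod n) mod n = Suc (i + n - 1) mod n" by (rule mod_Suc_eq)
    also have "Suc (i + n - 1) = i + n" using n0 by simp
    finally have "Suc ((i + n - 1) mod n) mod n = i mod n" by simp
    thus ?thesis using w[of "(i + n - 1) mod n"] md unfolding F_def W_def n_def by metis
  qed
  have W1: "W i \<in> set (F i)" "W (Suc i) \<in> set (F i)" for i using consecutive_in_set c1 c2 by fast+
  have dW: "(v, W i) \<in> D" for i using dart_of_face[OF F(1) c2] .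
  have WV: "W i \<in> V" for i using darts_V[OF dW] by blast
  have vq: "lq (k v) (q (F i)) = 0" for i by (rule face_orth[OF F(1,2)])
  define Ls where "Ls = map (\<lambda>f. opposite (Op f)) fs"
  have pp: "proper_hyperideal_polygon (C v) Ls" unfolding Ls_def by (rule star_polygon[OF v fc])
  hence hp: "hyperideal_polygon (C v) Ls" by (simp add: proper_hyperideal_polygon_def)
  hence dL: "distinct Ls" by (simp add: hyperideal_polygon_def)
  have LF: "opposite (Op (F i)) \<in> set Ls" for i using F(3)[of i] by (auto simp: Ls_def)
  have cL: "cvec (opposite (Op f)) = - q f" for f by (rule cvec_opposite)
  have n1: "n \<noteq> 1"
  proof
    assume "n = 1"
    hence "F 0 = F 1" "W 0 = W 1" by (simp_all add: F_def W_def)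
    hence cc: "consecutive (F 0) (W 0) v" "consecutive (F 0) v (W 0)" using c1[of 0] c2[of 0] by simp_all
    obtain i j where ij: "i < length (F 0)" "W 0 = F 0 ! i" "v = F 0 ! (Suc i mod length (F 0))"
      "j < length (F 0)" "v = F 0 ! j" "W 0 = F 0 ! (Suc j mod length (F 0))" using cc unfolding consecutive_def by blast
    have l: "3 \<le> length (F 0)" "distinct (F 0)" using face[OF F(1)] by auto
    have "Suc i mod length (F 0) < length (F 0)" "Suc j mod length (F 0) < length (F 0)" using l(1) by (auto intro: mod_less_divisor)
    hence "j = Suc i mod length (F 0)" "i = Suc j mod length (F 0)"
      using ij l(2) nth_eq_iff_index_eq by metis+
    thus False using l ij by (auto simp: mod_Suc split: if_splits)
  qed
  have "vertex_link (k v) n (\<lambda>i. q (F i)) (\<lambda>i. ev v (W i))"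
  proof
    fix i j :: nat and r :: real
    show "lq (k v) (k v) = 1" "lq (q (F i)) (q (F i)) = 1" by (rule kk)+
    show "2 \<le> n" using n0 n1 by simp
    show "q (F (i + n)) = q (F i)" by (simp add: F_def)
    have "i + n + n - 1 = i + n - 1 + n" using n0 by simp
    hence "(i + n + n - 1) mod n = (i + n - 1) mod n" by simp
    thus "ev v (W (i + n)) = ev v (W i)" by (simp add: W_def)
    show "lq (k v) (q (F i)) = 0" by (rule vq)
    show "lq (k v) (ev v (W i)) = 0" by (rule ev_orth)
    show "lq (ev v (W i)) (q (F i)) = 0" "lq (ev v (W (Suc i))) (q (F i)) = 0"
      unfolding ev_orth(2)[OF vq] using face_orth[OF F(1) W1(1)] face_orth[OF F(1) W1(2)] by simp_all
    show "lq (ev v (W i)) (ev v (W i)) = -1 \<and> fut (ev v (W i)) \<or> lq (ev v (W i)) (ev v (W i)) = 1" by (rule ev_unit(1)[OF dW])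
    show "lq (q (F i)) (ev v (W j)) \<le> 0"
    proof -
      have "lq (ev v (W j)) (q (F i)) \<le> 0"
        unfolding ev_orth(2)[OF vq] using face_neg[OF F(1) WV] less_imp_le[OF ev_scale[OF dW]] by (rule mult_nonneg_nonpos[rotated])
      thus ?thesis by (simp add: lq_sym)
    qed
    show "ev v (W (Suc i)) \<noteq> r *\<^sub>R ev v (W i)"
    proof
      assume eq: "ev v (W (Suc i)) = r *\<^sub>R ev v (W i)"
      define s where "s = 1 / sqrt \<bar>1 - (lq (k (W (Suc i))) (k v))^2\<bar>"
      define t where "t = 1 / sqrt \<bar>1 - (lq (k (W i)) (k v))^2\<bar>"
      have s: "s > 0" using ev_scale[OF dW] by (simp only: s_def)
      have "s *\<^sub>R proj (k v) (k (W (Suc i))) = (r * t) *\<^sub>R proj (k v) (k (W i))"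
        using eq by (simp add: ev_def s_def t_def)
      hence "(1 / s) *\<^sub>R s *\<^sub>R proj (k v) (k (W (Suc i))) = (1 / s) *\<^sub>R (r * t) *\<^sub>R proj (k v) (k (W i))" by simp
      hence "proj (k v) (k (W (Suc i))) = (r * t / s) *\<^sub>R proj (k v) (k (W i))" using s by simp
      hence "k (W (Suc i)) = (r * t / s) *\<^sub>R k (W i) + (lq (k (W (Suc i))) (k v) - (r * t / s) * lq (k (W i)) (k v)) *\<^sub>R k v"
        unfolding proj_def by (simp add: algebra_simps)
      thus False using face_independent[OF F(1) c1 c2] by blast
    qed
    show "i mod n = j mod n" if "q (F i) = q (F j) \<or> q (F i) = - q (F j)"
    proof -
      have "q (F i) \<noteq> - q (F j)"
      proof
        assume "q (F i) = - q (F j)"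
        hence "cvec (opposite (Op (F j))) = - cvec (opposite (Op (F i)))" unfolding cL by simp
        thus False using no_opposite_sides[OF pp LF LF] by blast
      qed
      hence "q (F i) = q (F j)" using that by blast
      hence "Op (F i) = Op (F j)" by (rule cvec_inj)
      hence "Ls ! (i mod n) = Ls ! (j mod n)" using md by (simp add: Ls_def F_def n_def)
      thus ?thesis using dL md nth_eq_iff_index_eq[OF dL] by (simp add: Ls_def n_def)
    qed
    show "\<exists>z z'. fut z \<and> fut z' \<and> lq (k v) z = 0 \<and> lq (k v) z' = 0 \<and> (\<forall>r. z' \<noteq> r *\<^sub>R z) \<and>
        lq (q (F i)) z = 0 \<and> lq (q (F i)) z' = 0 \<and> (\<forall>j. lq (q (F j)) z \<le> 0 \<and> lq (q (F j)) z' \<le> 0)"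
    proof -
      obtain z z' where z: "fut z" "fut z'" "lq (k v) z = 0" "lq (k v) z' = 0" "\<forall>r. z' \<noteq> r *\<^sub>R z"
        "lq (cvec (opposite (Op (F i)))) z = 0" "lq (cvec (opposite (Op (F i)))) z' = 0"
        "\<forall>M\<in>set Ls. lq (cvec M) z \<ge> 0 \<and> lq (cvec M) z' \<ge> 0"
        using hyperideal_side_points[OF hp LF[of i]] by blast
      have "lq (q (F j)) z \<le> 0 \<and> lq (q (F j)) z' \<le> 0" for j
        using bspec[OF z(8) LF[of j]] unfolding cL lq_lin by simp
      moreover have "lq (q (F i)) z = 0" "lq (q (F i)) z' = 0" using z(6,7) unfolding cL lq_lin by simp_all
      ultimately show ?thesis using z by blast
    qed
  qed
  thus ?thesis unfolding F_def W_def n_def .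
qed

text \<open>The cyclic order of the faces at \<open>v\<close> is positive, and points on successive sides of the
  link form positively oriented triangles.\<close>

lemma face_orientation:
  assumes f: "f \<in> P" "consecutive f u v" "consecutive f v w"
  shows "vol4 (k v) (k w) (k u) (q f) < 0"
proof -
  have v: "v \<in> V" using f consecutive_in_set unfolding vertex_set_def by fast
  show ?thesis
  proof (rule star[OF v])
    fix fs w'
    assume fc: "face_cycle P v fs" and n: "0 < length fs"
      and w': "\<And>i. i < length fs \<Longrightarrow> consecutive (fs ! i) (w' i) v \<and> consecutive (fs ! (Suc i mod length fs)) v (w' i)"
    define n where "n = length fs"
    define W where "W i = w' ((i + n - 1) mod n)" for i
    define F where "F i = fs ! (i mod n)" for i
    have lk: "vertex_link (k v) n (\<lambda>i. q (F i)) (\<lambda>i. ev v (W i))"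
      using star_link[OF v fc n w'] unfolding F_def W_def n_def .
    obtain phi where phi: "chart (k v) phi" using chart_exists[OF kk(1)] .
    have n3: "3 \<le> n" using vertex_link.n3[OF lk phi] .
    define Ls where "Ls = map (\<lambda>f. opposite (Op f)) fs"
    have pp: "proper_hyperideal_polygon (C v) Ls" unfolding Ls_def by (rule star_polygon[OF v fc])
    hence hp: "hyperideal_polygon (C v) Ls" by (simp add: proper_hyperideal_polygon_def)
    hence "\<exists>x. (\<forall>i<length Ls. x i \<in> hside (C v) Ls (Ls ! i)) \<and>
          (\<forall>i j k. i < j \<and> j < k \<and> k < length Ls \<longrightarrow> hleft (C v) (x i) (x j) (x k))"
      unfolding hyperideal_polygon_def by (elim conjE) assumption
    then obtain x where xx: "(\<forall>i<length Ls. x i \<in> hside (C v) Ls (Ls ! i)) \<and>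
          (\<forall>i j k. i < j \<and> j < k \<and> k < length Ls \<longrightarrow> hleft (C v) (x i) (x j) (x k))" by (rule exE)
    have len: "length Ls = n" by (simp add: Ls_def n_def)
    have x: "\<And>i. i < n \<Longrightarrow> x i \<in> hside (C v) Ls (Ls ! i)"
      and hl: "\<And>i j k. i < j \<Longrightarrow> j < k \<Longrightarrow> k < n \<Longrightarrow> hleft (C v) (x i) (x j) (x k)" using xx unfolding len by blast+
    have dist: "distinct fs" and sfs: "set fs = {f \<in> P. v \<in> set f}" using fc by (simp_all add: face_cycle_def)
    have cL: "cvec (opposite (Op f)) = - q f" for f by (rule cvec_opposite)
    have Fs: "F i \<in> set fs" for i unfolding F_def n_def using n by simp
    have vq: "lq (k v) (q (F i)) = 0" for i using face_orth[of "F i" v] Fs[of i] sfs by blast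
    have zz: "lq (k v) (proj (k v) (hat (x i))) = 0 \<and> lq (q (F i)) (proj (k v) (hat (x i))) = 0 \<and> (\<forall>j. lq (q (F j)) (proj (k v) (hat (x i))) \<le> 0)"
      if i: "i < 3" for i
    proof -
      have i: "i < n" using i n3 by simp
      have Li: "Ls ! i = opposite (Op (F i))" using i by (simp add: Ls_def F_def n_def)
      have pq: "lq (q (F j)) (proj (k v) (hat (x i))) = lq (q (F j)) (hat (x i))" for j
        using lq_proj[OF vq[of j], of "hat (x i)"] by (simp add: lq_sym)
      have "lq (cvec (Ls ! i)) (hat (x i)) = 0" by (rule hside_point(2)[OF x[OF i]])
      hence 1: "lq (q (F i)) (hat (x i)) = 0" unfolding Li cL lq_lin by simp
      have "opposite (Op (F j)) \<in> set Ls" for j using Fs[of j] by (auto simp: Ls_def)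
      hence "lq (cvec (opposite (Op (F j)))) (hat (x i)) \<ge> 0" for j by (rule hside_point(3)[OF x[OF i]])
      hence 2: "lq (q (F j)) (hat (x i)) \<le> 0" for j unfolding cL lq_lin by simp
      show ?thesis unfolding pq using 1 2 proj_orth(2)[OF kk(1)] by simp
    qed
    have "vol4 (k v) (hat (x 0)) (hat (x 1)) (hat (x 2)) > 0" by (rule hleft_vol4, rule hl) (use n3 in simp_all)
    hence "vol4 (k v) (proj (k v) (hat (x 0))) (proj (k v) (hat (x 1))) (proj (k v) (hat (x 2))) > 0"
      by (simp add: proj_def vol4_expand algebra_simps)
    from vertex_link.oriented[OF lk phi, of "\<lambda>i. proj (k v) (hat (x i))", OF zz this]
    have neg: "vol4 (k v) (ev v (W i)) (ev v (W (Suc i))) (q (F i)) < 0" for i by simp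
    have "f \<in> set fs" using sfs f consecutive_in_set by fast
    then obtain i where i: "i < n" "f = fs ! i" by (metis in_set_conv_nth n_def)
    have Fi: "F i = f" using i by (simp add: F_def)
    have "W (Suc i) = w' i" using i by (simp add: W_def)
    hence c1: "consecutive f (W (Suc i)) v" using w'[of i] i by (simp add: n_def)
    define j where "j = (i + n - 1) mod n"
    have "Suc j mod n = Suc (i + n - 1) mod n" unfolding j_def by (rule mod_Suc_eq)
    also have "Suc (i + n - 1) = i + n" using i by simp
    finally have "Suc j mod n = i" "j < n" using i by (simp_all add: j_def)
    moreover have "W i = w' j" by (simp add: W_def j_def)
    ultimately have c2: "consecutive f v (W i)" using w'[of j] i by (simp add: n_def)
    have dist_f: "distinct f" using face[OF f(1)] by blast
    have WS: "W (Suc i) = u" "W i = w"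
      using consecutive_prev_unique[OF dist_f c1 f(2)] consecutive_next_unique[OF dist_f c2 f(3)] .
    have duw: "(v, u) \<in> D" "(v, w) \<in> D" using dart_of_face[OF f(1,2)] darts_sym dart_of_face[OF f(1,3)] by blast+
    define s where "s = 1 / sqrt \<bar>1 - (lq (k u) (k v))^2\<bar>"
    define t where "t = 1 / sqrt \<bar>1 - (lq (k w) (k v))^2\<bar>"
    have st: "s > 0" "t > 0" using ev_scale[OF duw(1)] ev_scale[OF duw(2)] by (simp_all only: s_def t_def)
    have pv: "vol4 (k v) (proj (k v) x) (proj (k v) y) z = vol4 (k v) x y z" for x y z
      by (simp add: proj_def vol4_expand algebra_simps)
    have "vol4 (k v) (ev v w) (ev v u) (q f) < 0" using neg[of i] unfolding WS Fi .
    hence "t * (s * vol4 (k v) (k w) (k u) (q f)) < 0"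
      unfolding ev_def s_def[symmetric] t_def[symmetric] vol4_lin pv by (simp add: mult.left_commute)
    thus ?thesis using st by (simp add: mult_less_0_iff)
  qed
qed

end

section \<open>Equal angles and the spread of a congruence\<close>

context circle_polyhedron
begin

lemma adjacent_distinct:
  assumes d: "d \<in> D"
  shows "q (lf d) \<noteq> q (lf (rv d))" "q (lf d) \<noteq> - q (lf (rv d))"
proof -
  obtain v x where vx: "d = (v, x)" by (cases d)
  have v: "v \<in> V" using darts_V d vx by blast
  have "\<not> (q (lf d) = q (lf (rv d)) \<or> q (lf d) = - q (lf (rv d)))"
  proof (rule star[OF v])
    fix fs w
    assume fc: "face_cycle P v fs" and n: "0 < length fs"
      and w: "\<And>i. i < length fs \<Longrightarrow> consecutive (fs ! i) (w i) v \<and> consecutive (fs ! (Suc i mod length fs)) v (w i)"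
      and r: "\<And>x. (v, x) \<in> D \<Longrightarrow> \<exists>i<length fs. x = w i"
    obtain i where i: "i < length fs" "x = w i" using r d vx by blast
    have sfs: "set fs = {f \<in> P. v \<in> set f}" using fc by (simp add: face_cycle_def)
    have P: "fs ! i \<in> P" "fs ! (Suc i mod length fs) \<in> P" using nth_mem[of i fs] nth_mem[of "Suc i mod length fs" fs] i n sfs by auto
    have l: "lf d = fs ! (Suc i mod length fs)" "lf (rv d) = fs ! (i mod length fs)"
      using lf_eq[OF P(2)] lf_eq[OF P(1)] w[OF i(1)] i by (simp_all add: vx)
    have lk: "vertex_link (k v) (length fs) (\<lambda>i. q (fs ! (i mod length fs))) (\<lambda>i. ev v (w ((i + length fs - 1) mod length fs)))"
      by (rule star_link[OF v fc n w])
    obtain phi where phi: "chart (k v) phi" using chart_exists[OF kk(1)] .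
    have "Suc i mod length fs \<noteq> i mod length fs"
      using mod_neq[of i "Suc i" "length fs"] vertex_link.n3[OF lk phi] by simp
    thus ?thesis using vertex_link.dist[OF lk, of "Suc i" i] unfolding l by blast
  qed
  thus "q (lf d) \<noteq> q (lf (rv d))" "q (lf d) \<noteq> - q (lf (rv d))" by blast+
qed

text \<open>The label of a dart is \<open>s\<close>; up to positive factors it is the \<open>gain\<close> at the
  corresponding vertex of the link, seen from either end of the edge.\<close>

theorem equal_angles:
  assumes Y: "circle_polyhedron P C' Op'"
    and gram: "\<And>f u v. f \<in> P \<Longrightarrow> u \<in> set f \<Longrightarrow> v \<in> set f \<Longrightarrow> lq (k u) (k v) = lq (cvec (C' u)) (cvec (C' v))"
    and d0: "d0 \<in> D"
  shows "lq (q (lf d0)) (q (lf (rv d0))) = lq (cvec (Op' (lf d0))) (cvec (Op' (lf (rv d0))))"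
proof (rule ccontr)
  assume ne: "\<not> ?thesis"
  let ?k' = "\<lambda>u. cvec (C' u)" and ?q' = "\<lambda>f. cvec (Op' f)"
  define \<Delta> where "\<Delta> f g = lq (?q' f) (?q' g) - lq (q f) (q g)" for f g
  define s where "s d = ((lq (k (snd d)) (k (fst d)))^2 - 1) * \<Delta> (lf (rv d)) (lf d)" for d
  define N where "N = {d \<in> D. s d \<noteq> 0}"
  have s_rv: "s (rv d) = s d" for d
    using lq_sym[of "k (snd d)" "k (fst d)"] lq_sym[of "q (lf d)" "q (lf (rv d))"] lq_sym[of "?q' (lf d)" "?q' (lf (rv d))"]
    by (simp add: s_def \<Delta>_def)
  have "s d0 \<noteq> 0"
    using ne edge_square[OF darts_sym[of "fst d0" "snd d0"]] d0 by (simp add: s_def \<Delta>_def lq_sym)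
  hence d0N: "d0 \<in> N" using d0 by (simp add: N_def)
  interpret N: labelled_polyhedron P N
  proof
    show "N \<subseteq> D" by (auto simp: N_def)
    show "N \<noteq> {}" using d0N by blast
    show "rv d \<in> N" if "d \<in> N" for d using that rv_in[of d] s_rv[of d] by (simp add: N_def)
  qed
  show False
  proof (rule N.few_sign_changes[of "\<lambda>d. s d > 0"])
    show "(s (rv d) > 0) = (s d > 0)" for d by (simp add: s_rv)
    fix d assume dN: "d \<in> N"
    obtain v x where vx: "d = (v, x)" by (cases d)
    have dD: "(v, x) \<in> D" using dN vx by (simp add: N_def)
    have v: "v \<in> V" using darts_V[OF dD] by blast
    show "3 \<le> card {e \<in> N.Nv (fst d). (s e > 0) \<noteq> (s (N.nx e) > 0)}"
    proof (rule star[OF v])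
      fix fs w
      assume fc: "face_cycle P v fs" and n: "0 < length fs"
        and w: "\<And>i. i < length fs \<Longrightarrow> consecutive (fs ! i) (w i) v \<and> consecutive (fs ! (Suc i mod length fs)) v (w i)"
        and rw: "\<And>i. i < length fs \<Longrightarrow> (v, w i) \<in> D \<and> rot (v, w i) = (v, w (Suc i mod length fs)) \<and> lf (v, w i) = fs ! (Suc i mod length fs)"
        and r: "\<And>x. (v, x) \<in> D \<Longrightarrow> \<exists>i<length fs. x = w i" and inj: "inj_on w {..<length fs}"
      define n where "n = length fs"
      define W where "W i = w ((i + n - 1) mod n)" for i
      define F where "F i = fs ! (i mod n)" for i
      define e where "e i = ev v (W i)" for i
      define e' where "e' i = circle_polyhedron.ev C' v (W i)" for i
      have n0: "0 < n" using n by (simp add: n_def)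
      have sfs: "set fs = {f \<in> P. v \<in> set f}" using fc by (simp add: face_cycle_def)
      have F: "F i \<in> P" "v \<in> set (F i)" for i
      proof -
        have "F i \<in> set fs" unfolding F_def n_def using n by simp
        thus "F i \<in> P" "v \<in> set (F i)" using sfs by auto
      qed
      have lk: "vertex_link (k v) n (\<lambda>i. q (F i)) e"
        using star_link[OF v fc n w] unfolding F_def W_def n_def e_def .
      have lk': "vertex_link (?k' v) n (\<lambda>i. ?q' (F i)) e'"
        using circle_polyhedron.star_link[OF Y v fc n w] unfolding F_def W_def n_def e'_def .
      have WS: "W (Suc i) = w (i mod n)" for i using n0 by (simp add: W_def)
      have WF: "W (Suc i) \<in> set (F i)" "(v, W (Suc i)) \<in> D" for i
        using w[of "i mod n"] rw[of "i mod n"] n0 consecutive_in_set unfolding WS F_def n_def by fastforce+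
      have WF': "W i \<in> set (F i)" "(v, W i) \<in> D" for i
      proof -
        define j where "j = (i + n - 1) mod n"
        have j: "j < n" using n0 by (simp add: j_def)
        have "Suc j mod n = Suc (i + n - 1) mod n" unfolding j_def by (rule mod_Suc_eq)
        also have "Suc (i + n - 1) = i + n" using n0 by simp
        finally have "Suc j mod n = i mod n" by simp
        moreover have "W i = w j" by (simp add: W_def j_def)
        ultimately have "consecutive (F i) v (W i)" "(v, W i) \<in> D" using w[of j] rw[of j] j by (simp_all add: F_def n_def)
        thus "W i \<in> set (F i)" "(v, W i) \<in> D" using consecutive_in_set by fast+
      qed
      define g where "g i = - lq (e (Suc i)) (e (Suc i)) * (lq (?q' (F i)) (?q' (F (Suc i))) - lq (q (F i)) (q (F (Suc i))))" for i
      have S1: "lq (e i) (e i) = lq (e' i) (e' i)" for i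
        unfolding e_def e'_def ev_unit(2)[OF WF'(2)] circle_polyhedron.ev_unit(2)[OF Y WF'(2)]
        using gram[OF F(1) WF'(1) F(2)] by simp
      have S2: "lq (e i) (e (Suc i)) = lq (e' i) (e' (Suc i))" for i
        unfolding e_def e'_def ev_def circle_polyhedron.ev_def[OF Y] lq_lin lq_proj_proj[OF cvec_sq]
          gram[OF F(1) WF'(1) F(2)] gram[OF F(1) WF(1) F(2)] gram[OF F(1) WF'(1) WF(1)] ..
      have sg: "s (v, w i) = \<bar>1 - (lq (k (w i)) (k v))^2\<bar> * g i" "\<bar>1 - (lq (k (w i)) (k v))^2\<bar> > 0" if i: "i < n" for i
      proof -
        define z where "z = 1 - (lq (k (w i)) (k v))^2"
        have wi: "W (Suc i) = w i" using i WS by simp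
        have ri: "(v, w i) \<in> D" "lf (v, w i) = F (Suc i)" using rw[of i] i by (simp_all add: n_def F_def)
        have "fs ! i \<in> P" using F(1)[of i] i by (simp add: F_def)
        hence li: "lf (w i, v) = F i" using lf_eq w[of i] i by (simp add: F_def n_def)
        have "lq (e (Suc i)) (e (Suc i)) = sgn (1 - (lq (k (W (Suc i))) (k v))^2)"
          unfolding e_def by (rule ev_unit(2)[OF WF'(2)])
        hence "lq (e (Suc i)) (e (Suc i)) = sgn z" by (simp only: wi z_def)
        hence gi: "g i = - sgn z * \<Delta> (F i) (F (Suc i))" by (simp add: g_def \<Delta>_def)
        have "s (v, w i) = - z * \<Delta> (F i) (F (Suc i))" by (simp add: s_def z_def ri li)
        also have "\<dots> = \<bar>z\<bar> * g i" unfolding gi using abs_mult_sgn[of z] by (metis mult.assoc mult_minus_left mult_minus_right)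
        finally show "s (v, w i) = \<bar>1 - (lq (k (w i)) (k v))^2\<bar> * g i" by (simp only: z_def)
        show "\<bar>1 - (lq (k (w i)) (k v))^2\<bar> > 0" using edge_square[OF darts_sym[OF ri(1)]] by simp
      qed
      obtain j where j: "j < n" "x = w j" using r[OF dD] by (auto simp: n_def)
      have "g j \<noteq> 0" using dN sg[OF j(1)] by (auto simp: N_def vx j(2))
      then obtain i1 i2 i3 i4 where i: "i1 < i2" "i2 < i3" "i3 < i4" "i4 < n"
         "g i1 * g i2 < 0" "g i2 * g i3 < 0" "g i3 * g i4 < 0"
        using vertex_alternations[OF lk lk' S1 S2 g_def] by blast
      have neg: "s (v, w a) * s (v, w b) < 0" if "a < n" "b < n" "g a * g b < 0" for a b
      proof -
        have "s (v, w a) * s (v, w b) = (\<bar>1 - (lq (k (w a)) (k v))^2\<bar> * \<bar>1 - (lq (k (w b)) (k v))^2\<bar>) * (g a * g b)"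
          unfolding sg(1)[OF that(1)] sg(1)[OF that(2)] by (simp only: ac_simps)
        moreover have "\<bar>1 - (lq (k (w a)) (k v))^2\<bar> * \<bar>1 - (lq (k (w b)) (k v))^2\<bar> > 0"
          using sg(2)[OF that(1)] sg(2)[OF that(2)] by (rule mult_pos_pos)
        ultimately show ?thesis using that(3) by (simp only: mult_pos_neg)
      qed
      have in_n: "i1 < n" "i2 < n" "i3 < n" using i by linarith+
      have "3 \<le> card {e \<in> N.Nv v. (s e > 0) \<noteq> (s (N.nx e) > 0)}"
      proof (rule N.alternations_give_changes[OF _ v])
        show "d \<in> N \<longleftrightarrow> s d \<noteq> 0" if "d \<in> D" for d using that by (simp add: N_def)
        show "(v, w i) \<in> D \<and> rot (v, w i) = (v, w (Suc i mod n))" if "i < n" for i using rw[of i] that by (simp add: n_def)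
        show "inj_on w {..<n}" using inj by (simp add: n_def)
      qed (use i neg in_n in blast)+
      thus ?thesis by (simp add: vx)
    qed
  qed
qed

end

lemma vol4_nondegenerate:
  assumes v: "vol4 a b c d \<noteq> 0" and y: "lq a y = 0" "lq b y = 0" "lq c y = 0" "lq d y = 0"
  shows "y = 0"
proof -
  define z where "z = vec4 (vector [y$1, y$2, y$3]) (- y$4)"
  have zn: "z$1 = y$1" "z$2 = y$2" "z$3 = y$3" "z$4 = - y$4" by (simp_all add: z_def)
  have "rows4 a b c d *v z = 0"
    unfolding vec_eq_4 matrix_vector_mult_def using y by (simp add: sum_4 zn lq_def)
  moreover have "invertible (rows4 a b c d)" using v by (simp add: vol4_def invertible_det_nz)
  ultimately have "z = 0" using matrix_left_invertible_ker[of "rows4 a b c d"] invertible_left_inverse by blast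
  thus ?thesis using zn by (simp add: vec_eq_4)
qed

text \<open>The vectors orthogonal to \<open>a\<close>, \<open>b\<close> and \<open>p\<close> form a line,
  spanned by the component \<open>m\<close> of \<open>w\<close> orthogonal to \<open>a\<close> and
  \<open>b\<close>; it is not null because the form is nondegenerate.\<close>

lemma transversal:
  assumes v: "vol4 b w a p \<noteq> 0" and u: "lq a a = 1" "lq b b = 1" "(lq a b)^2 \<noteq> 1"
    and p: "lq a p = 0" "lq b p = 0" "lq w p = 0"
  obtains m alpha beta where "w = m + alpha *\<^sub>R a + beta *\<^sub>R b" "lq a m = 0" "lq b m = 0" "lq m m \<noteq> 0"
    "\<And>y. lq a y = 0 \<Longrightarrow> lq b y = 0 \<Longrightarrow> lq p y = 0 \<Longrightarrow> \<exists>\<tau>. y = \<tau> *\<^sub>R m"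
proof -
  define g where "g = lq a b"
  define G where "G = 1 - g * g"
  have G: "G \<noteq> 0" using u by (simp add: G_def g_def power2_eq_square)
  define alpha where "alpha = (lq a w - g * lq b w) / G"
  define beta where "beta = (lq b w - g * lq a w) / G"
  define m where "m = w - alpha *\<^sub>R a - beta *\<^sub>R b"
  have ba: "lq b a = g" by (simp add: g_def lq_sym)
  have w: "w = m + alpha *\<^sub>R a + beta *\<^sub>R b" by (simp add: m_def)
  have am: "lq a m = 0" "lq b m = 0"
    unfolding m_def lq_lin u ba g_def[symmetric] alpha_def beta_def using G by (simp_all add: field_simps) (simp_all add: G_def algebra_simps)
  have pm: "lq p m = 0" unfolding m_def lq_lin using p by (simp add: lq_sym)
  have key: "y = 0" if "lq a y = 0" "lq b y = 0" "lq p y = 0" "lq m y = 0" for y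
    by (rule vol4_nondegenerate[OF v]) (use that w in \<open>simp_all add: lq_lin\<close>)
  have mm: "lq m m \<noteq> 0"
  proof
    assume "lq m m = 0"
    hence "m = 0" using key am pm by simp
    hence "w = alpha *\<^sub>R a + beta *\<^sub>R b" using w by simp
    hence "vol4 b w a p = 0" by (simp add: vol4_expand algebra_simps)
    thus False using v by simp
  qed
  have mult: "\<exists>\<tau>. y = \<tau> *\<^sub>R m" if y: "lq a y = 0" "lq b y = 0" "lq p y = 0" for y
  proof -
    have "y - (lq m y / lq m m) *\<^sub>R m = 0" by (rule key) (use y am pm mm in \<open>simp_all add: lq_lin\<close>)
    thus ?thesis by (intro exI[of _ "lq m y / lq m m"]) simp
  qed
  show ?thesis using that[OF w am mm mult] .
qed

text \<open>A reflection ambiguity is resolved by a linear functional that must not be positive.\<close>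

lemma same_side_unique:
  assumes m: "lq m m \<noteq> 0" and eq: "lq (\<tau> *\<^sub>R m) (\<tau> *\<^sub>R m) = lq (\<tau>' *\<^sub>R m) (\<tau>' *\<^sub>R m)"
    and t: "lq t (\<tau> *\<^sub>R m) \<le> 0" "lq t (\<tau>' *\<^sub>R m) \<le> 0" "lq t m \<noteq> 0"
  shows "\<tau> = (\<tau>' :: real)"
proof -
  have "\<tau> * \<tau> = \<tau>' * \<tau>'" using eq m unfolding lq_lin by simp
  hence "\<tau> = \<tau>' \<or> \<tau> = - \<tau>'" by (simp add: square_eq_iff)
  thus ?thesis
  proof
    assume n: "\<tau> = - \<tau>'"
    hence "\<tau>' * lq t m \<ge> 0" "\<tau>' * lq t m \<le> 0" using t unfolding lq_lin by simp_all
    hence "\<tau>' = 0" using t(3) by simp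
    thus ?thesis using n by simp
  qed
qed

context circle_polyhedron
begin

text \<open>Across an edge \<open>uv\<close> the vector of the next ortho-circle, and then each circle of the
  next face, is known up to a reflection that fixes the circles of \<open>u\<close> and \<open>v\<close>.
  Convexity selects the same one of the two possibilities in both polyhedra. The orientation is used for the
  ortho-circle of the initial face only.\<close>

theorem congruence_spreads:
  assumes Y: "circle_polyhedron P C' Op'"
    and gram: "\<And>f u v. f \<in> P \<Longrightarrow> u \<in> set f \<Longrightarrow> v \<in> set f \<Longrightarrow> lq (k u) (k v) = lq (cvec (C' u)) (cvec (C' v))"
    and Lam: "linear Lam" "\<And>x y. lq (Lam x) (Lam y) = lq x y"
    and vol: "delta > 0" "\<And>x y z w. vol4 (Lam x) (Lam y) (Lam z) (Lam w) = delta * vol4 x y z w"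
    and f0: "f0 \<in> P" "\<And>u. u \<in> set f0 \<Longrightarrow> Lam (k u) = cvec (C' u)"
    and u: "u \<in> V"
  shows "Lam (k u) = cvec (C' u)"
proof -
  interpret Y: circle_polyhedron P C' Op' by (rule Y)
  let ?k' = "\<lambda>u. cvec (C' u)" and ?q' = "\<lambda>f. cvec (Op' f)"
  define A where "A = {f \<in> P. Lam (q f) = ?q' f \<and> (\<forall>u\<in>set f. Lam (k u) = ?k' u)}"
  have base: "f0 \<in> A"
  proof -
    obtain v where v: "v \<in> set f0" using face[OF f0(1)] by (cases f0) auto
    obtain a b where ab: "consecutive f0 a v" "consecutive f0 v b" using consecutive_ex[OF v] by blast
    have s: "a \<in> set f0" "b \<in> set f0" using ab consecutive_in_set by fast+
    have v1: "vol4 (k v) (k b) (k a) (q f0) < 0" by (rule face_orientation[OF f0(1) ab])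
    have v2: "vol4 (?k' v) (?k' b) (?k' a) (?q' f0) < 0" by (rule Y.face_orientation[OF f0(1) ab])
    define r where "r = lq (?q' f0) (Lam (q f0))"
    have or: "lq (?k' x) (Lam (q f0)) = 0" if "x \<in> set f0" for x
      using face_orth[OF f0(1) that] Lam(2)[of "k x" "q f0"] f0(2)[OF that] by simp
    have "Lam (q f0) - r *\<^sub>R ?q' f0 = 0"
      by (rule vol4_nondegenerate[of "?k' v" "?k' b" "?k' a" "?q' f0"])
         (use v2 or v s Y.face_orth[OF f0(1)] Y.kk in \<open>simp_all add: lq_lin r_def\<close>)
    hence e: "Lam (q f0) = r *\<^sub>R ?q' f0" by simp
    have "r * r = 1" using Lam(2)[of "q f0" "q f0"] unfolding e lq_lin by (simp add: kk Y.kk)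
    hence "r = 1 \<or> r = -1" by (simp add: square_eq_1_iff)
    moreover have "r * vol4 (?k' v) (?k' b) (?k' a) (?q' f0) = delta * vol4 (k v) (k b) (k a) (q f0)"
      using vol(2)[of "k v" "k b" "k a" "q f0"] unfolding e f0(2)[OF v] f0(2)[OF s(1)] f0(2)[OF s(2)] vol4_lin .
    hence "r * vol4 (?k' v) (?k' b) (?k' a) (?q' f0) < 0" using v1 vol(1) by (simp add: mult_pos_neg)
    hence "r > 0" using v2 by (simp add: mult_less_0_iff)
    ultimately have "r = 1" by auto
    thus ?thesis using e f0 by (simp add: A_def)
  qed
  have "A = P"
  proof (rule faces_connected)
    show "A \<subseteq> P" "A \<noteq> {}" using base by (auto simp: A_def)
    fix d assume d: "d \<in> D" "lf d \<in> A"
    obtain u v where uv: "d = (u, v)" by (cases d)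
    define f where "f = lf d"
    define g where "g = lf (rv d)"
    have f: "f \<in> P" "consecutive f u v" using lf[OF d(1)] by (auto simp: f_def uv)
    have dr: "(v, u) \<in> D" using rv_in[OF d(1)] by (simp add: uv)
    have g: "g \<in> P" "consecutive g v u" using lf[OF dr] by (auto simp: g_def uv)
    have fA: "Lam (q f) = ?q' f" "\<And>x. x \<in> set f \<Longrightarrow> Lam (k x) = ?k' x" using d(2) by (auto simp: A_def f_def)
    have uvf: "u \<in> set f" "v \<in> set f" "u \<in> set g" "v \<in> set g" using f g consecutive_in_set by fast+
    have X: "lq (q f) (q g) = lq (?q' f) (?q' g)" using equal_angles[OF Y gram d(1)] by (simp add: f_def g_def)
    have uw: "lq (?k' u) (?k' u) = 1" "lq (?k' v) (?k' v) = 1" "(lq (?k' u) (?k' v))^2 \<noteq> 1"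
      using Y.kk Y.edge_square d(1) by (auto simp: uv)
    have xV: "x \<in> V" if "x \<in> set f \<or> x \<in> set g" for x using that f g by (auto simp: vertex_set_def)
    have qg: "Lam (q g) = ?q' g"
    proof -
      obtain w where w: "consecutive f v w" using consecutive_ex[OF uvf(2)] by blast
      have wf: "w \<in> set f" using w consecutive_in_set by fast
      have "vol4 (?k' v) (?k' w) (?k' u) (?q' f) \<noteq> 0" using Y.face_orientation[OF f w] by simp
      then obtain m alpha beta where m: "?k' w = m + alpha *\<^sub>R ?k' u + beta *\<^sub>R ?k' v" "lq (?k' u) m = 0" "lq (?k' v) m = 0" "lq m m \<noteq> 0"
        "\<And>y. lq (?k' u) y = 0 \<Longrightarrow> lq (?k' v) y = 0 \<Longrightarrow> lq (?q' f) y = 0 \<Longrightarrow> \<exists>\<tau>. y = \<tau> *\<^sub>R m"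
        by (rule transversal[OF _ uw Y.face_orth[OF f(1) uvf(1)] Y.face_orth[OF f(1) uvf(2)] Y.face_orth[OF f(1) wf]]) blast
      define x where "x = lq (?q' f) (?q' g)"
      have r1: "lq (?k' y) (Lam (q g)) = lq (k y) (q g)" if "y \<in> set f" for y using Lam(2)[of "k y" "q g"] fA(2)[OF that] by simp
      have r2: "lq (?q' f) (Lam (q g)) = x" using Lam(2)[of "q f" "q g"] fA(1) X by (simp add: x_def)
      have sq: "lq (?q' f) (?k' y) = 0" if "y \<in> set f" for y using Y.face_orth[OF f(1) that] by (simp add: lq_sym)
      obtain s where s: "Lam (q g) - x *\<^sub>R ?q' f = s *\<^sub>R m"
        using m(5)[of "Lam (q g) - x *\<^sub>R ?q' f"] r1[OF uvf(1)] r1[OF uvf(2)] r2 face_orth[OF g(1) uvf(3)] face_orth[OF g(1) uvf(4)]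
          Y.face_orth[OF f(1) uvf(1)] Y.face_orth[OF f(1) uvf(2)] Y.kk by (auto simp: lq_lin)
      obtain t where t: "?q' g - x *\<^sub>R ?q' f = t *\<^sub>R m"
        using m(5)[of "?q' g - x *\<^sub>R ?q' f"] Y.face_orth[OF g(1) uvf(3)] Y.face_orth[OF g(1) uvf(4)]
          Y.face_orth[OF f(1) uvf(1)] Y.face_orth[OF f(1) uvf(2)] Y.kk by (auto simp: lq_lin x_def)
      have wm: "lq (?k' w) m = lq m m" unfolding m(1) lq_lin using m(2,3) by simp
      have "s = t"
      proof (rule same_side_unique[OF m(4)])
        have "lq (Lam (q g)) (Lam (q g)) = lq (?q' g) (?q' g)" using Lam(2) kk Y.kk by simp
        thus "lq (s *\<^sub>R m) (s *\<^sub>R m) = lq (t *\<^sub>R m) (t *\<^sub>R m)"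
          unfolding s[symmetric] t[symmetric] lq_lin using r2 lq_sym[of "Lam (q g)" "?q' f"] lq_sym[of "?q' g" "?q' f"] by (simp add: x_def)
        show "lq (?k' w) (s *\<^sub>R m) \<le> 0" unfolding s[symmetric] lq_lin r1[OF wf]
          using face_neg[OF g(1) xV] wf Y.face_orth[OF f(1) wf] by simp
        show "lq (?k' w) (t *\<^sub>R m) \<le> 0" unfolding t[symmetric] lq_lin
          using Y.face_neg[OF g(1) xV] wf Y.face_orth[OF f(1) wf] by simp
        show "lq (?k' w) m \<noteq> 0" using wm m(4) by simp
      qed
      hence "Lam (q g) - x *\<^sub>R ?q' f = ?q' g - x *\<^sub>R ?q' f" using s t by simp
      thus ?thesis by simp
    qed
    have "Lam (k x) = ?k' x" if xg: "x \<in> set g" for x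
    proof -
      obtain w where w: "consecutive g u w" using consecutive_ex[OF uvf(3)] by blast
      have wg: "w \<in> set g" using w consecutive_in_set by fast
      have "vol4 (?k' u) (?k' w) (?k' v) (?q' g) \<noteq> 0" using Y.face_orientation[OF g w] by simp
      moreover have "(lq (?k' v) (?k' u))^2 \<noteq> 1" using uw(3) by (simp add: lq_sym)
      ultimately obtain m alpha beta where m: "?k' w = m + alpha *\<^sub>R ?k' v + beta *\<^sub>R ?k' u" "lq (?k' v) m = 0" "lq (?k' u) m = 0" "lq m m \<noteq> 0"
        "\<And>y. lq (?k' v) y = 0 \<Longrightarrow> lq (?k' u) y = 0 \<Longrightarrow> lq (?q' g) y = 0 \<Longrightarrow> \<exists>\<tau>. y = \<tau> *\<^sub>R m"
        using transversal[OF _ uw(2,1) _ Y.face_orth[OF g(1) uvf(4)] Y.face_orth[OF g(1) uvf(3)] Y.face_orth[OF g(1) wg]] by blast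
      define G where "G = 1 - lq (?k' u) (?k' v) * lq (?k' u) (?k' v)"
      have G: "G \<noteq> 0" using uw(3) by (simp add: G_def power2_eq_square)
      define a where "a = lq (?k' u) (?k' x)"
      define b where "b = lq (?k' v) (?k' x)"
      define h where "h = lq (?k' u) (?k' v)"
      define z where "z = ((a - h * b) / G) *\<^sub>R ?k' u + ((b - h * a) / G) *\<^sub>R ?k' v"
      have Gh: "G = 1 - h * h" by (simp add: G_def h_def)
      have vu: "lq (?k' v) (?k' u) = h" by (simp add: h_def lq_sym)
      have z: "lq (?k' u) z = a" "lq (?k' v) z = b"
        unfolding z_def lq_lin uw vu h_def[symmetric] using G by (simp_all add: field_simps) (simp_all add: Gh algebra_simps)
      have o: "lq (?q' g) z = 0" "lq (?q' f) z = 0"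
        unfolding z_def lq_lin using Y.face_orth[OF g(1)] Y.face_orth[OF f(1)] uvf by (simp_all add: lq_sym)
      have r1: "lq (?k' u) (Lam (k x)) = a" "lq (?k' v) (Lam (k x)) = b"
        using Lam(2)[of "k u" "k x"] Lam(2)[of "k v" "k x"] fA(2)[OF uvf(1)] fA(2)[OF uvf(2)] gram[OF g(1) uvf(3) xg] gram[OF g(1) uvf(4) xg]
        by (simp_all add: a_def b_def)
      have r2: "lq (?q' g) (Lam (k x)) = 0" using Lam(2)[of "q g" "k x"] qg face_orth[OF g(1) xg] by (simp add: lq_sym)
      have r3: "lq (?q' f) (Lam (k x)) \<le> 0" using Lam(2)[of "q f" "k x"] fA(1) face_neg[OF f(1) xV] xg by (simp add: lq_sym)
      obtain s where s: "Lam (k x) - z = s *\<^sub>R m" using m(5)[of "Lam (k x) - z"] r1 r2 z o by (auto simp: lq_lin)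
      obtain t where t: "?k' x - z = t *\<^sub>R m"
        using m(5)[of "?k' x - z"] z o Y.face_orth[OF g(1) xg] by (auto simp: lq_lin a_def b_def lq_sym)
      have "lq z (Lam (k x)) = lq z (?k' x)" unfolding z_def lq_lin r1 by (simp add: a_def b_def)
      hence zz: "lq z (Lam (k x)) = lq z (?k' x)" "lq (Lam (k x)) z = lq (?k' x) z" by (simp_all add: lq_sym)
      have tm: "lq (?q' f) m \<noteq> 0"
      proof
        assume q0: "lq (?q' f) m = 0"
        define r where "r = lq (?q' g) (?q' f)"
        obtain \<tau> where \<tau>: "?q' f - r *\<^sub>R ?q' g = \<tau> *\<^sub>R m"
          using m(5)[of "?q' f - r *\<^sub>R ?q' g"] Y.face_orth[OF f(1) uvf(1)] Y.face_orth[OF f(1) uvf(2)]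
            Y.face_orth[OF g(1) uvf(3)] Y.face_orth[OF g(1) uvf(4)] Y.kk by (auto simp: lq_lin r_def)
        have "m = ?k' w - alpha *\<^sub>R ?k' v - beta *\<^sub>R ?k' u" using m(1) by simp
        hence "lq (?q' g) m = 0" using Y.face_orth[OF g(1) wg] Y.face_orth[OF g(1) uvf(3)] Y.face_orth[OF g(1) uvf(4)]
          by (simp add: lq_lin lq_sym)
        hence "lq (\<tau> *\<^sub>R m) m = 0" unfolding \<tau>[symmetric] lq_lin using q0 by simp
        hence "\<tau> = 0" using m(4) by (simp add: lq_lin)
        hence e: "?q' f = r *\<^sub>R ?q' g" using \<tau> by simp
        have "r * r = 1" using Y.kk(2)[of f] unfolding e lq_lin by (simp add: Y.kk)
        hence "r = 1 \<or> r = -1" by (simp add: square_eq_1_iff)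
        hence "?q' f = ?q' g \<or> ?q' f = - ?q' g" using e by auto
        thus False using Y.adjacent_distinct[OF d(1)] by (simp add: f_def g_def)
      qed
      have "s = t"
      proof (rule same_side_unique[OF m(4) _ _ _ tm])
        have "lq (Lam (k x)) (Lam (k x)) = lq (?k' x) (?k' x)" using Lam(2) kk Y.kk by simp
        thus "lq (s *\<^sub>R m) (s *\<^sub>R m) = lq (t *\<^sub>R m) (t *\<^sub>R m)" unfolding s[symmetric] t[symmetric] lq_lin zz by simp
        show "lq (?q' f) (s *\<^sub>R m) \<le> 0" unfolding s[symmetric] lq_lin o using r3 by simp
        show "lq (?q' f) (t *\<^sub>R m) \<le> 0" unfolding t[symmetric] lq_lin o using Y.face_neg[OF f(1) xV] xg by (simp add: lq_sym)
      qed
      hence "Lam (k x) - z = ?k' x - z" using s t by simp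
      thus ?thesis by simp
    qed
    thus "lf (rv d) \<in> A" using g(1) qg unfolding A_def g_def by blast
  qed
  moreover obtain f where "f \<in> P" "u \<in> set f" using u by (auto simp: vertex_set_def)
  ultimately show ?thesis by (auto simp: A_def)
qed

end

section \<open>Stereographic coordinates\<close>

definition wedge :: "complex \<Rightarrow> complex \<Rightarrow> real" where
  "wedge z w = Re z * Im w - Im z * Re w"

definition cline :: "complex \<Rightarrow> complex \<Rightarrow> complex set" where
  "cline p a = range (\<lambda>t. p + t *\<^sub>R a)"

lemma wedge_solve:
  assumes "wedge a b \<noteq> 0"
  shows "w = (wedge w b / wedge a b) *\<^sub>R a + (wedge a w / wedge a b) *\<^sub>R b"
proof -
  have "wedge a b *\<^sub>R w = wedge w b *\<^sub>R a + wedge a w *\<^sub>R b"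
    by (simp add: complex_eq_iff wedge_def algebra_simps)
  hence "(1 / wedge a b) *\<^sub>R (wedge a b *\<^sub>R w) = (1 / wedge a b) *\<^sub>R (wedge w b *\<^sub>R a + wedge a w *\<^sub>R b)" by simp
  thus ?thesis using assms by (simp add: scaleR_add_right)
qed

lemma wedge_zero:
  assumes "wedge a b = 0" "a \<noteq> 0"
  shows "\<exists>r. b = r *\<^sub>R a"
proof -
  have s: "(Re a)^2 + (Im a)^2 > 0" using assms(2) by (simp add: complex_neq_0)
  define r where "r = (Re a * Re b + Im a * Im b) / ((Re a)^2 + (Im a)^2)"
  have w: "Re a * Im b = Im a * Re b" using assms(1) by (simp add: wedge_def)
  have "((Re a)^2 + (Im a)^2) * Re b = (Re a * Re b + Im a * Im b) * Re a" using w by (simp add: power2_eq_square algebra_simps)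
  moreover have "((Re a)^2 + (Im a)^2) * Im b = (Re a * Re b + Im a * Im b) * Im a" using w by (simp add: power2_eq_square algebra_simps)
  moreover have ne: "(Re a)^2 + (Im a)^2 \<noteq> 0" using s by (metis less_irrefl)
  have "Re b = (((Re a)^2 + (Im a)^2) * Re b) / ((Re a)^2 + (Im a)^2)"
      "Im b = (((Re a)^2 + (Im a)^2) * Im b) / ((Re a)^2 + (Im a)^2)"
    by (simp_all only: nonzero_mult_div_cancel_left[OF ne])
  ultimately have "Re b = r * Re a" "Im b = r * Im a" by (simp_all add: r_def)
  thus ?thesis by (intro exI[of _ r]) (simp add: complex_eq_iff)
qed

lemma wedge_lin: "wedge a (x + y) = wedge a x + wedge a y" "wedge (x + y) a = wedge x a + wedge y a"
  "wedge a (r *\<^sub>R x) = r * wedge a x" "wedge (r *\<^sub>R x) a = r * wedge x a" "wedge a a = 0" "wedge 0 a = 0" "wedge a 0 = 0"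
  "wedge a (x - y) = wedge a x - wedge a y"
  by (simp_all add: wedge_def algebra_simps)

lemma cline_through: "q \<in> cline p a \<Longrightarrow> cline p a = cline q a"
proof -
  assume "q \<in> cline p a"
  then obtain s where s: "q = p + s *\<^sub>R a" by (auto simp: cline_def)
  have "p + t *\<^sub>R a = q + (t - s) *\<^sub>R a" "q + t *\<^sub>R a = p + (t + s) *\<^sub>R a" for t
    unfolding s by (simp_all add: algebra_simps)
  thus ?thesis unfolding cline_def by (metis (no_types, lifting) image_subset_iff rangeI subset_antisym)
qed

lemma cline_disjoint:
  assumes "cline p a \<inter> cline q b = {}"
  shows "wedge a b = 0"
proof (rule ccontr)
  assume "wedge a b \<noteq> 0"
  from wedge_solve[OF this, of "q - p"] obtain s t where "q - p = s *\<^sub>R a + t *\<^sub>R b" by blast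
  hence "p + s *\<^sub>R a = q + (- t) *\<^sub>R b" by (simp add: algebra_simps)
  hence "p + s *\<^sub>R a \<in> cline p a \<inter> cline q b" unfolding cline_def by blast
  thus False using assms by blast
qed

lemma parallel_disjoint:
  assumes "wedge a (q - p) \<noteq> 0"
  shows "cline p a \<inter> cline q a = {}"
proof (rule ccontr)
  assume "\<not> ?thesis"
  then obtain s t where "p + s *\<^sub>R a = q + t *\<^sub>R a" by (auto simp: cline_def)
  hence "q - p = (s - t) *\<^sub>R a" by (simp add: algebra_simps)
  thus False using assms by (simp add: wedge_lin)
qed

text \<open>Parallel lines are disjoint lines, so they stay parallel, and parallelograms go to parallelograms.
  This gives additivity, first for independent vectors. Continuity then gives linearity.\<close>

lemma lines_to_lines_linear:
  fixes g :: "complex \<Rightarrow> complex"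
  assumes inj: "inj g" and g0: "g 0 = 0" and cont: "continuous_on UNIV g"
    and lines: "\<And>p a. a \<noteq> 0 \<Longrightarrow> \<exists>p' a'. a' \<noteq> 0 \<and> g ` cline p a = cline p' a'"
  shows "linear g"
proof -
  have line: "\<exists>a'. a' \<noteq> 0 \<and> g ` cline p a = cline (g p) a'" if "a \<noteq> 0" for p a
  proof -
    obtain p' a' where pa: "a' \<noteq> 0" "g ` cline p a = cline p' a'" using lines \<open>a \<noteq> 0\<close> by blast
    have "p = p + 0 *\<^sub>R a" by simp
    hence "p \<in> cline p a" unfolding cline_def by (rule range_eqI)
    hence "g p \<in> cline p' a'" using pa by blast
    thus ?thesis using pa cline_through by metis
  qed
  have indep: "g (a + b) = g a + g b" if ab: "wedge a b \<noteq> 0" for a b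
  proof -
    have a0: "a \<noteq> 0" "b \<noteq> 0" using ab by (auto simp: wedge_lin)
    obtain a' where a': "a' \<noteq> 0" "g ` cline 0 a = cline 0 a'" using line[OF a0(1), of 0] g0 by auto
    obtain b' where b': "b' \<noteq> 0" "g ` cline 0 b = cline 0 b'" using line[OF a0(2), of 0] g0 by auto
    obtain c where c: "c \<noteq> 0" "g ` cline b a = cline (g b) c" using line[OF a0(1)] by blast
    obtain d where d: "d \<noteq> 0" "g ` cline a b = cline (g a) d" using line[OF a0(2)] by blast
    have "cline 0 a \<inter> cline b a = {}" "cline 0 b \<inter> cline a b = {}"
      using ab by (intro parallel_disjoint; simp add: wedge_def algebra_simps)+
    hence "cline 0 a' \<inter> cline (g b) c = {}" "cline 0 b' \<inter> cline (g a) d = {}"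
      using a'(2) b'(2) c(2) d(2) image_Int[OF inj] by (metis image_empty)+
    hence w: "wedge a' c = 0" "wedge b' d = 0" by (auto intro: cline_disjoint)
    then obtain r s where rs: "c = r *\<^sub>R a'" "d = s *\<^sub>R b'" using wedge_zero a' b' by metis
    have "a = 0 + 1 *\<^sub>R a" "b = 0 + 1 *\<^sub>R b" by simp_all
    hence "a \<in> cline 0 a" "b \<in> cline 0 b" unfolding cline_def by (metis rangeI)+
    hence "g a \<in> cline 0 a'" "g b \<in> cline 0 b'" using a' b' by blast+
    then obtain alpha beta where alpha: "g a = alpha *\<^sub>R a'" "g b = beta *\<^sub>R b'" by (auto simp: cline_def)
    have "a + b = b + 1 *\<^sub>R a" "a + b = a + 1 *\<^sub>R b" by simp_all
    hence "a + b \<in> cline b a" "a + b \<in> cline a b" unfolding cline_def by (metis rangeI)+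
    hence "g (a + b) \<in> cline (g b) c" "g (a + b) \<in> cline (g a) d" using c d by blast+
    then obtain t u where tu: "g (a + b) = g b + t *\<^sub>R c" "g (a + b) = g a + u *\<^sub>R d" by (auto simp: cline_def)
    have ind: "wedge a' b' \<noteq> 0"
    proof
      assume "wedge a' b' = 0"
      then obtain m where m: "b' = m *\<^sub>R a'" using wedge_zero a' by blast
      have "g b = 0 + (beta * m) *\<^sub>R a'" using alpha m by simp
      hence "g b \<in> cline 0 a'" unfolding cline_def by (rule range_eqI)
      hence "g b \<in> g ` cline 0 a" using a' by simp
      hence "b \<in> cline 0 a" using inj by (simp add: inj_image_mem_iff)
      then obtain k where "b = k *\<^sub>R a" by (auto simp: cline_def)
      thus False using ab by (simp add: wedge_lin)
    qed
    have "beta *\<^sub>R b' + (t * r) *\<^sub>R a' = alpha *\<^sub>R a' + (u * s) *\<^sub>R b'" using tu alpha rs by simp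
    hence "wedge (beta *\<^sub>R b' + (t * r) *\<^sub>R a') b' = wedge (alpha *\<^sub>R a' + (u * s) *\<^sub>R b') b'" by simp
    hence "(t * r) * wedge a' b' = alpha * wedge a' b'" by (simp add: wedge_lin)
    hence "t * r = alpha" using ind by simp
    thus ?thesis using tu alpha rs by simp
  qed
  have add: "g (a + b) = g a + g b" for a b
  proof (cases "wedge a b = 0 \<and> a \<noteq> 0 \<and> b \<noteq> 0")
    case True
    define c where "c = Complex (- Im a) (Re a)"
    have ac: "wedge a c \<noteq> 0"
    proof -
      have w: "wedge a c = (Re a)^2 + (Im a)^2" by (simp add: wedge_def c_def power2_eq_square)
      have "(Re a)^2 + (Im a)^2 > 0" using True by (simp add: complex_neq_0)
      thus ?thesis unfolding w by (metis less_irrefl)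
    qed
    obtain r where r: "b = r *\<^sub>R a" using True wedge_zero by blast
    have bc: "wedge b c \<noteq> 0" using r ac True by (simp add: wedge_lin)
    have "g (a + (b + c)) = g a + g (b + c)" by (rule indep) (use ac True in \<open>simp add: wedge_lin\<close>)
    also have "g (b + c) = g b + g c" by (rule indep[OF bc])
    finally have 1: "g (a + b + c) = g a + g b + g c" by (simp add: add.assoc)
    have "g (a + b + c) = g (a + b) + g c"
    proof (cases "a + b = 0")
      case False
      have "a + b = (1 + r) *\<^sub>R a" using r by (simp add: algebra_simps)
      hence "wedge (a + b) c \<noteq> 0" using ac False by (auto simp: wedge_lin)
      thus ?thesis by (rule indep)
    qed (simp add: g0)
    thus ?thesis using 1 by simp
  next
    case False
    thus ?thesis using indep[of a b] g0 by auto
  qed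
  have nat: "g (of_nat n *\<^sub>R x) = of_nat n *\<^sub>R g x" for n x
    by (induction n) (simp_all add: g0 add scaleR_add_left)
  have neg: "g (- x) = - g x" for x using add[of x "- x"] g0 by (simp add: eq_neg_iff_add_eq_0 add.commute)
  have int: "g (of_int m *\<^sub>R x) = of_int m *\<^sub>R g x" for m x
  proof (cases "m \<ge> 0")
    case True
    thus ?thesis using nat[of "nat m" x] by simp
  next
    case False
    thus ?thesis using nat[of "nat (- m)" x] neg[of "of_int (- m) *\<^sub>R x"] by simp
  qed
  have rat: "g (r *\<^sub>R x) = r *\<^sub>R g x" if rQ: "r \<in> \<rat>" for r x
  proof -
    obtain m n :: int where mn: "n > 0" "r = of_int m / of_int n" by (metis Rats_cases' rQ)
    have "of_int n *\<^sub>R g (r *\<^sub>R x) = g (of_int m *\<^sub>R x)" using int[of n "r *\<^sub>R x"] mn by simp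
    also have "\<dots> = of_int n *\<^sub>R (r *\<^sub>R g x)" using int mn by simp
    finally have "real_of_int n *\<^sub>R g (r *\<^sub>R x) = real_of_int n *\<^sub>R (r *\<^sub>R g x)" .
    hence "real_of_int n = 0 \<or> g (r *\<^sub>R x) = r *\<^sub>R g x" by (metis scaleR_cancel_left)
    thus ?thesis using mn(1) by auto
  qed
  have scale: "g (r *\<^sub>R x) = r *\<^sub>R g x" for r x
  proof (rule ccontr)
    assume ne: "g (r *\<^sub>R x) \<noteq> r *\<^sub>R g x"
    define h where "h s = g (s *\<^sub>R x) - s *\<^sub>R g x" for s
    have "continuous_on UNIV (\<lambda>s::real. g (s *\<^sub>R x))"
      by (rule continuous_on_compose2[OF cont]) (auto intro!: continuous_intros)
    hence "continuous_on UNIV h" unfolding h_def by (intro continuous_intros)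
    hence "open (h -` (- {0}))" by (intro open_vimage open_Compl closed_singleton)
    moreover have "r \<in> h -` (- {0})" using ne by (simp add: h_def)
    ultimately obtain e where e: "e > 0" "ball r e \<subseteq> h -` (- {0})" using open_contains_ball by blast
    obtain s where s: "s \<in> \<rat>" "r < s" "s < r + e" using Rats_dense_in_real[of r "r + e"] e by auto
    hence "s \<in> ball r e" by (simp add: dist_real_def)
    hence "h s \<noteq> 0" using e by auto
    thus False using rat[OF s(1)] by (simp add: h_def)
  qed
  show ?thesis by (rule linearI) (simp_all add: add scale)
qed

text \<open>The image of the unit circle is symmetric about the origin, which must therefore be its center.\<close>

lemma circle_to_circle_similarity:
  fixes A :: "complex \<Rightarrow> complex"
  assumes A: "linear A" "surj A" "inj A" and c: "A ` sphere 0 1 = sphere d R"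
  obtains rho where "rho > 0" "\<And>z w. A z \<bullet> A w = rho^2 * (z \<bullet> w)"
proof -
  have orth: "A z \<bullet> d = 0" if z: "norm z = 1" for z
  proof -
    have "A z \<in> sphere d R" "A (- z) \<in> sphere d R" using c z by auto
    hence "norm (A z - d) = R" "norm (- A z - d) = R" using linear_neg[OF A(1)] by (auto simp: dist_norm norm_minus_commute)
    hence "(A z - d) \<bullet> (A z - d) = (- A z - d) \<bullet> (- A z - d)" by (metis dot_square_norm)
    thus ?thesis by (simp add: inner_diff inner_commute)
  qed
  have orth': "A z \<bullet> d = 0" for z
  proof (cases "z = 0")
    case False
    have "z = norm z *\<^sub>R ((1 / norm z) *\<^sub>R z)" using False by simp
    hence "A z = norm z *\<^sub>R A ((1 / norm z) *\<^sub>R z)" using linear_cmul[OF A(1)] by metis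
    thus ?thesis using orth[of "(1 / norm z) *\<^sub>R z"] False by simp
  qed (simp add: linear_0[OF A(1)])
  obtain z where "d = A z" using A(2) by blast
  hence d0: "d = 0" using orth'[of z] by simp
  have one: "norm (A z) = R" if "norm z = 1" for z
  proof -
    have "A z \<in> sphere d R" using c that by auto
    thus ?thesis using d0 by simp
  qed
  have "A 1 \<noteq> 0" using A(3) linear_0[OF A(1)] by (metis injD one_neq_zero)
  hence R: "R > 0" using one[of 1] by (metis norm_one zero_less_norm_iff)
  have nn: "norm (A z) = R * norm z" for z
  proof (cases "z = 0")
    case False
    have "z = norm z *\<^sub>R ((1 / norm z) *\<^sub>R z)" using False by simp
    hence "A z = norm z *\<^sub>R A ((1 / norm z) *\<^sub>R z)" using linear_cmul[OF A(1)] by metis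
    hence "norm (A z) = norm z * norm (A ((1 / norm z) *\<^sub>R z))" by (metis abs_norm_cancel norm_scaleR)
    thus ?thesis using one[of "(1 / norm z) *\<^sub>R z"] False by simp
  qed (simp add: linear_0[OF A(1)])
  have sq: "A z \<bullet> A z = R^2 * (z \<bullet> z)" for z unfolding dot_square_norm nn by (simp add: power_mult_distrib)
  have "A z \<bullet> A w = R^2 * (z \<bullet> w)" for z w
    using sq[of "z + w"] sq[of z] sq[of w] unfolding linear_add[OF A(1)]
    by (simp add: inner_add inner_commute algebra_simps)
  thus ?thesis using that R by blast
qed

text \<open>Every unit space-like vector is an oriented circle.\<close>

lemma cvec_surj:
  assumes "lq c c = 1"
  obtains C where "cvec C = c"
proof -
  obtain p t where c: "c = vec4 p t" using vec4_surj by blast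
  define m where "m = norm p"
  have "m^2 = 1 + t^2" using assms unfolding c space_sq by (simp add: m_def)
  moreover have "1 + t^2 > 0" by (simp add: add_pos_nonneg)
  ultimately have m: "m > 0" "m^2 = 1 + t^2" using m_def by auto
  have "t^2 < m^2" using m by simp
  hence tm: "\<bar>t\<bar> < m" using m(1) power2_less_imp_less[of "\<bar>t\<bar>" m] by simp
  hence t: "-1 < t / m" "t / m < 1" using m by (auto simp: field_simps)
  define r where "r = arccos (t / m)"
  have r: "0 < r" "r < pi" "cos r = t / m" using t arccos_lt_bounded[of "t / m"] by (auto simp: r_def)
  have "1 - (t / m)^2 = (m^2 - t^2) / m^2" using m(1) by (simp add: field_simps)
  also have "\<dots> = (1 / m)^2" using m(2) by (simp add: power_divide)
  finally have "1 - (t / m)^2 = (1 / m)^2" .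
  hence "(sin r)^2 = (1 / m)^2" using r by (simp add: sin_squared_eq)
  hence sr: "sin r = 1 / m" using m r sin_gt_zero[of r] by (simp add: power2_eq_iff_nonneg)
  define C where "C = Abs_ocircle ((1 / m) *\<^sub>R p, r)"
  have "((1 / m) *\<^sub>R p, r) \<in> {(p :: real^3, r :: real). norm p = 1 \<and> 0 < r \<and> r < pi}" using m r by (simp add: m_def)
  hence "Rep_ocircle C = ((1 / m) *\<^sub>R p, r)" unfolding C_def by (rule Abs_ocircle_inverse)
  hence "center C = (1 / m) *\<^sub>R p" "radius C = r" by (simp_all add: center_def radius_def)
  hence "cvec C = c" unfolding c using m r sr by (simp add: cvec_def vec_eq_4)
  thus ?thesis by (rule that)
qed

text \<open>Stereographic projection from \<open>x0\<close>: \<open>M\<close> is the point at infinity,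
  \<open>N\<close> the origin, and \<open>pt z\<close> below is the null vector of the point with coordinate
  \<open>z\<close>.\<close>

locale null_frame =
  fixes x0 :: "real^3" and A B M N :: "real^4"
  assumes x0: "x0 \<in> S2" and M: "M = hat x0"
    and gram: "lq A A = 1" "lq B B = 1" "lq A B = 0" "lq A M = 0" "lq B M = 0" "lq A N = 0" "lq B N = 0"
      "lq M M = 0" "lq N N = 0" "lq M N = -2"
    and comp4: "A $ 4 = 0" "B $ 4 = 0" "N $ 4 = 1"
    and complete: "x = lq x A *\<^sub>R A + lq x B *\<^sub>R B - (lq x N / 2) *\<^sub>R M - (lq x M / 2) *\<^sub>R N"
begin

lemma gram': "lq B A = 0" "lq M A = 0" "lq M B = 0" "lq N A = 0" "lq N B = 0" "lq N M = -2"
  using gram lq_sym by metis+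

definition pt :: "complex \<Rightarrow> real^4" where
  "pt z = (2 * Re z) *\<^sub>R A + (2 * Im z) *\<^sub>R B + (norm z)^2 *\<^sub>R M + N"

definition st :: "complex \<Rightarrow> real^3" where
  "st z = (1 / ((norm z)^2 + 1)) *\<^sub>R (\<chi> i. if i = 1 then pt z $ 1 else if i = 2 then pt z $ 2 else pt z $ 3)"

definition co :: "real^3 \<Rightarrow> complex" where
  "co x = Complex (lq (hat x) A / - lq (hat x) M) (lq (hat x) B / - lq (hat x) M)"

lemma lq_pt: "lq (pt z) A = 2 * Re z" "lq (pt z) B = 2 * Im z" "lq (pt z) M = -2" "lq (pt z) N = -2 * (norm z)^2"
  by (simp_all add: pt_def lq_lin gram gram')

lemma pt_null: "lq (pt z) (pt z) = 0"
proof -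
  have "(norm z)^2 = (Re z)^2 + (Im z)^2" by (simp add: cmod_power2)
  thus ?thesis by (simp add: pt_def lq_lin gram gram' power2_eq_square algebra_simps)
qed

lemma nz1: "(norm z)^2 + 1 > (0::real)" for z :: complex by (simp add: add_nonneg_pos)

lemma pt4: "pt z $ 4 = (norm z)^2 + 1" unfolding pt_def by (simp add: comp4 M)

lemma hat_st: "pt z = ((norm z)^2 + 1) *\<^sub>R hat (st z)"
  using nz1[of z] by (simp add: vec_eq_4 hat_def st_def pt4)

lemma st_S2: "st z \<in> S2"
proof -
  have "((norm z)^2 + 1)^2 * lq (hat (st z)) (hat (st z)) = 0"
    using pt_null[of z] unfolding hat_st lq_lin by (simp add: power2_eq_square)
  hence "lq (hat (st z)) (hat (st z)) = 0" using nz1[of z] by simp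
  hence "(norm (st z))^2 = 1" by (simp add: hat_def space_sq)
  thus ?thesis by (simp add: power2_eq_1_iff) (metis norm_ge_zero not_one_le_zero neg_0_le_iff_le le_minus_one_simps(3))
qed

lemma st_neq: "st z \<noteq> x0"
proof
  assume "st z = x0"
  hence "lq (pt z) M = 0" unfolding hat_st using gram M by (simp add: lq_lin)
  thus False by (simp add: lq_pt)
qed

lemma hat_M_neg: "x \<in> S2 \<Longrightarrow> x \<noteq> x0 \<Longrightarrow> lq (hat x) M < 0"
  unfolding M by (rule hat_hat_neg[OF _ x0])

text \<open>A null vector with nonzero product with \<open>M\<close> is determined by its components along
  \<open>A\<close> and \<open>B\<close>.\<close>

lemma hat_co:
  assumes x: "x \<in> S2" "x \<noteq> x0"
  shows "hat x = (- lq (hat x) M / 2) *\<^sub>R pt (co x)"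
proof -
  define mu where "mu = - lq (hat x) M"
  define a where "a = lq (hat x) A"
  define b where "b = lq (hat x) B"
  define l where "l = lq (hat x) N"
  have mu: "mu > 0" using hat_M_neg[OF x] by (simp add: mu_def)
  have hx: "hat x = a *\<^sub>R A + b *\<^sub>R B - (l / 2) *\<^sub>R M + (mu / 2) *\<^sub>R N"
    using complete[of "hat x"] by (simp add: a_def b_def l_def mu_def)
  have "lq (hat x) (hat x) = a * a + b * b + l * mu"
    unfolding hx lq_lin by (simp add: gram gram' algebra_simps)
  hence n: "a * a + b * b = - l * mu" using hat_null[OF x(1)] by simp
  have co: "co x = Complex (a / mu) (b / mu)" by (simp add: co_def a_def b_def mu_def)
  have "(norm (co x))^2 = (a * a + b * b) / (mu * mu)"
    unfolding co cmod_power2 by (simp add: power2_eq_square add_divide_distrib)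
  also have "\<dots> = - l / mu" unfolding n using mu by simp
  finally have nn: "(norm (co x))^2 = - l / mu" .
  have re: "Re (co x) = a / mu" "Im (co x) = b / mu" by (simp_all add: co)
  have eqn: "(mu / 2) *\<^sub>R pt (co x) = a *\<^sub>R A + b *\<^sub>R B - (l / 2) *\<^sub>R M + (mu / 2) *\<^sub>R N"
    unfolding pt_def nn re using mu by (simp add: scaleR_add_right scaleR_diff_right)
  show ?thesis using trans[OF hx eqn[symmetric]] unfolding mu_def .
qed

lemma st_co: "x \<in> S2 \<Longrightarrow> x \<noteq> x0 \<Longrightarrow> st (co x) = x"
proof -
  assume x: "x \<in> S2" "x \<noteq> x0"
  define k where "k = (- lq (hat x) M / 2) * ((norm (co x))^2 + 1)"
  have e: "hat x = k *\<^sub>R hat (st (co x))" using hat_co[OF x] unfolding hat_st by (simp add: k_def)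
  have "hat x $ 4 = k * hat (st (co x)) $ 4" by (subst e) simp
  hence "k = 1" by simp
  thus ?thesis using e hat_inj[of x "st (co x)"] by simp
qed

lemma co_st: "co (st z) = z"
proof -
  define n where "n = (norm z)^2 + 1"
  have n: "n > 0" using nz1 by (simp add: n_def)
  have e: "hat (st z) = (1 / n) *\<^sub>R pt z" using n unfolding hat_st n_def[symmetric] by simp
  show ?thesis unfolding co_def e lq_lin lq_pt using n by (simp add: complex_eq_iff)
qed

lemma st_inj: "st z = st w \<Longrightarrow> z = w" using co_st by metis

lemma st_cont: "continuous_on UNIV st"
proof -
  have "continuous_on UNIV (\<lambda>z. pt z $ i)" for i unfolding pt_def by (intro continuous_intros)
  note pc = this
  have nz: "(norm z)^2 + 1 \<noteq> (0::real)" for z :: complex using nz1[of z] by linarith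
  have "continuous_on UNIV (\<lambda>z::complex. 1 / ((norm z)^2 + 1))"
    by (intro continuous_intros) (simp add: nz)
  moreover have "continuous_on UNIV (\<lambda>z. (\<chi> i. if i = 1 then pt z $ 1 else if i = 2 then pt z $ 2 else pt z $ 3) :: real^3)"
  proof (rule continuous_on_vec_lambda)
    fix i :: 3
    show "continuous_on UNIV (\<lambda>z. if i = 1 then pt z $ 1 else if i = 2 then pt z $ 2 else pt z $ 3)"
      using pc[of 1] pc[of 2] pc[of 3] by (cases "i = 1"; cases "i = 2"; simp)
  qed
  ultimately show ?thesis unfolding st_def by (rule continuous_on_scaleR)
qed

lemma hat_cont: "continuous_on S hat"
  unfolding hat_def vec4_def
proof (rule continuous_on_vec_lambda)
  fix i :: 4
  have c: "continuous_on S (\<lambda>x::real^3. x $ j)" for j by (intro continuous_intros)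
  show "continuous_on S (\<lambda>x::real^3. if i = 1 then x $ 1 else if i = 2 then x $ 2 else if i = 3 then x $ 3 else 1)"
    using c[of 1] c[of 2] c[of 3] by (cases "i = 1"; cases "i = 2"; cases "i = 3"; simp)
qed

lemma lq_cont: "continuous_on S f \<Longrightarrow> continuous_on S (\<lambda>x. lq (f x) c)"
  unfolding lq_def by (intro continuous_intros)

lemma co_cont: "continuous_on (S2 - {x0}) co"
  unfolding co_def Complex_eq
  by (intro continuous_intros lq_cont hat_cont) (use hat_M_neg in force)+

text \<open>The equation of a circle in the stereographic coordinate; it is linear exactly if the circle passes
  through \<open>x0\<close>.\<close>

lemma circ_pt: "st z \<in> circ C \<longleftrightarrow> 2 * Re z * lq (cvec C) A + 2 * Im z * lq (cvec C) B + (norm z)^2 * lq (cvec C) M + lq (cvec C) N = 0"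
proof -
  have "lq (cvec C) (pt z) = ((norm z)^2 + 1) * lq (cvec C) (hat (st z))" unfolding hat_st lq_lin ..
  hence "st z \<in> circ C \<longleftrightarrow> lq (cvec C) (pt z) = 0" using nz1[of z] st_S2 by (simp add: circ_iff)
  thus ?thesis by (simp add: pt_def lq_lin)
qed

lemma norm_cvec: "(lq (cvec C) A)^2 + (lq (cvec C) B)^2 - lq (cvec C) M * lq (cvec C) N = 1"
proof -
  define c where "c = cvec C"
  have "lq c c = lq c (lq c A *\<^sub>R A + lq c B *\<^sub>R B - (lq c N / 2) *\<^sub>R M - (lq c M / 2) *\<^sub>R N)"
    using complete[of c] by metis
  hence "lq c c = (lq c A)^2 + (lq c B)^2 - lq c M * lq c N" unfolding lq_lin by (simp add: power2_eq_square)
  thus ?thesis using cvec_sq by (simp add: c_def)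
qed

lemma M_circ: "x0 \<in> circ C \<longleftrightarrow> lq (cvec C) M = 0" using x0 by (simp add: circ_iff M)

lemma circ_line:
  assumes "x0 \<in> circ C"
  shows "\<exists>p a. a \<noteq> 0 \<and> {z. st z \<in> circ C} = cline p a"
proof -
  define alpha where "alpha = lq (cvec C) A"
  define beta where "beta = lq (cvec C) B"
  define l where "l = lq (cvec C) N"
  have n: "alpha * alpha + beta * beta = 1" using norm_cvec[of C] assms M_circ by (simp add: alpha_def beta_def power2_eq_square)
  define p where "p = Complex (- alpha * l / 2) (- beta * l / 2)"
  define a where "a = Complex (- beta) alpha"
  have "a \<noteq> 0" using n by (auto simp: a_def complex_eq_iff)
  moreover have "st z \<in> circ C \<longleftrightarrow> z \<in> cline p a" for z
  proof -
    have 1: "st z \<in> circ C \<longleftrightarrow> 2 * Re z * alpha + 2 * Im z * beta + l = 0"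
      using assms by (simp add: circ_pt M_circ alpha_def beta_def l_def)
    show ?thesis
    proof
      assume "st z \<in> circ C"
      hence e: "2 * (Re z * alpha + Im z * beta) = - l" using 1 by simp
      define t where "t = Im z * alpha - Re z * beta"
      have "Re z = (alpha * alpha + beta * beta) * Re z" "Im z = (alpha * alpha + beta * beta) * Im z" using n by simp_all
      hence "Re z = alpha * (Re z * alpha + Im z * beta) - beta * t" "Im z = beta * (Re z * alpha + Im z * beta) + alpha * t"
        by (simp_all add: t_def algebra_simps)
      moreover have "Re z * alpha + Im z * beta = - l / 2" using e by simp
      ultimately have "z = p + t *\<^sub>R a" by (simp add: complex_eq_iff p_def a_def)
      thus "z \<in> cline p a" unfolding cline_def by (rule range_eqI)
    next
      assume "z \<in> cline p a"
      then obtain t where "z = p + t *\<^sub>R a" by (auto simp: cline_def)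
      hence ri: "Re z = - alpha * l / 2 - t * beta" "Im z = - beta * l / 2 + t * alpha" by (simp_all add: p_def a_def)
      have "2 * Re z * alpha + 2 * Im z * beta + l = l - l * (alpha * alpha + beta * beta)" unfolding ri by (simp add: algebra_simps)
      thus "st z \<in> circ C" using 1 n by simp
    qed
  qed
  ultimately show ?thesis by blast
qed

lemma line_circ:
  assumes "a \<noteq> 0"
  shows "\<exists>C. x0 \<in> circ C \<and> {z. st z \<in> circ C} = cline p a"
proof -
  define m where "m = norm a"
  have m: "m > 0" "m * m = Re a * Re a + Im a * Im a" using assms by (simp_all add: m_def cmod_power2 flip: power2_eq_square)
  define alpha where "alpha = - Im a / m"
  define beta where "beta = Re a / m"
  define l where "l = - 2 * (alpha * Re p + beta * Im p)"
  have e: "alpha * alpha + beta * beta = (Re a * Re a + Im a * Im a) / (m * m)" by (simp add: alpha_def beta_def add_divide_distrib)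
  have n: "alpha * alpha + beta * beta = 1" unfolding e m(2)[symmetric] using m(1) by simp
  define c where "c = alpha *\<^sub>R A + beta *\<^sub>R B - (l / 2) *\<^sub>R M"
  have "lq c c = 1" unfolding c_def lq_lin using n by (simp add: gram gram')
  then obtain C where C: "cvec C = c" by (rule cvec_surj)
  have cc: "lq c A = alpha" "lq c B = beta" "lq c M = 0" "lq c N = l" unfolding c_def lq_lin by (simp_all add: gram gram')
  have "st z \<in> circ C \<longleftrightarrow> z \<in> cline p a" for z
  proof -
    have "2 * Re z * alpha + 2 * Im z * beta + (norm z)^2 * 0 + l = 2 * (alpha * (Re z - Re p) + beta * (Im z - Im p))"
      by (simp add: l_def algebra_simps)
    moreover have "alpha * (Re z - Re p) + beta * (Im z - Im p) = wedge a (z - p) / m"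
      using m(1) by (simp add: alpha_def beta_def wedge_def field_simps)
    ultimately have "st z \<in> circ C \<longleftrightarrow> 2 * (wedge a (z - p) / m) = 0" unfolding circ_pt C cc by simp
    also have "\<dots> \<longleftrightarrow> wedge a (z - p) = 0" using m(1) by simp
    also have "\<dots> \<longleftrightarrow> z \<in> cline p a"
    proof
      assume "wedge a (z - p) = 0"
      then obtain r where "z - p = r *\<^sub>R a" using wedge_zero assms by blast
      hence "z = p + r *\<^sub>R a" by (simp add: algebra_simps)
      thus "z \<in> cline p a" unfolding cline_def by (rule range_eqI)
    qed (auto simp: cline_def wedge_lin)
    finally show ?thesis .
  qed
  moreover have "x0 \<in> circ C" unfolding M_circ C by (rule cc)
  ultimately show ?thesis by blast
qed

lemma unit_circ: "\<exists>C. x0 \<notin> circ C \<and> {z. st z \<in> circ C} = sphere 0 1"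
proof -
  define c where "c = (1/2) *\<^sub>R N - (1/2) *\<^sub>R M"
  have "lq c c = 1" unfolding c_def lq_lin by (simp add: gram gram')
  then obtain C where C: "cvec C = c" by (rule cvec_surj)
  have cc: "lq c A = 0" "lq c B = 0" "lq c M = -1" "lq c N = 1" unfolding c_def lq_lin by (simp_all add: gram gram')
  have "{z. st z \<in> circ C} = sphere 0 1" unfolding circ_pt C cc by (auto simp: power2_eq_1_iff) (metis norm_ge_zero not_one_le_zero neg_0_le_iff_le le_minus_one_simps(3))
  moreover have "x0 \<notin> circ C" unfolding M_circ C cc by simp
  ultimately show ?thesis by blast
qed

lemma circ_sphere:
  assumes "x0 \<notin> circ C"
  shows "\<exists>d R. {z. st z \<in> circ C} = sphere d R"
proof -
  define alpha where "alpha = lq (cvec C) A"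
  define beta where "beta = lq (cvec C) B"
  define l where "l = lq (cvec C) N"
  define m where "m = lq (cvec C) M"
  have m: "m \<noteq> 0" using assms by (simp add: M_circ m_def)
  have n: "alpha * alpha + beta * beta - m * l = 1" using norm_cvec[of C] by (simp add: alpha_def beta_def l_def m_def power2_eq_square)
  define d where "d = Complex (- alpha / m) (- beta / m)"
  have "st z \<in> circ C \<longleftrightarrow> z \<in> sphere d (1 / \<bar>m\<bar>)" for z
  proof -
    have s: "m * m * (norm (z - d))^2 = m * (2 * Re z * alpha + 2 * Im z * beta + (norm z)^2 * m + l) + 1"
    proof -
      have "m * m * (norm (z - d))^2 = (m * Re z + alpha)^2 + (m * Im z + beta)^2"
        unfolding cmod_power2 using m by (simp add: d_def power2_eq_square field_simps)
      also have "\<dots> = m * (2 * Re z * alpha + 2 * Im z * beta + (norm z)^2 * m + l) + 1"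
        unfolding cmod_power2 using n by (simp add: power2_eq_square algebra_simps)
      finally show ?thesis .
    qed
    have "st z \<in> circ C \<longleftrightarrow> m * (2 * Re z * alpha + 2 * Im z * beta + (norm z)^2 * m + l) = 0"
      using m by (simp add: circ_pt alpha_def beta_def l_def m_def)
    also have "\<dots> \<longleftrightarrow> (\<bar>m\<bar> * norm (z - d))^2 = 1^2"     proof -
      have sq: "(\<bar>m\<bar> * norm (z - d))^2 = m * m * (norm (z - d))^2" by (simp add: power_mult_distrib power2_eq_square)
      show ?thesis unfolding sq s by simp
    qed
    also have "\<dots> \<longleftrightarrow> \<bar>m\<bar> * norm (z - d) = 1" by (intro power2_eq_iff_nonneg) simp_all
    also have "\<dots> \<longleftrightarrow> z \<in> sphere d (1 / \<bar>m\<bar>)" using m by (auto simp: dist_norm norm_minus_commute field_simps)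
    finally show ?thesis .
  qed
  thus ?thesis by blast
qed

end

lemma null_frame_exists:
  assumes x0: "x0 \<in> S2"
  obtains A B M N where "null_frame x0 A B M N"
proof -
  obtain a where a: "a \<bullet> a = 1" "x0 \<bullet> a = 0" by (rule unit_orthogonal3)
  have u: "x0 \<bullet> x0 = 1" using x0 by (simp add: norm_eq_1)
  define b where "b = cross3 x0 a"
  have b: "b \<bullet> x0 = 0" "b \<bullet> a = 0" "x0 \<bullet> b = 0" "a \<bullet> b = 0" by (simp_all add: b_def dot_cross_self)
  have "b \<bullet> b = (x0 \<bullet> x0) * (a \<bullet> a) - (x0 \<bullet> a)^2" unfolding b_def inner3 cross_components by algebra
  hence bb: "b \<bullet> b = 1" using u a by simp
  have "null_frame x0 (vec4 a 0) (vec4 b 0) (hat x0) (hat (- x0))"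
  proof
    fix x :: "real^4"
    obtain q s where x: "x = vec4 q s" using vec4_surj by blast
    have q: "q = (q \<bullet> x0) *\<^sub>R x0 + (q \<bullet> a) *\<^sub>R a + (q \<bullet> b) *\<^sub>R b"
      unfolding b_def by (rule orthonormal3[OF u a])
    let ?r = "lq x (vec4 a 0) *\<^sub>R vec4 a 0 + lq x (vec4 b 0) *\<^sub>R vec4 b 0 - (lq x (hat (- x0)) / 2) *\<^sub>R hat x0 - (lq x (hat x0) / 2) *\<^sub>R hat (- x0)"
    have "?r = vec4 ((q \<bullet> x0) *\<^sub>R x0 + (q \<bullet> a) *\<^sub>R a + (q \<bullet> b) *\<^sub>R b) s"
      unfolding x hat_def lq_vec4 vec_eq_4 by (simp add: field_simps)
    thus "x = ?r"
      using q x by metis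
  qed (use x0 u a b bb in \<open>simp_all add: hat_def lq_vec4 inner_commute\<close>)
  thus ?thesis by (rule that)
qed

text \<open>The cross product of two tangent vectors at \<open>X\<close> is a multiple of \<open>X\<close>.\<close>

lemma cross_tangent:
  fixes X U V W :: "real^3"
  assumes "X \<bullet> X = 1" "X \<bullet> U = 0" "X \<bullet> V = 0"
  shows "W \<bullet> cross3 U V = (W \<bullet> X) * (X \<bullet> cross3 U V)"
proof -
  define Y where "Y = cross3 U V"
  have "cross3 X Y = 0" unfolding Y_def Lagrange using assms by simp
  hence "cross3 X (cross3 X Y) = 0" by simp
  hence "(X \<bullet> Y) *\<^sub>R X = Y" unfolding Lagrange using assms by simp
  hence "W \<bullet> Y = W \<bullet> ((X \<bullet> Y) *\<^sub>R X)" by simp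
  thus ?thesis by (simp add: Y_def mult.commute)
qed

lemma ocircle_eqI:
  assumes circ: "circ C = circ B" and disk: "cdisk C = cdisk B"
  shows "C = B"
proof -
  define p where "p = center C"
  define r where "r = radius C"
  define p' where "p' = center B"
  define r' where "r' = radius B"
  have r: "0 < r" "r < pi" "0 < r'" "r' < pi" "sin r > 0" using center_radius sin_radius by (auto simp: r_def r'_def)
  have p: "p \<bullet> p = 1" "p' \<bullet> p' = 1" using center_sq by (simp_all add: p_def p'_def)
  have key: "p' \<bullet> a = 0 \<and> cos r * (p \<bullet> p') = cos r'" if a: "a \<bullet> a = 1" "p \<bullet> a = 0" for a
  proof -
    have "cos r *\<^sub>R p + s *\<^sub>R a \<in> circ C" if s: "s * s = sin r * sin r" for s
    proof -
      have "(cos r *\<^sub>R p + s *\<^sub>R a) \<bullet> (cos r *\<^sub>R p + s *\<^sub>R a) = cos r * cos r + sin r * sin r"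
        using a p s by (simp add: inner_add inner_commute)
      moreover have "cos r * cos r + sin r * sin r = 1" using sin_cos_squared_add[of r] by (simp add: power2_eq_square)
      ultimately have "cos r *\<^sub>R p + s *\<^sub>R a \<in> S2" by (simp add: norm_eq_1)
      moreover have "(cos r *\<^sub>R p + s *\<^sub>R a) \<bullet> p = cos r" using a p by (simp add: inner_add inner_commute)
      ultimately show ?thesis by (simp add: circ_def p_def r_def)
    qed
    from this[of "sin r"] this[of "- sin r"]
    have "(cos r *\<^sub>R p + sin r *\<^sub>R a) \<bullet> p' = cos r'" "(cos r *\<^sub>R p + (- sin r) *\<^sub>R a) \<bullet> p' = cos r'"
      unfolding circ by (auto simp: circ_def p'_def r'_def)
    hence e: "cos r * (p \<bullet> p') + sin r * (a \<bullet> p') = cos r'" "cos r * (p \<bullet> p') - sin r * (a \<bullet> p') = cos r'"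
      by (simp_all add: inner_add_left inner_diff_left)
    hence "sin r * (a \<bullet> p') = 0" "cos r * (p \<bullet> p') = cos r'" by linarith+
    thus ?thesis using r by (simp add: inner_commute)
  qed
  obtain a where a: "a \<bullet> a = 1" "p \<bullet> a = 0" by (rule unit_orthogonal3)
  have b: "cross3 p a \<bullet> cross3 p a = 1" "p \<bullet> cross3 p a = 0"
  proof -
    have "cross3 p a \<bullet> cross3 p a = (p \<bullet> p) * (a \<bullet> a) - (p \<bullet> a)^2" unfolding inner3 cross_components by algebra
    thus "cross3 p a \<bullet> cross3 p a = 1" using p a by simp
    show "p \<bullet> cross3 p a = 0" by (simp add: dot_cross_self)
  qed
  have "p' = (p' \<bullet> p) *\<^sub>R p" using orthonormal3[OF p(1) a, of p'] key[OF a] key[OF b] by simp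
  moreover define eps where "eps = p' \<bullet> p"
  ultimately have pe: "p' = eps *\<^sub>R p" by simp
  hence "eps * eps = 1" using p by simp
  hence "eps = 1 \<or> eps = -1" by (simp add: square_eq_1_iff)
  moreover have cr: "cos r' = eps * cos r" using key[OF a] by (simp add: eps_def inner_commute mult.commute)
  moreover have "eps \<noteq> -1"
  proof
    assume e: "eps = -1"
    have "p \<in> cdisk C" using p by (simp add: cdisk_def norm_eq_1 flip: p_def r_def)
    hence "p \<bullet> p' \<ge> cos r'" unfolding disk by (simp add: cdisk_def p'_def r'_def)
    hence "cos r \<ge> 1" using cr e pe p by simp
    moreover have "cos r < 1" using r cos_monotone_0_pi[of 0 r] by simp
    ultimately show False by simp
  qed
  ultimately have "p' = p" "cos r' = cos r" using pe by auto
  hence "r' = r" using r by (metis cos_inj_pi less_imp_le)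
  hence "Rep_ocircle C = Rep_ocircle B" using \<open>p' = p\<close> by (simp add: p_def p'_def r_def r'_def center_def radius_def prod_eq_iff)
  thus ?thesis by (simp add: Rep_ocircle_inject)
qed

section \<open>Moebius transformations are Lorentz transformations\<close>

definition sp :: "real^4 \<Rightarrow> real^3" where
  "sp v = (\<chi> i. if i = 1 then v $ 1 else if i = 2 then v $ 2 else v $ 3)"

lemma sp_vec4: "vec4 (sp v) (v $ 4) = v" "sp (vec4 p t) = p"
  by (simp_all add: vec_eq_4 sp_def vec_eq_iff forall_3)

lemma sp_lin: "sp (x + y) = sp x + sp y" "sp (r *\<^sub>R x) = r *\<^sub>R sp x"
  by (simp_all add: sp_def vec_eq_iff)

text \<open>Differentiate \<open>Lam (hat y) = k y *\<^sub>R hat (T y)\<close> along the great circle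
  through \<open>x\<close> in direction \<open>u\<close>.\<close>

lemma great_circle_derivative:
  assumes T: "(T has_derivative T') (at x within S2)" and x: "x \<in> S2" and u: "u \<bullet> u = 1" "u \<bullet> x = 0"
    and Lam: "linear Lam" and key: "\<And>y. y \<in> S2 \<Longrightarrow> Lam (hat y) = Lam (hat y) $ 4 *\<^sub>R hat (T y)"
  shows "Lam (vec4 u 0) = Lam (vec4 u 0) $ 4 *\<^sub>R hat (T x) + Lam (hat x) $ 4 *\<^sub>R vec4 (T' u) 0"
proof -
  define gamma where "gamma t = cos t *\<^sub>R x + sin t *\<^sub>R u" for t :: real
  have xx: "x \<bullet> x = 1" using x by (simp add: norm_eq_1)
  have gammaS: "gamma t \<in> S2" for t
  proof -
    have "gamma t \<bullet> gamma t = (cos t)^2 + (sin t)^2" using u xx by (simp add: gamma_def inner_add inner_commute power2_eq_square)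
    thus ?thesis by (simp add: norm_eq_1)
  qed
  have gamma0: "gamma 0 = x" by (simp add: gamma_def)
  have dgamma: "(gamma has_vector_derivative u) (at 0)"
    unfolding gamma_def by (auto intro!: derivative_eq_intros)
  have dT: "((\<lambda>t. T (gamma t)) has_vector_derivative T' u) (at 0)"
  proof -
    have "(T has_derivative T') (at (gamma 0) within range gamma)" unfolding gamma0
      by (rule has_derivative_subset[OF T]) (use gammaS in blast)
    from has_derivative_in_compose[OF dgamma[unfolded has_vector_derivative_def] this]
    have "((\<lambda>t. T (gamma t)) has_derivative (\<lambda>t. T' (t *\<^sub>R u))) (at 0)" .
    moreover have "T' (t *\<^sub>R u) = t *\<^sub>R T' u" for t
      using has_derivative_linear[OF T] by (rule linear_cmul)
    ultimately show ?thesis by (simp add: has_vector_derivative_def)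
  qed
  define a where "a = Lam (vec4 x 0)"
  define b where "b = Lam (vec4 u 0)"
  define c where "c = Lam (vec4 0 1)"
  have F: "Lam (hat (gamma t)) = cos t *\<^sub>R a + sin t *\<^sub>R b + c" for t
  proof -
    have "hat (gamma t) = cos t *\<^sub>R vec4 x 0 + sin t *\<^sub>R vec4 u 0 + vec4 0 1" by (simp add: hat_def gamma_def vec4_lin)
    thus ?thesis using linear_add[OF Lam] linear_cmul[OF Lam] by (simp add: a_def b_def c_def)
  qed
  define f where "f t = cos t * a $ 4 + sin t * b $ 4 + c $ 4" for t
  have spF: "cos t *\<^sub>R sp a + sin t *\<^sub>R sp b + sp c = f t *\<^sub>R T (gamma t)" for t
  proof -
    have "sp (Lam (hat (gamma t))) = Lam (hat (gamma t)) $ 4 *\<^sub>R T (gamma t)"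
      by (subst key[OF gammaS]) (simp add: sp_lin hat_def sp_vec4)
    thus ?thesis unfolding F by (simp add: sp_lin f_def)
  qed
  have "((\<lambda>t. cos t *\<^sub>R sp a + sin t *\<^sub>R sp b + sp c) has_vector_derivative sp b) (at 0)"
    by (auto intro!: derivative_eq_intros)
  moreover have "(f has_field_derivative b $ 4) (at 0)"
    unfolding f_def by (auto intro!: derivative_eq_intros)
  from has_vector_derivative_scaleR[OF this dT]
  have "((\<lambda>t. cos t *\<^sub>R sp a + sin t *\<^sub>R sp b + sp c) has_vector_derivative (f 0 *\<^sub>R T' u + b $ 4 *\<^sub>R T (gamma 0))) (at 0)"
    unfolding spF .
  ultimately have spb: "sp b = f 0 *\<^sub>R T' u + b $ 4 *\<^sub>R T x" unfolding gamma0 by (rule vector_derivative_unique_at)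
  have f0: "f 0 = Lam (hat x) $ 4" using F[of 0] by (simp add: gamma0 f_def)
  have "b = vec4 (sp b) (b $ 4)" by (simp add: sp_vec4)
  also have "\<dots> = b $ 4 *\<^sub>R hat (T x) + f 0 *\<^sub>R vec4 (T' u) 0" unfolding spb hat_def vec4_lin by (simp add: add.commute)
  finally show ?thesis unfolding b_def f0 .
qed

lemma vol4_tangent:
  "vol4 (vec4 p 1) (vec4 u 0) (vec4 v 0) (vec4 w 1) = p \<bullet> cross3 u v - w \<bullet> cross3 u v"
  unfolding vol4_expand vec4_nth inner3 cross_components by algebra

text \<open>In stereographic coordinates from a point and its image, \<open>T\<close> maps lines to lines and
  circles to circles, hence is a similarity; similarities are induced by Lorentz transformations. The derivative
  of \<open>T\<close> at the chosen point shows that the determinant is positive. Oriented circles correspond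
  because the transformation scales the null vectors of points by positive factors.\<close>

theorem moebius_lorentz:
  assumes T: "moebius_transformation T"
  obtains Lam delta where "linear Lam" "\<And>x y. lq (Lam x) (Lam y) = lq x y" "delta > 0"
    "\<And>x y z w. vol4 (Lam x) (Lam y) (Lam z) (Lam w) = delta * vol4 x y z w"
    "\<And>C C'. maps_ocircle T C C' \<longleftrightarrow> Lam (cvec C) = cvec C'"
proof -
  have bij: "bij_betw T S2 S2" and circs: "\<And>C. \<exists>C'. T ` circ C = circ C'" and op: "orientation_preserving T"
    using T by (auto simp: moebius_transformation_def)
  have TS: "x \<in> S2 \<Longrightarrow> T x \<in> S2" for x using bij by (auto simp: bij_betw_def)
  have Tinj: "T x = T y \<Longrightarrow> x = y" if "x \<in> S2" "y \<in> S2" for x y using bij that by (auto simp: bij_betw_def inj_on_def)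
  have Tsurj: "\<exists>x\<in>S2. y = T x" if "y \<in> S2" for y using bij that by (auto simp: bij_betw_def image_iff)
  obtain x0 :: "real^3" where x0: "x0 \<in> S2" by (rule that[of "axis 1 1"]) simp
  define y0 where "y0 = T x0"
  have y0: "y0 \<in> S2" using TS[OF x0] by (simp add: y0_def)
  obtain A B M N where F: "null_frame x0 A B M N" using null_frame_exists[OF x0] .
  obtain A' B' M' N' where F': "null_frame y0 A' B' M' N'" using null_frame_exists[OF y0] .
  interpret F: null_frame x0 A B M N by (rule F)
  interpret F': null_frame y0 A' B' M' N' by (rule F')
  define g where "g z = F'.co (T (F.st z))" for z
  have Tst: "T (F.st z) \<in> S2" "T (F.st z) \<noteq> y0" for z
    using TS[OF F.st_S2] Tinj[OF F.st_S2 x0] F.st_neq by (auto simp: y0_def)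
  have stg: "F'.st (g z) = T (F.st z)" for z unfolding g_def by (rule F'.st_co[OF Tst])
  have hit: "\<exists>z. w = g z \<and> F.st z = x" if "F'.st w = T x" "x \<in> S2" for w x
  proof -
    have "x \<noteq> x0" using that F'.st_neq[of w] by (auto simp: y0_def)
    hence "F.st (F.co x) = x" using F.st_co that by blast
    moreover from this have "g (F.co x) = w" unfolding g_def using that(1)[symmetric] F'.co_st by simp
    ultimately show ?thesis by blast
  qed
  have im: "g ` {z. F.st z \<in> circ C} = {z. F'.st z \<in> circ C'}" if CC: "T ` circ C = circ C'" for C C'
  proof (intro equalityI subsetI)
    fix w assume "w \<in> g ` {z. F.st z \<in> circ C}"
    then obtain z where "F.st z \<in> circ C" "w = g z" by blast
    thus "w \<in> {z. F'.st z \<in> circ C'}" using CC stg by auto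
  next
    fix w assume "w \<in> {z. F'.st z \<in> circ C'}"
    hence "F'.st w \<in> T ` circ C" using CC by simp
    then obtain x where x: "F'.st w = T x" "x \<in> circ C" by blast
    have "x \<in> S2" using x by (simp add: circ_iff)
    then obtain z where "w = g z" "F.st z = x" using hit[OF x(1)] by blast
    thus "w \<in> g ` {z. F.st z \<in> circ C}" using x by blast
  qed
  have ginj: "inj g"
  proof (rule injI)
    fix z w assume "g z = g w"
    hence "T (F.st z) = T (F.st w)" using stg by metis
    hence "F.st z = F.st w" by (rule Tinj[OF F.st_S2 F.st_S2])
    thus "z = w" by (rule F.st_inj)
  qed
  have gsurj: "surj g"
  proof
    show "UNIV \<subseteq> range g"
    proof
      fix w
      obtain x where x: "x \<in> S2" "F'.st w = T x" using Tsurj[OF F'.st_S2] by blast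
      thus "w \<in> range g" using hit by blast
    qed
  qed simp
  have "continuous_on S2 T"
    using op has_derivative_continuous unfolding orientation_preserving_def continuous_on_eq_continuous_within by blast
  hence "continuous_on UNIV (\<lambda>z. T (F.st z))"
    by (rule continuous_on_compose2[OF _ F.st_cont]) (use F.st_S2 in auto)
  hence gcont: "continuous_on UNIV g"
    unfolding g_def by (rule continuous_on_compose2[OF F'.co_cont]) (use Tst in auto)
  define \<tau> where "\<tau> = g 0"
  define h where "h z = g z - \<tau>" for z
  have gh: "g z = h z + \<tau>" for z by (simp add: h_def)
  have himage: "h ` S = (\<lambda>w. w - \<tau>) ` g ` S" for S by (simp add: h_def image_image)
  have lin: "linear h"
  proof (rule lines_to_lines_linear)
    show "inj h" using ginj by (auto simp: inj_def h_def)
    show "h 0 = 0" by (simp add: h_def \<tau>_def)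
    show "continuous_on UNIV h" unfolding h_def by (intro continuous_intros gcont)
    fix p a :: complex assume "a \<noteq> 0"
    then obtain C where C: "x0 \<in> circ C" "{z. F.st z \<in> circ C} = cline p a" using F.line_circ by blast
    obtain C' where C': "T ` circ C = circ C'" using circs by blast
    have "y0 \<in> circ C'" using C C' by (auto simp: y0_def)
    then obtain p' a' where pa: "a' \<noteq> 0" "{z. F'.st z \<in> circ C'} = cline p' a'" using F'.circ_line by blast
    have "h ` cline p a = (\<lambda>w. w - \<tau>) ` cline p' a'" unfolding himage C(2)[symmetric] im[OF C'] pa(2) ..
    also have "\<dots> = cline (p' - \<tau>) a'" unfolding cline_def image_image by (simp add: algebra_simps)
    finally show "\<exists>p' a'. a' \<noteq> 0 \<and> h ` cline p a = cline p' a'" using pa(1) by blast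
  qed
  obtain d R where dR: "h ` sphere 0 1 = sphere d R"
  proof -
    obtain C where C: "x0 \<notin> circ C" "{z. F.st z \<in> circ C} = sphere 0 1" using F.unit_circ by blast
    obtain C' where C': "T ` circ C = circ C'" using circs by blast
    have "y0 \<notin> circ C'"
    proof
      assume "y0 \<in> circ C'"
      then obtain x where x: "x \<in> circ C" "T x0 = T x" using C' by (auto simp: y0_def)
      hence "x0 = x" using Tinj[OF x0] by (simp add: circ_iff)
      thus False using x C by blast
    qed
    then obtain d R where d: "{z. F'.st z \<in> circ C'} = sphere d R" using F'.circ_sphere by blast
    have "h ` sphere 0 1 = (\<lambda>w. w - \<tau>) ` sphere d R" unfolding himage C(2)[symmetric] im[OF C'] d ..
    also have "\<dots> = sphere (d - \<tau>) R"
    proof (intro equalityI subsetI)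
      fix w assume "w \<in> sphere (d - \<tau>) R"
      hence "w + \<tau> \<in> sphere d R" by (simp add: dist_norm algebra_simps)
      thus "w \<in> (\<lambda>w. w - \<tau>) ` sphere d R" by (intro image_eqI[of _ _ "w + \<tau>"]) simp_all
    qed (auto simp: dist_norm)
    finally show ?thesis by (rule that)
  qed
  have "surj h" unfolding himage gsurj by (simp add: surj_diff_right)
  moreover have "inj h" using ginj by (auto simp: inj_def h_def)
  ultimately obtain rho where rho: "rho > 0" "\<And>z w. h z \<bullet> h w = rho^2 * (z \<bullet> w)"
    using circle_to_circle_similarity[OF lin _ _ dR] by blast
  define p where "p = h 1"
  define r where "r = h \<i>"
  have hz: "h z = Re z *\<^sub>R p + Im z *\<^sub>R r" for z
  proof -
    have "z = Re z *\<^sub>R 1 + Im z *\<^sub>R \<i>" by (simp add: complex_eq_iff)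
    hence "h z = h (Re z *\<^sub>R 1 + Im z *\<^sub>R \<i>)" by simp
    thus ?thesis by (simp add: linear_add[OF lin] linear_cmul[OF lin] p_def r_def)
  qed
  have pr: "p \<bullet> p = rho * rho" "r \<bullet> r = rho * rho" "p \<bullet> r = 0"
    unfolding p_def r_def rho(2) by (simp_all add: inner_complex_def power2_eq_square)
  have pr': "Re p * Re p + Im p * Im p = rho * rho" "Re r * Re r + Im r * Im r = rho * rho" "Re p * Re r + Im p * Im r = 0"
    using pr by (simp_all add: inner_complex_def)
  define LA where "LA = (1 / rho) *\<^sub>R (Re p *\<^sub>R A' + Im p *\<^sub>R B' + (p \<bullet> \<tau>) *\<^sub>R M')"
  define LB where "LB = (1 / rho) *\<^sub>R (Re r *\<^sub>R A' + Im r *\<^sub>R B' + (r \<bullet> \<tau>) *\<^sub>R M')"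
  define LM where "LM = rho *\<^sub>R M'"
  define LN where "LN = (1 / rho) *\<^sub>R F'.pt \<tau>"
  define Lam where "Lam x = lq x A *\<^sub>R LA + lq x B *\<^sub>R LB - (lq x N / 2) *\<^sub>R LM - (lq x M / 2) *\<^sub>R LN" for x
  have linLam: "linear Lam"
    by (rule linearI) (simp_all add: Lam_def lq_lin algebra_simps add_divide_distrib)
  have G: "lq LA LA = 1" "lq LB LB = 1" "lq LA LB = 0" "lq LA LM = 0" "lq LB LM = 0" "lq LM LM = 0"
    using pr' rho(1) unfolding LA_def LB_def LM_def lq_lin by (simp_all add: F'.gram F'.gram' field_simps)
  have ptA: "lq A' (F'.pt \<tau>) = 2 * Re \<tau>" "lq B' (F'.pt \<tau>) = 2 * Im \<tau>" "lq M' (F'.pt \<tau>) = -2"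
    using F'.lq_pt[of \<tau>] lq_sym by metis+
  have GN: "lq LA LN = 0" "lq LB LN = 0" "lq LM LN = -2" "lq LN LN = 0"
    unfolding LA_def LB_def LM_def LN_def lq_lin ptA F'.pt_null using rho(1) by (simp_all add: inner_complex_def)
  have G': "lq LB LA = 0" "lq LM LA = 0" "lq LM LB = 0" "lq LN LA = 0" "lq LN LB = 0" "lq LN LM = -2"
    using G GN lq_sym by metis+
  have lqLam: "lq (Lam x) (Lam y) = lq x y" for x y
  proof -
    have "lq x y = lq x (lq y A *\<^sub>R A + lq y B *\<^sub>R B - (lq y N / 2) *\<^sub>R M - (lq y M / 2) *\<^sub>R N)"
      using F.complete[of y] by metis
    hence "lq x y = lq x A * lq y A + lq x B * lq y B - lq x M * lq y N / 2 - lq x N * lq y M / 2" unfolding lq_lin by (simp add: mult.commute)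
    moreover have "lq (Lam x) (Lam y) = lq x A * lq y A + lq x B * lq y B - lq x M * lq y N / 2 - lq x N * lq y M / 2"
      unfolding Lam_def lq_lin by (simp add: G GN G' algebra_simps)
    ultimately show ?thesis by simp
  qed
  have Lampt: "Lam (F.pt z) = (1 / rho) *\<^sub>R F'.pt (g z)" for z
  proof -
    have "Lam (F.pt z) = (2 * Re z) *\<^sub>R LA + (2 * Im z) *\<^sub>R LB + (norm z)^2 *\<^sub>R LM + LN" by (simp add: Lam_def F.lq_pt)
    also have "\<dots> = (1 / rho) *\<^sub>R ((2 * (Re z * Re p + Im z * Re r + Re \<tau>)) *\<^sub>R A' + (2 * (Re z * Im p + Im z * Im r + Im \<tau>)) *\<^sub>R B'
        + (2 * Re z * (p \<bullet> \<tau>) + 2 * Im z * (r \<bullet> \<tau>) + rho * rho * (norm z)^2 + (norm \<tau>)^2) *\<^sub>R M' + N')"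
      using rho(1) by (simp add: LA_def LB_def LM_def LN_def F'.pt_def scaleR_add_right scaleR_add_left distrib_left add_divide_distrib ac_simps)
    also have "2 * Re z * (p \<bullet> \<tau>) + 2 * Im z * (r \<bullet> \<tau>) + rho * rho * (norm z)^2 + (norm \<tau>)^2 = (norm (g z))^2"
    proof -
      have "h z \<bullet> h z = rho * rho * (z \<bullet> z)" unfolding rho(2) by (simp add: power2_eq_square)
      moreover have "h z \<bullet> \<tau> = Re z * (p \<bullet> \<tau>) + Im z * (r \<bullet> \<tau>)" unfolding hz by (simp add: inner_add_left)
      moreover have "g z \<bullet> g z = h z \<bullet> h z + 2 * (h z \<bullet> \<tau>) + \<tau> \<bullet> \<tau>" unfolding gh by (simp add: inner_add inner_commute)
      ultimately show ?thesis unfolding dot_square_norm by simp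
    qed
    finally show ?thesis unfolding F'.pt_def gh hz by simp
  qed
  have key: "\<exists>k>0. Lam (hat x) = k *\<^sub>R hat (T x)" if x: "x \<in> S2" for x
  proof (cases "x = x0")
    case True
    have "Lam M = rho *\<^sub>R M'" unfolding Lam_def F.gram F.gram' LM_def by simp
    thus ?thesis using rho(1) True F.M F'.M by (auto simp: y0_def)
  next
    case False
    define m where "m = - lq (hat x) M / 2"
    have m: "m > 0" using F.hat_M_neg[OF x False] by (simp add: m_def)
    have hx: "hat x = m *\<^sub>R F.pt (F.co x)" unfolding m_def by (rule F.hat_co[OF x False])
    have "F'.st (g (F.co x)) = T x" unfolding stg F.st_co[OF x False] ..
    hence "Lam (hat x) = (m * (1 / rho) * ((norm (g (F.co x)))^2 + 1)) *\<^sub>R hat (T x)"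
      unfolding hx linear_cmul[OF linLam] Lampt F'.hat_st by simp
    moreover have "m * (1 / rho) * ((norm (g (F.co x)))^2 + 1) > 0" using m rho(1) F.nz1 by simp
    ultimately show ?thesis by blast
  qed
  have key4: "Lam (hat x) $ 4 > 0" "Lam (hat x) = Lam (hat x) $ 4 *\<^sub>R hat (T x)" if "x \<in> S2" for x
    using key[OF that] by auto
  define Q where "Q = matrix Lam"
  define delta where "delta = det Q"
  have MW: "Lam x = Q *v x" for x unfolding Q_def using matrix_vector_mul(2)[OF linLam] by metis
  have vol: "vol4 (Lam x) (Lam y) (Lam z) (Lam w) = delta * vol4 x y z w" for x y z w
  proof -
    have row: "(rows4 x y z w ** transpose Q) $ i = Q *v (rows4 x y z w $ i)" for i
      by (simp add: vec_eq_iff matrix_matrix_mult_def matrix_vector_mult_def transpose_def mult.commute)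
    have "\<forall>i. rows4 (Lam x) (Lam y) (Lam z) (Lam w) $ i = (rows4 x y z w ** transpose Q) $ i"
      unfolding row forall_4 rows4_nth MW by simp
    hence "rows4 (Lam x) (Lam y) (Lam z) (Lam w) = rows4 x y z w ** transpose Q" by (simp add: vec_eq_iff)
    thus ?thesis by (simp add: vol4_def det_mul det_transpose delta_def mult.commute)
  qed
  have delta: "delta > 0"
  proof -
    obtain T' where T': "(T has_derivative T') (at x0 within S2)"
      and pos: "\<And>u v. u \<bullet> x0 = 0 \<Longrightarrow> v \<bullet> x0 = 0 \<Longrightarrow> x0 \<bullet> cross3 u v > 0 \<Longrightarrow> T x0 \<bullet> cross3 (T' u) (T' v) > 0"
      using op x0 unfolding orientation_preserving_def by blast
    have xx: "x0 \<bullet> x0 = 1" "y0 \<bullet> y0 = 1" using x0 y0 by (simp_all add: norm_eq_1)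
    obtain u where u: "u \<bullet> u = 1" "x0 \<bullet> u = 0" by (rule unit_orthogonal3)
    define v where "v = cross3 x0 u"
    have "v \<bullet> v = (x0 \<bullet> x0) * (u \<bullet> u) - (x0 \<bullet> u)^2" unfolding v_def inner3 cross_components by algebra
    hence v: "v \<bullet> v = 1" "x0 \<bullet> v = 0" using xx u by (simp_all add: v_def dot_cross_self)
    have xuv: "x0 \<bullet> cross3 u v = 1" unfolding v_def triple3 using xx u by simp
    have U: "Lam (vec4 w 0) = Lam (vec4 w 0) $ 4 *\<^sub>R hat y0 + Lam (hat x0) $ 4 *\<^sub>R vec4 (T' w) 0" if "w \<bullet> w = 1" "x0 \<bullet> w = 0" for w
      unfolding y0_def by (rule great_circle_derivative[OF T' x0 that(1) _ linLam key4(2)]) (use that in \<open>simp_all add: inner_commute\<close>)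
    define k where "k = Lam (hat x0) $ 4"
    have k: "k > 0" "Lam (hat x0) = k *\<^sub>R hat y0" using key4[OF x0] by (simp_all add: k_def y0_def)
    have tang: "y0 \<bullet> T' w = 0" if w: "w \<bullet> w = 1" "x0 \<bullet> w = 0" for w
    proof -
      have "lq (hat x0) (vec4 w 0) = 0" using w by (simp add: hat_def lq_vec4)
      hence "lq (k *\<^sub>R hat y0) (Lam (vec4 w 0) $ 4 *\<^sub>R hat y0 + k *\<^sub>R vec4 (T' w) 0) = 0"
        using lqLam[of "hat x0" "vec4 w 0"] U[OF w] k(2) by (simp flip: k_def)
      hence "k * (k * (y0 \<bullet> T' w)) = 0" using hat_null[OF y0] by (simp add: lq_lin) (simp add: hat_def lq_vec4)
      thus ?thesis using k by simp
    qed
    have mx: "- x0 \<in> S2" "- x0 \<noteq> x0"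
    proof -
      show "- x0 \<in> S2" using x0 by simp
      show "- x0 \<noteq> x0"
      proof
        assume "- x0 = x0"
        hence "(- x0) \<bullet> x0 = x0 \<bullet> x0" by (rule arg_cong)
        thus False using xx by simp
      qed
    qed
    define W where "W = T (- x0)"
    define k' where "k' = Lam (hat (- x0)) $ 4"
    have W: "k' > 0" "Lam (hat (- x0)) = k' *\<^sub>R hat W" "W \<in> S2" "W \<noteq> y0"
      using key4[OF mx(1)] TS[OF mx(1)] Tinj[OF mx(1) x0] mx(2) by (auto simp: k'_def W_def y0_def)
    define l where "l = y0 \<bullet> cross3 (T' u) (T' v)"
    have l: "l > 0" unfolding l_def y0_def by (rule pos) (use u v xuv in \<open>simp_all add: inner_commute\<close>)
    have "vol4 (Lam (hat x0)) (Lam (vec4 u 0)) (Lam (vec4 v 0)) (Lam (hat (- x0)))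
        = vol4 (k *\<^sub>R hat y0) (Lam (vec4 u 0) $ 4 *\<^sub>R hat y0 + k *\<^sub>R vec4 (T' u) 0) (Lam (vec4 v 0) $ 4 *\<^sub>R hat y0 + k *\<^sub>R vec4 (T' v) 0) (k' *\<^sub>R hat W)"
      using U[OF u] U[OF v] k(2) W(2) by (simp flip: k_def)
    also have "\<dots> = k * k * k * k' * vol4 (hat y0) (vec4 (T' u) 0) (vec4 (T' v) 0) (hat W)"
      unfolding vol4_lin by (simp add: vol4_eq0)
    also have "vol4 (hat y0) (vec4 (T' u) 0) (vec4 (T' v) 0) (hat W) = l - (W \<bullet> y0) * l"
      unfolding hat_def vol4_tangent l_def using cross_tangent[OF xx(2) tang[OF u] tang[OF v], of W] by simp
    finally have "delta * vol4 (hat x0) (vec4 u 0) (vec4 v 0) (hat (- x0)) = k * k * k * k' * (l * (1 - W \<bullet> y0))"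
      unfolding vol by (simp add: algebra_simps)
    moreover have "vol4 (hat x0) (vec4 u 0) (vec4 v 0) (hat (- x0)) = 2" unfolding hat_def vol4_tangent using xuv by simp
    moreover have "1 - W \<bullet> y0 > 0" using hat_hat_neg[OF W(3) y0 W(4)] by (simp add: hat_hat)
    hence "k * k * k * k' * (l * (1 - W \<bullet> y0)) > 0" using k W l by simp
    ultimately show ?thesis by simp
  qed
  have signs: "lq (cvec C') (hat (T x)) * Lam (hat x) $ 4 = lq (cvec C) (hat x)" if "Lam (cvec C) = cvec C'" "x \<in> S2" for C C' x
  proof -
    have "lq (cvec C) (hat x) = lq (cvec C') (Lam (hat x))" using lqLam[of "cvec C" "hat x"] that(1) by simp
    also have "\<dots> = lq (cvec C') (Lam (hat x) $ 4 *\<^sub>R hat (T x))" using key4(2)[OF that(2)] by metis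
    finally show ?thesis by (simp add: lq_lin)
  qed
  have fwd: "maps_ocircle T C C'" if CC: "Lam (cvec C) = cvec C'" for C C'
  proof -
    have c: "T x \<in> circ C' \<longleftrightarrow> x \<in> circ C" "T x \<in> cdisk C' \<longleftrightarrow> x \<in> cdisk C" if x: "x \<in> S2" for x
    proof -
      have s: "lq (cvec C) (hat x) = lq (cvec C') (hat (T x)) * Lam (hat x) $ 4" using signs[OF CC x] by simp
      show "T x \<in> circ C' \<longleftrightarrow> x \<in> circ C" "T x \<in> cdisk C' \<longleftrightarrow> x \<in> cdisk C"
        unfolding circ_iff cdisk_iff s using TS[OF x] x key4(1)[OF x] by (auto simp: zero_le_mult_iff)
    qed
    have S: "circ D \<subseteq> S2" "cdisk D \<subseteq> S2" for D by (auto simp: circ_def cdisk_def)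
    have "T ` X = X'" if X: "X \<subseteq> S2" "X' \<subseteq> S2" "\<And>x. x \<in> S2 \<Longrightarrow> T x \<in> X' \<longleftrightarrow> x \<in> X" for X X'
    proof (intro equalityI subsetI)
      fix y assume y: "y \<in> X'"
      then obtain x where "x \<in> S2" "y = T x" using Tsurj X(2) by blast
      thus "y \<in> T ` X" using X(3) y by blast
    qed (use X in blast)
    hence "T ` circ C = circ C'" "T ` cdisk C = cdisk C'" using S c by (simp_all only:)
    thus ?thesis by (simp add: maps_ocircle_def)
  qed
  have iff: "maps_ocircle T C C' \<longleftrightarrow> Lam (cvec C) = cvec C'" for C C'
  proof
    assume m: "maps_ocircle T C C'"
    have "lq (Lam (cvec C)) (Lam (cvec C)) = 1" unfolding lqLam by (rule cvec_sq)
    then obtain D where D: "cvec D = Lam (cvec C)" by (rule cvec_surj)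
    hence "maps_ocircle T C D" by (intro fwd) simp
    hence "circ D = circ C'" "cdisk D = cdisk C'" using m by (simp_all add: maps_ocircle_def)
    hence "D = C'" by (rule ocircle_eqI)
    thus "Lam (cvec C) = cvec C'" using D by simp
  qed (rule fwd)
  show ?thesis using that[OF linLam lqLam delta vol iff] .
qed

theorem mainTheorem2:
  fixes P :: "'v polyhedron"
    and C C' :: "'v \<Rightarrow> ocircle"
    and Op Op' :: "'v list \<Rightarrow> ocircle"
  assumes "spherical_polyhedron P"
    and "c_polyhedron P C" and "c_polyhedron P C'"
    and "non_unitary P C" and "non_unitary P C'"
    and "convex_c_polyhedron P C Op" and "convex_c_polyhedron P C' Op'"
    and "proper_c_polyhedron P C Op" and "proper_c_polyhedron P C' Op'"
    and "consistently_oriented P C Op" and "consistently_oriented P C' Op'"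
    and "\<forall>f\<in>P. \<exists>T. moebius_transformation T \<and> (\<forall>u\<in>set f. maps_ocircle T (C u) (C' u))"
  shows "\<exists>T. moebius_transformation T \<and> (\<forall>u\<in>vertex_set P. maps_ocircle T (C u) (C' u))"
proof -
  have X: "circle_polyhedron P C Op"
    using assms(1,4,6,8) by (simp only: circle_polyhedron_def circle_polyhedron_axioms_def polyhedron_def)
  have Y: "circle_polyhedron P C' Op'"
    using assms(1,5,7,9) by (simp only: circle_polyhedron_def circle_polyhedron_axioms_def polyhedron_def)
  interpret circle_polyhedron P C Op by (rule X)
  have gram: "lq (cvec (C u)) (cvec (C v)) = lq (cvec (C' u)) (cvec (C' v))"
    if f: "f \<in> P" "u \<in> set f" "v \<in> set f" for f u v
  proof -
    obtain T where T: "moebius_transformation T" "\<forall>u\<in>set f. maps_ocircle T (C u) (C' u)" using assms f by blast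
    obtain Lam where Lam: "\<And>x y. lq (Lam x) (Lam y) = lq x y" "\<And>C C'. maps_ocircle T C C' \<longleftrightarrow> Lam (cvec C) = cvec C'"
      using moebius_lorentz[OF T(1)] by metis
    have "Lam (cvec (C u)) = cvec (C' u)" "Lam (cvec (C v)) = cvec (C' v)" using Lam(2) T(2) f by blast+
    thus ?thesis using Lam(1)[of "cvec (C u)" "cvec (C v)"] by simp
  qed
  obtain f0 where f0: "f0 \<in> P" using P_nonempty by blast
  then obtain T where T: "moebius_transformation T" "\<forall>u\<in>set f0. maps_ocircle T (C u) (C' u)" using assms by blast
  show ?thesis
  proof (rule moebius_lorentz[OF T(1)])
    fix Lam delta
    assume Lam: "linear Lam" "\<And>x y. lq (Lam x) (Lam y) = lq x y" "delta > 0"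
      "\<And>x y z w. vol4 (Lam x) (Lam y) (Lam z) (Lam w) = delta * vol4 x y z w"
      "\<And>C C'. maps_ocircle T C C' \<longleftrightarrow> Lam (cvec C) = cvec C'"
    have on_f0: "Lam (cvec (C u)) = cvec (C' u)" if "u \<in> set f0" for u using Lam(5) T(2) that by blast
    have "Lam (cvec (C u)) = cvec (C' u)" if "u \<in> vertex_set P" for u
      by (rule congruence_spreads[OF Y gram Lam(1-4) f0 on_f0 that])
    hence "\<forall>u\<in>vertex_set P. maps_ocircle T (C u) (C' u)" unfolding Lam(5) by blast
    thus ?thesis using T(1) by blast
  qed
qed

end
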